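(* Let $K$ be a field, let $G$ be a connected indecomposable block graph with $n$ vertices, with vertex set $[n]$, let $S=K[x_1,\ldots,x_n,y_1,\ldots,y_n]$, and let $J_G\subset S$ be the binomial edge ideal of $G$. Let $<$ be the lexicographic order on $S$ induced by $x_1>x_2>\cdots>x_n>y_1>y_2>\cdots>y_n$, and let $\operatorname{in}_<(J_G)$ be the initial ideal of $J_G$ with respect to $<$. Let $f(G)$ be the number of free vertices and $i(G)$ the number of inner vertices of $G$. Then $\beta_{n-1,\,n-1+i(G)+1}(S/J_G)$ is an extremal Betti number of $S/J_G$, and $\beta_{n-1,\,n-1+i(G)+1}(S/\operatorname{in}_<(J_G))$ is an extremal Betti number of $S/\operatorname{in}_<(J_G)$. Moreover, \[ \beta_{n-1,\,n-1+i(G)+1}(S/\operatorname{in}_<(J_G))=\beta_{n-1,\,n-1+i(G)+1}(S/J_G)=f(G)-1. \]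
   Context: All graphs are finite and simple. The polynomial ring $S$ is standard graded (every variable has degree 1). The binomial edge ideal of a graph $G$ on $[n]$ is $J_G=(x_iy_j-x_jy_i : \{i,j\}\in E(G),\ i<j)\subset S$. For a finitely generated graded $S$-module $M$, $\beta_{i,j}(M)=\dim_K\operatorname{Tor}^S_i(M,K)_j$. A graded Betti number $\beta_{i,i+j}(M)\ne 0$ is called extremal if $\beta_{k,k+l}(M)=0$ for all pairs $(k,l)\neq(i,j)$ with $k\ge i$ and $l\ge j$. A clique of $G$ is a set of pairwise adjacent vertices. The clique degree $\operatorname{cdeg}(v)$ of a vertex $v$ is the number of maximal cliques of $G$ containing $v$. A vertex $v$ is free if $\operatorname{cdeg}(v)=1$ and inner if $\operatorname{cdeg}(v)>1$. A cutpoint of a graph is a vertex whose removal increases the number of connected components. A block of $G$ is a connected subgraph that has no cutpoint and is maximal with this property. $G$ is a block graph if each block of $G$ is a clique (complete graph). $G$ is decomposable if there are subgraphs $G_1,G_2$ of $G$, neither of them just a single vertex, such that $G=G_1\cup G_2$, $V(G_1)\cap V(G_2)=\{v\}$, and $v$ is a free vertex of both $G_1$ and $G_2$; otherwise $G$ is indecomposable. A block graph is decomposable if and only if it has a vertex $v$ with $\operatorname{cdeg}(v)=2$.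
   Formalization: The formal theorem assumes n ≥ 2; for n = 1 the graph is a single vertex, J_G = 0 and β_{0,1}(S) = 0 = f(G) − 1, so the Betti number is zero and cannot be extremal. *)

theory Defs
  imports Complex_Main "HOL-Library.Poly_Mapping" "HOL-Algebra.Ideal"
begin

section \<open>Finite simple graphs\<close>

type_synonym 'a graph = "'a set \<times> 'a set set"

abbreviation verts :: "'a graph \<Rightarrow> 'a set" where "verts \<equiv> fst"
abbreviation edges :: "'a graph \<Rightarrow> 'a set set" where "edges \<equiv> snd"

definition simple_graph :: "'a graph \<Rightarrow> bool" where
  "simple_graph G \<longleftrightarrow> finite (verts G) \<and> (\<forall>e \<in> edges G. e \<subseteq> verts G \<and> card e = 2)"

definition subgraph :: "'a graph \<Rightarrow> 'a graph \<Rightarrow> bool" where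
  "subgraph H G \<longleftrightarrow> simple_graph H \<and> verts H \<subseteq> verts G \<and> edges H \<subseteq> edges G"

definition graph_union :: "'a graph \<Rightarrow> 'a graph \<Rightarrow> 'a graph" where
  "graph_union G H = (verts G \<union> verts H, edges G \<union> edges H)"

definition delete_vertex :: "'a graph \<Rightarrow> 'a \<Rightarrow> 'a graph" where
  "delete_vertex G v = (verts G - {v}, {e \<in> edges G. v \<notin> e})"

definition reachable :: "'a graph \<Rightarrow> 'a rel" where
  "reachable G = {(u, v). {u, v} \<in> edges G}\<^sup>* \<inter> verts G \<times> verts G"

definition components :: "'a graph \<Rightarrow> 'a set set" where
  "components G = verts G // reachable G"

definition connected_graph :: "'a graph \<Rightarrow> bool" where
  "connected_graph G \<longleftrightarrow> verts G \<noteq> {} \<and> (\<forall>u \<in> verts G. \<forall>v \<in> verts G. (u, v) \<in> reachable G)"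

definition cutpoint :: "'a graph \<Rightarrow> 'a \<Rightarrow> bool" where
  "cutpoint G v \<longleftrightarrow> v \<in> verts G \<and> card (components (delete_vertex G v)) > card (components G)"

definition nonseparable_subgraph :: "'a graph \<Rightarrow> 'a graph \<Rightarrow> bool" where
  "nonseparable_subgraph H G \<longleftrightarrow> subgraph H G \<and> connected_graph H \<and> (\<nexists>v. cutpoint H v)"

definition block :: "'a graph \<Rightarrow> 'a graph \<Rightarrow> bool" where
  "block H G \<longleftrightarrow> nonseparable_subgraph H G \<and>
     (\<forall>H'. nonseparable_subgraph H' G \<and> subgraph H H' \<longrightarrow> H' = H)"

definition clique :: "'a graph \<Rightarrow> 'a set \<Rightarrow> bool" where
  "clique G C \<longleftrightarrow> C \<subseteq> verts G \<and> (\<forall>u \<in> C. \<forall>v \<in> C. u \<noteq> v \<longrightarrow> {u, v} \<in> edges G)"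

definition block_graph :: "'a graph \<Rightarrow> bool" where
  "block_graph G \<longleftrightarrow> simple_graph G \<and> (\<forall>H. block H G \<longrightarrow> clique H (verts H))"

definition maximal_clique :: "'a graph \<Rightarrow> 'a set \<Rightarrow> bool" where
  "maximal_clique G C \<longleftrightarrow> clique G C \<and> (\<forall>D. clique G D \<and> C \<subseteq> D \<longrightarrow> D = C)"

definition cdeg :: "'a graph \<Rightarrow> 'a \<Rightarrow> nat" where
  "cdeg G v = card {C. maximal_clique G C \<and> v \<in> C}"

definition free_vertex :: "'a graph \<Rightarrow> 'a \<Rightarrow> bool" where
  "free_vertex G v \<longleftrightarrow> v \<in> verts G \<and> cdeg G v = 1"

definition inner_vertex :: "'a graph \<Rightarrow> 'a \<Rightarrow> bool" where
  "inner_vertex G v \<longleftrightarrow> v \<in> verts G \<and> cdeg G v > 1"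

definition num_free :: "'a graph \<Rightarrow> nat" where
  "num_free G = card {v. free_vertex G v}"

definition num_inner :: "'a graph \<Rightarrow> nat" where
  "num_inner G = card {v. inner_vertex G v}"

definition decomposable :: "'a graph \<Rightarrow> bool" where
  "decomposable G \<longleftrightarrow> (\<exists>G1 G2 v. subgraph G1 G \<and> subgraph G2 G \<and>
     card (verts G1) \<noteq> 1 \<and> card (verts G2) \<noteq> 1 \<and>
     G = graph_union G1 G2 \<and> verts G1 \<inter> verts G2 = {v} \<and>
     free_vertex G1 v \<and> free_vertex G2 v)"


section \<open>The polynomial ring and its ideals\<close>

datatype pvar = X nat | Y nat

type_synonym mon = "pvar \<Rightarrow>\<^sub>0 nat"
type_synonym 'k mpoly = "mon \<Rightarrow>\<^sub>0 'k"

definition pvars :: "nat set \<Rightarrow> pvar set" where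
  "pvars V = X ` V \<union> Y ` V"

definition polys :: "nat set \<Rightarrow> 'k::field mpoly set" where
  "polys V = {p. \<forall>m \<in> Poly_Mapping.keys p. Poly_Mapping.keys m \<subseteq> pvars V}"

text \<open>The type \<^typ>\<open>'k mpoly\<close> has infinitely many variables; the polynomial ring
  in the variables indexed by \<open>V\<close> is the following ring record.\<close>

definition poly_ring :: "nat set \<Rightarrow> 'k::field mpoly ring" where
  "poly_ring V = \<lparr>carrier = polys V, mult = (*), one = 1, zero = 0, add = (+)\<rparr>"

definition pv :: "pvar \<Rightarrow> 'k::field mpoly" where
  "pv v = Poly_Mapping.single (Poly_Mapping.single v 1) 1"

definition mdeg :: "mon \<Rightarrow> nat" where
  "mdeg m = (\<Sum>v \<in> Poly_Mapping.keys m. Poly_Mapping.lookup m v)"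

definition irrelevant_ideal :: "nat set \<Rightarrow> 'k::field mpoly set" where
  "irrelevant_ideal V = genideal (poly_ring V) (pv ` pvars V)"

definition binomial_edge_ideal :: "nat graph \<Rightarrow> 'k::field mpoly set" where
  "binomial_edge_ideal G = genideal (poly_ring (verts G))
     {pv (X i) * pv (Y j) - pv (X j) * pv (Y i) | i j. {i, j} \<in> edges G \<and> i < j}"

fun var_gt :: "pvar \<Rightarrow> pvar \<Rightarrow> bool" where
  "var_gt (X i) (X j) = (i < j)"
| "var_gt (X i) (Y j) = True"
| "var_gt (Y i) (X j) = False"
| "var_gt (Y i) (Y j) = (i < j)"

definition lex_less :: "mon \<Rightarrow> mon \<Rightarrow> bool" where
  "lex_less m m' \<longleftrightarrow> (\<exists>v. Poly_Mapping.lookup m v < Poly_Mapping.lookup m' v \<and>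
     (\<forall>u. var_gt u v \<longrightarrow> Poly_Mapping.lookup m u = Poly_Mapping.lookup m' u))"

definition leading_mon :: "'k::field mpoly \<Rightarrow> mon \<Rightarrow> bool" where
  "leading_mon f m \<longleftrightarrow> m \<in> Poly_Mapping.keys f \<and>
     (\<forall>m' \<in> Poly_Mapping.keys f. m' \<noteq> m \<longrightarrow> lex_less m' m)"

definition initial_ideal :: "nat set \<Rightarrow> 'k::field mpoly set \<Rightarrow> 'k mpoly set" where
  "initial_ideal V I = genideal (poly_ring V)
     {Poly_Mapping.single m 1 | m. \<exists>f \<in> I. leading_mon f m}"


section \<open>Graded free resolutions, Tor and Betti numbers\<close>

text \<open>A complex of graded free modules \<open>F\<^sub>0 \<leftarrow> F\<^sub>1 \<leftarrow> \<dots>\<close> with an augmentation: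
  \<open>F\<^sub>i\<close> has the basis \<open>e\<^sub>i\<^sub>,\<^sub>k\<close> with \<open>k \<in> basis i\<close>, where \<open>e\<^sub>i\<^sub>,\<^sub>k\<close> has degree \<open>bdeg i k\<close>;
  for \<open>i > 0\<close>, \<open>bdiff i k \<in> F\<^sub>i\<^sub>-\<^sub>1\<close> is the image of \<open>e\<^sub>i\<^sub>,\<^sub>k\<close> under the differential,
  and \<open>aug k\<close> represents the image of \<open>e\<^sub>0\<^sub>,\<^sub>k\<close> in \<open>S/I\<close>.
  The elements of \<open>F\<^sub>i\<close> are the coordinate vectors with respect to this basis.\<close>

type_synonym 'k fvec = "nat \<Rightarrow>\<^sub>0 'k mpoly"

record (overloaded) 'k free_cplx =
  basis :: "nat \<Rightarrow> nat set"
  bdeg :: "nat \<Rightarrow> nat \<Rightarrow> nat"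
  bdiff :: "nat \<Rightarrow> nat \<Rightarrow> 'k fvec"
  aug :: "nat \<Rightarrow> 'k mpoly"

definition vsmult :: "'k::field mpoly \<Rightarrow> 'k fvec \<Rightarrow> 'k fvec" where
  "vsmult p f = Poly_Mapping.map ((*) p) f"

definition kscale :: "'k::field \<Rightarrow> 'k fvec \<Rightarrow> 'k fvec" where
  "kscale c f = vsmult (Poly_Mapping.single 0 c) f"

definition fmod :: "nat set \<Rightarrow> 'k::field free_cplx \<Rightarrow> nat \<Rightarrow> 'k fvec set" where
  "fmod V F i = {f. Poly_Mapping.keys f \<subseteq> basis F i \<and> (\<forall>k. Poly_Mapping.lookup f k \<in> polys V)}"

definition fpart :: "nat set \<Rightarrow> 'k::field free_cplx \<Rightarrow> nat \<Rightarrow> nat \<Rightarrow> 'k fvec set" where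
  "fpart V F i j = {f \<in> fmod V F i.
     \<forall>k. \<forall>m \<in> Poly_Mapping.keys (Poly_Mapping.lookup f k). mdeg m + bdeg F i k = j}"

text \<open>\<open>J F\<^sub>i\<close>; since \<open>F\<^sub>i\<close> is free, this is the set of vectors with coordinates in \<open>J\<close>.\<close>

definition ideal_fmod ::
  "nat set \<Rightarrow> 'k::field mpoly set \<Rightarrow> 'k free_cplx \<Rightarrow> nat \<Rightarrow> 'k fvec set" where
  "ideal_fmod V J F i = {f \<in> fmod V F i. \<forall>k. Poly_Mapping.lookup f k \<in> J}"

definition fdiff :: "'k::field free_cplx \<Rightarrow> nat \<Rightarrow> 'k fvec \<Rightarrow> 'k fvec" where
  "fdiff F i f = (\<Sum>k \<in> Poly_Mapping.keys f. vsmult (Poly_Mapping.lookup f k) (bdiff F i k))"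

definition faug :: "'k::field free_cplx \<Rightarrow> 'k fvec \<Rightarrow> 'k mpoly" where
  "faug F f = (\<Sum>k \<in> Poly_Mapping.keys f. Poly_Mapping.lookup f k * aug F k)"

text \<open>\<open>F\<close> is a graded free resolution of \<open>S/I\<close>. The modules may have infinite rank, but only
  finitely many basis elements in each degree, so the graded components of every \<open>F\<^sub>i\<close>
  are finite-dimensional.\<close>

definition graded_free_resolution ::
  "nat set \<Rightarrow> 'k::field mpoly set \<Rightarrow> 'k free_cplx \<Rightarrow> bool" where
  "graded_free_resolution V I F \<longleftrightarrow>
     (\<forall>i j. finite {k \<in> basis F i. bdeg F i k = j}) \<and>
     (\<forall>i. \<forall>k \<in> basis F (Suc i). bdiff F (Suc i) k \<in> fpart V F i (bdeg F (Suc i) k)) \<and>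
     (\<forall>k \<in> basis F 0. aug F k \<in> polys V \<and>
        (\<forall>m \<in> Poly_Mapping.keys (aug F k). mdeg m = bdeg F 0 k)) \<and>
     (\<forall>p \<in> polys V. \<exists>f \<in> fmod V F 0. p - faug F f \<in> I) \<and>
     {f \<in> fmod V F 0. faug F f \<in> I} = fdiff F 1 ` fmod V F 1 \<and>
     (\<forall>i. {f \<in> fmod V F (Suc i). fdiff F (Suc i) f = 0} =
        fdiff F (Suc (Suc i)) ` fmod V F (Suc (Suc i)))"

text \<open>Tensoring with \<open>S/J\<close> turns \<open>F\<^sub>i\<close> into \<open>F\<^sub>i/JF\<^sub>i\<close>. The cycles and boundaries of
  \<open>F \<otimes> S/J\<close> in internal degree \<open>j\<close> are described by their preimages in \<open>(F\<^sub>i)\<^sub>j\<close>.\<close>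

definition tor_cycles ::
  "nat set \<Rightarrow> 'k::field mpoly set \<Rightarrow> 'k free_cplx \<Rightarrow> nat \<Rightarrow> nat \<Rightarrow> 'k fvec set" where
  "tor_cycles V J F i j =
     {f \<in> fpart V F i j. i > 0 \<longrightarrow> fdiff F i f \<in> ideal_fmod V J F (i - 1)}"

definition tor_boundaries ::
  "nat set \<Rightarrow> 'k::field mpoly set \<Rightarrow> 'k free_cplx \<Rightarrow> nat \<Rightarrow> nat \<Rightarrow> 'k fvec set" where
  "tor_boundaries V J F i j =
     {f \<in> fpart V F i j. \<exists>g \<in> fmod V F (Suc i). f - fdiff F (Suc i) g \<in> ideal_fmod V J F i}"

lemma vector_space_kscale: "vector_space (kscale :: 'k::field \<Rightarrow> _)"
proof -
  have lk: "Poly_Mapping.lookup (kscale c f) k = Poly_Mapping.single 0 c * Poly_Mapping.lookup f k"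
    for c :: 'k and f k
    by (auto simp: kscale_def vsmult_def map.rep_eq when_def)
  show ?thesis
    by unfold_locales
      (auto intro!: poly_mapping_eqI
        simp: lk lookup_add single_add distrib_left distrib_right mult.assoc[symmetric] mult_single)
qed

text \<open>The \<open>K\<close>-dimension of the degree \<open>j\<close> component of \<open>Tor\<^sub>i(S/I, S/J)\<close>, for homogeneous
  ideals \<open>I\<close>, \<open>J\<close>; it does not depend on the choice of the resolution.\<close>

definition tor_dim ::
  "nat set \<Rightarrow> 'k::field mpoly set \<Rightarrow> 'k mpoly set \<Rightarrow> nat \<Rightarrow> nat \<Rightarrow> nat" where
  "tor_dim V I J i j = (let F = (SOME F. graded_free_resolution V I F) in
     vector_space.dim kscale (tor_cycles V J F i j) -
     vector_space.dim kscale (tor_boundaries V J F i j))"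

text \<open>The Betti number \<open>\<beta>\<^sub>i\<^sub>,\<^sub>j(S/I)\<close>; the residue field is \<open>S\<close> modulo the irrelevant ideal.\<close>

definition betti :: "nat set \<Rightarrow> 'k::field mpoly set \<Rightarrow> nat \<Rightarrow> nat \<Rightarrow> nat" where
  "betti V I i j = tor_dim V I (irrelevant_ideal V) i j"

text \<open>\<open>\<beta>\<^sub>i\<^sub>,\<^sub>i\<^sub>+\<^sub>j(S/I)\<close> is an extremal Betti number; note that the last argument
  is \<open>j\<close>, not \<open>i + j\<close>.\<close>

definition extremal_betti :: "nat set \<Rightarrow> 'k::field mpoly set \<Rightarrow> nat \<Rightarrow> nat \<Rightarrow> bool" where
  "extremal_betti V I i j \<longleftrightarrow> betti V I i (i + j) \<noteq> 0 \<and>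
     (\<forall>k l. (k, l) \<noteq> (i, j) \<and> k \<ge> i \<and> l \<ge> j \<longrightarrow> betti V I k (k + l) = 0)"

end

theory Submission
  imports Defs "HOL-Library.Function_Algebras" "HOL-Library.Nat_Bijection"
begin

text \<open>Betti numbers are computed by the Koszul complex, all ideals being taken in the fixed ring \<open>S\<close>.
  For a vertex \<open>i\<close> let \<open>G\<^sub>i\<close> be the graph obtained from \<open>G\<close> by making the neighbours of \<open>i\<close> pairwise
  adjacent. Then \<open>J\<^sub>G = J\<^bsub>G\<^sub>i\<^esub> \<inter> ((x\<^sub>i, y\<^sub>i) + J\<^bsub>G - i\<^esub>)\<close>, the sum of the two ideals on the right is
  \<open>(x\<^sub>i, y\<^sub>i) + J\<^bsub>G\<^sub>i - i\<^esub>\<close>, and both statements remain true for the initial ideals. If \<open>G\<close> is a block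
  graph and \<open>i\<close> an inner vertex, the resulting long exact sequence of Tor reduces everything to graphs with
  fewer inner vertices: it first bounds the projective dimension by the number of vertices minus the number
  of components, and then, because indecomposability means that \<open>G - i\<close> has at least three components, it
  identifies the Betti numbers of \<open>G\<close> in question with those of \<open>G\<^sub>i - i\<close>, which has as many free vertices as
  \<open>G\<close> and one inner vertex less. For disjoint unions of complete graphs the ideals are
  treated by dividing out the variable \<open>x\<^sub>v\<close> of the last vertex \<open>v\<close> of a clique, a nonzerodivisor, and
  taking the colon ideal with respect to \<open>y\<^sub>v\<close>.\<close>

section \<open>Polynomials\<close>

text \<open>As all ideals live in one ring, deleting a vertex means adjoining its two variables to
  the ideal, and each adjoined variable raises projective dimension and internal degree by one.
  Hence the offset \<open>2 * card (V - W)\<close>. From G to G_i - i one vertex is lost and two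
  variables are gained, so the top index p becomes p + 1: exactly the source of the connecting map
  Tor_{p+1}(S/(A+B)) -> Tor_p(S/(A \<inter> B)). The internal degree p + l stays, so l drops by one
  together with the number of inner vertices. The map is an isomorphism because the neighbouring
  groups vanish: for G - i the components push the projective dimension below p; for G_i the degree
  l is too large at p, and p + 1 exceeds the projective dimension. Since \<open>betti\<close> refers
  to an arbitrarily chosen resolution, one has to exist and its Tor has to agree with Koszul
  homology; a zigzag through their double complex gives this. For initial ideals everything rests on
  the leading monomials of A + B being covered by those of A and of B: then passing to initial
  ideals commutes with both intersection and sum.\<close>

abbreviation lookup :: "('a \<Rightarrow>\<^sub>0 'b::zero) \<Rightarrow> 'a \<Rightarrow> 'b" where "lookup \<equiv> Poly_Mapping.lookup"
abbreviation keys :: "('a \<Rightarrow>\<^sub>0 'b::zero) \<Rightarrow> 'a set" where "keys \<equiv> Poly_Mapping.keys"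
abbreviation single :: "'a \<Rightarrow> 'b::zero \<Rightarrow> 'a \<Rightarrow>\<^sub>0 'b" where "single \<equiv> Poly_Mapping.single"
abbreviation mvar :: "pvar \<Rightarrow> mon" where "mvar v \<equiv> single v (Suc 0)"

text \<open>This order only fixes the signs of the Koszul complex and the variable singled out by
  its contracting homotopy. It is unrelated to \<open>var_gt\<close>, which governs initial
  ideals.\<close>

instantiation pvar :: linorder
begin

fun pvar_index :: "pvar \<Rightarrow> nat" where
  "pvar_index (X i) = 2 * i"
| "pvar_index (Y i) = 2 * i + 1"

definition "u \<le> v \<longleftrightarrow> pvar_index u \<le> pvar_index v"
definition "u < v \<longleftrightarrow> pvar_index u < pvar_index v"

lemma pvar_index_inject: "pvar_index u = pvar_index v \<longleftrightarrow> u = v"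
proof
  assume eq: "pvar_index u = pvar_index v"
  then have "even (pvar_index u) = even (pvar_index v)" "pvar_index u div 2 = pvar_index v div 2"
    by simp_all
  then show "u = v" by (cases u; cases v) auto
qed simp

instance
  by standard (auto simp: less_eq_pvar_def less_pvar_def pvar_index_inject)

end

lemma keys_add_nat: "keys (m + m' :: 'a \<Rightarrow>\<^sub>0 nat) = keys m \<union> keys m'"
  by (auto simp: in_keys_iff lookup_add)

lemma mdeg_superset: "finite A \<Longrightarrow> keys m \<subseteq> A \<Longrightarrow> mdeg m = (\<Sum>v\<in>A. lookup m v)"
  unfolding mdeg_def by (rule sum.mono_neutral_left) (auto simp: in_keys_iff)

lemma mdeg_add: "mdeg (m + m') = mdeg m + mdeg m'"
proof -
  have "mdeg (m + m') = (\<Sum>v\<in>keys m \<union> keys m'. lookup (m + m') v)"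
    by (rule mdeg_superset) (auto simp: keys_add_nat)
  also have "\<dots> = (\<Sum>v\<in>keys m \<union> keys m'. lookup m v) + (\<Sum>v\<in>keys m \<union> keys m'. lookup m' v)"
    by (simp add: lookup_add sum.distrib)
  also have "\<dots> = mdeg m + mdeg m'"
    by (simp add: mdeg_superset[of "keys m \<union> keys m'"])
  finally show ?thesis .
qed

lemma mdeg_single [simp]: "mdeg (single v k) = k"
  by (cases "k = 0") (simp_all add: mdeg_def)

lemma mdeg_0 [simp]: "mdeg 0 = 0"
  by (simp add: mdeg_def)

lemma lookup_le_mdeg: "lookup m v \<le> mdeg m"
proof (cases "v \<in> keys m")
  case True
  then show ?thesis unfolding mdeg_def by (intro member_le_sum) auto
qed (simp add: in_keys_iff)

lemma mdeg_eq_0_iff: "mdeg m = 0 \<longleftrightarrow> m = 0"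
proof
  assume "mdeg m = 0"
  then have "lookup m v = 0" for v using lookup_le_mdeg[of m v] by simp
  then show "m = 0" by (intro poly_mapping_eqI) simp
qed simp

lemma mvar_add_minus: "v \<in> keys m \<Longrightarrow> mvar v + (m - mvar v) = m"
  by (rule poly_mapping_eqI) (auto simp: lookup_add lookup_minus lookup_single when_def in_keys_iff)

lemma finite_monomials:
  assumes "finite U"
  shows "finite {m :: mon. keys m \<subseteq> U \<and> mdeg m \<le> d}"
proof -
  have "finite {f. \<forall>v. (v \<in> U \<longrightarrow> f v \<in> {..d}) \<and> (v \<notin> U \<longrightarrow> f v = (0::nat))}"
    by (rule finite_set_of_finite_funs) (use assms in auto)
  moreover have "lookup ` {m :: mon. keys m \<subseteq> U \<and> mdeg m \<le> d} \<subseteq>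
      {f. \<forall>v. (v \<in> U \<longrightarrow> f v \<in> {..d}) \<and> (v \<notin> U \<longrightarrow> f v = 0)}"
  proof clarsimp
    fix m :: mon and v assume m: "keys m \<subseteq> U" "mdeg m \<le> d"
    show "(v \<in> U \<longrightarrow> lookup m v \<le> d) \<and> (v \<notin> U \<longrightarrow> lookup m v = 0)"
      using m lookup_le_mdeg[of m v] by (auto simp: in_keys_iff subset_iff)
  qed
  moreover have "inj_on lookup {m :: mon. keys m \<subseteq> U \<and> mdeg m \<le> d}"
    by (auto intro: inj_onI dest: poly_mapping_eq_iff[THEN iffD2])
  ultimately have "finite (lookup ` {m :: mon. keys m \<subseteq> U \<and> mdeg m \<le> d})"
      "inj_on lookup {m :: mon. keys m \<subseteq> U \<and> mdeg m \<le> d}"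
    by (auto intro: finite_subset)
  then show ?thesis by (rule finite_imageD)
qed

lemma finite_pvars: "finite V \<Longrightarrow> finite (pvars V)"
  by (simp add: pvars_def)

lemma mpoly_sum_monomials: "p = (\<Sum>m\<in>keys p. single m (lookup p m))"
  by (rule poly_mapping_eqI) (auto simp: lookup_sum lookup_single when_def in_keys_iff)

text \<open>\<open>Q\<close> carries what is known about the exponents of \<open>p\<close> into the
  induction step.\<close>

lemma mpoly_induct_keys [case_names keys zero add]:
  assumes "\<And>m. m \<in> keys p \<Longrightarrow> Q m" and "P 0"
    and step: "\<And>m c p. Q m \<Longrightarrow> P p \<Longrightarrow> P (single m c + p)"
  shows "P (p :: 'a \<Rightarrow>\<^sub>0 'b::comm_monoid_add)"
proof -
  have "P (\<Sum>m\<in>M. single m (lookup p m))" if "finite M" "M \<subseteq> keys p" for M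
    using that by (induction M rule: finite_induct) (auto intro: assms)
  from this[of "keys p"] show ?thesis using mpoly_sum_monomials[of p] by simp
qed

lemmas mpoly_induct [case_names zero add] =
  mpoly_induct_keys[where Q = "\<lambda>_. True", OF TrueI, simplified]

lemma lookup_single_mult:
  fixes p :: "mon \<Rightarrow>\<^sub>0 'k::field"
  shows "lookup (single m c * p) (m + k) = c * lookup p k"
proof (induction p rule: mpoly_induct)
  case (add m' c' p)
  then show ?case by (simp add: distrib_left lookup_add mult_single lookup_single when_def)
qed auto

lemma lookup_single_mult_0:
  fixes p :: "mon \<Rightarrow>\<^sub>0 'k::field"
  assumes "\<And>k'. k \<noteq> m + k'"
  shows "lookup (single m c * p) k = 0"
  using assms
proof (induction p rule: mpoly_induct)
  case (add m' c' p)
  then show ?case by (auto simp: distrib_left lookup_add mult_single lookup_single when_def)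
qed auto

lemma lookup_pv_mult:
  "lookup (pv v * p) m = (if v \<in> keys m then lookup p (m - mvar v) else 0)"
proof (cases "v \<in> keys m")
  case True
  then show ?thesis
    using lookup_single_mult[of "mvar v" 1 p "m - mvar v"] by (simp add: pv_def mvar_add_minus)
next
  case False
  then have "m \<noteq> mvar v + k" for k by (auto simp: keys_add_nat)
  then show ?thesis using False by (simp add: pv_def lookup_single_mult_0)
qed

lemma lookup_pv_mult_add: "lookup (pv v * p) (mvar v + m) = lookup p m"
  using lookup_single_mult[of "mvar v" 1 p m] by (simp add: pv_def)

lemma lookup_const_mult: "lookup (single 0 c * p) m = c * lookup (p :: 'k::field mpoly) m"
  using lookup_single_mult[of 0 c p m] by simp

lemma keys_pv_mult: "keys (pv v * p) = (+) (mvar v) ` keys p"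
proof (intro Set.set_eqI iffI)
  fix m assume m: "m \<in> keys (pv v * p)"
  then have v: "v \<in> keys m" "lookup p (m - mvar v) \<noteq> 0"
    by (auto simp: in_keys_iff lookup_pv_mult split: if_splits)
  then show "m \<in> (+) (mvar v) ` keys p"
    by (intro image_eqI[of _ _ "m - mvar v"]) (simp_all add: mvar_add_minus in_keys_iff[of _ p])
qed (auto simp only: in_keys_iff lookup_pv_mult_add image_iff)

subsection \<open>Coefficientwise operations\<close>

text \<open>One filter on monomials serves for homogeneous components, for setting variables to zero
  and for the fibres of a monomial map.\<close>

definition restr :: "('a \<Rightarrow> bool) \<Rightarrow> ('a \<Rightarrow>\<^sub>0 'b::zero) \<Rightarrow> ('a \<Rightarrow>\<^sub>0 'b)" where
  "restr P p = Poly_Mapping.mapp (\<lambda>k c. if P k then c else 0) p"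

lemma lookup_restr: "lookup (restr P p) k = (if P k then lookup p k else 0)"
  by (simp add: restr_def lookup_mapp when_def in_keys_iff)

lemma keys_restr: "keys (restr P p) = {k \<in> keys p. P k}"
  by (auto simp: in_keys_iff lookup_restr split: if_splits)

lemma restr_add: "restr P (p + q) = restr P p + restr P (q :: 'a \<Rightarrow>\<^sub>0 'b::monoid_add)"
  by (rule poly_mapping_eqI) (simp add: lookup_restr lookup_add)

lemma restr_diff: "restr P (p - q) = restr P p - restr P (q :: 'a \<Rightarrow>\<^sub>0 'b::ab_group_add)"
  by (rule poly_mapping_eqI) (simp add: lookup_restr lookup_minus)

lemma restr_0 [simp]: "restr P 0 = 0"
  by (rule poly_mapping_eqI) (simp add: lookup_restr)

lemma restr_single: "restr P (single k c) = (if P k then single k c else 0)"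
  by (rule poly_mapping_eqI) (simp add: lookup_restr lookup_single when_def)

lemma restr_id: "(\<And>k. k \<in> keys p \<Longrightarrow> P k) \<Longrightarrow> restr P p = p"
  by (rule poly_mapping_eqI) (auto simp: lookup_restr in_keys_iff)

lemma restr_eq_0: "(\<And>k. k \<in> keys p \<Longrightarrow> \<not> P k) \<Longrightarrow> restr P p = 0"
  by (rule poly_mapping_eqI) (auto simp: lookup_restr in_keys_iff)

text \<open>A linear left inverse of multiplication by \<open>v\<close>: terms not divisible by
  \<open>v\<close> are discarded.\<close>

definition divvar :: "pvar \<Rightarrow> 'k::field mpoly \<Rightarrow> 'k mpoly" where
  "divvar v p = Poly_Mapping.map_key ((+) (mvar v)) p"

lemma lookup_divvar: "lookup (divvar v p) m = lookup p (mvar v + m)"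
  by (simp add: divvar_def map_key.rep_eq)

lemma divvar_pv_mult: "divvar v (pv v * p) = p"
  by (rule poly_mapping_eqI) (simp add: lookup_divvar lookup_pv_mult_add)

lemma divvar_add: "divvar v (p + q) = divvar v p + divvar v q"
  by (rule poly_mapping_eqI) (simp add: lookup_divvar lookup_add)

lemma divvar_0 [simp]: "divvar v 0 = 0"
  by (rule poly_mapping_eqI) (simp add: lookup_divvar)

abbreviation hcomp :: "nat \<Rightarrow> 'k::field mpoly \<Rightarrow> 'k mpoly" where
  "hcomp e \<equiv> restr (\<lambda>m. mdeg m = e)"

subsection \<open>Polynomials in a set of variables\<close>

lemma polysI: "(\<And>m. m \<in> keys p \<Longrightarrow> keys m \<subseteq> pvars V) \<Longrightarrow> p \<in> polys V"
  by (auto simp: polys_def)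

lemma polysD: "p \<in> polys V \<Longrightarrow> m \<in> keys p \<Longrightarrow> keys m \<subseteq> pvars V"
  by (auto simp: polys_def)

lemma polys_0 [simp]: "0 \<in> polys V"
  by (simp add: polys_def)

lemma polys_add: "p \<in> polys V \<Longrightarrow> q \<in> polys V \<Longrightarrow> p + q \<in> polys V"
  unfolding polys_def using Poly_Mapping.keys_add by fastforce

lemma polys_uminus: "p \<in> polys V \<Longrightarrow> - p \<in> polys V"
  by (simp add: polys_def in_keys_iff)

lemma polys_diff: "p \<in> polys V \<Longrightarrow> q \<in> polys V \<Longrightarrow> p - q \<in> polys V"
  using polys_add[of p V "- q"] polys_uminus by auto

lemma polys_mult: "p \<in> polys V \<Longrightarrow> q \<in> polys V \<Longrightarrow> p * q \<in> polys V"
proof (rule polysI)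
  fix m assume pq: "p \<in> polys V" "q \<in> polys V" and "m \<in> keys (p * q)"
  then obtain a b where "m = a + b" "a \<in> keys p" "b \<in> keys q" using keys_mult by blast
  then show "keys m \<subseteq> pvars V" using pq by (auto simp: keys_add_nat polys_def)
qed

lemma polys_single: "keys m \<subseteq> pvars V \<Longrightarrow> single m c \<in> polys V"
  by (cases "c = 0") (auto simp: polys_def)

lemma polys_const [simp]: "single 0 c \<in> polys V"
  by (rule polys_single) simp

lemma polys_1 [simp]: "1 \<in> polys V"
  using polys_const[of 1] by simp

lemma polys_pv: "v \<in> pvars V \<Longrightarrow> pv v \<in> polys V"
  unfolding pv_def by (rule polys_single) simp

lemma polys_sum: "(\<And>i. i \<in> A \<Longrightarrow> f i \<in> polys V) \<Longrightarrow> sum f A \<in> polys V"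
  by (induction A rule: infinite_finite_induct) (auto intro: polys_add)

lemma polys_restr: "p \<in> polys V \<Longrightarrow> restr P p \<in> polys V"
  by (auto simp: polys_def keys_restr)

lemma polys_divvar:
  assumes "p \<in> polys V"
  shows "divvar v p \<in> polys V"
proof (rule polysI)
  fix m assume "m \<in> keys (divvar v p)"
  then have "mvar v + m \<in> keys p" by (simp add: in_keys_iff lookup_divvar)
  from polysD[OF assms this] show "keys m \<subseteq> pvars V" by (simp add: keys_add_nat)
qed

subsection \<open>Homogeneous ideals\<close>

definition hideal :: "nat set \<Rightarrow> 'k::field mpoly set \<Rightarrow> bool" where
  "hideal V I \<longleftrightarrow> I \<subseteq> polys V \<and> 0 \<in> I \<and> (\<forall>p\<in>I. \<forall>q\<in>I. p + q \<in> I) \<and>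
     (\<forall>p\<in>I. \<forall>q\<in>polys V. q * p \<in> I) \<and> (\<forall>p\<in>I. \<forall>e. hcomp e p \<in> I)"

lemma hideal_polys: "hideal V I \<Longrightarrow> p \<in> I \<Longrightarrow> p \<in> polys V"
  and hideal_0: "hideal V I \<Longrightarrow> 0 \<in> I"
  and hideal_add: "hideal V I \<Longrightarrow> p \<in> I \<Longrightarrow> q \<in> I \<Longrightarrow> p + q \<in> I"
  and hideal_mult: "hideal V I \<Longrightarrow> p \<in> I \<Longrightarrow> q \<in> polys V \<Longrightarrow> q * p \<in> I"
  and hideal_hcomp: "hideal V I \<Longrightarrow> p \<in> I \<Longrightarrow> hcomp e p \<in> I"
  by (auto simp: hideal_def)

lemma hideal_uminus: "hideal V I \<Longrightarrow> p \<in> I \<Longrightarrow> - p \<in> I"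
  using hideal_mult[of V I p "- 1"] polys_uminus[OF polys_1] by fastforce

lemma hideal_diff: "hideal V I \<Longrightarrow> p \<in> I \<Longrightarrow> q \<in> I \<Longrightarrow> p - q \<in> I"
  using hideal_add[of V I p "- q"] hideal_uminus by auto

lemma hideal_sum: "hideal V I \<Longrightarrow> (\<And>i. i \<in> A \<Longrightarrow> f i \<in> I) \<Longrightarrow> sum f A \<in> I"
  by (induction A rule: infinite_finite_induct) (auto intro: hideal_add hideal_0)

definition ideal_sum :: "'k::field mpoly set \<Rightarrow> 'k mpoly set \<Rightarrow> 'k mpoly set" where
  "ideal_sum A B = {a + b | a b. a \<in> A \<and> b \<in> B}"

definition colon :: "nat set \<Rightarrow> 'k::field mpoly set \<Rightarrow> pvar \<Rightarrow> 'k mpoly set" where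
  "colon V I y = {p \<in> polys V. pv y * p \<in> I}"

definition add_var :: "nat set \<Rightarrow> 'k::field mpoly set \<Rightarrow> pvar \<Rightarrow> 'k mpoly set" where
  "add_var V I y = {p + pv y * q | p q. p \<in> I \<and> q \<in> polys V}"

lemma hcomp_pv_mult: "hcomp (Suc e) (pv v * p) = pv v * hcomp e p"
proof (rule poly_mapping_eqI)
  fix m :: mon
  have "mdeg m = Suc (mdeg (m - mvar v))" if "v \<in> keys m"
    using mdeg_add[of "mvar v" "m - mvar v"] mvar_add_minus[OF that] by simp
  then show "lookup (hcomp (Suc e) (pv v * p)) m = lookup (pv v * hcomp e p) m"
    by (simp add: lookup_restr lookup_pv_mult)
qed

lemma hcomp_0_pv_mult: "hcomp 0 (pv v * p) = 0"
  by (rule restr_eq_0) (auto simp: keys_pv_mult mdeg_add)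

lemma hidealI:
  assumes "\<And>p. p \<in> I \<Longrightarrow> p \<in> polys V" "0 \<in> I" "\<And>p q. p \<in> I \<Longrightarrow> q \<in> I \<Longrightarrow> p + q \<in> I"
    "\<And>p q. p \<in> I \<Longrightarrow> q \<in> polys V \<Longrightarrow> q * p \<in> I" "\<And>p e. p \<in> I \<Longrightarrow> hcomp e p \<in> I"
  shows "hideal V I"
  using assms by (auto simp: hideal_def)

lemma hideal_Int: "hideal V A \<Longrightarrow> hideal V B \<Longrightarrow> hideal V (A \<inter> B)"
  by (auto simp: hideal_def)

lemma hideal_ideal_sum:
  assumes A: "hideal V A" and B: "hideal V B"
  shows "hideal V (ideal_sum A B)"
proof (rule hidealI)
  have I: "a + b \<in> ideal_sum A B" if "a \<in> A" "b \<in> B" for a b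
    using that by (auto simp: ideal_sum_def)
  show "0 \<in> ideal_sum A B" using I[OF hideal_0[OF A] hideal_0[OF B]] by simp
  fix p assume "p \<in> ideal_sum A B"
  then obtain a b where p: "p = a + b" "a \<in> A" "b \<in> B" by (auto simp: ideal_sum_def)
  show "p \<in> polys V" using p A B by (auto intro: polys_add hideal_polys)
  show "hcomp e p \<in> ideal_sum A B" for e
    unfolding p(1) restr_add using p A B by (intro I hideal_hcomp)
  show "q * p \<in> ideal_sum A B" if "q \<in> polys V" for q
    unfolding p(1) distrib_left using p A B that by (intro I hideal_mult)
  fix q assume "q \<in> ideal_sum A B"
  then obtain a' b' where q: "q = a' + b'" "a' \<in> A" "b' \<in> B" by (auto simp: ideal_sum_def)
  show "p + q \<in> ideal_sum A B"
    using I[OF hideal_add[OF A p(2) q(2)] hideal_add[OF B p(3) q(3)]] p(1) q(1) by (simp add: ac_simps)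
qed

lemma hideal_colon:
  assumes I: "hideal V I"
  shows "hideal V (colon V I y)"
proof (rule hidealI)
  fix p assume p: "p \<in> colon V I y"
  show "hcomp e p \<in> colon V I y" for e
    using p I hideal_hcomp[OF I, of "pv y * p" "Suc e"] by (simp add: colon_def polys_restr hcomp_pv_mult)
  show "q * p \<in> colon V I y" if "q \<in> polys V" for q
    using p I that by (simp add: colon_def polys_mult mult.left_commute[of _ q] hideal_mult)
qed (use I in \<open>auto simp: colon_def distrib_left intro: hideal_0 hideal_add polys_add\<close>)

lemma hideal_add_var:
  assumes I: "hideal V I" and y: "y \<in> pvars V"
  shows "hideal V (add_var V I y)"
proof -
  have "hideal V {pv y * q | q. q \<in> (polys V :: 'a mpoly set)}"
  proof (rule hidealI)
    fix p :: "'a mpoly" assume "p \<in> {pv y * q | q. q \<in> polys V}"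
    then obtain q where p: "p = pv y * q" "q \<in> polys V" by blast
    show "p \<in> polys V" using p y by (simp add: polys_mult polys_pv)
    show "r * p \<in> {pv y * q | q. q \<in> polys V}" if "r \<in> polys V" for r
      unfolding p(1) mult.left_commute[of r] using p(2) that polys_mult by blast
    show "hcomp e p \<in> {pv y * q | q. q \<in> polys V}" for e
    proof (cases e)
      case 0
      then show ?thesis using p hcomp_0_pv_mult[of y q] by (auto intro!: exI[of _ 0])
    next
      case (Suc e')
      then show ?thesis using p hcomp_pv_mult[of e' y q] polys_restr by blast
    qed
    fix p' :: "'a mpoly" assume "p' \<in> {pv y * q | q. q \<in> polys V}"
    then obtain q' where "p' = pv y * q'" "q' \<in> polys V" by blast
    then show "p + p' \<in> {pv y * q | q. q \<in> polys V}"
      using p polys_add[of q V q'] by (auto simp: distrib_left[symmetric])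
  qed (auto intro!: exI[of _ 0])
  moreover have "add_var V I y = ideal_sum I {pv y * q | q. q \<in> polys V}"
    by (auto simp: add_var_def ideal_sum_def)
  ultimately show ?thesis using hideal_ideal_sum[OF I] by simp
qed

subsection \<open>Dimension of a quotient\<close>

text \<open>A family representing a basis of the quotient is used instead of a dimension function, so
  that neither \<open>Z\<close> nor \<open>B\<close> has to be finite-dimensional.\<close>

definition has_qdim :: "('k::field \<Rightarrow> 'v::ab_group_add \<Rightarrow> 'v) \<Rightarrow> 'v set \<Rightarrow> 'v set \<Rightarrow> nat \<Rightarrow> bool" where
  "has_qdim s Z B d \<longleftrightarrow> (\<exists>c. (\<forall>i<d. c i \<in> Z) \<and>
     (\<forall>z\<in>Z. \<exists>a. z - (\<Sum>i<d. s (a i) (c i)) \<in> B) \<and>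
     (\<forall>a. (\<Sum>i<d. s (a i) (c i)) \<in> B \<longrightarrow> (\<forall>i<d. a i = 0)))"

lemma has_qdim_0: "has_qdim s Z B 0 \<longleftrightarrow> Z \<subseteq> B"
  by (auto simp: has_qdim_def)

definition ksub :: "('k::field \<Rightarrow> 'v::ab_group_add \<Rightarrow> 'v) \<Rightarrow> 'v set \<Rightarrow> bool" where
  "ksub s Z \<longleftrightarrow> 0 \<in> Z \<and> (\<forall>x\<in>Z. \<forall>y\<in>Z. x + y \<in> Z) \<and> (\<forall>x\<in>Z. \<forall>c. s c x \<in> Z)"

lemma ksub_sum: "ksub s Z \<Longrightarrow> (\<And>i. i \<in> A \<Longrightarrow> f i \<in> Z) \<Longrightarrow> sum f A \<in> Z"
  by (induction A rule: infinite_finite_induct) (auto simp: ksub_def)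

lemma ksub_diff: "vector_space s \<Longrightarrow> ksub s Z \<Longrightarrow> x \<in> Z \<Longrightarrow> y \<in> Z \<Longrightarrow> x - y \<in> Z"
proof -
  assume "vector_space s" and Z: "ksub s Z" "x \<in> Z" "y \<in> Z"
  then interpret vector_space s by simp
  have "x + s (- 1) y \<in> Z" using Z unfolding ksub_def by blast
  then show ?thesis by simp
qed

text \<open>An additive relation that is total on both sides and matches \<open>B1\<close> with
  \<open>B2\<close> induces an isomorphism of the quotients. Connecting homomorphisms fit this form
  directly: their values depend on chosen lifts, and a relation needs neither linearity nor
  uniqueness of the choice.\<close>

lemma has_qdim_relation:
  assumes s1: "vector_space s1" and s2: "vector_space s2"
    and Z1: "ksub s1 Z1" and Z2: "ksub s2 Z2"
    and R0: "R 0 0"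
    and Radd: "\<And>x y x' y'. R x y \<Longrightarrow> R x' y' \<Longrightarrow> R (x + x') (y + y')"
    and Rscale: "\<And>c x y. R x y \<Longrightarrow> R (s1 c x) (s2 c y)"
    and tot1: "\<And>x. x \<in> Z1 \<Longrightarrow> \<exists>y\<in>Z2. R x y"
    and tot2: "\<And>y. y \<in> Z2 \<Longrightarrow> \<exists>x\<in>Z1. R x y"
    and match: "\<And>x y. x \<in> Z1 \<Longrightarrow> y \<in> Z2 \<Longrightarrow> R x y \<Longrightarrow> x \<in> B1 \<longleftrightarrow> y \<in> B2"
    and q: "has_qdim s1 Z1 B1 d"
  shows "has_qdim s2 Z2 B2 d"
proof -
  obtain c where c: "\<And>i. i < d \<Longrightarrow> c i \<in> Z1"
    and sp: "\<And>z. z \<in> Z1 \<Longrightarrow> \<exists>a. z - (\<Sum>i<d. s1 (a i) (c i)) \<in> B1"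
    and ind: "\<And>a. (\<Sum>i<d. s1 (a i) (c i)) \<in> B1 \<Longrightarrow> \<forall>i<d. a i = 0"
    using q unfolding has_qdim_def by blast
  have "\<forall>i. \<exists>y. i < d \<longrightarrow> y \<in> Z2 \<and> R (c i) y" using tot1 c by blast
  then obtain c' where c': "\<And>i. i < d \<Longrightarrow> c' i \<in> Z2" "\<And>i. i < d \<Longrightarrow> R (c i) (c' i)"
    by metis
  have Rsum: "R (\<Sum>i\<in>A. s1 (a i) (c i)) (\<Sum>i\<in>A. s2 (a i) (c' i))" if "finite A" "A \<subseteq> {..<d}" for a A
    using that by (induction A rule: finite_induct) (auto intro: R0 Radd Rscale c')
  have m1: "(\<Sum>i<d. s1 (a i) (c i)) \<in> Z1" and m2: "(\<Sum>i<d. s2 (a i) (c' i)) \<in> Z2" for a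
    using Z1 Z2 c c' by (auto intro!: ksub_sum simp: ksub_def)
  have Rdiff: "R (x - x') (y - y')" if "R x y" "R x' y'" for x y x' y'
  proof -
    interpret v1: vector_space s1 by (rule s1)
    interpret v2: vector_space s2 by (rule s2)
    show ?thesis using Radd[OF that(1) Rscale[OF that(2), of "- 1"]] by simp
  qed
  show ?thesis unfolding has_qdim_def
  proof (intro exI[of _ c'] conjI allI impI ballI)
    fix z assume z: "z \<in> Z2"
    then obtain x where x: "x \<in> Z1" "R x z" using tot2 by blast
    then obtain a where a: "x - (\<Sum>i<d. s1 (a i) (c i)) \<in> B1" using sp by blast
    have "R (x - (\<Sum>i<d. s1 (a i) (c i))) (z - (\<Sum>i<d. s2 (a i) (c' i)))"
      by (rule Rdiff[OF x(2) Rsum]) auto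
    then have "z - (\<Sum>i<d. s2 (a i) (c' i)) \<in> B2"
      using a match ksub_diff[OF s1 Z1 x(1) m1] ksub_diff[OF s2 Z2 z m2] by blast
    then show "\<exists>a. z - (\<Sum>i<d. s2 (a i) (c' i)) \<in> B2" by blast
  next
    fix a i assume "(\<Sum>i<d. s2 (a i) (c' i)) \<in> B2" and i: "i < d"
    then have "(\<Sum>i<d. s1 (a i) (c i)) \<in> B1"
      using match[OF m1 m2] Rsum[of "{..<d}" a] by blast
    then show "a i = 0" using ind i by blast
  qed (use c' in auto)
qed

section \<open>Koszul complexes\<close>

definition sg :: "nat \<Rightarrow> 'm::ab_group_add \<Rightarrow> 'm" where
  "sg n p = (if even n then p else - p)"

lemma sg_Suc: "sg (Suc n) p = - sg n p"
  by (simp add: sg_def)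

lemma sg_0 [simp]: "sg n 0 = 0"
  by (simp add: sg_def)

lemma sg_add: "sg n (p + q) = sg n p + sg n q"
  by (simp add: sg_def)

lemma sg_minus: "sg n (- p) = - sg n p"
  by (simp add: sg_def)

lemma sg_sg: "sg n (sg n p) = p"
  by (simp add: sg_def)

lemma sg_commute: "sg n (sg k p) = sg k (sg n p)"
  by (simp add: sg_def)

lemma sg_sum: "sg n (sum f A) = (\<Sum>i\<in>A. sg n (f i))"
  by (simp add: sg_def sum_negf)

text \<open>Positions in e_B are counted from the top, so inserting a new largest variable costs no
  sign; the homotopy through \<open>Max\<close> is thereby free of signs.\<close>

definition nabove :: "'v::linorder \<Rightarrow> 'v set \<Rightarrow> nat" where
  "nabove u B = card {b \<in> B. u < b}"

lemma nabove_insert: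
  assumes "finite B" "w \<notin> B"
  shows "nabove u (insert w B) = (if u < w then Suc (nabove u B) else nabove u B)"
proof -
  have "{b \<in> insert w B. u < b} = (if u < w then insert w {b \<in> B. u < b} else {b \<in> B. u < b})"
    by auto
  then show ?thesis using assms by (simp add: nabove_def)
qed

lemma nabove_remove:
  assumes "finite B" "w \<in> B"
  shows "nabove u B = (if u < w then Suc (nabove u (B - {w})) else nabove u (B - {w}))"
  using nabove_insert[of "B - {w}" w u] assms by (simp add: insert_absorb)

lemma nabove_eq_0: "(\<And>b. b \<in> B \<Longrightarrow> b \<le> u) \<Longrightarrow> nabove u B = 0"
proof -
  assume "\<And>b. b \<in> B \<Longrightarrow> b \<le> u"
  then have "{b \<in> B. u < b} = {}" by (auto simp: not_less)
  then show ?thesis by (simp only: nabove_def card.empty)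
qed

text \<open>The operators \<open>x v\<close> are abstract so that one development covers the Koszul
  complex of polynomials and that of coordinate vectors of a free module.\<close>

locale koszul =
  fixes U :: "'v::linorder set" and x :: "'v \<Rightarrow> 'm::ab_group_add \<Rightarrow> 'm"
  assumes finite_U: "finite U"
    and x_add: "x v (p + q) = x v p + x v q"
    and x_commute: "x u (x v p) = x v (x u p)"
begin

lemma x_0 [simp]: "x v 0 = 0"
  using x_add[of v 0 0] by simp

lemma x_minus: "x v (- p) = - x v p"
  using x_add[of v p "- p"] by (simp add: eq_neg_iff_add_eq_0 add.commute)

lemma x_sum: "x v (sum f A) = (\<Sum>i\<in>A. x v (f i))"
  by (induction A rule: infinite_finite_induct) (auto simp: x_add)

lemma x_sg: "x v (sg n p) = sg n (x v p)"
  by (simp add: sg_def x_minus)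

text \<open>A chain is given by its coefficients \<open>a A\<close> of \<open>e\<^sub>A\<close>, where \<open>A\<close> is a set of variables.\<close>

definition bd :: "('v set \<Rightarrow> 'm) \<Rightarrow> 'v set \<Rightarrow> 'm" where
  "bd a B = (\<Sum>u\<in>U - B. sg (nabove u B) (x u (a (insert u B))))"

lemma bd_add: "bd (\<lambda>A. a A + b A) B = bd a B + bd b B"
  by (simp add: bd_def x_add sg_add sum.distrib)

lemma bd_minus: "bd (\<lambda>A. - a A) B = - bd a B"
  by (simp add: bd_def x_minus sg_minus sum_negf)

lemma bd_diff: "bd (\<lambda>A. a A - b A) B = bd a B - bd b B"
  using bd_add[of a "\<lambda>A. - b A" B] by (simp add: bd_minus)

lemma bd_0 [simp]: "bd (\<lambda>A. 0) B = 0"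
  by (simp add: bd_def)

lemma bd_x: "bd (\<lambda>A. x v (a A)) B = x v (bd a B)"
  by (simp add: bd_def x_sum x_sg x_commute[of v])

text \<open>Inserting \<open>u < w\<close> in the two possible orders gives opposite signs: the
  presence of \<open>w\<close> raises the count above \<open>u\<close> by one, while
  \<open>u\<close> does not affect the count above \<open>w\<close>.\<close>

lemma bd_bd:
  assumes "B \<subseteq> U"
  shows "bd (bd a) B = 0"
proof -
  have fB: "finite B" using assms finite_U finite_subset by blast
  define f where "f u w = sg (nabove u B) (sg (nabove w (insert u B)) (x u (x w (a (insert u (insert w B))))))" for u w
  have "bd (bd a) B = (\<Sum>u\<in>U - B. \<Sum>w\<in>U - insert u B. f u w)"
    by (simp add: bd_def f_def x_sum sg_sum x_sg insert_commute)
  also have "\<dots> = (\<Sum>(u, w)\<in>(SIGMA u:U - B. U - insert u B). f u w)"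
    using finite_U by (simp add: sum.Sigma)
  also have "(SIGMA u:U - B. U - insert u B) =
      {(u, w). u \<in> U - B \<and> w \<in> U - B \<and> u < w} \<union> {(u, w). u \<in> U - B \<and> w \<in> U - B \<and> w < u}"
    by auto
  also have "(\<Sum>(u, w)\<in>\<dots>. f u w) = (\<Sum>(u, w)\<in>{(u, w). u \<in> U - B \<and> w \<in> U - B \<and> u < w}. f u w) +
      (\<Sum>(u, w)\<in>{(u, w). u \<in> U - B \<and> w \<in> U - B \<and> w < u}. f u w)"
    by (rule sum.union_disjoint) (auto intro: finite_subset[OF _ finite_cartesian_product[OF finite_U finite_U]])
  also have "(\<Sum>(u, w)\<in>{(u, w). u \<in> U - B \<and> w \<in> U - B \<and> w < u}. f u w) =
      (\<Sum>(u, w)\<in>{(u, w). u \<in> U - B \<and> w \<in> U - B \<and> u < w}. f w u)"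
    by (rule sum.reindex_bij_witness[of _ "\<lambda>(u, w). (w, u)" "\<lambda>(u, w). (w, u)"]) auto
  also have "\<dots> = (\<Sum>(u, w)\<in>{(u, w). u \<in> U - B \<and> w \<in> U - B \<and> u < w}. - f u w)"
  proof (rule sum.cong[OF refl], clarify)
    fix u w assume "u \<in> U" "u \<notin> B" "w \<in> U" "w \<notin> B" "u < w"
    moreover from this have "\<not> w < u" by auto
    ultimately show "f w u = - f u w"
      using fB by (simp add: f_def nabove_insert sg_Suc sg_minus sg_commute x_commute[of w] insert_commute)
  qed
  finally show ?thesis by (simp add: case_prod_unfold sum_negf)
qed

text \<open>Exterior multiplication by e_v, signed so as to be a null-homotopy of multiplication by
  \<open>x v\<close>.\<close>

definition wedge :: "'v \<Rightarrow> ('v set \<Rightarrow> 'm) \<Rightarrow> 'v set \<Rightarrow> 'm" where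
  "wedge v a B = (if v \<in> B then sg (nabove v (B - {v})) (a (B - {v})) else 0)"

text \<open>For \<open>v\<close> outside \<open>B\<close> only the summand that reinserts
  \<open>v\<close> survives. For \<open>v\<close> in \<open>B\<close> that summand occurs in the
  second term and gives \<open>x v (a B)\<close>, while all others cancel in pairs.\<close>

lemma bd_wedge:
  assumes "B \<subseteq> U" "v \<in> U"
  shows "bd (wedge v a) B + wedge v (bd a) B = x v (a B)"
proof (cases "v \<in> B")
  case False
  have "bd (wedge v a) B = (\<Sum>u\<in>{v}. sg (nabove u B) (x u (wedge v a (insert u B))))"
    unfolding bd_def using False assms finite_U
    by (intro sum.mono_neutral_right) (auto simp: wedge_def)
  also have "\<dots> = x v (a B)"
    using False by (simp add: wedge_def insert_Diff_if x_sg sg_sg)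
  finally show ?thesis using False by (simp add: wedge_def)
next
  case True
  have fB: "finite B" using assms finite_U finite_subset by blast
  have "wedge v (bd a) B = (\<Sum>u\<in>U - (B - {v}). sg (nabove v (B - {v})) (sg (nabove u (B - {v})) (x u (a (insert u (B - {v}))))))"
    using True by (simp add: wedge_def bd_def sg_sum)
  also have "U - (B - {v}) = insert v (U - B)" using True assms by auto
  also have "(\<Sum>u\<in>insert v (U - B). sg (nabove v (B - {v})) (sg (nabove u (B - {v})) (x u (a (insert u (B - {v})))))) =
     x v (a B) + (\<Sum>u\<in>U - B. sg (nabove v (B - {v})) (sg (nabove u (B - {v})) (x u (a (insert u (B - {v}))))))"
    using True finite_U by (simp add: sg_sg insert_absorb)
  also have "(\<Sum>u\<in>U - B. sg (nabove v (B - {v})) (sg (nabove u (B - {v})) (x u (a (insert u (B - {v})))))) = - bd (wedge v a) B"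
    unfolding bd_def sum_negf[symmetric]
  proof (rule sum.cong[OF refl])
    fix u assume u: "u \<in> U - B"
    then have uv: "u \<noteq> v" using True by auto
    have i: "insert u B - {v} = insert u (B - {v})" using uv by auto
    have "wedge v a (insert u B) = sg (nabove v (insert u (B - {v}))) (a (insert u (B - {v})))"
      using True uv by (simp add: wedge_def i)
    moreover have "nabove u B = (if u < v then Suc (nabove u (B - {v})) else nabove u (B - {v}))"
      by (rule nabove_remove[OF fB True])
    moreover have "nabove v (insert u (B - {v})) =
        (if u < v then nabove v (B - {v}) else Suc (nabove v (B - {v})))"
      using nabove_insert[of "B - {v}" u v] fB u uv by auto
    ultimately show "sg (nabove v (B - {v})) (sg (nabove u (B - {v})) (x u (a (insert u (B - {v}))))) =
       - sg (nabove u B) (x u (wedge v a (insert u B)))"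
      by (simp add: sg_Suc sg_minus x_sg x_minus sg_commute[of "nabove v (B - {v})"])
  qed
  finally show ?thesis by simp
qed

end

lemma bd_hom:
  assumes "koszul U x" "koszul U x'"
    and h_add: "\<And>p q. h (p + q) = h p + h q" and h_x: "\<And>v p. v \<in> U \<Longrightarrow> h (x v p) = x' v (h p)"
  shows "h (koszul.bd U x a B) = koszul.bd U x' (\<lambda>A. h (a A)) B"
proof -
  interpret k1: koszul U x by fact
  interpret k2: koszul U x' by fact
  have h0: "h 0 = 0" using h_add[of 0 0] by simp
  have hm: "h (- p) = - h p" for p using h_add[of p "- p"] h0 by (simp add: eq_neg_iff_add_eq_0 add.commute)
  have hsg: "h (sg n p) = sg n (h p)" for n p by (simp add: sg_def hm)
  have hsum: "h (sum f A) = (\<Sum>i\<in>A. h (f i))" for f and A :: "'a set"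
    by (induction A rule: infinite_finite_induct) (auto simp: h0 h_add)
  show ?thesis by (simp add: k1.bd_def k2.bd_def hsum hsg h_x)
qed

text \<open>The contracting homotopy: on a monomial multiple \<open>m e\<^sub>A\<close> it moves the largest variable
  occurring in \<open>m\<close> or \<open>A\<close> from \<open>m\<close> to \<open>A\<close>; \<open>r v\<close> divides by \<open>v\<close> those monomials in which
  \<open>v\<close> is the largest variable.\<close>

locale koszul_homotopy = koszul U x
  for U :: "'v::linorder set" and x :: "'v \<Rightarrow> 'm::ab_group_add \<Rightarrow> 'm" +
  fixes r :: "'v::linorder \<Rightarrow> 'm::ab_group_add \<Rightarrow> 'm" and M :: "'m set" and Mpos :: "'m set"
  assumes r_add: "r v (p + q) = r v p + r v q"
    and r_x_less: "u < v \<Longrightarrow> r v (x u p) = x u (r v p)"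
    and r_x_greater: "v < u \<Longrightarrow> r v (x u p) = 0"
    and r_split: "p \<in> M \<Longrightarrow> r v (x v p) + (\<Sum>u\<in>{u \<in> U. v < u}. x u (r u p)) = p"
    and r_split0: "p \<in> Mpos \<Longrightarrow> (\<Sum>u\<in>U. x u (r u p)) = p"
begin

definition hty :: "('v set \<Rightarrow> 'm) \<Rightarrow> 'v set \<Rightarrow> 'm" where
  "hty a A = (if A = {} then 0 else r (Max A) (a (A - {Max A})))"

lemma r_0 [simp]: "r v 0 = 0"
  using r_add[of v 0 0] by simp

lemma r_minus: "r v (- p) = - r v p"
  using r_add[of v p "- p"] by (simp add: eq_neg_iff_add_eq_0 add.commute)

lemma r_sg: "r v (sg n p) = sg n (r v p)"
  by (simp add: sg_def r_minus)

lemma r_sum: "r v (sum f A) = (\<Sum>i\<in>A. r v (f i))"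
  by (induction A rule: infinite_finite_induct) (auto simp: r_add)

lemma bd_hty_empty: "a {} \<in> Mpos \<Longrightarrow> bd (hty a) {} = a {}"
  using r_split0 by (simp add: bd_def hty_def nabove_def sg_def)

text \<open>Variables \<open>u\<close> outside \<open>B\<close> are sorted by whether they exceed
  \<open>v = Max B\<close>. Those above \<open>v\<close> reproduce the terms whose largest variable
  exceeds \<open>v\<close>; those below cancel between the two summands because \<open>r v\<close>
  commutes with \<open>x u\<close>; the summand \<open>r v (x v (a B))\<close> supplies the
  remaining terms, and \<open>r_split\<close> adds these up.\<close>

lemma bd_hty:
  assumes "B \<subseteq> U" "B \<noteq> {}" and aM: "a B \<in> M"
  shows "bd (hty a) B + hty (bd a) B = a B"
proof -
  have fB: "finite B" using assms finite_U finite_subset by blast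
  define v where "v = Max B"
  have v: "v \<in> B" "\<And>b. b \<in> B \<Longrightarrow> b \<le> v" using fB assms by (auto simp: v_def)
  have UB: "U - B = {u \<in> U. v < u} \<union> {u \<in> U - B. u < v}"
  proof -
    have "\<not> v < u" if "u \<in> B" for u using v(2)[OF that] by auto
    moreover have "v < u \<or> u < v" if "u \<notin> B" for u
      using linorder_less_linear[of u v] v(1) that by blast
    ultimately show ?thesis by auto
  qed
  have split: "(\<Sum>u\<in>U - B. g u) = (\<Sum>u\<in>{u \<in> U. v < u}. g u) + (\<Sum>u\<in>{u \<in> U - B. u < v}. g u)" for g :: "'v \<Rightarrow> 'm"
  proof -
    have "sum g (U - B) = sum g ({u \<in> U. v < u} \<union> {u \<in> U - B. u < v})"
      by (rule arg_cong[OF UB])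
    also have "\<dots> = (\<Sum>u\<in>{u \<in> U. v < u}. g u) + (\<Sum>u\<in>{u \<in> U - B. u < v}. g u)"
      using finite_U by (intro sum.union_disjoint) auto
    finally show ?thesis .
  qed
  have 1: "bd (hty a) B = (\<Sum>u\<in>{u \<in> U. v < u}. x u (r u (a B))) +
      (\<Sum>u\<in>{u \<in> U - B. u < v}. sg (nabove u B) (x u (r v (a (insert u (B - {v}))))))"
    unfolding bd_def split
  proof (intro arg_cong2[of _ _ _ _ "(+)"] sum.cong[OF refl])
    fix u assume u: "u \<in> {u \<in> U. v < u}"
    have "Max (insert u B) = u" using u v fB by (intro Max_eqI) force+
    moreover have "u \<notin> B" using u v(2)[of u] by auto
    moreover have "nabove u B = 0" using u v by (intro nabove_eq_0) force
    ultimately show "sg (nabove u B) (x u (hty a (insert u B))) = x u (r u (a B))"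
      by (simp add: hty_def sg_def)
  next
    fix u assume u: "u \<in> {u \<in> U - B. u < v}"
    have "Max (insert u B) = v" using u v fB by (intro Max_eqI) force+
    moreover have "insert u B - {v} = insert u (B - {v})" using u by auto
    ultimately show "sg (nabove u B) (x u (hty a (insert u B))) = sg (nabove u B) (x u (r v (a (insert u (B - {v})))))"
      by (simp add: hty_def)
  qed
  have "hty (bd a) B = (\<Sum>u\<in>U - (B - {v}). sg (nabove u (B - {v})) (r v (x u (a (insert u (B - {v}))))))"
    using assms by (simp add: hty_def v_def bd_def r_sum r_sg)
  also have "U - (B - {v}) = insert v (U - B)" using v(1) assms(1) by auto
  also have "(\<Sum>u\<in>\<dots>. sg (nabove u (B - {v})) (r v (x u (a (insert u (B - {v})))))) =
      r v (x v (a B)) + (\<Sum>u\<in>U - B. sg (nabove u (B - {v})) (r v (x u (a (insert u (B - {v}))))))"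
    using v finite_U nabove_eq_0[of "B - {v}" v] by (simp add: insert_absorb sg_def)
  also have "(\<Sum>u\<in>U - B. sg (nabove u (B - {v})) (r v (x u (a (insert u (B - {v})))))) =
     - (\<Sum>u\<in>{u \<in> U - B. u < v}. sg (nabove u B) (x u (r v (a (insert u (B - {v}))))))"
    unfolding split sum_negf[symmetric]
    using nabove_remove[OF fB v(1)] by (simp add: r_x_greater r_x_less sg_Suc)
  finally have 2: "hty (bd a) B = r v (x v (a B)) +
     - (\<Sum>u\<in>{u \<in> U - B. u < v}. sg (nabove u B) (x u (r v (a (insert u (B - {v}))))))" .
  show ?thesis using r_split[OF aM, of v] unfolding 1 2 by (simp add: algebra_simps)
qed

end

section \<open>Koszul homology of quotient rings\<close>

definition rmax :: "pvar \<Rightarrow> 'k::field mpoly \<Rightarrow> 'k mpoly" where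
  "rmax v p = restr (\<lambda>m. \<forall>u\<in>keys m. u \<le> v) (divvar v p)"

lemma lookup_rmax:
  "lookup (rmax v p) m = (if \<forall>u\<in>keys m. u \<le> v then lookup p (mvar v + m) else 0)"
  by (simp add: rmax_def lookup_restr lookup_divvar)

lemma rmax_add: "rmax v (p + q) = rmax v p + rmax v q"
  by (simp add: rmax_def divvar_add restr_add)

lemma pv_rmax:
  "pv u * rmax u p = restr (\<lambda>m. u \<in> keys m \<and> (\<forall>w\<in>keys m. w \<le> u)) p"
proof (rule poly_mapping_eqI)
  fix m :: mon
  have "(\<forall>w\<in>keys (m - mvar u). w \<le> u) \<longleftrightarrow> (\<forall>w\<in>keys m. w \<le> u)" if "u \<in> keys m"
    using keys_add_nat[of "mvar u" "m - mvar u"] mvar_add_minus[OF that] by auto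
  then show "lookup (pv u * rmax u p) m = lookup (restr (\<lambda>m. u \<in> keys m \<and> (\<forall>w\<in>keys m. w \<le> u)) p) m"
    by (simp add: lookup_pv_mult lookup_restr lookup_rmax mvar_add_minus)
qed

lemma rmax_pv: "rmax v (pv v * p) = restr (\<lambda>m. \<forall>u\<in>keys m. u \<le> v) p"
  by (simp add: rmax_def divvar_pv_mult)

lemma rmax_pv_less:
  assumes "u < v"
  shows "rmax v (pv u * p) = pv u * rmax v p"
proof (rule poly_mapping_eqI)
  fix m :: mon
  show "lookup (rmax v (pv u * p)) m = lookup (pv u * rmax v p) m"
  proof (cases "u \<in> keys m")
    case True
    have "(\<forall>w\<in>keys (m - mvar u). w \<le> v) \<longleftrightarrow> (\<forall>w\<in>keys m. w \<le> v)"
      using keys_add_nat[of "mvar u" "m - mvar u"] mvar_add_minus[OF True] assms by auto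
    moreover have "mvar v + m - mvar u = mvar v + (m - mvar u)"
      using mvar_add_minus[OF True] by (metis add.left_commute add_diff_cancel_left')
    ultimately show ?thesis using True
      by (simp add: lookup_rmax lookup_pv_mult keys_add_nat)
  next
    case False
    moreover have "u \<noteq> v" using assms by auto
    ultimately show ?thesis by (simp add: lookup_rmax lookup_pv_mult keys_add_nat)
  qed
qed

lemma rmax_pv_greater:
  assumes "v < u"
  shows "rmax v (pv u * p) = 0"
proof (rule poly_mapping_eqI)
  fix m :: mon
  show "lookup (rmax v (pv u * p)) m = lookup 0 m"
    using assms leD by (auto simp: lookup_rmax lookup_pv_mult keys_add_nat)
qed

lemma sum_restr_disjoint:
  assumes "finite A" and "\<And>u w m. u \<in> A \<Longrightarrow> w \<in> A \<Longrightarrow> P u m \<Longrightarrow> P w m \<Longrightarrow> u = w"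
  shows "(\<Sum>u\<in>A. restr (P u) p) = restr (\<lambda>m. \<exists>u\<in>A. P u m) (p :: 'a \<Rightarrow>\<^sub>0 'b::comm_monoid_add)"
proof (rule poly_mapping_eqI)
  fix m
  show "lookup (\<Sum>u\<in>A. restr (P u) p) m = lookup (restr (\<lambda>m. \<exists>u\<in>A. P u m) p) m"
  proof (cases "\<exists>u\<in>A. P u m")
    case True
    then obtain u where u: "u \<in> A" "P u m" by blast
    have "(\<Sum>w\<in>A. lookup (restr (P w) p) m) = (\<Sum>w\<in>{u}. lookup (restr (P w) p) m)"
      using u assms by (intro sum.mono_neutral_right) (auto simp: lookup_restr)
    then show ?thesis using u by (auto simp: lookup_sum lookup_restr)
  qed (simp add: lookup_sum lookup_restr)
qed

lemma koszul_mpoly: "finite U \<Longrightarrow> koszul U (\<lambda>v p. pv v * (p :: 'k::field mpoly))"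
  by unfold_locales (auto simp: distrib_left mult.left_commute)

text \<open>A monomial either has no variable above \<open>v\<close>, or is counted exactly once, at
  its largest variable.\<close>

lemma rmax_split:
  assumes U: "finite U" and p: "\<And>m. m \<in> keys p \<Longrightarrow> keys m \<subseteq> U"
  shows "rmax v (pv v * p) + (\<Sum>u\<in>{u \<in> U. v < u}. pv u * rmax u p) = p"
proof -
  have "(\<Sum>u\<in>{u \<in> U. v < u}. pv u * rmax u p) =
      restr (\<lambda>m. \<exists>u\<in>{u \<in> U. v < u}. u \<in> keys m \<and> (\<forall>w\<in>keys m. w \<le> u)) p"
    unfolding pv_rmax using U by (intro sum_restr_disjoint) (auto intro: antisym)
  moreover have "restr (\<lambda>m. \<forall>u\<in>keys m. u \<le> v) p +
      restr (\<lambda>m. \<exists>u\<in>{u \<in> U. v < u}. u \<in> keys m \<and> (\<forall>w\<in>keys m. w \<le> u)) p = p"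
  proof (rule poly_mapping_eqI)
    fix m
    have "(\<exists>u\<in>{u \<in> U. v < u}. u \<in> keys m \<and> (\<forall>w\<in>keys m. w \<le> u)) \<longleftrightarrow> \<not> (\<forall>u\<in>keys m. u \<le> v)"
      if m: "m \<in> keys p"
    proof
      assume "\<not> (\<forall>u\<in>keys m. u \<le> v)"
      then obtain u where u: "u \<in> keys m" "v < u" by auto
      then have "keys m \<noteq> {}" by blast
      then have "Max (keys m) \<in> keys m" "\<forall>w\<in>keys m. w \<le> Max (keys m)"
        using Max_in[of "keys m"] by auto
      moreover have "v < Max (keys m)" using u calculation(2) less_le_trans by blast
      ultimately show "\<exists>u\<in>{u \<in> U. v < u}. u \<in> keys m \<and> (\<forall>w\<in>keys m. w \<le> u)" using p[OF m] by blast
    qed force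
    then show "lookup (restr (\<lambda>m. \<forall>u\<in>keys m. u \<le> v) p +
      restr (\<lambda>m. \<exists>u\<in>{u \<in> U. v < u}. u \<in> keys m \<and> (\<forall>w\<in>keys m. w \<le> u)) p) m = lookup p m"
      by (cases "m \<in> keys p") (simp_all add: lookup_add lookup_restr in_keys_iff)
  qed
  ultimately show ?thesis by (simp add: rmax_pv)
qed

lemma rmax_split0:
  assumes U: "finite U" and p: "\<And>m. m \<in> keys p \<Longrightarrow> keys m \<subseteq> U" "0 \<notin> keys p"
  shows "(\<Sum>u\<in>U. pv u * rmax u p) = p"
proof -
  have "(\<Sum>u\<in>U. pv u * rmax u p) = restr (\<lambda>m. \<exists>u\<in>U. u \<in> keys m \<and> (\<forall>w\<in>keys m. w \<le> u)) p"
    unfolding pv_rmax using U by (intro sum_restr_disjoint) (auto intro: antisym)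
  also have "\<dots> = p"
  proof (rule restr_id)
    fix m assume m: "m \<in> keys p"
    then have "keys m \<noteq> {}" using p(2) by auto
    then have "Max (keys m) \<in> keys m" "\<forall>w\<in>keys m. w \<le> Max (keys m)"
      using Max_in[of "keys m"] by auto
    then show "\<exists>u\<in>U. u \<in> keys m \<and> (\<forall>w\<in>keys m. w \<le> u)" using p(1)[OF m] by blast
  qed
  finally show ?thesis .
qed

lemma koszul_homotopy_mpoly:
  "finite V \<Longrightarrow> koszul_homotopy (pvars V) (\<lambda>v p. pv v * (p :: 'k::field mpoly)) rmax
     (polys V) {p \<in> polys V. 0 \<notin> keys p}"
  unfolding koszul_homotopy_def koszul_homotopy_axioms_def
  by (intro conjI koszul_mpoly finite_pvars allI impI)
    (auto simp: rmax_add rmax_pv_less rmax_pv_greater intro!: rmax_split rmax_split0 finite_pvars dest: polysD)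

type_synonym 'k chain = "pvar set \<Rightarrow> 'k mpoly"

definition kbd :: "nat set \<Rightarrow> 'k::field chain \<Rightarrow> 'k chain" where
  "kbd V = koszul.bd (pvars V) (\<lambda>v p. pv v * p)"

text \<open>The internal degree \<open>j\<close> counts e_A with degree \<open>card A\<close>.
  Coefficients are taken in S instead of S/I, so the cycles and boundaries that follow are preimages
  and contain all chains with coefficients in I.\<close>

definition kch :: "nat set \<Rightarrow> nat \<Rightarrow> nat \<Rightarrow> 'k::field chain set" where
  "kch V k j = {c. \<forall>A. (c A \<noteq> 0 \<longrightarrow> A \<subseteq> pvars V \<and> card A = k) \<and> c A \<in> polys V \<and>
     (\<forall>m\<in>keys (c A). mdeg m + k = j)}"

definition kcyc :: "nat set \<Rightarrow> 'k::field mpoly set \<Rightarrow> nat \<Rightarrow> nat \<Rightarrow> 'k chain set" where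
  "kcyc V I k j = {c \<in> kch V k j. \<forall>A. kbd V c A \<in> I}"

definition kbou :: "nat set \<Rightarrow> 'k::field mpoly set \<Rightarrow> nat \<Rightarrow> nat \<Rightarrow> 'k chain set" where
  "kbou V I k j = {c \<in> kch V k j. \<exists>g\<in>kch V (Suc k) j. \<forall>A. c A - kbd V g A \<in> I}"

definition kscl :: "'k::field \<Rightarrow> 'k chain \<Rightarrow> 'k chain" where
  "kscl c a = (\<lambda>A. single 0 c * a A)"

text \<open>\<open>tor V I k j d\<close>: the degree \<open>j\<close> component of \<open>Tor\<^sub>k(S/I, K)\<close>, computed by the Koszul
  complex, has dimension \<open>d\<close>.\<close>

definition tor :: "nat set \<Rightarrow> 'k::field mpoly set \<Rightarrow> nat \<Rightarrow> nat \<Rightarrow> nat \<Rightarrow> bool" where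
  "tor V I k j d \<longleftrightarrow> has_qdim kscl (kcyc V I k j) (kbou V I k j) d"

lemma tor_0: "tor V I k j 0 \<longleftrightarrow> kcyc V I k j \<subseteq> kbou V I k j"
  by (simp add: tor_def has_qdim_0)

lemma vector_space_kscl: "vector_space (kscl :: 'k::field \<Rightarrow> _)"
  by unfold_locales
    (auto simp: kscl_def fun_eq_iff single_add distrib_left distrib_right mult.assoc[symmetric] mult_single)

lemma kchI:
  assumes "\<And>A. c A \<noteq> 0 \<Longrightarrow> A \<subseteq> pvars V \<and> card A = k" "\<And>A. c A \<in> polys V"
    "\<And>A m. m \<in> keys (c A) \<Longrightarrow> mdeg m + k = j"
  shows "c \<in> kch V k j"
  using assms by (auto simp: kch_def)

lemma kch_supp: "c \<in> kch V k j \<Longrightarrow> c A \<noteq> 0 \<Longrightarrow> A \<subseteq> pvars V \<and> card A = k"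
  and kch_polys: "c \<in> kch V k j \<Longrightarrow> c A \<in> polys V"
  and kch_deg: "c \<in> kch V k j \<Longrightarrow> m \<in> keys (c A) \<Longrightarrow> mdeg m + k = j"
  by (auto simp: kch_def)

lemma kch_0: "(\<lambda>A. 0) \<in> kch V k j"
  by (simp add: kch_def)

lemma kch_add:
  assumes "a \<in> kch V k j" "b \<in> kch V k j"
  shows "(\<lambda>A. a A + b A) \<in> kch V k j"
proof (rule kchI)
  fix A
  show "a A + b A \<noteq> 0 \<Longrightarrow> A \<subseteq> pvars V \<and> card A = k"
    using kch_supp[OF assms(1)] kch_supp[OF assms(2)] by (metis add_0)
  show "a A + b A \<in> polys V" by (intro polys_add kch_polys[OF assms(1)] kch_polys[OF assms(2)])
  show "mdeg m + k = j" if "m \<in> keys (a A + b A)" for m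
    using that Poly_Mapping.keys_add[of "a A" "b A"] kch_deg[OF assms(1)] kch_deg[OF assms(2)] by blast
qed

lemma kch_scale:
  assumes "a \<in> kch V k j"
  shows "kscl c a \<in> kch V k j"
proof (rule kchI)
  fix A
  show "kscl c a A \<noteq> 0 \<Longrightarrow> A \<subseteq> pvars V \<and> card A = k"
    using kch_supp[OF assms, of A] by (auto simp: kscl_def)
  show "kscl c a A \<in> polys V" unfolding kscl_def by (intro polys_mult polys_const kch_polys[OF assms])
  show "mdeg m + k = j" if "m \<in> keys (kscl c a A)" for m
    using that kch_deg[OF assms, of m A] by (auto simp: kscl_def in_keys_iff lookup_const_mult)
qed

lemma kch_minus: "a \<in> kch V k j \<Longrightarrow> (\<lambda>A. - a A) \<in> kch V k j"
  by (auto simp: kch_def intro: polys_uminus)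

lemma kch_diff:
  assumes "a \<in> kch V k j" "b \<in> kch V k j"
  shows "(\<lambda>A. a A - b A) \<in> kch V k j"
  using kch_add[OF assms(1) kch_minus[OF assms(2)]] by simp

lemma kch_pv:
  assumes "a \<in> kch V k j" "v \<in> pvars V"
  shows "(\<lambda>A. pv v * a A) \<in> kch V k (Suc j)"
proof (rule kchI)
  fix A
  show "pv v * a A \<noteq> 0 \<Longrightarrow> A \<subseteq> pvars V \<and> card A = k"
    using kch_supp[OF assms(1), of A] by auto
  show "pv v * a A \<in> polys V" by (intro polys_mult polys_pv kch_polys[OF assms(1)] assms)
  show "mdeg m + k = Suc j" if "m \<in> keys (pv v * a A)" for m
    using that kch_deg[OF assms(1), of _ A] by (auto simp: keys_pv_mult mdeg_add)
qed

lemma polys_sg: "p \<in> polys V \<Longrightarrow> sg n p \<in> polys V"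
  by (simp add: sg_def polys_uminus)

lemma keys_sg: "keys (sg n p) = keys p"
  by (simp add: sg_def in_keys_iff)

locale kring =
  fixes V :: "nat set"
  assumes finite_V: "finite V"
begin

lemma koszul_V: "koszul (pvars V) (\<lambda>v p. pv v * (p :: 'k::field mpoly))"
  by (intro koszul_mpoly finite_pvars finite_V)

lemmas kbd_add = koszul.bd_add[OF koszul_V, folded kbd_def]
lemmas kbd_diff = koszul.bd_diff[OF koszul_V, folded kbd_def]
lemmas kbd_0 = koszul.bd_0[OF koszul_V, folded kbd_def]
lemmas kbd_pv = koszul.bd_x[OF koszul_V, folded kbd_def]

lemma kbd_supp:
  assumes "c \<in> kch V k j" "kbd V c A \<noteq> 0"
  shows "A \<subseteq> pvars V" "Suc (card A) = k"
proof -
  obtain u where u: "u \<in> pvars V - A" "c (insert u A) \<noteq> 0"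
    using assms(2) unfolding kbd_def koszul.bd_def[OF koszul_V] by (metis (no_types, lifting) mult_zero_right sg_0 sum.neutral)
  then have *: "insert u A \<subseteq> pvars V" "card (insert u A) = k" using kch_supp[OF assms(1)] by auto
  then show "A \<subseteq> pvars V" by auto
  then have "finite A" using finite_pvars[OF finite_V] finite_subset by auto
  then show "Suc (card A) = k" using * u by simp
qed

lemma kbd_kch:
  assumes "c \<in> kch V (Suc k) j"
  shows "kbd V c \<in> kch V k j"
proof (rule kchI)
  fix A
  show "kbd V c A \<noteq> 0 \<Longrightarrow> A \<subseteq> pvars V \<and> card A = k" using kbd_supp[OF assms] by auto
  show "kbd V c A \<in> polys V"
    unfolding kbd_def koszul.bd_def[OF koszul_V]
    by (intro polys_sum polys_sg polys_mult polys_pv kch_polys[OF assms]) auto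
  show "mdeg m + k = j" if "m \<in> keys (kbd V c A)" for m
  proof -
    from that obtain u where u: "u \<in> pvars V - A" "m \<in> keys (sg (nabove u A) (pv u * c (insert u A)))"
      unfolding kbd_def koszul.bd_def[OF koszul_V]
      by (auto dest: subsetD[OF Poly_Mapping.keys_sum])
    then obtain m' where "m = mvar u + m'" "m' \<in> keys (c (insert u A))"
      by (auto simp: keys_sg keys_pv_mult)
    then show ?thesis using kch_deg[OF assms, of m'] by (simp add: mdeg_add)
  qed
qed

lemma kbd_kch_0: "c \<in> kch V 0 j \<Longrightarrow> kbd V c A = 0"
  using kbd_supp(2) by (metis Zero_not_Suc)

lemma kbd_kbd:
  assumes "c \<in> kch V k j"
  shows "kbd V (kbd V c) A = 0"
proof (rule ccontr)
  assume *: "kbd V (kbd V c) A \<noteq> 0"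
  have "A \<subseteq> pvars V"
  proof (cases k)
    case 0
    then have "kbd V c = (\<lambda>A. 0)" using kbd_kch_0 assms by blast
    then show ?thesis using * by (simp add: kbd_0)
  next
    case (Suc k')
    then show ?thesis using kbd_kch[of c k' j] assms kbd_supp(1) * by blast
  qed
  then show False using * koszul.bd_bd[OF koszul_V, folded kbd_def] by blast
qed

lemma kbd_in: "hideal V I \<Longrightarrow> (\<And>A. c A \<in> I) \<Longrightarrow> kbd V c A \<in> I"
  unfolding kbd_def koszul.bd_def[OF koszul_V]
  by (intro hideal_sum) (auto simp: sg_def intro!: hideal_uminus hideal_mult polys_pv)

lemma kbd_scale: "kbd V (kscl c a) = kscl c (kbd V a)"
proof
  fix A
  show "kbd V (kscl c a) A = kscl c (kbd V a) A"
    using bd_hom[OF koszul_V koszul_V, of "\<lambda>p. single 0 c * p" a A]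
    by (simp add: kscl_def kbd_def distrib_left mult.left_commute)
qed

lemma kcyc_kch: "c \<in> kcyc V I k j \<Longrightarrow> c \<in> kch V k j"
  and kcyc_bd: "c \<in> kcyc V I k j \<Longrightarrow> kbd V c A \<in> I"
  and kcycI: "c \<in> kch V k j \<Longrightarrow> (\<And>A. kbd V c A \<in> I) \<Longrightarrow> c \<in> kcyc V I k j"
  and kbouI: "c \<in> kch V k j \<Longrightarrow> g \<in> kch V (Suc k) j \<Longrightarrow> (\<And>A. c A - kbd V g A \<in> I) \<Longrightarrow> c \<in> kbou V I k j"
  by (auto simp: kcyc_def kbou_def)

lemma kbouE:
  assumes "c \<in> kbou V I k j"
  obtains g i where "g \<in> kch V (Suc k) j" "i \<in> kch V k j" "\<And>A. i A \<in> I" "\<And>A. c A = kbd V g A + i A"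
proof -
  from assms obtain g where g: "c \<in> kch V k j" "g \<in> kch V (Suc k) j" "\<And>A. c A - kbd V g A \<in> I"
    by (auto simp: kbou_def)
  show thesis
    by (rule that[of g "\<lambda>A. c A - kbd V g A"]) (use g kch_diff[OF g(1) kbd_kch[OF g(2)]] in auto)
qed

lemma ksub_kcyc: "hideal V I \<Longrightarrow> ksub kscl (kcyc V I k j)"
  unfolding ksub_def kcyc_def
  by (auto simp: plus_fun_def zero_fun_def kbd_add kbd_0 kbd_scale kch_add kch_0 kch_scale
      intro: hideal_0 hideal_add) (auto simp: kscl_def intro!: hideal_mult)

subsection \<open>Long exact sequences\<close>

text \<open>The homogeneous components of the prescribed degree of any two summands again add up to
  \<open>c D\<close>, and zero coefficients are split trivially; both parts therefore remain chains
  of the same degree.\<close>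

lemma kch_split_sum:
  assumes A: "hideal V A" and B: "hideal V B" and c: "c \<in> kch V k j" "\<And>D. c D \<in> ideal_sum A B"
  obtains a b where "a \<in> kch V k j" "b \<in> kch V k j" "\<And>D. a D \<in> A" "\<And>D. b D \<in> B" "\<And>D. c D = a D + b D"
proof -
  have "\<exists>p q. p \<in> A \<and> q \<in> B \<and> c D = p + q \<and> (c D = 0 \<longrightarrow> p = 0 \<and> q = 0) \<and>
      (\<forall>m\<in>keys p \<union> keys q. mdeg m + k = j)" for D
  proof (cases "c D = 0")
    case True
    then show ?thesis using hideal_0[OF A] hideal_0[OF B] by (intro exI[of _ 0]) auto
  next
    case False
    obtain p q where pq: "p \<in> A" "q \<in> B" "c D = p + q" using c(2)[of D] by (auto simp: ideal_sum_def)
    have kj: "k \<le> j" using False kch_deg[OF c(1), of _ D] by (metis keys_eq_empty all_not_in_conv le_add2)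
    have "hcomp (j - k) (c D) = c D"
      by (rule restr_id) (use kch_deg[OF c(1)] in fastforce)
    then have "c D = hcomp (j - k) p + hcomp (j - k) q" by (simp add: pq(3) restr_add)
    then show ?thesis using pq A B kj False
      by (intro exI[of _ "hcomp (j - k) p"] exI[of _ "hcomp (j - k) q"])
        (auto simp: keys_restr intro: hideal_hcomp)
  qed
  then obtain a b where ab: "\<And>D. a D \<in> A" "\<And>D. b D \<in> B" "\<And>D. c D = a D + b D"
    "\<And>D. c D = 0 \<Longrightarrow> a D = 0 \<and> b D = 0" "\<And>D m. m \<in> keys (a D) \<union> keys (b D) \<Longrightarrow> mdeg m + k = j"
    by metis
  have "a D \<noteq> 0 \<or> b D \<noteq> 0 \<Longrightarrow> D \<subseteq> pvars V \<and> card D = k" for D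
    using ab(4)[of D] kch_supp[OF c(1), of D] by blast
  then have "a \<in> kch V k j" "b \<in> kch V k j"
    using ab(5) hideal_polys[OF A ab(1)] hideal_polys[OF B ab(2)] by (intro kchI; blast)+
  then show thesis using that ab(1-3) by blast
qed

lemma kch_split_var:
  assumes I: "hideal V I" and y: "y \<in> pvars V" and c: "c \<in> kch V k (Suc j)" "\<And>D. c D \<in> add_var V I y"
  obtains a f where "a \<in> kch V k (Suc j)" "f \<in> kch V k j" "\<And>D. a D \<in> I" "\<And>D. c D = a D + pv y * f D"
proof -
  have "\<exists>p q. p \<in> I \<and> q \<in> polys V \<and> c D = p + pv y * q \<and> (c D = 0 \<longrightarrow> p = 0 \<and> q = 0) \<and>
      (\<forall>m\<in>keys p. mdeg m + k = Suc j) \<and> (\<forall>m\<in>keys q. mdeg m + k = j)" for D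
  proof (cases "c D = 0")
    case True
    then show ?thesis using hideal_0[OF I] by (intro exI[of _ 0]) auto
  next
    case False
    obtain p q where pq: "p \<in> I" "q \<in> polys V" "c D = p + pv y * q" using c(2)[of D] by (auto simp: add_var_def)
    have kj: "k \<le> Suc j" using False kch_deg[OF c(1), of _ D] by (metis keys_eq_empty all_not_in_conv le_add2)
    have cD: "hcomp (Suc j - k) (c D) = c D"
      by (rule restr_id) (use kch_deg[OF c(1)] in fastforce)
    show ?thesis
    proof (cases "k \<le> j")
      case True
      then have "c D = hcomp (Suc j - k) p + pv y * hcomp (j - k) q"
        using cD by (simp add: pq(3) restr_add Suc_diff_le hcomp_pv_mult)
      then show ?thesis using pq I True False
        by (intro exI[of _ "hcomp (Suc j - k) p"] exI[of _ "hcomp (j - k) q"])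
          (auto simp: keys_restr intro: hideal_hcomp polys_restr)
    next
      case False
      \<comment> \<open>Here the coefficients have degree 0, where multiples of y contribute
        nothing.\<close>
      then have "Suc j = k" using kj by simp
      then have "c D = hcomp 0 p"
        using cD by (simp add: pq(3) restr_add hcomp_0_pv_mult)
      then show ?thesis using pq I \<open>Suc j = k\<close> \<open>c D \<noteq> 0\<close>
        by (intro exI[of _ "hcomp 0 p"] exI[of _ 0]) (auto simp: keys_restr intro: hideal_hcomp)
    qed
  qed
  then obtain a f where ab: "\<And>D. a D \<in> I" "\<And>D. f D \<in> polys V" "\<And>D. c D = a D + pv y * f D"
    "\<And>D. c D = 0 \<Longrightarrow> a D = 0 \<and> f D = 0" "\<And>D m. m \<in> keys (a D) \<Longrightarrow> mdeg m + k = Suc j"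
    "\<And>D m. m \<in> keys (f D) \<Longrightarrow> mdeg m + k = j"
    by metis
  have "a D \<noteq> 0 \<or> f D \<noteq> 0 \<Longrightarrow> D \<subseteq> pvars V \<and> card D = k" for D
    using ab(4)[of D] kch_supp[OF c(1), of D] by blast
  then have "a \<in> kch V k (Suc j)" "f \<in> kch V k j"
    using ab(2,5,6) hideal_polys[OF I ab(1)] by (intro kchI; blast)+
  then show thesis using that ab(1,3) by blast
qed

lemma add_var_left: "a \<in> I \<Longrightarrow> a \<in> add_var V I y"
  by (force simp: add_var_def)

text \<open>Injectivity of the connecting map: a relation g1 - g2 = bd h + a + b makes g1 - a and g2
  + b + bd h coincide, and this common chain bounds \<open>c\<close> modulo both ideals at
  once.\<close>

lemma kbou_IntI:
  assumes A: "hideal V A" and B: "hideal V B" and c: "c \<in> kch V k j"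
    and g1: "g1 \<in> kch V (Suc k) j" "\<And>D. c D - kbd V g1 D \<in> A"
    and g2: "g2 \<in> kch V (Suc k) j" "\<And>D. c D - kbd V g2 D \<in> B"
    and bou: "g1 - g2 \<in> kbou V (ideal_sum A B) (Suc k) j"
  shows "c \<in> kbou V (A \<inter> B) k j"
proof -
  obtain h i where h: "h \<in> kch V (Suc (Suc k)) j" "i \<in> kch V (Suc k) j" "\<And>D. i D \<in> ideal_sum A B"
    "\<And>D. (g1 - g2) D = kbd V h D + i D"
    using bou by (rule kbouE) blast
  obtain a b where ab: "a \<in> kch V (Suc k) j" "b \<in> kch V (Suc k) j" "\<And>D. a D \<in> A" "\<And>D. b D \<in> B" "\<And>D. i D = a D + b D"
    by (rule kch_split_sum[OF A B h(2,3)]) blast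
  define g where "g = (\<lambda>D. g1 D - a D)"
  have g': "g = (\<lambda>D. (g2 D + b D) + kbd V h D)"
  proof
    show "g D = (g2 D + b D) + kbd V h D" for D
      using h(4)[of D] ab(5)[of D] by (simp add: g_def algebra_simps)
  qed
  show "c \<in> kbou V (A \<inter> B) k j"
  proof (rule kbouI[of _ _ _ g])
    show "g \<in> kch V (Suc k) j" unfolding g_def by (rule kch_diff[OF g1(1) ab(1)])
    fix D
    have "c D - kbd V g D = (c D - kbd V g1 D) + kbd V a D" by (simp add: g_def kbd_diff)
    moreover have "c D - kbd V g D = (c D - kbd V g2 D) - kbd V b D"
      by (simp add: g' kbd_add kbd_kbd[OF h(1)])
    ultimately show "c D - kbd V g D \<in> A \<inter> B"
      using hideal_add[OF A g1(2)[of D] kbd_in[OF A, of a, OF ab(3)]] hideal_diff[OF B g2(2)[of D] kbd_in[OF B, of b, OF ab(4)]]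
      by (metis IntI)
  qed fact
qed

lemma kcyc_sumI:
  assumes A: "hideal V A" and B: "hideal V B"
    and g1: "g1 \<in> kch V (Suc k) j" "\<And>D. c D - kbd V g1 D \<in> A"
    and g2: "g2 \<in> kch V (Suc k) j" "\<And>D. c D - kbd V g2 D \<in> B"
  shows "g1 - g2 \<in> kcyc V (ideal_sum A B) (Suc k) j"
  unfolding fun_diff_def
proof (rule kcycI[OF kch_diff[OF g1(1) g2(1)]])
  fix D
  have "kbd V (\<lambda>D. g1 D - g2 D) D = (- (c D - kbd V g1 D)) + (c D - kbd V g2 D)"
    by (simp add: kbd_diff)
  then show "kbd V (\<lambda>D. g1 D - g2 D) D \<in> ideal_sum A B"
    using hideal_uminus[OF A g1(2)[of D]] g2(2)[of D] unfolding ideal_sum_def by blast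
qed

lemma kcyc_Int_split:
  assumes "tor V A k j 0" "tor V B k j 0" "c \<in> kcyc V (A \<inter> B) k j"
  obtains g1 g2 where "g1 \<in> kch V (Suc k) j" "\<And>D. c D - kbd V g1 D \<in> A"
    "g2 \<in> kch V (Suc k) j" "\<And>D. c D - kbd V g2 D \<in> B"
proof -
  have "c \<in> kcyc V A k j" "c \<in> kcyc V B k j" using assms by (auto simp: kcyc_def)
  then have "c \<in> kbou V A k j" "c \<in> kbou V B k j" using assms by (auto simp: tor_0)
  then show thesis using that by (auto simp: kbou_def)
qed

text \<open>Exactness of Tor_{k+1}(S/(A+B)) -> Tor_k(S/(A \<inter> B)) -> Tor_k(S/A) \<oplus>
  Tor_k(S/B) in the middle.\<close>

lemma tor_Int_0:
  assumes A: "hideal V A" and B: "hideal V B"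
    and A0: "tor V A k j 0" and B0: "tor V B k j 0" and "tor V (ideal_sum A B) (Suc k) j 0"
  shows "tor V (A \<inter> B) k j 0"
  unfolding tor_0
proof
  fix c assume c: "c \<in> kcyc V (A \<inter> B) k j"
  obtain g1 g2 where g: "g1 \<in> kch V (Suc k) j" "\<And>D. c D - kbd V g1 D \<in> A"
    "g2 \<in> kch V (Suc k) j" "\<And>D. c D - kbd V g2 D \<in> B"
    by (rule kcyc_Int_split[OF A0 B0 c]) blast
  then have "g1 - g2 \<in> kbou V (ideal_sum A B) (Suc k) j"
    using kcyc_sumI[OF A B g] assms by (auto simp: tor_0)
  then show "c \<in> kbou V (A \<inter> B) k j" by (rule kbou_IntI[OF A B kcyc_kch[OF c] g])
qed

text \<open>The four vanishing groups surround the connecting map of 0 -> S/(A \<inter> B) -> S/A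
  \<oplus> S/B -> S/(A+B) -> 0, which is therefore an isomorphism.\<close>

lemma tor_Int_Suc:
  assumes A: "hideal V A" and B: "hideal V B"
    and A0: "tor V A k j 0" and B0: "tor V B k j 0" and A1: "tor V A (Suc k) j 0" and B1: "tor V B (Suc k) j 0"
    and d: "tor V (ideal_sum A B) (Suc k) j d"
  shows "tor V (A \<inter> B) k j d"
proof -
  \<comment> \<open>The connecting map as a relation: \<open>c\<close> bounds modulo A by
    \<open>g1\<close> and modulo B by \<open>g2\<close>, and \<open>g\<close> is their
    difference.\<close>
  define R where "R g c \<longleftrightarrow> (\<exists>g1\<in>kch V (Suc k) j. \<exists>g2\<in>kch V (Suc k) j. g = g1 - g2 \<and>
    (\<forall>D. c D - kbd V g1 D \<in> A) \<and> (\<forall>D. c D - kbd V g2 D \<in> B))" for g c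
  have RI: "R (g1 - g2) c" if "g1 \<in> kch V (Suc k) j" "g2 \<in> kch V (Suc k) j"
    "\<And>D. c D - kbd V g1 D \<in> A" "\<And>D. c D - kbd V g2 D \<in> B" for g1 g2 c
    using that unfolding R_def by blast
  have RE: "\<exists>g1 g2. g1 \<in> kch V (Suc k) j \<and> g2 \<in> kch V (Suc k) j \<and> g = g1 - g2 \<and>
    (\<forall>D. c D - kbd V g1 D \<in> A) \<and> (\<forall>D. c D - kbd V g2 D \<in> B)" if "R g c" for g c
    using that unfolding R_def by blast
  note AB = hideal_ideal_sum[OF A B]
  show ?thesis unfolding tor_def
  proof (rule has_qdim_relation[where R = R])
    show "ksub kscl (kcyc V (ideal_sum A B) (Suc k) j)" "ksub kscl (kcyc V (A \<inter> B) k j)"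
      by (intro ksub_kcyc AB hideal_Int A B)+
    show "has_qdim kscl (kcyc V (ideal_sum A B) (Suc k) j) (kbou V (ideal_sum A B) (Suc k) j) d"
      using d by (simp add: tor_def)
    show "vector_space (kscl :: 'a \<Rightarrow> _)" "vector_space (kscl :: 'a \<Rightarrow> _)" by (rule vector_space_kscl)+
    show "R 0 0"
      using RI[OF kch_0 kch_0, of "\<lambda>_. 0"] A B by (simp add: kbd_0 zero_fun_def fun_diff_def hideal_0)
  next
    fix x y x' y' assume "R x y" "R x' y'"
    then obtain g1 g2 g1' g2' where g: "g1 \<in> kch V (Suc k) j" "g2 \<in> kch V (Suc k) j" "x = g1 - g2"
        "\<And>D. y D - kbd V g1 D \<in> A" "\<And>D. y D - kbd V g2 D \<in> B"
      and g': "g1' \<in> kch V (Suc k) j" "g2' \<in> kch V (Suc k) j" "x' = g1' - g2'"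
        "\<And>D. y' D - kbd V g1' D \<in> A" "\<And>D. y' D - kbd V g2' D \<in> B"
      by (blast dest: RE)
    have "x + x' = (\<lambda>D. g1 D + g1' D) - (\<lambda>D. g2 D + g2' D)"
      by (simp add: g(3) g'(3) fun_eq_iff)
    moreover have "R ((\<lambda>D. g1 D + g1' D) - (\<lambda>D. g2 D + g2' D)) (y + y')"
      using hideal_add[OF A g(4) g'(4)] hideal_add[OF B g(5) g'(5)]
      by (intro RI kch_add g(1,2) g'(1,2)) (auto simp: kbd_add algebra_simps)
    ultimately show "R (x + x') (y + y')" by simp
  next
    fix c x y assume "R x y"
    then obtain g1 g2 where g: "g1 \<in> kch V (Suc k) j" "g2 \<in> kch V (Suc k) j" "x = g1 - g2"
        "\<And>D. y D - kbd V g1 D \<in> A" "\<And>D. y D - kbd V g2 D \<in> B"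
      by (blast dest: RE)
    have "kscl c x = kscl c g1 - kscl c g2"
      by (simp add: g(3) fun_eq_iff kscl_def right_diff_distrib)
    moreover have "R (kscl c g1 - kscl c g2) (kscl c y)"
      using hideal_mult[OF A g(4) polys_const] hideal_mult[OF B g(5) polys_const]
      unfolding right_diff_distrib
      by (intro RI kch_scale g(1,2)) (simp_all only: kbd_scale, simp_all add: kscl_def)
    ultimately show "R (kscl c x) (kscl c y)" by simp
  next
    fix g assume g: "g \<in> kcyc V (ideal_sum A B) (Suc k) j"
    obtain a b where ab: "a \<in> kch V k j" "b \<in> kch V k j" "\<And>D. a D \<in> A" "\<And>D. b D \<in> B" "\<And>D. kbd V g D = a D + b D"
      by (rule kch_split_sum[OF A B kbd_kch[OF kcyc_kch[OF g]] kcyc_bd[OF g]]) blast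
    \<comment> \<open>As bd g = a + b, the boundaries of \<open>a\<close> and \<open>b\<close> are
      opposite and hence lie in both ideals; the pair (g, 0) then relates \<open>g\<close> to
      \<open>b\<close>.\<close>
    have "b \<in> kcyc V (A \<inter> B) k j"
    proof (rule kcycI[OF ab(2)])
      fix D
      have "kbd V (kbd V g) D = 0" by (rule kbd_kbd[OF kcyc_kch[OF g]])
      then have "kbd V (\<lambda>D. a D + b D) D = 0" by (simp add: ab(5)[abs_def])
      then have "kbd V b D = - kbd V a D" unfolding kbd_add by (simp add: eq_neg_iff_add_eq_0 add.commute)
      moreover have "kbd V b D \<in> B" "- kbd V a D \<in> A"
        by (intro kbd_in[OF B] ab hideal_uminus[OF A] kbd_in[OF A])+
      ultimately show "kbd V b D \<in> A \<inter> B" by simp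
    qed
    moreover have "R (g - (\<lambda>_. 0)) b"
      using hideal_uminus[OF A ab(3)] by (intro RI kcyc_kch[OF g] kch_0) (auto simp: ab(4,5) kbd_0)
    ultimately show "\<exists>c\<in>kcyc V (A \<inter> B) k j. R g c" by (auto simp: fun_diff_def)
  next
    fix c assume c: "c \<in> kcyc V (A \<inter> B) k j"
    obtain g1 g2 where g: "g1 \<in> kch V (Suc k) j" "\<And>D. c D - kbd V g1 D \<in> A"
      "g2 \<in> kch V (Suc k) j" "\<And>D. c D - kbd V g2 D \<in> B"
      by (rule kcyc_Int_split[OF A0 B0 c]) blast
    show "\<exists>g\<in>kcyc V (ideal_sum A B) (Suc k) j. R g c"
      using kcyc_sumI[OF A B g] RI[OF g(1,3,2,4)] by blast
  next
    fix g c assume c: "c \<in> kcyc V (A \<inter> B) k j" and "R g c"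
    then obtain g1 g2 where g: "g1 \<in> kch V (Suc k) j" "g2 \<in> kch V (Suc k) j" "g = g1 - g2"
        "\<And>D. c D - kbd V g1 D \<in> A" "\<And>D. c D - kbd V g2 D \<in> B"
      by (blast dest: RE)
    show "g \<in> kbou V (ideal_sum A B) (Suc k) j \<longleftrightarrow> c \<in> kbou V (A \<inter> B) k j"
    proof
      assume "c \<in> kbou V (A \<inter> B) k j"
      then obtain u i where u: "u \<in> kch V (Suc k) j" "i \<in> kch V k j" "\<And>D. i D \<in> A \<inter> B" "\<And>D. c D = kbd V u D + i D"
        by (rule kbouE) blast
      \<comment> \<open>A chain \<open>u\<close> bounding \<open>c\<close> modulo the intersection
        differs from \<open>g1\<close> and \<open>g2\<close> by cycles, which bound by the vanishing
        one step up.\<close>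
      have 1: "(\<lambda>D. u D - g1 D) \<in> kcyc V A (Suc k) j"
      proof (rule kcycI[OF kch_diff[OF u(1) g(1)]])
        show "kbd V (\<lambda>D. u D - g1 D) D \<in> A" for D
          using hideal_diff[OF A g(4)[of D], of "i D"] u(3)[of D] by (simp add: kbd_diff u(4) algebra_simps)
      qed
      have 2: "(\<lambda>D. u D - g2 D) \<in> kcyc V B (Suc k) j"
      proof (rule kcycI[OF kch_diff[OF u(1) g(2)]])
        show "kbd V (\<lambda>D. u D - g2 D) D \<in> B" for D
          using hideal_diff[OF B g(5)[of D], of "i D"] u(3)[of D] by (simp add: kbd_diff u(4) algebra_simps)
      qed
      from 1 2 A1 B1 obtain h1 h2 where h: "h1 \<in> kch V (Suc (Suc k)) j" "\<And>D. u D - g1 D - kbd V h1 D \<in> A"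
          "h2 \<in> kch V (Suc (Suc k)) j" "\<And>D. u D - g2 D - kbd V h2 D \<in> B"
        unfolding tor_0 kbou_def by blast
      show "g \<in> kbou V (ideal_sum A B) (Suc k) j" unfolding g(3) fun_diff_def
      proof (rule kbouI[OF kch_diff[OF g(1,2)] kch_diff[OF h(3,1)]])
        fix D
        have "g1 D - g2 D - kbd V (\<lambda>A. h2 A - h1 A) D = - (u D - g1 D - kbd V h1 D) + (u D - g2 D - kbd V h2 D)"
          by (simp add: kbd_diff)
        then show "g1 D - g2 D - kbd V (\<lambda>A. h2 A - h1 A) D \<in> ideal_sum A B"
          using hideal_uminus[OF A h(2)] h(4)[of D] unfolding ideal_sum_def by blast
      qed
    qed (use kbou_IntI[OF A B kcyc_kch[OF c] g(1,4,2,5)] g(3) in blast)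
  qed
qed


section \<open>Colon ideals and the exact sequence 0 -> S/(I:y)(-1) -> S/I -> S/(I + (y)) ->
  0\<close>

lemma colonI: "p \<in> polys V \<Longrightarrow> pv y * p \<in> I \<Longrightarrow> p \<in> colon V I y"
  and colonD: "p \<in> colon V I y \<Longrightarrow> pv y * p \<in> I"
  by (auto simp: colon_def)

lemma kbou_addI:
  assumes I: "hideal V I" and y: "y \<in> pvars V" and c: "c \<in> kch V k (Suc j)"
    and g: "g \<in> kch V (Suc k) (Suc j)" and a: "\<And>D. a D \<in> I"
    and f: "f \<in> kbou V (colon V I y) k j" and eq: "\<And>D. c D = kbd V g D + a D + pv y * f D"
  shows "c \<in> kbou V I k (Suc j)"
proof -
  obtain h i where h: "h \<in> kch V (Suc k) j" "i \<in> kch V k j" "\<And>D. i D \<in> colon V I y" "\<And>D. f D = kbd V h D + i D"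
    using f by (rule kbouE) blast
  show ?thesis
  proof (rule kbouI[OF c kch_add[OF g kch_pv[OF h(1) y]]])
    fix D
    have "c D - kbd V (\<lambda>A. g A + pv y * h A) D = a D + pv y * i D"
      by (simp add: kbd_add kbd_pv eq h(4) algebra_simps)
    then show "c D - kbd V (\<lambda>A. g A + pv y * h A) D \<in> I"
      using hideal_add[OF I a[of D] colonD[OF h(3)[of D]]] by simp
  qed
qed

lemma kbou_add_var_split:
  assumes I: "hideal V I" and y: "y \<in> pvars V" and c: "c \<in> kbou V (add_var V I y) k (Suc j)"
  obtains g a f where "g \<in> kch V (Suc k) (Suc j)" "a \<in> kch V k (Suc j)" "\<And>D. a D \<in> I" "f \<in> kch V k j"
    "\<And>D. c D = kbd V g D + a D + pv y * f D"
proof -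
  obtain g i where g: "g \<in> kch V (Suc k) (Suc j)" "i \<in> kch V k (Suc j)" "\<And>D. i D \<in> add_var V I y" "\<And>D. c D = kbd V g D + i D"
    using c by (rule kbouE) blast
  obtain a f where "a \<in> kch V k (Suc j)" "f \<in> kch V k j" "\<And>D. a D \<in> I" "\<And>D. i D = a D + pv y * f D"
    by (rule kch_split_var[OF I y g(2,3)]) blast
  then show thesis using that[of g a f] g by (simp add: algebra_simps)
qed

lemma kcyc_colonI:
  assumes I: "hideal V I" and c: "\<And>D. kbd V c D \<in> I" and a: "\<And>D. a D \<in> I" and f: "f \<in> kch V k j"
    and g: "g \<in> kch V k' j'" and eq: "\<And>D. c D = kbd V g D + a D + pv y * f D"
  shows "f \<in> kcyc V (colon V I y) k j"
proof (rule kcycI[OF f])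
  fix D
  have "kbd V c D = kbd V (kbd V g) D + kbd V a D + pv y * kbd V f D"
    unfolding eq[abs_def] by (simp add: kbd_add kbd_pv)
  then have "pv y * kbd V f D = kbd V c D - kbd V a D" by (simp add: kbd_kbd[OF g])
  then have "pv y * kbd V f D \<in> I" using hideal_diff[OF I c kbd_in[OF I, of a, OF a]] by simp
  moreover have "kbd V f D \<in> polys V"
    unfolding kbd_def koszul.bd_def[OF koszul_V]
    by (intro polys_sum polys_sg polys_mult polys_pv kch_polys[OF f]) auto
  ultimately show "kbd V f D \<in> colon V I y" by (intro colonI)
qed

lemma kcyc_add_var: "c \<in> kcyc V I k j \<Longrightarrow> c \<in> kcyc V (add_var V I y) k j"
  by (auto simp: kcyc_def add_var_left)

lemma tor_small: "j < k \<Longrightarrow> 0 \<in> I \<Longrightarrow> tor V I k j 0"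
  unfolding tor_0
proof
  fix c assume "j < k" "0 \<in> I" and c: "c \<in> kcyc V I k j"
  have "c D = 0" for D
    using kch_deg[OF kcyc_kch[OF c], of _ D] \<open>j < k\<close> by (metis add_lessD1 keys_eq_empty all_not_in_conv add.commute less_irrefl)
  then show "c \<in> kbou V I k j" using \<open>0 \<in> I\<close>
    by (intro kbouI[OF kcyc_kch[OF c] kch_0]) (auto simp: kbd_0)
qed

text \<open>Exactness in the middle: a class that dies modulo y comes from the colon ideal by
  multiplication with y, and there it bounds.\<close>

lemma tor_colon_0:
  assumes I: "hideal V I" and y: "y \<in> pvars V"
    and 1: "tor V (colon V I y) k j 0" and 2: "tor V (add_var V I y) k (Suc j) 0"
  shows "tor V I k (Suc j) 0"
  unfolding tor_0
proof
  fix c assume c: "c \<in> kcyc V I k (Suc j)"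
  then have "c \<in> kbou V (add_var V I y) k (Suc j)" using kcyc_add_var[OF c, of y] 2 by (auto simp: tor_0)
  then obtain g a f where gaf: "g \<in> kch V (Suc k) (Suc j)" "a \<in> kch V k (Suc j)" "\<And>D. a D \<in> I" "f \<in> kch V k j"
    "\<And>D. c D = kbd V g D + a D + pv y * f D"
    by (rule kbou_add_var_split[OF I y]) blast
  have "f \<in> kcyc V (colon V I y) k j" by (rule kcyc_colonI[OF I kcyc_bd[OF c] gaf(3,4,1,5)])
  then have "f \<in> kbou V (colon V I y) k j" using 1 by (auto simp: tor_0)
  then show "c \<in> kbou V I k (Suc j)" using kbou_addI[OF I y kcyc_kch[OF c] gaf(1,3) _ gaf(5)] by blast
qed

lemma kscl_sum: "(\<Sum>i<(n::nat). kscl (b i) (c i)) D = (\<Sum>i<n. single 0 (b i) * c i D)"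
  by (induction n) (auto simp: kscl_def)

text \<open>Hypothesis 3 kills the target of the connecting map on the classes modulo y, so they
  lift; hypothesis 4 kills the source of the one into the colon classes, so multiplication by y is
  injective on them. The sequence being short exact, the two bases combine to one in the middle,
  which is assembled by hand because \<open>tor\<close> is expressed by representatives.\<close>

lemma tor_colon_add:
  assumes I: "hideal V I" and y: "y \<in> pvars V"
    and 1: "tor V (colon V I y) (Suc k) j d1" and 2: "tor V (add_var V I y) (Suc k) (Suc j) d2"
    and 3: "tor V (colon V I y) k j 0" and 4: "tor V (add_var V I y) (Suc (Suc k)) (Suc j) 0"
  shows "tor V I (Suc k) (Suc j) (d1 + d2)"
proof -
  note C = hideal_colon[OF I, of y] and P = hideal_add_var[OF I y]
  obtain c1 where c1: "\<And>i. i < d1 \<Longrightarrow> c1 i \<in> kcyc V (colon V I y) (Suc k) j"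
    and sp1: "\<And>z. z \<in> kcyc V (colon V I y) (Suc k) j \<Longrightarrow> \<exists>b. z - (\<Sum>i<d1. kscl (b i) (c1 i)) \<in> kbou V (colon V I y) (Suc k) j"
    and ind1: "\<And>b. (\<Sum>i<d1. kscl (b i) (c1 i)) \<in> kbou V (colon V I y) (Suc k) j \<Longrightarrow> \<forall>i<d1. b i = 0"
    using 1 unfolding tor_def has_qdim_def by blast
  obtain c2 where c2: "\<And>i. i < d2 \<Longrightarrow> c2 i \<in> kcyc V (add_var V I y) (Suc k) (Suc j)"
    and sp2: "\<And>z. z \<in> kcyc V (add_var V I y) (Suc k) (Suc j) \<Longrightarrow> \<exists>b. z - (\<Sum>i<d2. kscl (b i) (c2 i)) \<in> kbou V (add_var V I y) (Suc k) (Suc j)"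
    and ind2: "\<And>b. (\<Sum>i<d2. kscl (b i) (c2 i)) \<in> kbou V (add_var V I y) (Suc k) (Suc j) \<Longrightarrow> \<forall>i<d2. b i = 0"
    using 2 unfolding tor_def has_qdim_def by blast
  have "\<exists>g. g \<in> kch V (Suc k) j \<and> (\<lambda>D. c D - pv y * g D) \<in> kcyc V I (Suc k) (Suc j)"
    if c: "c \<in> kcyc V (add_var V I y) (Suc k) (Suc j)" for c
  proof -
    obtain a f where af: "a \<in> kch V k (Suc j)" "f \<in> kch V k j" "\<And>D. a D \<in> I" "\<And>D. kbd V c D = a D + pv y * f D"
      by (rule kch_split_var[OF I y kbd_kch[OF kcyc_kch[OF c]] kcyc_bd[OF c]]) blast
    have "f \<in> kcyc V (colon V I y) k j"
    proof (rule kcyc_colonI[OF I _ af(3,2) kch_0])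
      show "kbd V (kbd V c) D \<in> I" for D using kbd_kbd[OF kcyc_kch[OF c]] hideal_0[OF I] by simp
      show "kbd V c D = kbd V (\<lambda>A. 0) D + a D + pv y * f D" for D by (simp add: af(4) kbd_0)
    qed
    then obtain g where g: "g \<in> kch V (Suc k) j" "\<And>D. f D - kbd V g D \<in> colon V I y"
      using 3 by (auto simp: tor_0 kbou_def)
    have "(\<lambda>D. c D - pv y * g D) \<in> kcyc V I (Suc k) (Suc j)"
    proof (rule kcycI[OF kch_diff[OF kcyc_kch[OF c] kch_pv[OF g(1) y]]])
      fix D
      have "kbd V (\<lambda>D. c D - pv y * g D) D = a D + pv y * (f D - kbd V g D)"
        by (simp add: kbd_diff kbd_pv af(4) algebra_simps)
      then show "kbd V (\<lambda>D. c D - pv y * g D) D \<in> I"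
        using hideal_add[OF I af(3)[of D] colonD[OF g(2)[of D]]] by simp
    qed
    then show ?thesis using g by blast
  qed
  then have "\<forall>i. \<exists>g. i < d2 \<longrightarrow> g \<in> kch V (Suc k) j \<and>
      (\<lambda>D. c2 i D - pv y * g D) \<in> kcyc V I (Suc k) (Suc j)"
    using c2 by blast
  from choice[OF this] obtain h where h: "\<And>i. i < d2 \<Longrightarrow> h i \<in> kch V (Suc k) j"
    "\<And>i. i < d2 \<Longrightarrow> (\<lambda>D. c2 i D - pv y * h i D) \<in> kcyc V I (Suc k) (Suc j)"
    by blast
  \<comment> \<open>The colon cycles times y come first, followed by the lifts of the cycles modulo
    y, which \<open>h\<close> corrects to cycles modulo I.\<close>
  define c where "c i = (if i < d1 then (\<lambda>D. pv y * c1 i D) else (\<lambda>D. c2 (i - d1) D - pv y * h (i - d1) D))" for i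
  define s1 where "s1 b D = (\<Sum>i<d1. single 0 (b i) * c1 i D)" for b :: "nat \<Rightarrow> 'a" and D
  define s2 where "s2 b D = (\<Sum>i<d2. single 0 (b i) * c2 i D)" for b :: "nat \<Rightarrow> 'a" and D
  define sh where "sh b D = (\<Sum>i<d2. single 0 (b i) * h i D)" for b :: "nat \<Rightarrow> 'a" and D
  have s1_eq: "(\<Sum>i<d1. kscl (b i) (c1 i)) = s1 b" and s2_eq: "(\<Sum>i<d2. kscl (b i) (c2 i)) = s2 b" for b
    by (auto simp: fun_eq_iff kscl_sum s1_def s2_def)
  have sh_eq: "(\<Sum>i<d2. kscl (b i) (h i)) = sh b" for b by (auto simp: fun_eq_iff kscl_sum sh_def)
  have sum_c: "(\<Sum>i<d1 + d2. kscl (b i) (c i)) D = pv y * s1 b D + (s2 (\<lambda>i. b (d1 + i)) D - pv y * sh (\<lambda>i. b (d1 + i)) D)" for b D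
  proof -
    have "(\<Sum>i<d1 + d2. kscl (b i) (c i)) D = (\<Sum>i<d1 + d2. single 0 (b i) * c i D)" by (rule kscl_sum)
    also have "\<dots> = (\<Sum>i<d1. single 0 (b i) * c i D) + (\<Sum>i<d2. single 0 (b (d1 + i)) * c (d1 + i) D)"
      by (induction d2) (auto simp: algebra_simps)
    also have "\<dots> = pv y * s1 b D + (s2 (\<lambda>i. b (d1 + i)) D - pv y * sh (\<lambda>i. b (d1 + i)) D)"
    proof -
      have "(\<Sum>i<d1. single 0 (b i) * c i D) = pv y * s1 b D"
        unfolding s1_def sum_distrib_left by (rule sum.cong) (auto simp: c_def mult.left_commute)
      moreover have "(\<Sum>i<d2. single 0 (b (d1 + i)) * c (d1 + i) D) =
          s2 (\<lambda>i. b (d1 + i)) D - pv y * sh (\<lambda>i. b (d1 + i)) D"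
        unfolding s2_def sh_def sum_distrib_left sum_subtractf[symmetric]
        by (rule sum.cong) (auto simp: c_def right_diff_distrib mult.left_commute)
      ultimately show ?thesis by simp
    qed
    finally show ?thesis .
  qed
  have sh: "sh b \<in> kch V (Suc k) j" for b
  proof -
    have "ksub kscl (kch V (Suc k) j :: 'a chain set)"
      by (auto simp: ksub_def plus_fun_def zero_fun_def kch_0 kch_add kch_scale)
    then have "(\<Sum>i<d2. kscl (b i) (h i)) \<in> kch V (Suc k) j"
      by (intro ksub_sum) (auto intro: kch_scale h)
    then show ?thesis by (simp add: sh_eq)
  qed
  have s1: "s1 b \<in> kcyc V (colon V I y) (Suc k) j" for b
  proof -
    have "(\<Sum>i<d1. kscl (b i) (c1 i)) \<in> kcyc V (colon V I y) (Suc k) j"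
      using ksub_kcyc[OF C] c1 by (intro ksub_sum) (auto simp: ksub_def)
    then show ?thesis by (simp add: s1_eq)
  qed
  have c': "c i \<in> kcyc V I (Suc k) (Suc j)" if "i < d1 + d2" for i
  proof (cases "i < d1")
    case True
    have "(\<lambda>D. pv y * c1 i D) \<in> kcyc V I (Suc k) (Suc j)"
      using kcyc_bd[OF c1[OF True]]
      by (intro kcycI kch_pv[OF kcyc_kch[OF c1[OF True]] y]) (auto simp: kbd_pv intro: colonD)
    then show ?thesis using True by (simp add: c_def)
  qed (use that h(2)[of "i - d1"] in \<open>simp add: c_def\<close>)
  show ?thesis unfolding tor_def has_qdim_def
  proof (intro exI[of _ c] conjI allI impI ballI)
    fix z assume z: "z \<in> kcyc V I (Suc k) (Suc j)"
    obtain b2 where b2: "z - s2 b2 \<in> kbou V (add_var V I y) (Suc k) (Suc j)"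
      using sp2[OF kcyc_add_var[OF z]] by (auto simp: s2_eq)
    then obtain g a f where gaf: "g \<in> kch V (Suc (Suc k)) (Suc j)" "a \<in> kch V (Suc k) (Suc j)" "\<And>D. a D \<in> I" "f \<in> kch V (Suc k) j"
      "\<And>D. (z - s2 b2) D = kbd V g D + a D + pv y * f D"
      by (rule kbou_add_var_split[OF I y]) blast
    \<comment> \<open>The lifts subtract y times \<open>sh b2\<close>, which has to be added back
      before the colon basis is applied.\<close>
    define f' where "f' = (\<lambda>D. f D + sh b2 D)"
    define w where "w = (\<lambda>D. z D - (s2 b2 D - pv y * sh b2 D))"
    have f': "f' \<in> kch V (Suc k) j" unfolding f'_def by (rule kch_add[OF gaf(4) sh])
    have w: "w D = kbd V g D + a D + pv y * f' D" for D
      using gaf(5)[of D] by (simp add: w_def f'_def algebra_simps)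
    have "w \<in> kcyc V I (Suc k) (Suc j)"
    proof -
      have "z - (\<Sum>i<d1 + d2. kscl ((\<lambda>i. if i < d1 then 0 else b2 (i - d1)) i) (c i)) \<in> kcyc V I (Suc k) (Suc j)"
        using ksub_kcyc[OF I] c' z
        by (intro ksub_diff[OF vector_space_kscl ksub_kcyc[OF I]] ksub_sum) (auto simp: ksub_def)
      moreover have "z - (\<Sum>i<d1 + d2. kscl ((\<lambda>i. if i < d1 then 0 else b2 (i - d1)) i) (c i)) = w"
        by (rule ext) (simp add: sum_c w_def s1_def del: sum.lessThan_Suc)
      ultimately show ?thesis by simp
    qed
    note w_cyc = this
    have "f' \<in> kcyc V (colon V I y) (Suc k) j"
      by (rule kcyc_colonI[OF I kcyc_bd[OF w_cyc] gaf(3) f' gaf(1) w])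
    then obtain b1 where b1: "f' - s1 b1 \<in> kbou V (colon V I y) (Suc k) j"
      using sp1 by (auto simp: s1_eq)
    define b where "b i = (if i < d1 then b1 i else b2 (i - d1))" for i
    have zb: "(z - (\<Sum>i<d1 + d2. kscl (b i) (c i))) D = kbd V g D + a D + pv y * (f' - s1 b1) D" for D
    proof -
      have "s1 b D = s1 b1 D" "(\<lambda>i. b (d1 + i)) = b2" by (auto simp: s1_def b_def)
      then show ?thesis using w[of D] unfolding fun_diff_def sum_c w_def by (simp add: algebra_simps)
    qed
    have "z - (\<Sum>i<d1 + d2. kscl (b i) (c i)) \<in> kbou V I (Suc k) (Suc j)"
    proof (rule kbou_addI[OF I y _ gaf(1,3) b1 zb])
      have "z - (\<Sum>i<d1 + d2. kscl (b i) (c i)) \<in> kcyc V I (Suc k) (Suc j)"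
        using ksub_kcyc[OF I] c' z
        by (intro ksub_diff[OF vector_space_kscl ksub_kcyc[OF I]] ksub_sum) (auto simp: ksub_def)
      then show "z - (\<Sum>i<d1 + d2. kscl (b i) (c i)) \<in> kch V (Suc k) (Suc j)" by (rule kcyc_kch)
    qed
    then show "\<exists>b. z - (\<Sum>i<d1 + d2. kscl (b i) (c i)) \<in> kbou V I (Suc k) (Suc j)" by blast
  next
    fix b i assume bou: "(\<Sum>i<d1 + d2. kscl (b i) (c i)) \<in> kbou V I (Suc k) (Suc j)" and i: "i < d1 + d2"
    from bou obtain g e where ge: "g \<in> kch V (Suc (Suc k)) (Suc j)" "e \<in> kch V (Suc k) (Suc j)" "\<And>D. e D \<in> I"
      "\<And>D. (\<Sum>i<d1 + d2. kscl (b i) (c i)) D = kbd V g D + e D"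
      by (rule kbouE) blast
    define b2 where "b2 = (\<lambda>i. b (d1 + i))"
    have eq: "pv y * s1 b D + (s2 b2 D - pv y * sh b2 D) = kbd V g D + e D" for D
      using ge(4)[of D] unfolding sum_c b2_def .
    have "s2 b2 \<in> kcyc V (add_var V I y) (Suc k) (Suc j)"
      using ksub_kcyc[OF P] c2 unfolding s2_eq[symmetric] by (intro ksub_sum) (auto simp: ksub_def)
    then have "s2 b2 \<in> kbou V (add_var V I y) (Suc k) (Suc j)"
    proof (rule kbouI[OF kcyc_kch ge(1)])
      fix D
      have "s2 b2 D - kbd V g D = e D + pv y * (sh b2 D - s1 b D)" using eq[of D] by (simp add: algebra_simps)
      then show "s2 b2 D - kbd V g D \<in> add_var V I y"
        using ge(3)[of D] polys_diff[OF kch_polys[OF sh] kch_polys[OF kcyc_kch[OF s1]]] unfolding add_var_def by blast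
    qed
    then have b2: "\<forall>i<d2. b2 i = 0" using ind2[of b2] by (simp add: s2_eq)
    then have "s2 b2 D = 0" "sh b2 D = 0" for D by (auto simp: s2_def sh_def)
    then have eq1: "pv y * s1 b D = kbd V g D + e D" for D using eq[of D] by simp
    \<comment> \<open>Independence of the colon part: \<open>g\<close> bounds y times
      \<open>s1 b\<close> modulo I, so it is a cycle modulo y and bounds there by hypothesis 4.
      Comparing boundaries and dividing by y then shows that \<open>s1 b\<close> itself
      bounds.\<close>
    have "g \<in> kcyc V (add_var V I y) (Suc (Suc k)) (Suc j)"
    proof (rule kcycI[OF ge(1)])
      fix D
      have "kbd V g D = - e D + pv y * s1 b D" by (simp add: eq1)
      then show "kbd V g D \<in> add_var V I y"
        using hideal_uminus[OF I ge(3)[of D]] kch_polys[OF kcyc_kch[OF s1]] unfolding add_var_def by blast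
    qed
    then have "g \<in> kbou V (add_var V I y) (Suc (Suc k)) (Suc j)" using 4 by (auto simp: tor_0)
    then obtain g' a f where gaf: "g' \<in> kch V (Suc (Suc (Suc k))) (Suc j)" "a \<in> kch V (Suc (Suc k)) (Suc j)" "\<And>D. a D \<in> I"
      "f \<in> kch V (Suc (Suc k)) j" "\<And>D. g D = kbd V g' D + a D + pv y * f D"
      by (rule kbou_add_var_split[OF I y]) blast
    have "s1 b \<in> kbou V (colon V I y) (Suc k) j"
    proof (rule kbouI[OF kcyc_kch[OF s1] gaf(4)])
      fix D
      have "kbd V g D = kbd V a D + pv y * kbd V f D"
        unfolding gaf(5)[abs_def] by (simp add: kbd_add kbd_pv kbd_kbd[OF gaf(1)])
      then have "pv y * (s1 b D - kbd V f D) = kbd V a D + e D"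
        using eq1[of D] by (simp add: algebra_simps)
      then have "pv y * (s1 b D - kbd V f D) \<in> I"
        using hideal_add[OF I kbd_in[OF I, of a, OF gaf(3)] ge(3)] by simp
      then show "s1 b D - kbd V f D \<in> colon V I y"
        by (intro colonI polys_diff kch_polys[OF kcyc_kch[OF s1]] kch_polys[OF kbd_kch[OF gaf(4)]])
    qed
    then have "\<forall>i<d1. b i = 0" using ind1[of b] by (simp add: s1_eq)
    then show "b i = 0" using b2 i by (cases "i < d1") (auto simp: b2_def dest: spec[of _ "i - d1"])
  qed (use c' in blast)
qed

end

section \<open>Nonzerodivisors, and the Koszul homology of S itself\<close>

context kring
begin

abbreviation kwedge :: "pvar \<Rightarrow> 'k::field chain \<Rightarrow> 'k chain" where
  "kwedge \<equiv> koszul.wedge"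

lemma kwedge_kch:
  assumes c: "c \<in> kch V k j" and v: "v \<in> pvars V"
  shows "kwedge v c \<in> kch V (Suc k) (Suc j)"
proof (rule kchI)
  note w = koszul.wedge_def[OF koszul_V]
  fix A
  show "A \<subseteq> pvars V \<and> card A = Suc k" if "kwedge v c A \<noteq> 0"
  proof -
    from that have A: "v \<in> A" "c (A - {v}) \<noteq> 0" by (auto simp: w split: if_splits)
    then have "A - {v} \<subseteq> pvars V" "card (A - {v}) = k" using kch_supp[OF c] by auto
    moreover have "finite A" using finite_subset[OF calculation(1) finite_pvars[OF finite_V]] by simp
    ultimately show ?thesis using card_Suc_Diff1[of A v] A(1) v by auto
  qed
  show "kwedge v c A \<in> polys V" by (simp add: w polys_sg kch_polys[OF c])
  show "mdeg m + Suc k = Suc j" if "m \<in> keys (kwedge v c A)" for m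
    using that kch_deg[OF c, of m "A - {v}"] by (simp add: w keys_sg split: if_splits)
qed

lemma kbd_kwedge:
  assumes c: "c \<in> kch V k j" and v: "v \<in> pvars V"
  shows "kbd V (kwedge v c) B + kwedge v (kbd V c) B = pv v * c B"
proof (cases "B \<subseteq> pvars V")
  case True
  then show ?thesis using koszul.bd_wedge[OF koszul_V True v, of c] by (simp add: kbd_def)
next
  case False
  have "kbd V (kwedge v c) B = 0" using kbd_supp(1)[OF kwedge_kch[OF c v]] False by blast
  moreover have "c B = 0" using kch_supp[OF c] False by blast
  moreover have "kbd V c (B - {v}) = 0" using kbd_supp(1)[OF c] False v by blast
  ultimately show ?thesis by (simp add: koszul.wedge_def[OF koszul_V])
qed

lemma kwedge_in: "hideal V I \<Longrightarrow> (\<And>A. c A \<in> I) \<Longrightarrow> kwedge v c B \<in> I"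
  by (auto simp: koszul.wedge_def[OF koszul_V] sg_def intro: hideal_0 hideal_uminus)

text \<open>Multiplication by a variable is null-homotopic on the Koszul complex, so for a variable which
  is a nonzerodivisor the long exact sequence splits into short ones.\<close>

lemma kwedge_kcyc:
  assumes I: "hideal V I" and x: "x \<in> pvars V" and c: "c \<in> kcyc V I k j"
  shows "kbd V (kwedge x c) D - pv x * c D \<in> I"
proof -
  have "kbd V (kwedge x c) D - pv x * c D = - kwedge x (kbd V c) D"
    using kbd_kwedge[OF kcyc_kch[OF c] x, of D] by (simp add: algebra_simps)
  moreover have "- kwedge x (kbd V c) D \<in> I"
    by (intro hideal_uminus[OF I] kwedge_in[OF I] kcyc_bd[OF c])
  ultimately show ?thesis by simp
qed

text \<open>Wedging with e_x sends Tor_k(S/I) injectively into Tor_{k+1}(S/(I + (x))): if the image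
  bounds, applying the boundary puts x (c - bd f) into I, and x cancels.\<close>

lemma tor_nzd_0:
  assumes I: "hideal V I" and x: "x \<in> pvars V" and nz: "\<And>p. p \<in> polys V \<Longrightarrow> pv x * p \<in> I \<Longrightarrow> p \<in> I"
    and 1: "tor V (add_var V I x) (Suc k) (Suc j) 0"
  shows "tor V I k j 0"
  unfolding tor_0
proof
  fix c assume c: "c \<in> kcyc V I k j"
  have "kwedge x c \<in> kcyc V (add_var V I x) (Suc k) (Suc j)"
  proof (rule kcycI[OF kwedge_kch[OF kcyc_kch[OF c] x]])
    fix D
    have "kbd V (kwedge x c) D = (kbd V (kwedge x c) D - pv x * c D) + pv x * c D" by simp
    then show "kbd V (kwedge x c) D \<in> add_var V I x"
      using kwedge_kcyc[OF I x c, of D] kch_polys[OF kcyc_kch[OF c]] unfolding add_var_def by blast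
  qed
  then have "kwedge x c \<in> kbou V (add_var V I x) (Suc k) (Suc j)" using 1 by (auto simp: tor_0)
  then obtain g a f where gaf: "g \<in> kch V (Suc (Suc k)) (Suc j)" "a \<in> kch V (Suc k) (Suc j)" "\<And>D. a D \<in> I" "f \<in> kch V (Suc k) j"
    "\<And>D. kwedge x c D = kbd V g D + a D + pv x * f D"
    by (rule kbou_add_var_split[OF I x]) blast
  show "c \<in> kbou V I k j"
  proof (rule kbouI[OF kcyc_kch[OF c] gaf(4)])
    fix D
    have "kbd V (kwedge x c) D = kbd V a D + pv x * kbd V f D"
      unfolding gaf(5)[abs_def] by (simp add: kbd_add kbd_pv kbd_kbd[OF gaf(1)])
    then have "pv x * (c D - kbd V f D) = kbd V a D - (kbd V (kwedge x c) D - pv x * c D)"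
      by (simp add: algebra_simps)
    then have "pv x * (c D - kbd V f D) \<in> I"
      using hideal_diff[OF I kbd_in[OF I, of a, OF gaf(3)] kwedge_kcyc[OF I x c, of D]] by simp
    then show "c D - kbd V f D \<in> I"
      by (rule nz[rotated]) (intro polys_diff kch_polys[OF kcyc_kch[OF c]] kch_polys[OF kbd_kch[OF gaf(4)]])
  qed
qed

text \<open>Multiplication by x is zero on Tor, so the connecting map from Tor_{k+1}(S/(I + (x))) to
  Tor_k(S/I) is surjective; the assumed vanishing of Tor_{k+1}(S/I) makes it injective.\<close>

lemma tor_nzd_iff:
  assumes I: "hideal V I" and x: "x \<in> pvars V" and nz: "\<And>p. p \<in> polys V \<Longrightarrow> pv x * p \<in> I \<Longrightarrow> p \<in> I"
    and 1: "tor V I (Suc k) (Suc j) 0"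
  shows "tor V I k j d \<longleftrightarrow> tor V (add_var V I x) (Suc k) (Suc j) d"
proof -
  define R where "R g c \<longleftrightarrow> (\<forall>D. kbd V g D - pv x * c D \<in> I)" for g c
  note P = hideal_add_var[OF I x]
  have R0: "R 0 0" using hideal_0[OF I] by (simp add: R_def zero_fun_def kbd_0)
  have Radd: "R (g + g') (c + c')" if "R g c" "R g' c'" for g c g' c'
    using hideal_add[OF I] that by (simp add: R_def plus_fun_def kbd_add distrib_left add_diff_add)
  have Rscale: "R (kscl b g) (kscl b c)" if "R g c" for b g c
  proof -
    have "single 0 b * (kbd V g D - pv x * c D) \<in> I" for D
      using that hideal_mult[OF I _ polys_const] by (simp add: R_def)
    then show ?thesis unfolding R_def kbd_scale by (simp add: kscl_def right_diff_distrib mult.left_commute)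
  qed
  have tot1: "\<exists>c\<in>kcyc V I k j. R g c" if g: "g \<in> kcyc V (add_var V I x) (Suc k) (Suc j)" for g
  proof -
    obtain a f where af: "a \<in> kch V k (Suc j)" "f \<in> kch V k j" "\<And>D. a D \<in> I" "\<And>D. kbd V g D = a D + pv x * f D"
      by (rule kch_split_var[OF I x kbd_kch[OF kcyc_kch[OF g]] kcyc_bd[OF g]]) blast
    have "f \<in> kcyc V (colon V I x) k j"
    proof (rule kcyc_colonI[OF I _ af(3,2) kch_0])
      show "kbd V (kbd V g) D \<in> I" for D using kbd_kbd[OF kcyc_kch[OF g]] hideal_0[OF I] by simp
      show "kbd V g D = kbd V (\<lambda>A. 0) D + a D + pv x * f D" for D by (simp add: af(4) kbd_0)
    qed
    then have "f \<in> kcyc V I k j" using nz by (auto simp: kcyc_def colon_def)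
    moreover have "R g f" using af(3) by (simp add: R_def af(4))
    ultimately show ?thesis by blast
  qed
  have tot2: "\<exists>g\<in>kcyc V (add_var V I x) (Suc k) (Suc j). R g c" if c: "c \<in> kcyc V I k j" for c
  proof (rule bexI)
    show "R (kwedge x c) c" using kwedge_kcyc[OF I x c] by (simp add: R_def)
    show "kwedge x c \<in> kcyc V (add_var V I x) (Suc k) (Suc j)"
    proof (rule kcycI[OF kwedge_kch[OF kcyc_kch[OF c] x]])
      fix D
      have "kbd V (kwedge x c) D = (kbd V (kwedge x c) D - pv x * c D) + pv x * c D" by simp
      then show "kbd V (kwedge x c) D \<in> add_var V I x"
        using kwedge_kcyc[OF I x c, of D] kch_polys[OF kcyc_kch[OF c]] unfolding add_var_def by blast
    qed
  qed
  have match: "g \<in> kbou V (add_var V I x) (Suc k) (Suc j) \<longleftrightarrow> c \<in> kbou V I k j"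
    if g: "g \<in> kcyc V (add_var V I x) (Suc k) (Suc j)" and c: "c \<in> kcyc V I k j" and R: "R g c" for g c
  proof
    assume "g \<in> kbou V (add_var V I x) (Suc k) (Suc j)"
    then obtain h a f where haf: "h \<in> kch V (Suc (Suc k)) (Suc j)" "a \<in> kch V (Suc k) (Suc j)" "\<And>D. a D \<in> I" "f \<in> kch V (Suc k) j"
      "\<And>D. g D = kbd V h D + a D + pv x * f D"
      by (rule kbou_add_var_split[OF I x]) blast
    show "c \<in> kbou V I k j"
    proof (rule kbouI[OF kcyc_kch[OF c] haf(4)])
      fix D
      have "kbd V g D = kbd V a D + pv x * kbd V f D"
        unfolding haf(5)[abs_def] by (simp add: kbd_add kbd_pv kbd_kbd[OF haf(1)])
      then have "pv x * (c D - kbd V f D) = kbd V a D - (kbd V g D - pv x * c D)"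
        by (simp add: algebra_simps)
      moreover have "kbd V g D - pv x * c D \<in> I" using R by (simp add: R_def)
      ultimately have "pv x * (c D - kbd V f D) \<in> I"
        using hideal_diff[OF I kbd_in[OF I, of a, OF haf(3)], of "kbd V g D - pv x * c D"] by simp
      then show "c D - kbd V f D \<in> I"
        by (rule nz[rotated]) (intro polys_diff kch_polys[OF kcyc_kch[OF c]] kch_polys[OF kbd_kch[OF haf(4)]])
    qed
  next
    assume "c \<in> kbou V I k j"
    then obtain f i where f: "f \<in> kch V (Suc k) j" "i \<in> kch V k j" "\<And>D. i D \<in> I" "\<And>D. c D = kbd V f D + i D"
      by (rule kbouE) blast
    have "(\<lambda>D. g D - pv x * f D) \<in> kcyc V I (Suc k) (Suc j)"
    proof (rule kcycI[OF kch_diff[OF kcyc_kch[OF g] kch_pv[OF f(1) x]]])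
      fix D
      have "kbd V (\<lambda>D. g D - pv x * f D) D = (kbd V g D - pv x * c D) + pv x * i D"
        by (simp add: kbd_diff kbd_pv f(4) algebra_simps)
      moreover have "kbd V g D - pv x * c D \<in> I" using R by (simp add: R_def)
      ultimately show "kbd V (\<lambda>D. g D - pv x * f D) D \<in> I"
        using hideal_add[OF I _ hideal_mult[OF I f(3)[of D] polys_pv[OF x]]] by simp
    qed
    then obtain h where h: "h \<in> kch V (Suc (Suc k)) (Suc j)" "\<And>D. g D - pv x * f D - kbd V h D \<in> I"
      using 1 unfolding tor_0 kbou_def by blast
    show "g \<in> kbou V (add_var V I x) (Suc k) (Suc j)"
    proof (rule kbouI[OF kcyc_kch[OF g] h(1)])
      fix D
      have "g D - kbd V h D = (g D - pv x * f D - kbd V h D) + pv x * f D" by simp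
      then show "g D - kbd V h D \<in> add_var V I x"
        using h(2)[of D] kch_polys[OF f(1)] unfolding add_var_def by blast
    qed
  qed
  show ?thesis
  proof
    assume "tor V (add_var V I x) (Suc k) (Suc j) d"
    then show "tor V I k j d" unfolding tor_def
      by (intro has_qdim_relation[where R = R, OF vector_space_kscl vector_space_kscl
            ksub_kcyc[OF P] ksub_kcyc[OF I] R0 Radd Rscale tot1 tot2 match])
  next
    assume "tor V I k j d"
    then show "tor V (add_var V I x) (Suc k) (Suc j) d" unfolding tor_def
      by (intro has_qdim_relation[where R = "\<lambda>c g. R g c", OF vector_space_kscl vector_space_kscl
            ksub_kcyc[OF I] ksub_kcyc[OF P] R0 Radd Rscale tot2 tot1 match[symmetric]])
  qed
qed

lemma tor_add_var_deg0:
  assumes I: "hideal V I" and 1: "tor V I 0 j 0"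
  shows "tor V (add_var V I x) 0 j 0"
  unfolding tor_0
proof
  fix c :: "'a chain" assume "c \<in> kcyc V (add_var V I x) 0 j"
  then have c: "c \<in> kch V 0 j" by (rule kcyc_kch)
  then have "c \<in> kcyc V I 0 j" using kbd_kch_0[OF c] hideal_0[OF I] by (simp add: kcyc_def)
  then obtain g where g: "g \<in> kch V (Suc 0) j" "\<And>A. c A - kbd V g A \<in> I"
    using 1 unfolding tor_0 kbou_def by blast
  show "c \<in> kbou V (add_var V I x) 0 j" by (intro kbouI[OF c g(1)] add_var_left g(2))
qed

text \<open>The contracting homotopy fails only on constants times the basis element of the empty
  set, and these live in internal degree 0.\<close>

lemma kbd_exact:
  assumes c: "c \<in> kch V k j" and k: "0 < j" and bd: "\<And>A. kbd V c A = 0"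
  shows "\<exists>g\<in>kch V (Suc k) j. kbd V g = c"
proof -
  interpret kh: koszul_homotopy "pvars V" "\<lambda>v p. pv v * (p :: 'a mpoly)" rmax "polys V" "{p \<in> polys V. 0 \<notin> keys p}"
    by (rule koszul_homotopy_mpoly[OF finite_V])
  have g: "kh.hty c \<in> kch V (Suc k) j"
  proof (rule kchI)
    fix A
    show "A \<subseteq> pvars V \<and> card A = Suc k" if "kh.hty c A \<noteq> 0"
    proof -
      from that have A: "A \<noteq> {}" "c (A - {Max A}) \<noteq> 0" by (auto simp: kh.hty_def split: if_splits)
      then have *: "A - {Max A} \<subseteq> pvars V" "card (A - {Max A}) = k" using kch_supp[OF c] by auto
      then have fA: "finite A" using finite_subset[OF *(1) finite_pvars[OF finite_V]] by simp
      then have "card A = Suc k" using * A(1) by (metis Max_in card_Suc_Diff1)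
      moreover have "Max A \<in> pvars V"
      proof -
        from that obtain m where "m \<in> keys (rmax (Max A) (c (A - {Max A})))" using A(1) by (force simp: kh.hty_def)
        then have "mvar (Max A) + m \<in> keys (c (A - {Max A}))"
          by (simp add: in_keys_iff lookup_rmax split: if_splits)
        from polysD[OF kch_polys[OF c] this] show ?thesis by (simp add: keys_add_nat)
      qed
      ultimately show ?thesis using * by auto
    qed
    show "kh.hty c A \<in> polys V"
      by (auto simp: kh.hty_def rmax_def intro: polys_restr polys_divvar kch_polys[OF c])
    show "mdeg m + Suc k = j" if "m \<in> keys (kh.hty c A)" for m
    proof -
      from that have "A \<noteq> {}" "m \<in> keys (rmax (Max A) (c (A - {Max A})))" by (auto simp: kh.hty_def split: if_splits)
      then have "mvar (Max A) + m \<in> keys (c (A - {Max A}))"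
        by (simp add: in_keys_iff lookup_rmax split: if_splits)
      then show ?thesis using kch_deg[OF c] by (force simp: mdeg_add)
    qed
  qed
  have "kbd V (kh.hty c) A = c A" for A
  proof (cases "A \<subseteq> pvars V")
    case False
    then show ?thesis using kbd_supp(1)[OF g] kch_supp[OF c] by metis
  next
    case True
    show ?thesis
    proof (cases "A = {}")
      case True
      have "0 \<notin> keys (c {})"
      proof
        assume "0 \<in> keys (c {})"
        then have "c {} \<noteq> 0" "0 + k = j" using kch_deg[OF c, of 0 "{}"] by auto
        then show False using kch_supp[OF c, of "{}"] k by simp
      qed
      then show ?thesis using True kh.bd_hty_empty[of c] kch_polys[OF c] by (simp add: kbd_def)
    next
      case False
      have "kh.hty (kbd V c) A = 0" using bd by (simp add: kh.hty_def)
      then show ?thesis using kh.bd_hty[OF True False, of c] kch_polys[OF c] by (simp add: kbd_def)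
    qed
  qed
  then show ?thesis using g by blast
qed

lemma tor_zero_ideal:
  assumes "0 < j"
  shows "tor V {0 :: 'k::field mpoly} k j 0"
  unfolding tor_0
proof
  fix c :: "'k chain" assume c: "c \<in> kcyc V {0} k j"
  obtain g where g: "g \<in> kch V (Suc k) j" "kbd V g = c"
    using kbd_exact[OF kcyc_kch[OF c] assms] kcyc_bd[OF c] by auto
  then show "c \<in> kbou V {0} k j" by (intro kbouI[OF kcyc_kch[OF c] g(1)]) simp
qed

lemma tor_zero_ideal_00: "tor V {0 :: 'k::field mpoly} 0 0 1"
  unfolding tor_def has_qdim_def
proof (intro exI[of _ "\<lambda>_ A. if A = {} then 1 else 0"] conjI allI impI ballI)
  show "(\<lambda>A. if A = {} then 1 else 0) \<in> kcyc V {0 :: 'k mpoly} 0 0"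
  proof (rule kcycI)
    show c: "(\<lambda>A. if A = {} then 1 else 0 :: 'k mpoly) \<in> kch V 0 0"
      by (rule kchI) (auto split: if_splits)
    show "kbd V (\<lambda>A. if A = {} then 1 else 0 :: 'k mpoly) A \<in> {0}" for A
      using kbd_kch_0[OF c] by simp
  qed
next
  fix z :: "'k chain" assume z: "z \<in> kcyc V {0} 0 0"
  define e where "e = lookup (z {}) 0"
  have "z A = (if A = {} then single 0 e else 0)" for A
  proof (cases "A = {}")
    case True
    have "m = 0" if "m \<in> keys (z {})" for m using kch_deg[OF kcyc_kch[OF z] that] mdeg_eq_0_iff by simp
    then have "z {} = single 0 e"
      by (intro poly_mapping_eqI) (auto simp: e_def lookup_single when_def in_keys_iff)
    then show ?thesis using True by simp
  next
    case False
    have "z A = 0"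
    proof (rule ccontr)
      assume "z A \<noteq> 0"
      then have "A \<subseteq> pvars V" "card A = 0" using kch_supp[OF kcyc_kch[OF z]] by auto
      then show False using False finite_subset[OF _ finite_pvars[OF finite_V]] by auto
    qed
    then show ?thesis using False by simp
  qed
  then have "z - (\<Sum>i<1::nat. kscl e (\<lambda>A. if A = {} then 1 else 0)) = (\<lambda>A. 0)"
    by (auto simp: fun_eq_iff kscl_def)
  moreover have "(\<lambda>A. 0) \<in> kbou V {0 :: 'k mpoly} 0 0" by (rule kbouI[OF kch_0 kch_0]) (simp add: kbd_0)
  ultimately show "\<exists>a. z - (\<Sum>i<1::nat. kscl (a i) (\<lambda>A. if A = {} then 1 else 0)) \<in> kbou V {0} 0 0"
    by (intro exI[of _ "\<lambda>_. e"]) simp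
next
  fix a :: "nat \<Rightarrow> 'k" and i assume "(\<Sum>i<1::nat. kscl (a i) (\<lambda>A. if A = {} then 1 else 0)) \<in> kbou V {0} 0 0" and i: "i < (1::nat)"
  then have "kscl (a 0) (\<lambda>A. if A = {} then 1 else 0) \<in> kbou V {0} 0 0" by simp
  then obtain g where g: "g \<in> kch V (Suc 0) 0"
    "\<And>A. kscl (a 0) (\<lambda>A. if A = {} then 1 else 0) A - kbd V g A \<in> {0}" by (auto simp: kbou_def)
  have "g A = 0" for A using kch_deg[OF g(1), of _ A] by (metis add_Suc_right nat.distinct(1) keys_eq_empty all_not_in_conv)
  then have "kbd V g A = 0" for A using kbd_0[of A] by (metis ext)
  then have "single 0 (a 0) = (0 :: 'k mpoly)" using g(2)[of "{}"] by (simp add: kscl_def)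
  then show "a i = 0" using i by (metis less_one lookup_single_eq lookup_zero)
qed

end

section \<open>Generated ideals\<close>

text \<open>One step adds a single-term multiple of a generator, so inductions over an ideal see
  only such products. \<open>genideal_idl\<close> identifies the result with the ideal of the ring
  record.\<close>

inductive_set idl :: "nat set \<Rightarrow> 'k::field mpoly set \<Rightarrow> 'k mpoly set" for V S where
  idl_zero: "0 \<in> idl V S"
| idl_step: "keys m \<subseteq> pvars V \<Longrightarrow> s \<in> S \<Longrightarrow> p \<in> idl V S \<Longrightarrow> single m c * s + p \<in> idl V S"

lemma idl_add: "p \<in> idl V S \<Longrightarrow> q \<in> idl V S \<Longrightarrow> p + q \<in> idl V S"
  by (induction rule: idl.induct) (auto simp: add.assoc intro: idl.intros)

lemma idl_sum: "(\<And>i. i \<in> A \<Longrightarrow> f i \<in> idl V S) \<Longrightarrow> sum f A \<in> idl V S"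
  by (induction A rule: infinite_finite_induct) (auto intro: idl_add idl_zero)

lemma idl_gen_mult: "keys m \<subseteq> pvars V \<Longrightarrow> s \<in> S \<Longrightarrow> single m c * s \<in> idl V S"
  using idl_step[OF _ _ idl_zero] by fastforce

lemma idl_gen: "s \<in> S \<Longrightarrow> s \<in> idl V S"
  using idl_gen_mult[of 0 V s S 1] by simp

lemma idl_single_mult:
  assumes "p \<in> idl V S" "keys m \<subseteq> pvars V"
  shows "single m c * p \<in> idl V S"
  using assms(1)
proof (induction rule: idl.induct)
  case (idl_step m' s p c')
  have "single m c * (single m' c' * s + p) = single (m + m') (c * c') * s + single m c * p"
    by (simp add: distrib_left mult.assoc[symmetric] mult_single)
  then show ?case using idl_step assms(2) by (auto intro!: idl.idl_step simp: keys_add_nat)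
qed (simp add: idl_zero)

lemma idl_mult:
  assumes p: "p \<in> idl V S" and q: "q \<in> polys V"
  shows "q * p \<in> idl V S"
proof (rule mpoly_induct_keys[where Q = "\<lambda>m. keys m \<subseteq> pvars V" and P = "\<lambda>q. q * p \<in> idl V S"])
  show "keys m \<subseteq> pvars V" if "m \<in> keys q" for m using polysD[OF q that] .
qed (auto simp: distrib_right intro: idl_zero idl_add idl_single_mult[OF p])

lemma idl_subset:
  assumes "\<And>s. s \<in> S \<Longrightarrow> s \<in> idl V T" and "p \<in> idl V S"
  shows "p \<in> idl V T"
  using assms(2) by (induction rule: idl.induct) (auto intro: idl_zero idl_add idl_single_mult assms(1))

lemma idl_mono: "S \<subseteq> T \<Longrightarrow> p \<in> idl V S \<Longrightarrow> p \<in> idl V T"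
  by (rule idl_subset[of S]) (auto intro: idl_gen)

lemma idl_polys: "S \<subseteq> polys V \<Longrightarrow> p \<in> idl V S \<Longrightarrow> p \<in> polys V"
  by (rotate_tac, induction rule: idl.induct) (auto intro!: polys_add polys_mult polys_single)

lemma restr_mult_homogeneous:
  assumes "\<And>m. m \<in> keys e \<Longrightarrow> mdeg m + b = d"
  shows "restr (\<lambda>m. mdeg m + b = j) (p * e) = restr (\<lambda>m. mdeg m + d = j) p * (e :: 'k::field mpoly)"
proof (induction p rule: mpoly_induct)
  case (add m c p)
  have "mdeg k + b = mdeg m + d" if k: "k \<in> keys (single m c * e)" for k
  proof -
    obtain m' where "k = m + m'" "m' \<in> keys e"
      using subsetD[OF keys_mult k] by (auto split: if_splits)
    then show ?thesis using assms[of m'] by (simp add: mdeg_add)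
  qed
  then have "restr (\<lambda>m. mdeg m + b = j) (single m c * e) = restr (\<lambda>m. mdeg m + d = j) (single m c) * e"
    by (cases "mdeg m + d = j") (auto simp: restr_single intro!: restr_id restr_eq_0)
  then show ?case using add by (simp add: distrib_right restr_add)
qed simp

lemma hideal_idl:
  assumes S: "S \<subseteq> polys V" and hom: "\<And>s. s \<in> S \<Longrightarrow> \<exists>d. \<forall>m\<in>keys s. mdeg m = d"
  shows "hideal V (idl V S)"
proof (rule hidealI)
  show "hcomp e p \<in> idl V S" if "p \<in> idl V S" for p e
    using that
  proof (induction rule: idl.induct)
    case (idl_step m s p c)
    obtain d where "\<And>m. m \<in> keys s \<Longrightarrow> mdeg m + 0 = d" using hom[OF idl_step(2)] by auto
    from restr_mult_homogeneous[OF this, where j = e and p = "single m c"]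
    have "hcomp e (single m c * s) = (if mdeg m + d = e then single m c else 0) * s"
      by (simp add: restr_single)
    then show ?case using idl_step by (auto simp: restr_add intro: idl.idl_step)
  qed (simp add: idl_zero)
qed (auto intro: idl_zero idl_add idl_mult idl_polys[OF S])

lemma cring_poly_ring: "cring (poly_ring V :: 'k::field mpoly ring)"
proof (rule cringI)
  show "abelian_group (poly_ring V :: 'k mpoly ring)"
  proof (rule abelian_groupI)
    fix x :: "'k mpoly" assume "x \<in> carrier (poly_ring V)"
    then show "\<exists>y\<in>carrier (poly_ring V). y \<oplus>\<^bsub>poly_ring V\<^esub> x = \<zero>\<^bsub>poly_ring V\<^esub>"
      by (intro bexI[of _ "- x"]) (auto simp: poly_ring_def polys_uminus)
  qed (auto simp: poly_ring_def polys_add ac_simps)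
  show "Group.comm_monoid (poly_ring V :: 'k mpoly ring)"
    by (rule comm_monoidI) (auto simp: poly_ring_def polys_mult ac_simps)
qed (auto simp: poly_ring_def distrib_right)

lemma genideal_idl:
  assumes S: "S \<subseteq> polys V"
  shows "genideal (poly_ring V) S = idl V S"
proof -
  interpret R: cring "poly_ring V :: 'a mpoly ring" by (rule cring_poly_ring)
  have inv: "a_inv (poly_ring V) p = - p" if "p \<in> polys V" for p :: "'a mpoly"
    using that R.minus_equality[of "- p" p] by (simp add: poly_ring_def polys_uminus)
  have "ideal (idl V S) (poly_ring V)"
  proof (rule idealI)
    show "ring (poly_ring V :: 'a mpoly ring)" by (rule R.ring_axioms)
    have m: "- p \<in> idl V S" if "p \<in> idl V S" for p
      using idl_mult[OF that polys_uminus[OF polys_1]] by simp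
    show "subgroup (idl V S) (add_monoid (poly_ring V))"
    proof (rule R.add.subgroupI)
      show "idl V S \<subseteq> carrier (poly_ring V)" using idl_polys[OF S] by (auto simp: poly_ring_def)
      show "idl V S \<noteq> {}" using idl_zero by blast
      show "\<ominus>\<^bsub>poly_ring V\<^esub> a \<in> idl V S" if "a \<in> idl V S" for a
        using that m inv idl_polys[OF S] by simp
      show "a \<oplus>\<^bsub>poly_ring V\<^esub> b \<in> idl V S" if "a \<in> idl V S" "b \<in> idl V S" for a b
        using idl_add that by (simp add: poly_ring_def)
    qed
    fix a x :: "'a mpoly" assume a: "a \<in> idl V S" "x \<in> carrier (poly_ring V)"
    then show "x \<otimes>\<^bsub>poly_ring V\<^esub> a \<in> idl V S" by (simp add: poly_ring_def idl_mult)
    then show "a \<otimes>\<^bsub>poly_ring V\<^esub> x \<in> idl V S" by (simp add: poly_ring_def mult.commute)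
  qed
  moreover have "S \<subseteq> idl V S" using idl_gen by blast
  moreover have "idl V S \<subseteq> J" if J: "ideal J (poly_ring V)" "S \<subseteq> J" for J
  proof
    interpret J: ideal J "poly_ring V" by fact
    fix p assume "p \<in> idl V S"
    then show "p \<in> J"
    proof (induction rule: idl.induct)
      case idl_zero
      then show ?case using J.zero_closed by (simp add: poly_ring_def)
    next
      case (idl_step m s p c)
      have "single m c * s \<in> J"
        using J.I_l_closed[of s "single m c"] J(2) idl_step polys_single[of m V c] by (auto simp: poly_ring_def)
      then show ?case using J.a_closed[of "single m c * s" p] idl_step by (simp add: poly_ring_def)
    qed
  qed
  ultimately show ?thesis unfolding genideal_def by blast
qed

lemma irrelevant_ideal_eq:
  assumes "finite V"
  shows "irrelevant_ideal V = {p \<in> polys V. 0 \<notin> keys (p :: 'k::field mpoly)}"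
proof -
  have S: "pv ` pvars V \<subseteq> (polys V :: 'k mpoly set)" by (auto intro: polys_pv)
  have "0 \<notin> keys p" if "p \<in> idl V (pv ` pvars V)" for p :: "'k mpoly"
    using that
  proof (induction rule: idl.induct)
    case (idl_step m s p c)
    then obtain v where "s = pv v" by blast
    then have "single m c * s = pv v * single m c" by (simp add: mult.commute)
    then have "lookup (single m c * s) 0 = lookup (pv v * single m c) 0" by (simp only:)
    then have "lookup (single m c * s) 0 = 0" by (simp add: lookup_pv_mult)
    then show ?case using idl_step by (simp add: in_keys_iff lookup_add)
  qed simp
  moreover have "p \<in> idl V (pv ` pvars V)" if p: "p \<in> polys V" "0 \<notin> keys p" for p :: "'k mpoly"
  proof -
    have *: "pv u * rmax u p \<in> idl V (pv ` pvars V)" if "u \<in> pvars V" for u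
      using idl_mult[OF idl_gen, of "pv u" "pv ` pvars V" "rmax u p" V] that p
      by (simp add: mult.commute rmax_def polys_restr polys_divvar)
    \<comment> \<open>Each nonconstant monomial is attributed to its largest variable.\<close>
    have "p = (\<Sum>u\<in>pvars V. pv u * rmax u p)"
      by (rule rmax_split0[symmetric, OF finite_pvars[OF assms] polysD[OF p(1)] p(2)])
    also have "\<dots> \<in> idl V (pv ` pvars V)" by (rule idl_sum) (rule *)
    finally show ?thesis .
  qed
  ultimately show ?thesis unfolding irrelevant_ideal_def genideal_idl[OF S] using idl_polys[OF S] by blast
qed

section \<open>Free modules and their Koszul complexes\<close>

lemma lookup_vsmult: "lookup (vsmult p f) k = p * lookup f k"
  by (simp add: vsmult_def map.rep_eq when_def)

lemma vsmult_add: "vsmult p (f + g) = vsmult p f + vsmult p g"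
  by (rule poly_mapping_eqI) (simp add: lookup_vsmult lookup_add distrib_left)

lemma vsmult_add_left: "vsmult (p + q) f = vsmult p f + vsmult q f"
  by (rule poly_mapping_eqI) (simp add: lookup_vsmult lookup_add distrib_right)

lemma vsmult_vsmult: "vsmult p (vsmult q f) = vsmult (p * q) f"
  by (rule poly_mapping_eqI) (simp add: lookup_vsmult mult.assoc)

lemma vsmult_0 [simp]: "vsmult p 0 = 0" "vsmult 0 f = 0"
  by (rule poly_mapping_eqI, simp add: lookup_vsmult)+

lemma vsmult_sum: "vsmult p (sum f A) = (\<Sum>i\<in>A. vsmult p (f i))"
  by (induction A rule: infinite_finite_induct) (auto simp: vsmult_add)

lemma fdiff_superset:
  assumes "finite K" "keys f \<subseteq> K"
  shows "fdiff F i f = (\<Sum>k\<in>K. vsmult (lookup f k) (bdiff F i k))"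
  unfolding fdiff_def using assms by (intro sum.mono_neutral_left) (auto simp: in_keys_iff)

lemma faug_superset:
  assumes "finite K" "keys f \<subseteq> K"
  shows "faug F f = (\<Sum>k\<in>K. lookup f k * aug F k)"
  unfolding faug_def using assms by (intro sum.mono_neutral_left) (auto simp: in_keys_iff)

lemma fdiff_add: "fdiff F i (f + g) = fdiff F i f + fdiff F i g"
  using Poly_Mapping.keys_add[of f g]
  by (simp add: fdiff_superset[of "keys f \<union> keys g"] lookup_add vsmult_add_left sum.distrib)

lemma faug_add: "faug F (f + g) = faug F f + faug F g"
  using Poly_Mapping.keys_add[of f g]
  by (simp add: faug_superset[of "keys f \<union> keys g"] lookup_add distrib_right sum.distrib)

lemma keys_vsmult: "keys (vsmult p f) \<subseteq> keys f"
  by (auto simp: in_keys_iff lookup_vsmult)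

lemma fdiff_vsmult: "fdiff F i (vsmult p f) = vsmult p (fdiff F i f)"
  using keys_vsmult[of p f]
  by (simp add: fdiff_superset[of "keys f"] lookup_vsmult vsmult_vsmult[symmetric] vsmult_sum)

lemma faug_vsmult: "faug F (vsmult p f) = p * faug F f"
  using keys_vsmult[of p f]
  by (simp add: faug_superset[of "keys f"] lookup_vsmult sum_distrib_left mult.assoc)

lemma fdiff_0 [simp]: "fdiff F i 0 = 0" and faug_0 [simp]: "faug F 0 = 0"
  by (simp_all add: fdiff_def faug_def)

lemma fdiff_diff: "fdiff F i (f - g) = fdiff F i f - fdiff F i g"
  using fdiff_add[of F i "f - g" g] by simp

lemma faug_diff: "faug F (f - g) = faug F f - faug F g"
  using faug_add[of F "f - g" g] by simp

definition fhcomp :: "'k::field free_cplx \<Rightarrow> nat \<Rightarrow> nat \<Rightarrow> 'k fvec \<Rightarrow> 'k fvec" where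
  "fhcomp F i j f = Poly_Mapping.mapp (\<lambda>k. restr (\<lambda>m. mdeg m + bdeg F i k = j)) f"

lemma lookup_fhcomp: "lookup (fhcomp F i j f) k = restr (\<lambda>m. mdeg m + bdeg F i k = j) (lookup f k)"
  by (simp add: fhcomp_def lookup_mapp when_def in_keys_iff)

lemma keys_fhcomp: "keys (fhcomp F i j f) \<subseteq> keys f"
  by (auto simp: in_keys_iff lookup_fhcomp)

lemma fmod_add: "f \<in> fmod V F i \<Longrightarrow> g \<in> fmod V F i \<Longrightarrow> f + g \<in> fmod V F i"
  unfolding fmod_def using Poly_Mapping.keys_add[of f g] by (auto simp: lookup_add polys_add)

lemma fmod_0 [simp]: "0 \<in> fmod V F i"
  by (simp add: fmod_def)

lemma fmod_vsmult: "f \<in> fmod V F i \<Longrightarrow> p \<in> polys V \<Longrightarrow> vsmult p f \<in> fmod V F i"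
  unfolding fmod_def using keys_vsmult[of p f] by (auto simp: lookup_vsmult polys_mult)

lemma fpart_fhcomp: "f \<in> fmod V F i \<Longrightarrow> fhcomp F i j f \<in> fpart V F i j"
  unfolding fpart_def fmod_def using keys_fhcomp[of F i j f]
  by (auto simp: lookup_fhcomp polys_restr keys_restr)

lemma fhcomp_fpart: "f \<in> fpart V F i j \<Longrightarrow> fhcomp F i j f = f"
  by (rule poly_mapping_eqI) (auto simp: lookup_fhcomp fpart_def intro!: restr_id)

lemma fpart_fmod: "f \<in> fpart V F i j \<Longrightarrow> f \<in> fmod V F i"
  by (simp add: fpart_def)

lemma restr_sum: "restr P (sum f A) = (\<Sum>i\<in>A. restr P (f i :: 'a \<Rightarrow>\<^sub>0 'b::comm_monoid_add))"
  by (induction A rule: infinite_finite_induct) (auto simp: restr_add)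

lemma fdiff_fhcomp:
  assumes "\<And>k. k \<in> basis F (Suc i) \<Longrightarrow> bdiff F (Suc i) k \<in> fpart V F i (bdeg F (Suc i) k)"
    and f: "f \<in> fmod V F (Suc i)"
  shows "fdiff F (Suc i) (fhcomp F (Suc i) j f) = fhcomp F i j (fdiff F (Suc i) f)"
proof (rule poly_mapping_eqI)
  fix l
  have kf: "keys f \<subseteq> basis F (Suc i)" using f by (simp add: fmod_def)
  have "lookup (fhcomp F i j (fdiff F (Suc i) f)) l =
      (\<Sum>k\<in>keys f. restr (\<lambda>m. mdeg m + bdeg F i l = j) (lookup f k * lookup (bdiff F (Suc i) k) l))"
    by (simp add: lookup_fhcomp fdiff_def lookup_sum lookup_vsmult restr_sum)
  also have "\<dots> = (\<Sum>k\<in>keys f. restr (\<lambda>m. mdeg m + bdeg F (Suc i) k = j) (lookup f k) * lookup (bdiff F (Suc i) k) l)"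
  proof (intro sum.cong refl restr_mult_homogeneous)
    fix k m assume "k \<in> keys f" "m \<in> keys (lookup (bdiff F (Suc i) k) l)"
    then show "mdeg m + bdeg F i l = bdeg F (Suc i) k" using assms(1)[of k] kf by (auto simp: fpart_def)
  qed
  also have "\<dots> = lookup (fdiff F (Suc i) (fhcomp F (Suc i) j f)) l"
    by (simp add: fdiff_superset[OF finite_keys keys_fhcomp] lookup_sum lookup_vsmult lookup_fhcomp)
  finally show "lookup (fdiff F (Suc i) (fhcomp F (Suc i) j f)) l = lookup (fhcomp F i j (fdiff F (Suc i) f)) l" ..
qed

lemma faug_fhcomp:
  assumes "\<And>k m. k \<in> basis F 0 \<Longrightarrow> m \<in> keys (aug F k) \<Longrightarrow> mdeg m = bdeg F 0 k"
    and f: "f \<in> fmod V F 0"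
  shows "faug F (fhcomp F 0 j f) = hcomp j (faug F f)"
proof -
  have kf: "keys f \<subseteq> basis F 0" using f by (simp add: fmod_def)
  have "hcomp j (faug F f) = (\<Sum>k\<in>keys f. restr (\<lambda>m. mdeg m + 0 = j) (lookup f k * aug F k))"
    by (simp add: faug_def restr_sum)
  also have "\<dots> = (\<Sum>k\<in>keys f. restr (\<lambda>m. mdeg m + bdeg F 0 k = j) (lookup f k) * aug F k)"
  proof (intro sum.cong refl restr_mult_homogeneous)
    fix k m assume "k \<in> keys f" "m \<in> keys (aug F k)"
    then show "mdeg m + 0 = bdeg F 0 k" using assms(1)[of k m] kf by auto
  qed
  also have "\<dots> = faug F (fhcomp F 0 j f)"
    by (simp add: faug_superset[OF finite_keys keys_fhcomp] lookup_fhcomp)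
  finally show ?thesis ..
qed

section \<open>Balancing Tor\<close>

type_synonym 'k fchain = "pvar set \<Rightarrow> 'k fvec"

definition fbd :: "nat set \<Rightarrow> 'k::field fchain \<Rightarrow> 'k fchain" where
  "fbd V = koszul.bd (pvars V) (\<lambda>v. vsmult (pv v))"

text \<open>The double complex of the Koszul complex tensored with F, in total internal degree
  \<open>j\<close>. The condition \<open>q \<le> j\<close> guards the truncated difference
  \<open>j - q\<close>, which would otherwise admit elements of degree 0.\<close>

definition fch :: "nat set \<Rightarrow> 'k::field free_cplx \<Rightarrow> nat \<Rightarrow> nat \<Rightarrow> nat \<Rightarrow> 'k fchain set" where
  "fch V F p q j = {a. \<forall>A. (a A \<noteq> 0 \<longrightarrow> A \<subseteq> pvars V \<and> card A = q \<and> q \<le> j) \<and> a A \<in> fpart V F p (j - q)}"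

definition fscl :: "'k::field \<Rightarrow> 'k fchain \<Rightarrow> 'k fchain" where
  "fscl c a = (\<lambda>A. kscale c (a A))"

lemma vector_space_fscl: "vector_space (fscl :: 'k::field \<Rightarrow> _)"
proof -
  interpret vector_space "kscale :: 'k \<Rightarrow> _" by (rule vector_space_kscale)
  show ?thesis
    by unfold_locales (auto simp: fscl_def fun_eq_iff scale_right_distrib scale_left_distrib)
qed

lemma fpart_0 [simp]: "0 \<in> fpart V F p j"
  by (simp add: fpart_def)

lemma fpart_add: "f \<in> fpart V F p j \<Longrightarrow> g \<in> fpart V F p j \<Longrightarrow> f + g \<in> fpart V F p j"
proof -
  assume f: "f \<in> fpart V F p j" and g: "g \<in> fpart V F p j"
  have "fhcomp F p j (f + g) = fhcomp F p j f + fhcomp F p j g"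
    by (rule poly_mapping_eqI) (simp add: lookup_fhcomp lookup_add restr_add)
  then have "fhcomp F p j (f + g) = f + g"
    by (simp add: fhcomp_fpart[OF f] fhcomp_fpart[OF g])
  then show ?thesis using fpart_fhcomp[OF fmod_add[OF fpart_fmod[OF f] fpart_fmod[OF g]], of j] by simp
qed

lemma fpart_kscale: "f \<in> fpart V F p j \<Longrightarrow> kscale c f \<in> fpart V F p j"
  unfolding fpart_def kscale_def
  by (auto intro!: fmod_vsmult simp: lookup_vsmult in_keys_iff lookup_const_mult)

lemma fpart_diff: "f \<in> fpart V F p j \<Longrightarrow> g \<in> fpart V F p j \<Longrightarrow> f - g \<in> fpart V F p j"
proof -
  assume f: "f \<in> fpart V F p j" and g: "g \<in> fpart V F p j"
  interpret vector_space "kscale :: 'a \<Rightarrow> _" by (rule vector_space_kscale)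
  show ?thesis using fpart_add[OF f fpart_kscale[OF g, of "- 1"]] by simp
qed

lemma fchI:
  assumes "\<And>A. a A \<noteq> 0 \<Longrightarrow> A \<subseteq> pvars V \<and> card A = q \<and> q \<le> j" "\<And>A. a A \<in> fpart V F p (j - q)"
  shows "a \<in> fch V F p q j"
  using assms by (auto simp: fch_def)

lemma fch_supp: "a \<in> fch V F p q j \<Longrightarrow> a A \<noteq> 0 \<Longrightarrow> A \<subseteq> pvars V \<and> card A = q \<and> q \<le> j"
  and fch_fpart: "a \<in> fch V F p q j \<Longrightarrow> a A \<in> fpart V F p (j - q)"
  by (auto simp: fch_def)

lemma fch_fmod: "a \<in> fch V F p q j \<Longrightarrow> a A \<in> fmod V F p"
  using fch_fpart fpart_fmod by blast

lemma fch_0: "(\<lambda>A. 0) \<in> fch V F p q j"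
  by (simp add: fch_def)

lemma fch_add:
  assumes "a \<in> fch V F p q j" "b \<in> fch V F p q j"
  shows "(\<lambda>A. a A + b A) \<in> fch V F p q j"
proof (rule fchI)
  show "A \<subseteq> pvars V \<and> card A = q \<and> q \<le> j" if "a A + b A \<noteq> 0" for A
    using that fch_supp[OF assms(1), of A] fch_supp[OF assms(2), of A] by (cases "a A = 0") auto
qed (intro fpart_add fch_fpart assms)

lemma fch_diff:
  assumes "a \<in> fch V F p q j" "b \<in> fch V F p q j"
  shows "(\<lambda>A. a A - b A) \<in> fch V F p q j"
proof (rule fchI)
  show "A \<subseteq> pvars V \<and> card A = q \<and> q \<le> j" if "a A - b A \<noteq> 0" for A
    using that fch_supp[OF assms(1), of A] fch_supp[OF assms(2), of A] by (cases "a A = 0") auto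
qed (intro fpart_diff fch_fpart assms)

lemma kscale_0 [simp]: "kscale c 0 = 0"
  by (simp add: kscale_def)

lemma fch_scale:
  assumes "a \<in> fch V F p q j"
  shows "fscl c a \<in> fch V F p q j"
  unfolding fscl_def
proof (rule fchI)
  show "A \<subseteq> pvars V \<and> card A = q \<and> q \<le> j" if "kscale c (a A) \<noteq> 0" for A
    using that fch_supp[OF assms(1), of A] by (cases "a A = 0") auto
qed (intro fpart_kscale fch_fpart assms)

locale graded_resolution = kring +
  fixes I :: "'k::field mpoly set" and F :: "'k free_cplx"
  assumes hideal_I: "hideal V I" and resolution: "graded_free_resolution V I F"
begin

lemma bdiff_fpart: "k \<in> basis F (Suc i) \<Longrightarrow> bdiff F (Suc i) k \<in> fpart V F i (bdeg F (Suc i) k)"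
  and aug_polys: "k \<in> basis F 0 \<Longrightarrow> aug F k \<in> polys V"
  and aug_deg: "k \<in> basis F 0 \<Longrightarrow> m \<in> keys (aug F k) \<Longrightarrow> mdeg m = bdeg F 0 k"
  and aug_surj: "p \<in> polys V \<Longrightarrow> \<exists>f\<in>fmod V F 0. p - faug F f \<in> I"
  and exact0: "{f \<in> fmod V F 0. faug F f \<in> I} = fdiff F 1 ` fmod V F 1"
  and exact: "{f \<in> fmod V F (Suc i). fdiff F (Suc i) f = 0} = fdiff F (Suc (Suc i)) ` fmod V F (Suc (Suc i))"
  using resolution by (auto simp: graded_free_resolution_def)

lemma fdiff_fmod: "f \<in> fmod V F (Suc i) \<Longrightarrow> fdiff F (Suc i) f \<in> fmod V F i"
  using exact0 exact[of "i - 1"] by (cases i) auto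

lemma fdiff_fpart:
  assumes "f \<in> fpart V F (Suc i) j"
  shows "fdiff F (Suc i) f \<in> fpart V F i j"
proof -
  have "fdiff F (Suc i) f = fhcomp F i j (fdiff F (Suc i) f)"
    using fdiff_fhcomp[OF bdiff_fpart fpart_fmod[OF assms], of j] fhcomp_fpart[OF assms] by simp
  then show ?thesis using fpart_fhcomp[OF fdiff_fmod[OF fpart_fmod[OF assms]], of j] by simp
qed

lemma faug_hom:
  assumes "f \<in> fpart V F 0 j"
  shows "faug F f \<in> polys V" "m \<in> keys (faug F f) \<Longrightarrow> mdeg m = j"
proof -
  have "faug F f = hcomp j (faug F f)"
    using faug_fhcomp[OF aug_deg fpart_fmod[OF assms], of j] fhcomp_fpart[OF assms] by simp
  then show "m \<in> keys (faug F f) \<Longrightarrow> mdeg m = j" by (metis (mono_tags, lifting) keys_restr mem_Collect_eq)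
  show "faug F f \<in> polys V" unfolding faug_def
    using fpart_fmod[OF assms] by (intro polys_sum polys_mult aug_polys) (auto simp: fmod_def)
qed

lemma exact0_fpart:
  assumes f: "f \<in> fpart V F 0 j" "faug F f \<in> I"
  shows "\<exists>g\<in>fpart V F 1 j. fdiff F 1 g = f"
proof -
  have "f \<in> fdiff F 1 ` fmod V F 1" using exact0 fpart_fmod[OF f(1)] f(2) by blast
  then obtain g where g: "g \<in> fmod V F (Suc 0)" "fdiff F (Suc 0) g = f" by auto
  have "fdiff F (Suc 0) (fhcomp F (Suc 0) j g) = f"
    using fdiff_fhcomp[OF bdiff_fpart g(1), of j] fhcomp_fpart[OF f(1)] by (simp add: g)
  then show ?thesis using fpart_fhcomp[OF g(1)] by auto
qed

lemma exact_fpart: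
  assumes f: "f \<in> fpart V F (Suc i) j" "fdiff F (Suc i) f = 0"
  shows "\<exists>g\<in>fpart V F (Suc (Suc i)) j. fdiff F (Suc (Suc i)) g = f"
proof -
  have "f \<in> fdiff F (Suc (Suc i)) ` fmod V F (Suc (Suc i))" using exact[of i] fpart_fmod[OF f(1)] f(2) by blast
  then obtain g where g: "g \<in> fmod V F (Suc (Suc i))" "fdiff F (Suc (Suc i)) g = f" by auto
  have "fdiff F (Suc (Suc i)) (fhcomp F (Suc (Suc i)) j g) = f"
    using fdiff_fhcomp[OF bdiff_fpart g(1), of j] fhcomp_fpart[OF f(1)] by (simp add: g)
  then show ?thesis using fpart_fhcomp[OF g(1)] by blast
qed

lemma aug_surj_hom:
  assumes p: "p \<in> polys V" "\<And>m. m \<in> keys p \<Longrightarrow> mdeg m = j"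
  shows "\<exists>f\<in>fpart V F 0 j. p - faug F f \<in> I"
proof -
  obtain f where f: "f \<in> fmod V F 0" "p - faug F f \<in> I" using aug_surj[OF p(1)] by blast
  have "p - faug F (fhcomp F 0 j f) = hcomp j (p - faug F f)"
    using faug_fhcomp[OF aug_deg f(1), of j] restr_id[of p "\<lambda>m. mdeg m = j"] p(2) by (simp add: restr_diff)
  then show ?thesis using fpart_fhcomp[OF f(1)] hideal_hcomp[OF hideal_I f(2), of j] by metis
qed

lemma fdiff_fdiff: "f \<in> fmod V F (Suc (Suc i)) \<Longrightarrow> fdiff F (Suc i) (fdiff F (Suc (Suc i)) f) = 0"
  using exact[of i] by blast

lemma faug_fdiff: "f \<in> fmod V F 1 \<Longrightarrow> faug F (fdiff F 1 f) \<in> I"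
  using exact0 by blast

subsection \<open>The double complex\<close>

lemma koszul_fvec: "koszul (pvars V) (\<lambda>v. vsmult (pv v) :: 'k fvec \<Rightarrow> _)"
  by unfold_locales (auto simp: finite_pvars[OF finite_V] vsmult_add vsmult_vsmult mult.commute)

lemmas fbd_add = koszul.bd_add[OF koszul_fvec, folded fbd_def]
lemmas fbd_diff = koszul.bd_diff[OF koszul_fvec, folded fbd_def]
lemmas fbd_0 = koszul.bd_0[OF koszul_fvec, folded fbd_def]

lemma lookup_fbd: "lookup (fbd V a B) k = kbd V (\<lambda>A. lookup (a A) k) (B :: pvar set) "
  for a :: "'k fchain"
  unfolding fbd_def kbd_def
  by (rule bd_hom[OF koszul_fvec koszul_V]) (auto simp: lookup_add lookup_vsmult)

lemma fdiff_fbd: "fdiff F i (fbd V a B) = fbd V (\<lambda>A. fdiff F i (a A)) B"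
  unfolding fbd_def by (rule bd_hom[OF koszul_fvec koszul_fvec]) (auto simp: fdiff_add fdiff_vsmult)

lemma faug_fbd: "faug F (fbd V a B) = kbd V (\<lambda>A. faug F (a A)) B"
  unfolding fbd_def kbd_def by (rule bd_hom[OF koszul_fvec koszul_V]) (auto simp: faug_add faug_vsmult)

lemma fbd_scale: "fbd V (fscl c a) = fscl c (fbd V a)" for a :: "'k fchain"
proof
  fix A
  show "fbd V (fscl c a) A = fscl c (fbd V a) A"
    using bd_hom[OF koszul_fvec koszul_fvec, of "kscale c" a A]
    by (simp add: fscl_def fbd_def kscale_def vsmult_add vsmult_vsmult mult.commute)
qed

lemma fch_coord:
  assumes a: "a \<in> fch V F p q j"
  shows "(\<lambda>A. lookup (a A) k) \<in> kch V q (j - bdeg F p k)"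
    "lookup (a A) k \<noteq> 0 \<Longrightarrow> k \<in> basis F p \<and> bdeg F p k + q \<le> j"
proof -
  have deg: "mdeg m + bdeg F p k + q = j" if "m \<in> keys (lookup (a A) k)" for m A
  proof -
    have "a A \<noteq> 0" using that by auto
    then show ?thesis using fch_supp[OF a, of A] fch_fpart[OF a, of A] that by (fastforce simp: fpart_def)
  qed
  show "(\<lambda>A. lookup (a A) k) \<in> kch V q (j - bdeg F p k)"
  proof (rule kchI)
    show "A \<subseteq> pvars V \<and> card A = q" if "lookup (a A) k \<noteq> 0" for A
    proof -
      have "a A \<noteq> 0" using that by auto
      then show ?thesis using fch_supp[OF a] by blast
    qed
    show "lookup (a A) k \<in> polys V" for A using fch_fmod[OF a, of A] by (simp add: fmod_def)
    show "mdeg m + q = j - bdeg F p k" if "m \<in> keys (lookup (a A) k)" for A m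
      using deg[OF that] by simp
  qed
  assume nz: "lookup (a A) k \<noteq> 0"
  then obtain m where "m \<in> keys (lookup (a A) k)" by (metis keys_eq_empty all_not_in_conv)
  moreover have "k \<in> basis F p" using fch_fmod[OF a, of A] nz by (auto simp: fmod_def in_keys_iff)
  ultimately show "k \<in> basis F p \<and> bdeg F p k + q \<le> j" using deg by fastforce
qed

lemma fch_of_coords:
  assumes c: "\<And>k. (\<lambda>A. lookup (a A) k) \<in> kch V q (j - bdeg F p k)"
    and b: "\<And>k A. lookup (a A) k \<noteq> 0 \<Longrightarrow> k \<in> basis F p \<and> bdeg F p k + q \<le> j"
  shows "a \<in> fch V F p q j"
proof (rule fchI)
  fix A
  show "A \<subseteq> pvars V \<and> card A = q \<and> q \<le> j" if "a A \<noteq> 0"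
  proof -
    from that obtain k where "lookup (a A) k \<noteq> 0" by (metis poly_mapping_eqI lookup_zero)
    then show ?thesis using kch_supp[OF c, of A k] b[of A k] by auto
  qed
  have "mdeg m + bdeg F p k = j - q" if m: "m \<in> keys (lookup (a A) k)" for k m
  proof -
    have "lookup (a A) k \<noteq> 0" using m by auto
    then show ?thesis using b[of A k] kch_deg[OF c m] by linarith
  qed
  then show "a A \<in> fpart V F p (j - q)"
    using b kch_polys[OF c, of A] by (auto simp: fpart_def fmod_def in_keys_iff)
qed

lemma fbd_fch:
  assumes a: "a \<in> fch V F p (Suc q) j"
  shows "fbd V a \<in> fch V F p q j"
proof (rule fch_of_coords)
  show "(\<lambda>A. lookup (fbd V a A) k) \<in> kch V q (j - bdeg F p k)" for k
    using kbd_kch[OF fch_coord(1)[OF a, of k]] by (simp add: lookup_fbd)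
  show "k \<in> basis F p \<and> bdeg F p k + q \<le> j" if "lookup (fbd V a A) k \<noteq> 0" for A k
  proof -
    have "\<exists>A. lookup (a A) k \<noteq> 0"
    proof (rule ccontr)
      assume "\<not> (\<exists>A. lookup (a A) k \<noteq> 0)"
      then have "(\<lambda>A. lookup (a A) k) = (\<lambda>A. 0)" by auto
      then show False using that by (simp add: lookup_fbd kbd_0)
    qed
    then show ?thesis using fch_coord(2)[OF a] by fastforce
  qed
qed

lemma fbd_fbd:
  assumes a: "a \<in> fch V F p q j"
  shows "fbd V (fbd V a) A = 0"
proof (rule poly_mapping_eqI)
  fix k
  show "lookup (fbd V (fbd V a) A) k = lookup 0 k"
    using kbd_kbd[OF fch_coord(1)[OF a, of k]] by (simp add: lookup_fbd)
qed

lemma fbd_fch_0: "a \<in> fch V F p 0 j \<Longrightarrow> fbd V a A = 0"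
  by (rule poly_mapping_eqI) (simp add: lookup_fbd kbd_kch_0[OF fch_coord(1)])

text \<open>Coordinate by coordinate this is exactness of the Koszul complex over S, in degrees
  shifted by \<open>bdeg\<close>. Constants can obstruct only for \<open>q = 0\<close>, whence the
  extra hypothesis.\<close>

lemma fbd_exact:
  assumes a: "a \<in> fch V F p q j" and bd: "\<And>A. fbd V a A = 0"
    and pos: "q = 0 \<Longrightarrow> (\<And>k. 0 \<notin> keys (lookup (a {}) k))"
  shows "\<exists>b\<in>fch V F p (Suc q) j. fbd V b = a"
proof -
  \<comment> \<open>Only finitely many coordinates occur, since \<open>A\<close> ranges over the
    subsets of a finite set; the coordinatewise preimages can thus be summed to one chain.\<close>
  define K where "K = (\<Union>A\<in>Pow (pvars V). keys (a A))"
  have fK: "finite K" using finite_pvars[OF finite_V] by (auto simp: K_def)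
  have KI: "k \<in> K" if "lookup (a A) k \<noteq> 0" for k A
  proof -
    have "a A \<noteq> 0" using that by auto
    then have "A \<subseteq> pvars V" using fch_supp[OF a] by blast
    then show ?thesis using that by (auto simp: K_def in_keys_iff)
  qed
  have "\<exists>g\<in>kch V (Suc q) (j - bdeg F p k). kbd V g = (\<lambda>A. lookup (a A) k)" if k: "k \<in> K" for k
  proof (rule kbd_exact[OF fch_coord(1)[OF a]])
    obtain A where A: "A \<subseteq> pvars V" "lookup (a A) k \<noteq> 0" using k by (auto simp: K_def in_keys_iff)
    then obtain m where m: "m \<in> keys (lookup (a A) k)" by (metis keys_eq_empty all_not_in_conv)
    have d: "mdeg m + q = j - bdeg F p k" using kch_deg[OF fch_coord(1)[OF a] m] .
    have "mdeg m > 0" if "q = 0"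
    proof -
      have "a A \<noteq> 0" using A(2) by auto
      then have "card A = 0" using fch_supp[OF a, of A] that by simp
      then have "A = {}" using finite_subset[OF A(1) finite_pvars[OF finite_V]] by simp
      then have "m \<noteq> 0" using pos[OF that, of k] m by auto
      then show ?thesis using mdeg_eq_0_iff[of m] by simp
    qed
    then show "0 < j - bdeg F p k" using d by (cases q) auto
    show "kbd V (\<lambda>A. lookup (a A) k) A = 0" for A using bd[of A] lookup_fbd[of a A k] by simp
  qed
  then have "\<forall>k. \<exists>g. k \<in> K \<longrightarrow> g \<in> kch V (Suc q) (j - bdeg F p k) \<and> kbd V g = (\<lambda>A. lookup (a A) k)" by blast
  from choice[OF this] obtain g where g: "\<And>k. k \<in> K \<Longrightarrow> g k \<in> kch V (Suc q) (j - bdeg F p k)"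
    "\<And>k. k \<in> K \<Longrightarrow> kbd V (g k) = (\<lambda>A. lookup (a A) k)" by blast
  define b where "b A = (\<Sum>k\<in>K. single k (g k A))" for A
  have lb: "lookup (b A) k = (if k \<in> K then g k A else 0)" for A k
    using fK by (simp add: b_def lookup_sum lookup_single when_def)
  have b: "b \<in> fch V F p (Suc q) j"
  proof (rule fch_of_coords)
    show "(\<lambda>A. lookup (b A) k) \<in> kch V (Suc q) (j - bdeg F p k)" for k
      using g(1)[of k] kch_0 by (cases "k \<in> K") (auto simp: lb)
    show "k \<in> basis F p \<and> bdeg F p k + Suc q \<le> j" if nz: "lookup (b A) k \<noteq> 0" for k A
    proof -
      from nz have k: "k \<in> K" "g k A \<noteq> 0" by (auto simp: lb split: if_splits)
      then obtain m where m: "m \<in> keys (g k A)" by (metis keys_eq_empty all_not_in_conv)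
      obtain A' where "lookup (a A') k \<noteq> 0" using k(1) by (auto simp: K_def in_keys_iff)
      then have *: "k \<in> basis F p" using fch_coord(2)[OF a] by blast
      moreover have "mdeg m + Suc q = j - bdeg F p k" using kch_deg[OF g(1)[OF k(1)] m] .
      ultimately show ?thesis by linarith
    qed
  qed
  have "fbd V b A = a A" for A
  proof (rule poly_mapping_eqI)
    fix k
    have "(\<lambda>A. lookup (b A) k) = (if k \<in> K then g k else (\<lambda>A. 0))" by (auto simp: lb)
    then have "lookup (fbd V b A) k = (if k \<in> K then lookup (a A) k else 0)"
      using g(2)[of k] by (auto simp: lookup_fbd kbd_0)
    then show "lookup (fbd V b A) k = lookup (a A) k" using KI[of A k] by auto
  qed
  then show ?thesis using b by blast
qed

lemma fdiff_fch: "a \<in> fch V F (Suc p) q j \<Longrightarrow> (\<lambda>A. fdiff F (Suc p) (a A)) \<in> fch V F p q j"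
proof (rule fchI)
  assume a: "a \<in> fch V F (Suc p) q j"
  show "A \<subseteq> pvars V \<and> card A = q \<and> q \<le> j" if "fdiff F (Suc p) (a A) \<noteq> 0" for A
    using that fch_supp[OF a, of A] by (cases "a A = 0") auto
  show "fdiff F (Suc p) (a A) \<in> fpart V F p (j - q)" for A by (rule fdiff_fpart[OF fch_fpart[OF a]])
qed

text \<open>Choosing 0 wherever \<open>a\<close> vanishes keeps the pointwise choice supported on
  sets of size \<open>q\<close>.\<close>

lemma fch_lift:
  assumes a: "a \<in> fch V F p q j"
    and ex: "\<And>A. \<exists>g\<in>fpart V F p' (j - q). P A g" and z: "\<And>A. a A = 0 \<Longrightarrow> P A 0"
  shows "\<exists>b\<in>fch V F p' q j. \<forall>A. P A (b A)"
proof -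
  have "\<forall>A. \<exists>g. g \<in> fpart V F p' (j - q) \<and> P A g \<and> (a A = 0 \<longrightarrow> g = 0)"
  proof
    fix A
    show "\<exists>g. g \<in> fpart V F p' (j - q) \<and> P A g \<and> (a A = 0 \<longrightarrow> g = 0)"
    proof (cases "a A = 0")
      case True
      then show ?thesis using z[OF True] by (intro exI[of _ 0]) simp
    qed (use ex[of A] in blast)
  qed
  from choice[OF this] obtain b where b: "\<And>A. b A \<in> fpart V F p' (j - q)" "\<And>A. P A (b A)" "\<And>A. a A = 0 \<Longrightarrow> b A = 0"
    by blast
  have "b \<in> fch V F p' q j"
    using fch_supp[OF a] b(1,3) by (intro fchI) blast+
  then show ?thesis using b(2) by blast
qed

lemma fch_exact:
  assumes a: "a \<in> fch V F (Suc p) q j" "\<And>A. fdiff F (Suc p) (a A) = 0"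
  shows "\<exists>b\<in>fch V F (Suc (Suc p)) q j. \<forall>A. fdiff F (Suc (Suc p)) (b A) = a A"
  by (rule fch_lift[OF a(1)]) (use exact_fpart[OF fch_fpart[OF a(1)] a(2)] in auto)

lemma fch_exact0:
  assumes a: "a \<in> fch V F 0 q j" "\<And>A. faug F (a A) \<in> I"
  shows "\<exists>b\<in>fch V F (Suc 0) q j. \<forall>A. fdiff F (Suc 0) (b A) = a A"
  by (rule fch_lift[OF a(1)]) (use exact0_fpart[OF fch_fpart[OF a(1)] a(2)] in auto)

text \<open>One group for each place of an antidiagonal: elements whose image under the resolution
  differential is a Koszul boundary, to be taken modulo the images of both differentials. For
  \<open>p = 0\<close> the Koszul boundary has to augment into I instead. These groups interpolate
  between the Koszul homology of S/I and the homology of F tensored with the residue field.\<close>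

definition fz :: "nat \<Rightarrow> nat \<Rightarrow> nat \<Rightarrow> 'k fchain set" where
  "fz p q j = {a \<in> fch V F p q j. case p of 0 \<Rightarrow> \<forall>B. faug F (fbd V a B) \<in> I
     | Suc i \<Rightarrow> \<exists>b\<in>fch V F i (Suc q) j. \<forall>A. fdiff F p (a A) = fbd V b A}"

definition fb :: "nat \<Rightarrow> nat \<Rightarrow> nat \<Rightarrow> 'k fchain set" where
  "fb p q j = {a \<in> fch V F p q j. \<exists>g\<in>fch V F (Suc p) q j. \<exists>h\<in>fch V F p (Suc q) j.
     \<forall>A. a A = fdiff F (Suc p) (g A) + fbd V h A}"

lemma fz_fch: "a \<in> fz p q j \<Longrightarrow> a \<in> fch V F p q j"
  by (simp add: fz_def)

lemma faug_kscale: "faug F (kscale c f) = single 0 c * faug F f"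
  by (simp add: kscale_def faug_vsmult)

lemma fdiff_kscale: "fdiff F i (kscale c f) = kscale c (fdiff F i f)"
  by (simp add: kscale_def fdiff_vsmult)

lemma ksub_fz: "ksub fscl (fz p q j)"
  unfolding ksub_def
proof (intro conjI ballI allI)
  show "0 \<in> fz p q j"
    unfolding zero_fun_def using hideal_0[OF hideal_I]
    by (auto simp: fz_def fch_0 fbd_0 split: nat.split intro!: bexI[of _ "\<lambda>A. 0"])
next
  fix a b assume a: "a \<in> fz p q j" and b: "b \<in> fz p q j"
  show "a + b \<in> fz p q j"
  proof (cases p)
    case 0
    then show ?thesis using a b hideal_add[OF hideal_I]
      by (simp add: fz_def plus_fun_def fch_add fbd_add faug_add)
  next
    case (Suc i)
    from a b Suc obtain a' b' where "a' \<in> fch V F i (Suc q) j" "\<And>A. fdiff F p (a A) = fbd V a' A"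
      "b' \<in> fch V F i (Suc q) j" "\<And>A. fdiff F p (b A) = fbd V b' A"
      unfolding fz_def by auto
    then show ?thesis using a b Suc fch_add[of a' V F i "Suc q" j b']
      by (auto simp: fz_def plus_fun_def fch_add fdiff_add fbd_add intro!: bexI[of _ "\<lambda>A. a' A + b' A"])
  qed
next
  fix a c assume a: "a \<in> fz p q j"
  show "fscl c a \<in> fz p q j"
  proof (cases p)
    case 0
    have "faug F (fbd V (fscl c a) B) \<in> I" for B
      unfolding fbd_scale using a 0 hideal_mult[OF hideal_I _ polys_const]
      by (simp add: fz_def fscl_def faug_kscale)
    then show ?thesis using a 0 by (simp add: fz_def fch_scale)
  next
    case (Suc i)
    from a Suc obtain a' where a': "a' \<in> fch V F i (Suc q) j" "\<And>A. fdiff F p (a A) = fbd V a' A"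
      unfolding fz_def by auto
    have "fdiff F p (fscl c a A) = fbd V (fscl c a') A" for A
      unfolding fbd_scale using a'(2)[of A] by (simp add: fscl_def fdiff_kscale)
    then show ?thesis using a Suc fch_scale[OF a'(1), of c] by (auto simp: fz_def fch_scale)
  qed
qed

text \<open>One zigzag step. Exactness of the resolution produces \<open>a\<close> from
  \<open>b\<close>; in the other direction exactness of the Koszul complex is used, always at a
  place of positive Koszul degree, where constants are no obstacle.\<close>

lemma fz_step:
  assumes "has_qdim fscl (fz p (Suc q) j) (fb p (Suc q) j) d"
  shows "has_qdim fscl (fz (Suc p) q j) (fb (Suc p) q j) d"
proof -
  define R where "R b a \<longleftrightarrow> (\<forall>A. fdiff F (Suc p) (a A) = fbd V b A)" for a b
  show ?thesis
  proof (rule has_qdim_relation[where R = R, OF vector_space_fscl vector_space_fscl ksub_fz ksub_fz _ _ _ _ _ _ assms])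
    show "R 0 0" by (simp add: R_def zero_fun_def fbd_0)
    show "R (x + x') (y + y')" if "R x y" "R x' y'" for x y x' y'
      using that by (simp add: R_def plus_fun_def fbd_add fdiff_add)
    show "R (fscl c x) (fscl c y)" if "R x y" for c x y
      unfolding R_def fbd_scale using that by (simp add: R_def fscl_def fdiff_kscale)
  next
    fix b assume b: "b \<in> fz p (Suc q) j"
    have bb: "fbd V b \<in> fch V F p q j" by (rule fbd_fch[OF fz_fch[OF b]])
    have "\<exists>a\<in>fch V F (Suc p) q j. \<forall>A. fdiff F (Suc p) (a A) = fbd V b A"
    proof (cases p)
      case 0
      then have "faug F (fbd V b A) \<in> I" for A using b by (simp add: fz_def)
      then show ?thesis using fch_exact0[of "fbd V b" q j] bb 0 by simp
    next
      case (Suc i)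
      then obtain c where c: "c \<in> fch V F i (Suc (Suc q)) j" "\<And>A. fdiff F p (b A) = fbd V c A"
        using b unfolding fz_def by auto
      have "fdiff F p (fbd V b A) = 0" for A
        using fbd_fbd[OF c(1)] by (simp add: fdiff_fbd c(2))
      then show ?thesis using fch_exact[of "fbd V b" i q j] bb Suc by simp
    qed
    then obtain a where a: "a \<in> fch V F (Suc p) q j" "\<And>A. fdiff F (Suc p) (a A) = fbd V b A" by blast
    then have "a \<in> fz (Suc p) q j" using fz_fch[OF b] by (auto simp: fz_def)
    then show "\<exists>a\<in>fz (Suc p) q j. R b a" using a by (auto simp: R_def)
  next
    fix a assume a: "a \<in> fz (Suc p) q j"
    then obtain b where b: "b \<in> fch V F p (Suc q) j" "\<And>A. fdiff F (Suc p) (a A) = fbd V b A"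
      unfolding fz_def by auto
    have "b \<in> fz p (Suc q) j"
    proof (cases p)
      case 0
      have "faug F (fbd V b A) \<in> I" for A
        using faug_fdiff[of "a A"] fch_fmod[OF fz_fch[OF a], of A] b(2)[of A] 0 by simp
      then show ?thesis using b 0 by (simp add: fz_def)
    next
      case (Suc i)
      have db: "(\<lambda>A. fdiff F p (b A)) \<in> fch V F i (Suc q) j" using fdiff_fch b(1) Suc by simp
      have "fbd V (\<lambda>A. fdiff F p (b A)) A = 0" for A
      proof -
        have "fbd V (\<lambda>A. fdiff F p (b A)) A = fdiff F p (fbd V b A)" by (simp add: fdiff_fbd)
        also have "\<dots> = fdiff F (Suc i) (fdiff F (Suc (Suc i)) (a A))" using b(2)[of A] Suc by simp
        also have "\<dots> = 0" using fdiff_fdiff fch_fmod[OF fz_fch[OF a], of A] Suc by simp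
        finally show ?thesis .
      qed
      then obtain c where "c \<in> fch V F i (Suc (Suc q)) j" "fbd V c = (\<lambda>A. fdiff F p (b A))"
        using fbd_exact[OF db] by auto
      then show ?thesis using b Suc by (auto simp: fz_def intro!: bexI[of _ c])
    qed
    then show "\<exists>b\<in>fz p (Suc q) j. R b a" using b by (auto simp: R_def)
  next
    fix b a assume b: "b \<in> fz p (Suc q) j" and a: "a \<in> fz (Suc p) q j" and R: "R b a"
    show "b \<in> fb p (Suc q) j \<longleftrightarrow> a \<in> fb (Suc p) q j"
    proof
      assume "a \<in> fb (Suc p) q j"
      then obtain g h where g: "g \<in> fch V F (Suc (Suc p)) q j" and h: "h \<in> fch V F (Suc p) (Suc q) j"
        and eq: "\<And>A. a A = fdiff F (Suc (Suc p)) (g A) + fbd V h A"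
        unfolding fb_def by auto
      define e where "e = (\<lambda>A. b A - fdiff F (Suc p) (h A))"
      have "fbd V e A = 0" for A
      proof -
        have "fbd V b A = fdiff F (Suc p) (a A)" using R by (simp add: R_def)
        also have "\<dots> = fdiff F (Suc p) (fbd V h A)"
          using fdiff_fdiff[OF fch_fmod[OF g, of A]] by (simp add: eq fdiff_add)
        finally show ?thesis by (simp add: e_def fbd_diff fdiff_fbd)
      qed
      moreover have "e \<in> fch V F p (Suc q) j"
        unfolding e_def by (rule fch_diff[OF fz_fch[OF b] fdiff_fch[OF h]])
      ultimately obtain h' where h': "h' \<in> fch V F p (Suc (Suc q)) j" "fbd V h' = e"
        using fbd_exact[of e p "Suc q" j] by auto
      have "b A = fdiff F (Suc p) (h A) + fbd V h' A" for A using h'(2) by (simp add: e_def)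
      then show "b \<in> fb p (Suc q) j" using fz_fch[OF b] h h'(1) unfolding fb_def by blast
    next
      assume "b \<in> fb p (Suc q) j"
      then obtain g h where g: "g \<in> fch V F (Suc p) (Suc q) j" and h: "h \<in> fch V F p (Suc (Suc q)) j"
        and eq: "\<And>A. b A = fdiff F (Suc p) (g A) + fbd V h A"
        unfolding fb_def by auto
      define e where "e = (\<lambda>A. a A - fbd V g A)"
      have "fdiff F (Suc p) (e A) = 0" for A
      proof -
        have "fdiff F (Suc p) (a A) = fbd V b A" using R by (simp add: R_def)
        also have "\<dots> = fbd V (\<lambda>A. fdiff F (Suc p) (g A)) A"
          using fbd_fbd[OF h, of A] by (simp add: eq[abs_def] fbd_add)
        finally show ?thesis by (simp add: e_def fdiff_diff fdiff_fbd)
      qed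
      moreover have "e \<in> fch V F (Suc p) q j"
        unfolding e_def by (rule fch_diff[OF fz_fch[OF a] fbd_fch[OF g]])
      ultimately obtain g' where g': "g' \<in> fch V F (Suc (Suc p)) q j" "\<And>A. fdiff F (Suc (Suc p)) (g' A) = e A"
        using fch_exact[of e p q j] by blast
      have "a A = fdiff F (Suc (Suc p)) (g' A) + fbd V g A" for A using g'(2) by (simp add: e_def)
      then show "a \<in> fb (Suc p) q j" using fz_fch[OF a] g g'(1) unfolding fb_def by blast
    qed
  qed
qed

lemma fz_steps: "has_qdim fscl (fz 0 k j) (fb 0 k j) d \<Longrightarrow> has_qdim fscl (fz k 0 j) (fb k 0 j) d"
proof -
  assume 0: "has_qdim fscl (fz 0 k j) (fb 0 k j) d"
  have "has_qdim fscl (fz p (k - p) j) (fb p (k - p) j) d" if "p \<le> k" for p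
    using that
  proof (induction p)
    case (Suc p)
    then have "k - p = Suc (k - Suc p)" by simp
    then show ?case using Suc fz_step[of p "k - Suc p" j d] by simp
  qed (use 0 in simp)
  from this[of k] show ?thesis by simp
qed

text \<open>One end of the zigzag: the augmentation maps F_0 onto S/I with kernel the image of F_1,
  so chains over F_0 can stand in for chains over S/I.\<close>

lemma tor_fz:
  assumes "tor V I k j d"
  shows "has_qdim fscl (fz 0 k j) (fb 0 k j) d"
proof -
  define R where "R c a \<longleftrightarrow> (\<forall>A. c A - faug F (a A) \<in> I)" for c :: "'k chain" and a
  note I = hideal_I
  have aug_kch: "(\<lambda>A. faug F (a A)) \<in> kch V k' j" if a: "a \<in> fch V F 0 k' j" for a k'
  proof (rule kchI)
    fix A
    show "A \<subseteq> pvars V \<and> card A = k'" if "faug F (a A) \<noteq> 0"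
      using that fch_supp[OF a, of A] by (cases "a A = 0") auto
    show "faug F (a A) \<in> polys V" by (rule faug_hom(1)[OF fch_fpart[OF a]])
    show "mdeg m + k' = j" if m: "m \<in> keys (faug F (a A))" for m
    proof -
      have "a A \<noteq> 0" using m by auto
      then show ?thesis using fch_supp[OF a, of A] faug_hom(2)[OF fch_fpart[OF a] m] by simp
    qed
  qed
  have lift: "\<exists>a\<in>fch V F 0 k' j. \<forall>A. c A - faug F (a A) \<in> I" if c: "c \<in> kch V k' j" for c k'
  proof -
    have "\<forall>A. \<exists>g. g \<in> fpart V F 0 (j - k') \<and> c A - faug F g \<in> I \<and> (c A = 0 \<longrightarrow> g = 0)"
    proof
      fix A
      show "\<exists>g. g \<in> fpart V F 0 (j - k') \<and> c A - faug F g \<in> I \<and> (c A = 0 \<longrightarrow> g = 0)"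
      proof (cases "c A = 0")
        case True
        then show ?thesis using hideal_0[OF I] by (intro exI[of _ 0]) simp
      next
        case False
        have "mdeg m = j - k'" if "m \<in> keys (c A)" for m using kch_deg[OF c that] by simp
        then show ?thesis using aug_surj_hom[OF kch_polys[OF c, of A], of "j - k'"] False by blast
      qed
    qed
    from choice[OF this] obtain a where a: "\<And>A. a A \<in> fpart V F 0 (j - k')" "\<And>A. c A - faug F (a A) \<in> I"
      "\<And>A. c A = 0 \<Longrightarrow> a A = 0" by blast
    have "a \<in> fch V F 0 k' j"
    proof (rule fchI)
      fix A
      show "A \<subseteq> pvars V \<and> card A = k' \<and> k' \<le> j" if "a A \<noteq> 0"
      proof -
        have nz: "c A \<noteq> 0" using that a(3) by blast
        then obtain m where "m \<in> keys (c A)" by (metis keys_eq_empty all_not_in_conv)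
        then have "k' \<le> j" using kch_deg[OF c] by fastforce
        then show ?thesis using kch_supp[OF c nz] by simp
      qed
    qed (rule a(1))
    then show ?thesis using a(2) by blast
  qed
  have bdR: "kbd V c A - faug F (fbd V a A) \<in> I" if R: "R c a" for c a A
  proof -
    have "kbd V (\<lambda>A. c A - faug F (a A)) A \<in> I" by (rule kbd_in[OF I]) (use R in \<open>simp add: R_def\<close>)
    then show ?thesis by (simp add: kbd_diff faug_fbd)
  qed
  have cyc_iff: "(\<forall>A. kbd V c A \<in> I) \<longleftrightarrow> (\<forall>A. faug F (fbd V a A) \<in> I)" if R: "R c a" for c a
  proof
    assume *: "\<forall>A. kbd V c A \<in> I"
    show "\<forall>A. faug F (fbd V a A) \<in> I"
    proof
      fix A show "faug F (fbd V a A) \<in> I"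
        using hideal_diff[OF I _ bdR[OF R, of A], of "kbd V c A"] * by simp
    qed
  next
    assume *: "\<forall>A. faug F (fbd V a A) \<in> I"
    show "\<forall>A. kbd V c A \<in> I"
    proof
      fix A show "kbd V c A \<in> I"
        using hideal_add[OF I bdR[OF R, of A], of "faug F (fbd V a A)"] * by simp
    qed
  qed
  show ?thesis
  proof (rule has_qdim_relation[where R = R, OF vector_space_kscl vector_space_fscl ksub_kcyc[OF I] ksub_fz _ _ _ _ _ _ assms[unfolded tor_def]])
    show "R 0 0" using hideal_0[OF I] by (simp add: R_def zero_fun_def)
    show "R (x + x') (y + y')" if "R x y" "R x' y'" for x y x' y'
      using that hideal_add[OF I] by (simp add: R_def plus_fun_def faug_add add_diff_add)
    show "R (kscl c x) (fscl c y)" if "R x y" for c x y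
    proof -
      have "single 0 c * (x A - faug F (y A)) \<in> I" for A
        using that hideal_mult[OF I _ polys_const] by (simp add: R_def)
      then show ?thesis by (simp add: R_def kscl_def fscl_def faug_kscale right_diff_distrib)
    qed
  next
    fix c assume c: "c \<in> kcyc V I k j"
    obtain a where a: "a \<in> fch V F 0 k j" "\<And>A. c A - faug F (a A) \<in> I" using lift[OF kcyc_kch[OF c]] by blast
    then have R: "R c a" by (simp add: R_def)
    have "a \<in> fz 0 k j" using a(1) cyc_iff[OF R] kcyc_bd[OF c] by (simp add: fz_def)
    then show "\<exists>a\<in>fz 0 k j. R c a" using R by blast
  next
    fix a assume a: "a \<in> fz 0 k j"
    have R: "R (\<lambda>A. faug F (a A)) a" using hideal_0[OF I] by (simp add: R_def)
    have "(\<lambda>A. faug F (a A)) \<in> kcyc V I k j"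
      using cyc_iff[OF R] a by (intro kcycI aug_kch fz_fch) (auto simp: fz_def)
    then show "\<exists>c\<in>kcyc V I k j. R c a" using R by blast
  next
    fix c a assume c: "c \<in> kcyc V I k j" and a: "a \<in> fz 0 k j" and R: "R c a"
    show "c \<in> kbou V I k j \<longleftrightarrow> a \<in> fb 0 k j"
    proof
      assume "c \<in> kbou V I k j"
      then obtain g where g: "g \<in> kch V (Suc k) j" "\<And>A. c A - kbd V g A \<in> I" by (auto simp: kbou_def)
      obtain h where h: "h \<in> fch V F 0 (Suc k) j" "\<And>A. g A - faug F (h A) \<in> I" using lift[OF g(1)] by blast
      have "R g h" using h(2) by (simp add: R_def)
      have "faug F (a A - fbd V h A) \<in> I" for A
      proof -
        have "faug F (a A - fbd V h A) =
            (c A - kbd V g A) - (c A - faug F (a A)) + (kbd V g A - faug F (fbd V h A))"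
          by (simp add: faug_diff)
        moreover have "c A - faug F (a A) \<in> I" using R by (simp add: R_def)
        ultimately show ?thesis
          using hideal_add[OF I hideal_diff[OF I g(2)[of A]] bdR[OF \<open>R g h\<close>, of A]] by metis
      qed
      then obtain e where e: "e \<in> fch V F (Suc 0) k j" "\<And>A. fdiff F (Suc 0) (e A) = a A - fbd V h A"
        using fch_exact0[OF fch_diff[OF fz_fch[OF a] fbd_fch[OF h(1)]]] by blast
      have "a A = fdiff F (Suc 0) (e A) + fbd V h A" for A by (simp add: e(2))
      then show "a \<in> fb 0 k j" using fz_fch[OF a] e(1) h(1) unfolding fb_def by blast
    next
      assume "a \<in> fb 0 k j"
      then obtain g h where g: "g \<in> fch V F (Suc 0) k j" and h: "h \<in> fch V F 0 (Suc k) j"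
        and eq: "\<And>A. a A = fdiff F (Suc 0) (g A) + fbd V h A"
        unfolding fb_def by auto
      show "c \<in> kbou V I k j"
      proof (rule kbouI[OF kcyc_kch[OF c] aug_kch[OF h]])
        fix A
        have "c A - kbd V (\<lambda>A. faug F (h A)) A = (c A - faug F (a A)) + faug F (fdiff F 1 (g A))"
          by (simp add: eq faug_add faug_fbd)
        moreover have "c A - faug F (a A) \<in> I" using R by (simp add: R_def)
        moreover have "faug F (fdiff F 1 (g A)) \<in> I" using faug_fdiff fch_fmod[OF g, of A] by simp
        ultimately show "c A - kbd V (\<lambda>A. faug F (h A)) A \<in> I"
          by (simp only: hideal_add[OF I])
      qed
    qed
  qed
qed

lemma lookup_kbd_0: "lookup (kbd V c A) 0 = 0"
  unfolding kbd_def koszul.bd_def[OF koszul_V] unfolding lookup_sum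
  by (intro sum.neutral) (simp add: sg_def lookup_pv_mult)

lemma ideal_fmod_irrelevant:
  "f \<in> ideal_fmod V (irrelevant_ideal V) F i \<longleftrightarrow> f \<in> fmod V F i \<and> (\<forall>k. 0 \<notin> keys (lookup f k))"
  by (auto simp: ideal_fmod_def irrelevant_ideal_eq[OF finite_V] fmod_def)

lemma fbd_ideal_fmod:
  assumes "a \<in> fch V F p (Suc q) j"
  shows "fbd V a A \<in> ideal_fmod V (irrelevant_ideal V) F p"
  unfolding ideal_fmod_irrelevant
  using fch_fmod[OF fbd_fch[OF assms], of A] by (simp add: in_keys_iff lookup_fbd lookup_kbd_0)

lemma fch_single: "f \<in> fpart V F p j \<Longrightarrow> (\<lambda>A. if A = {} then f else 0) \<in> fch V F p 0 j"
  by (rule fchI) (auto split: if_splits)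

lemma fch_0_eq:
  assumes "a \<in> fch V F p 0 j" "A \<noteq> {}"
  shows "a A = 0"
proof (rule ccontr)
  assume "a A \<noteq> 0"
  then have "A \<subseteq> pvars V" "card A = 0" using fch_supp[OF assms(1)] by auto
  then show False using finite_subset[OF _ finite_pvars[OF finite_V]] assms(2) by auto
qed

lemma fbd_exact_single:
  assumes f: "f \<in> fpart V F p j" and pos: "\<And>k. 0 \<notin> keys (lookup f k)"
  shows "\<exists>b\<in>fch V F p (Suc 0) j. fbd V b = (\<lambda>A. if A = {} then f else 0)"
  by (rule fbd_exact[OF fch_single[OF f]]) (auto simp: fbd_fch_0[OF fch_single[OF f]] pos)

text \<open>The definition of boundaries allows an inhomogeneous \<open>g\<close>; its component of
  degree \<open>j\<close> does the same.\<close>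

lemma tor_boundaries_fpart:
  assumes "f \<in> tor_boundaries V (irrelevant_ideal V) F k j"
  obtains g where "g \<in> fpart V F (Suc k) j" "f - fdiff F (Suc k) g \<in> fpart V F k j"
    "\<And>l. 0 \<notin> keys (lookup (f - fdiff F (Suc k) g) l)"
proof -
  obtain g where f: "f \<in> fpart V F k j" and g: "g \<in> fmod V F (Suc k)"
    "\<And>l. 0 \<notin> keys (lookup (f - fdiff F (Suc k) g) l)"
    using assms by (auto simp: tor_boundaries_def ideal_fmod_irrelevant)
  have eq0: "fdiff F (Suc k) (fhcomp F (Suc k) j g) = fhcomp F k j (fdiff F (Suc k) g)"
    by (rule fdiff_fhcomp[OF bdiff_fpart g(1)])
  have eq: "f - fdiff F (Suc k) (fhcomp F (Suc k) j g) = fhcomp F k j (f - fdiff F (Suc k) g)"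
    unfolding eq0 using arg_cong[OF fhcomp_fpart[OF f], of "\<lambda>f. lookup f _"]
    by (intro poly_mapping_eqI) (simp add: lookup_fhcomp lookup_minus restr_diff)
  show thesis
  proof (rule that)
    show "fhcomp F (Suc k) j g \<in> fpart V F (Suc k) j" by (rule fpart_fhcomp[OF g(1)])
    then show "f - fdiff F (Suc k) (fhcomp F (Suc k) j g) \<in> fpart V F k j"
      by (intro fpart_diff f fdiff_fpart)
    show "0 \<notin> keys (lookup (f - fdiff F (Suc k) (fhcomp F (Suc k) j g)) l)" for l
      unfolding eq lookup_fhcomp keys_restr using g(2)[of l] by simp
  qed
qed

lemma ksub_tor_cycles: "ksub kscale (tor_cycles V (irrelevant_ideal V) F k j)"
  unfolding ksub_def
proof (intro conjI ballI allI)
  show "0 \<in> tor_cycles V (irrelevant_ideal V) F k j"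
    by (simp add: tor_cycles_def ideal_fmod_irrelevant)
  fix f assume f: "f \<in> tor_cycles V (irrelevant_ideal V) F k j"
  show "kscale c f \<in> tor_cycles V (irrelevant_ideal V) F k j" for c
    using f fmod_vsmult[OF _ polys_const]
    by (auto simp: tor_cycles_def ideal_fmod_irrelevant fpart_kscale fdiff_kscale in_keys_iff)
      (auto simp: kscale_def lookup_vsmult lookup_const_mult)
  fix g assume g: "g \<in> tor_cycles V (irrelevant_ideal V) F k j"
  show "f + g \<in> tor_cycles V (irrelevant_ideal V) F k j"
    using f g by (auto simp: tor_cycles_def ideal_fmod_irrelevant fpart_add fdiff_add in_keys_iff lookup_add intro: fmod_add)
qed

text \<open>The other end of the zigzag: with \<open>q = 0\<close> only the empty set carries a
  coefficient, and Koszul boundaries there are exactly the vectors without constant terms, that is,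
  the irrelevant ideal times F_k.\<close>

lemma fz_tor:
  assumes "has_qdim fscl (fz k 0 j) (fb k 0 j) d"
  shows "has_qdim kscale (tor_cycles V (irrelevant_ideal V) F k j) (tor_boundaries V (irrelevant_ideal V) F k j) d"
proof (rule has_qdim_relation[where R = "\<lambda>a f. a {} = f", OF vector_space_fscl vector_space_kscale ksub_fz ksub_tor_cycles _ _ _ _ _ _ assms])
  fix a assume a: "a \<in> fz k 0 j"
  have "a {} \<in> fpart V F k j" using fch_fpart[OF fz_fch[OF a], of "{}"] by simp
  moreover have "fdiff F k (a {}) \<in> ideal_fmod V (irrelevant_ideal V) F (k - 1)" if "0 < k"
  proof -
    from that obtain i where i: "k = Suc i" by (cases k) auto
    then obtain b where b: "b \<in> fch V F i (Suc 0) j" "\<And>A. fdiff F k (a A) = fbd V b A"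
      using a unfolding fz_def by auto
    then show ?thesis using fbd_ideal_fmod[OF b(1)] i by simp
  qed
  ultimately show "\<exists>f\<in>tor_cycles V (irrelevant_ideal V) F k j. a {} = f" by (simp add: tor_cycles_def)
next
  fix f assume f: "f \<in> tor_cycles V (irrelevant_ideal V) F k j"
  define a where "a = (\<lambda>A :: pvar set. if A = {} then f else 0)"
  have fp: "f \<in> fpart V F k j" using f by (simp add: tor_cycles_def)
  have a: "a \<in> fch V F k 0 j" unfolding a_def by (rule fch_single[OF fp])
  have "a \<in> fz k 0 j"
  proof (cases k)
    case 0
    then show ?thesis using a fbd_fch_0[OF a] hideal_0[OF hideal_I] by (simp add: fz_def)
  next
    case (Suc i)
    have "fdiff F k f \<in> fpart V F i j" using fdiff_fpart fp Suc by simp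
    moreover have "0 \<notin> keys (lookup (fdiff F k f) l)" for l
      using f Suc by (simp add: tor_cycles_def ideal_fmod_irrelevant)
    ultimately obtain b where b: "b \<in> fch V F i (Suc 0) j" "fbd V b = (\<lambda>A. if A = {} then fdiff F k f else 0)"
      using fbd_exact_single by blast
    have "fdiff F k (a A) = fbd V b A" for A by (simp add: a_def b(2))
    then show ?thesis using a b(1) Suc by (auto simp: fz_def)
  qed
  then show "\<exists>a\<in>fz k 0 j. a {} = f" by (intro bexI[of _ a]) (simp_all add: a_def)
next
  fix a f assume a: "a \<in> fz k 0 j" and f: "f \<in> tor_cycles V (irrelevant_ideal V) F k j" and R: "a {} = f"
  show "a \<in> fb k 0 j \<longleftrightarrow> f \<in> tor_boundaries V (irrelevant_ideal V) F k j"
  proof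
    assume "a \<in> fb k 0 j"
    then obtain g h where g: "g \<in> fch V F (Suc k) 0 j" and h: "h \<in> fch V F k (Suc 0) j"
      and eq: "\<And>A. a A = fdiff F (Suc k) (g A) + fbd V h A"
      unfolding fb_def by auto
    have "f - fdiff F (Suc k) (g {}) = fbd V h {}" using eq[of "{}"] R by simp
    then show "f \<in> tor_boundaries V (irrelevant_ideal V) F k j"
      using f fbd_ideal_fmod[OF h, of "{}"] fch_fmod[OF g, of "{}"]
      by (auto simp: tor_boundaries_def tor_cycles_def intro!: bexI[of _ "g {}"])
  next
    assume "f \<in> tor_boundaries V (irrelevant_ideal V) F k j"
    then obtain g where g: "g \<in> fpart V F (Suc k) j" "f - fdiff F (Suc k) g \<in> fpart V F k j"
      "\<And>l. 0 \<notin> keys (lookup (f - fdiff F (Suc k) g) l)" by (rule tor_boundaries_fpart) blast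
    obtain h where h: "h \<in> fch V F k (Suc 0) j" "fbd V h = (\<lambda>A. if A = {} then f - fdiff F (Suc k) g else 0)"
      using fbd_exact_single[OF g(2,3)] by blast
    define G where "G = (\<lambda>A :: pvar set. if A = {} then g else 0)"
    have "a A = fdiff F (Suc k) (G A) + fbd V h A" for A
      using R fch_0_eq[OF fz_fch[OF a], of A] by (simp add: h(2) G_def)
    moreover have "G \<in> fch V F (Suc k) 0 j" unfolding G_def by (rule fch_single[OF g(1)])
    ultimately show "a \<in> fb k 0 j" using fz_fch[OF a] h(1) unfolding fb_def by blast
  qed
qed (auto simp: fscl_def)

lemma finite_basis_le: "finite {k \<in> basis F i. bdeg F i k \<le> j}"
proof -
  have "{k \<in> basis F i. bdeg F i k \<le> j} = (\<Union>e\<in>{..j}. {k \<in> basis F i. bdeg F i k = e})" by auto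
  then show ?thesis using resolution by (simp add: graded_free_resolution_def)
qed

end

section \<open>Finite-dimensional graded pieces, and Betti numbers as Koszul homology\<close>

lemma fpart_finite_span:
  assumes V: "finite V" and fin: "finite {k \<in> basis F i. bdeg F i k \<le> j}"
  shows "\<exists>T. finite T \<and> fpart V F i j \<subseteq> module.span kscale T"
proof -
  interpret vector_space "kscale :: 'a \<Rightarrow> _" by (rule vector_space_kscale)
  let ?K = "{k \<in> basis F i. bdeg F i k \<le> j}" and ?M = "{m. keys m \<subseteq> pvars V \<and> mdeg m \<le> j}"
  let ?T = "(\<lambda>(k, m). single k (single m 1) :: 'a fvec) ` (?K \<times> ?M)"
  have "finite ?T" using fin finite_monomials[OF finite_pvars[OF V]] by simp
  moreover have "fpart V F i j \<subseteq> span ?T"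
  proof
    fix f assume f: "f \<in> fpart V F i j"
    have "f = (\<Sum>k\<in>keys f. \<Sum>m\<in>keys (lookup f k). kscale (lookup (lookup f k) m) (single k (single m 1)))"
    proof (rule poly_mapping_eqI)
      fix l
      have "lookup (\<Sum>m\<in>keys (lookup f k). kscale (lookup (lookup f k) m) (single k (single m 1))) l =
        (if l = k then lookup f k else 0)" for k
        using mpoly_sum_monomials[of "lookup f k"]
        by (simp add: lookup_sum kscale_def lookup_vsmult lookup_single when_def mult_single)
      then show "lookup f l = lookup (\<Sum>k\<in>keys f. \<Sum>m\<in>keys (lookup f k). kscale (lookup (lookup f k) m) (single k (single m 1))) l"
        by (simp add: lookup_sum[of _ "keys f"] in_keys_iff)
    qed
    also have "\<dots> \<in> span ?T"
    proof (intro span_sum span_scale span_base)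
      fix k m assume "k \<in> keys f" "m \<in> keys (lookup f k)"
      moreover from this have "mdeg m + bdeg F i k = j" using f by (simp add: fpart_def)
      then have "mdeg m \<le> j" "bdeg F i k \<le> j" by simp_all
      ultimately have "k \<in> ?K" "m \<in> ?M" using f polysD[of "lookup f k" V m] by (auto simp: fpart_def fmod_def)
      then show "single k (single m 1) \<in> ?T" by force
    qed
    finally show "f \<in> span ?T" .
  qed
  ultimately show ?thesis by blast
qed

text \<open>A basis of \<open>B\<close> together with the representatives is a basis of
  \<open>Z\<close>. The finite spanning set is what allows the dimensions to be subtracted.\<close>

lemma dim_has_qdim:
  assumes "vector_space s" and Z: "ksub s Z" and B: "ksub s B" "B \<subseteq> Z"
    and fin: "finite T" "Z \<subseteq> module.span s T" and q: "has_qdim s Z B d"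
  shows "vector_space.dim s Z - vector_space.dim s B = d"
proof -
  interpret vector_space s by fact
  have sub: "subspace Z" "subspace B" using Z B by (auto simp: ksub_def subspace_def)
  obtain c where c: "\<And>i. i < d \<Longrightarrow> c i \<in> Z"
    and sp: "\<And>z. z \<in> Z \<Longrightarrow> \<exists>a. z - (\<Sum>i<d. s (a i) (c i)) \<in> B"
    and ind: "\<And>a. (\<Sum>i<d. s (a i) (c i)) \<in> B \<Longrightarrow> \<forall>i<d. a i = 0"
    using q unfolding has_qdim_def by blast
  obtain b where b: "b \<subseteq> B" "independent b" "B \<subseteq> span b" "card b = dim B" by (rule basis_exists)
  have spb: "span b = B" using b(1,3) sub(2) span_minimal by blast
  have fb: "finite b" using independent_span_bound[OF fin(1) b(2)] b(1) B(2) fin(2) by blast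
  have z0: "(\<Sum>i<d. s (if i = k then x else 0) (c i)) = s x (c k)" if "k < d" for k x
    using that by (simp add: if_distrib[of "\<lambda>y. s y _"] cong: if_cong)
  have cB: "c k \<notin> B" if "k < d" for k
  proof
    assume "c k \<in> B"
    then have "\<forall>i<d. (if i = k then 1 else 0) = (0 :: 'a)" using z0[OF that, of 1] by (intro ind) simp
    then show False using that by (auto dest: spec[of _ k])
  qed
  have inj: "inj_on c {..<d}"
  proof (rule inj_onI)
    fix k l assume kl: "k \<in> {..<d}" "l \<in> {..<d}" "c k = c l"
    show "k = l"
    proof (rule ccontr)
      assume "k \<noteq> l"
      have "(\<Sum>i<d. s ((if i = k then 1 else 0) + (if i = l then - 1 else 0)) (c i)) = s 1 (c k) + s (- 1) (c l)"
        unfolding scale_left_distrib sum.distrib using kl z0 by simp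
      also have "\<dots> = 0" using kl by simp
      finally have "\<forall>i<d. (if i = k then 1 else 0) + (if i = l then - 1 else 0) = (0 :: 'a)"
        using B(1) by (intro ind) (simp add: ksub_def)
      then show False using \<open>k \<noteq> l\<close> kl by (auto dest: spec[of _ k])
    qed
  qed
  let ?C = "c ` {..<d}"
  have disj: "b \<inter> ?C = {}" using b(1) cB by auto
  have sumC: "(\<Sum>x\<in>?C. s (u x) x) = (\<Sum>i<d. s (u (c i)) (c i))" for u
    using inj by (simp add: sum.reindex)
  have "independent (b \<union> ?C)"
  proof (rule independent_if_scalars_zero)
    show "finite (b \<union> ?C)" using fb by simp
    fix u x assume "(\<Sum>x\<in>b \<union> ?C. s (u x) x) = 0" and x: "x \<in> b \<union> ?C"
    then have eq: "(\<Sum>x\<in>b. s (u x) x) + (\<Sum>i<d. s (u (c i)) (c i)) = 0"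
      using sum.union_disjoint[OF fb _ disj, of "\<lambda>x. s (u x) x"] sumC by simp
    have inB: "(\<Sum>x\<in>b. s (u x) x) \<in> B" using b(1) sub(2) by (intro subspace_sum subspace_scale) auto
    have "(\<Sum>i<d. s (u (c i)) (c i)) = - (\<Sum>x\<in>b. s (u x) x)"
      using eq by (simp add: eq_neg_iff_add_eq_0 add.commute)
    then have "(\<Sum>i<d. s (u (c i)) (c i)) \<in> B" using subspace_neg[OF sub(2) inB] by simp
    then have uc: "\<forall>i<d. u (c i) = 0" by (rule ind)
    then have "(\<Sum>x\<in>b. s (u x) x) = 0" using eq by simp
    then have "\<forall>x\<in>b. u x = 0" using b(2) fb independentD[OF b(2) fb subset_refl] by blast
    then show "u x = 0" using uc x by auto
  qed
  moreover have "b \<union> ?C \<subseteq> Z" using b(1) B(2) c by auto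
  moreover have "Z \<subseteq> span (b \<union> ?C)"
  proof
    fix z assume "z \<in> Z"
    then obtain a where a: "z - (\<Sum>i<d. s (a i) (c i)) \<in> B" using sp by blast
    then have "z - (\<Sum>i<d. s (a i) (c i)) \<in> span (b \<union> ?C)" using b(3) span_mono[of b "b \<union> ?C"] by blast
    moreover have "(\<Sum>i<d. s (a i) (c i)) \<in> span (b \<union> ?C)"
      by (intro span_sum span_scale span_base) auto
    ultimately show "z \<in> span (b \<union> ?C)" using span_add by fastforce
  qed
  ultimately have "dim Z = card (b \<union> ?C)" by (metis dim_unique)
  also have "\<dots> = dim B + d" using b(4) fb disj inj by (simp add: card_Un_disjoint card_image)
  finally show ?thesis by simp
qed

text \<open>Existence turns the \<open>SOME\<close> in \<open>tor_dim\<close> into a genuine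
  resolution, to which the zigzag applies whichever one was chosen.\<close>

lemma (in kring) betti_eqI:
  assumes I: "hideal V I" and ex: "\<exists>F. graded_free_resolution V I F" and t: "tor V I k j d"
  shows "betti V I k j = d"
proof -
  define F where "F = (SOME F. graded_free_resolution V I F)"
  have F: "graded_free_resolution V I F" unfolding F_def using ex by (rule someI_ex)
  interpret graded_resolution V I F by unfold_locales fact+
  let ?Z = "tor_cycles V (irrelevant_ideal V) F k j" and ?B = "tor_boundaries V (irrelevant_ideal V) F k j"
  have q: "has_qdim kscale ?Z ?B d" by (intro fz_tor fz_steps tor_fz t)
  obtain T where T: "finite T" "fpart V F k j \<subseteq> module.span kscale T"
    using fpart_finite_span[OF finite_V finite_basis_le] by blast
  have BZ: "?B \<subseteq> ?Z"
  proof
    fix f assume f: "f \<in> ?B"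
    then obtain g where g: "g \<in> fpart V F (Suc k) j" "f - fdiff F (Suc k) g \<in> fpart V F k j"
      "\<And>l. 0 \<notin> keys (lookup (f - fdiff F (Suc k) g) l)" by (rule tor_boundaries_fpart) blast
    have "fdiff F k f \<in> ideal_fmod V (irrelevant_ideal V) F (k - 1)" if "0 < k"
    proof -
      from that obtain i where i: "k = Suc i" by (cases k) auto
      have fm: "f - fdiff F (Suc k) g \<in> fmod V F (Suc i)" using fpart_fmod[OF g(2)] i by simp
      have "fdiff F k f = fdiff F (Suc i) (f - fdiff F (Suc k) g)"
        using fdiff_fdiff[of g i] fpart_fmod[OF g(1)] i by (simp add: fdiff_diff)
      moreover have "lookup (fdiff F (Suc i) (f - fdiff F (Suc k) g)) l \<in> irrelevant_ideal V" for l
      proof -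
        let ?h = "f - fdiff F (Suc k) g"
        have "lookup (fdiff F (Suc i) ?h) l \<in> polys V" using fdiff_fmod[OF fm] by (simp add: fmod_def)
        moreover have "0 \<notin> keys (lookup (fdiff F (Suc i) ?h) l)"
        proof
          assume "0 \<in> keys (lookup (fdiff F (Suc i) ?h) l)"
          then have "0 \<in> keys (\<Sum>n\<in>keys ?h. lookup ?h n * lookup (bdiff F (Suc i) n) l)"
            by (simp add: fdiff_def lookup_sum lookup_vsmult)
          then obtain n where "0 \<in> keys (lookup ?h n * lookup (bdiff F (Suc i) n) l)"
            by (auto dest: subsetD[OF Poly_Mapping.keys_sum])
          then obtain m m' where "(0::mon) = m + m'" "m \<in> keys (lookup ?h n)"
            by (auto dest: subsetD[OF keys_mult])
          moreover from this have "m = 0" using mdeg_add[of m m'] mdeg_eq_0_iff[of m] by (metis add_is_0 mdeg_0)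
          ultimately show False using g(3) by blast
        qed
        ultimately show ?thesis by (simp add: irrelevant_ideal_eq[OF finite_V])
      qed
      ultimately show ?thesis using fdiff_fmod[OF fm] i by (simp add: ideal_fmod_def)
    qed
    then show "f \<in> ?Z" using f by (simp add: tor_cycles_def tor_boundaries_def)
  qed
  have "ksub kscale ?B"
    unfolding ksub_def
  proof (intro conjI ballI allI)
    show "0 \<in> ?B" by (auto simp: tor_boundaries_def ideal_fmod_irrelevant intro!: bexI[of _ 0])
    fix f assume "f \<in> ?B"
    then obtain g where f: "f \<in> fpart V F k j" and g: "g \<in> fmod V F (Suc k)" "f - fdiff F (Suc k) g \<in> ideal_fmod V (irrelevant_ideal V) F k"
      by (auto simp: tor_boundaries_def)
    show "kscale c f \<in> ?B" for c
    proof -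
      have "kscale c f - fdiff F (Suc k) (kscale c g) = kscale c (f - fdiff F (Suc k) g)"
        by (rule poly_mapping_eqI) (simp add: fdiff_vsmult kscale_def lookup_minus lookup_vsmult right_diff_distrib)
      moreover have "kscale c (f - fdiff F (Suc k) g) \<in> ideal_fmod V (irrelevant_ideal V) F k"
        using g(2) fmod_vsmult[OF _ polys_const]
        by (auto simp: ideal_fmod_irrelevant kscale_def in_keys_iff lookup_vsmult lookup_const_mult)
      moreover have "kscale c g \<in> fmod V F (Suc k)" unfolding kscale_def by (rule fmod_vsmult[OF g(1) polys_const])
      ultimately show ?thesis using f by (auto simp: tor_boundaries_def fpart_kscale intro!: bexI[of _ "kscale c g"])
    qed
    fix f' assume "f' \<in> ?B"
    then obtain g' where f': "f' \<in> fpart V F k j" and g': "g' \<in> fmod V F (Suc k)" "f' - fdiff F (Suc k) g' \<in> ideal_fmod V (irrelevant_ideal V) F k"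
      by (auto simp: tor_boundaries_def)
    have "f + f' - fdiff F (Suc k) (g + g') = (f - fdiff F (Suc k) g) + (f' - fdiff F (Suc k) g')"
      by (simp add: fdiff_add)
    moreover have "(f - fdiff F (Suc k) g) + (f' - fdiff F (Suc k) g') \<in> ideal_fmod V (irrelevant_ideal V) F k"
      using g(2) g'(2) by (auto simp: ideal_fmod_irrelevant in_keys_iff lookup_add intro: fmod_add)
    ultimately have "f + f' - fdiff F (Suc k) (g + g') \<in> ideal_fmod V (irrelevant_ideal V) F k" by (simp only:)
    then show "f + f' \<in> ?B"
      using f f' fmod_add[OF g(1) g'(1)] by (auto simp: tor_boundaries_def fpart_add intro!: bexI[of _ "g + g'"])
  qed
  moreover have "?Z \<subseteq> module.span kscale T" using T(2) by (auto simp: tor_cycles_def)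
  ultimately have "vector_space.dim kscale ?Z - vector_space.dim kscale ?B = d"
    by (intro dim_has_qdim[OF vector_space_kscale ksub_tor_cycles _ BZ T(1) _ q])
  then show ?thesis by (simp add: betti_def tor_dim_def F_def Let_def)
qed

section \<open>Existence of graded free resolutions\<close>

lemma sum_fhcomp:
  "\<exists>D. finite D \<and> f = (\<Sum>j\<in>D. fhcomp F i j f)"
proof (intro exI conjI)
  let ?D = "\<Union>k\<in>keys f. (\<lambda>m. mdeg m + bdeg F i k) ` keys (lookup f k)"
  show fin: "finite ?D" by auto
  show "f = (\<Sum>j\<in>?D. fhcomp F i j f)"
  proof (rule poly_mapping_eqI, rule poly_mapping_eqI)
    fix k m
    have "lookup (lookup (\<Sum>j\<in>?D. fhcomp F i j f) k) m = (\<Sum>j\<in>?D. if mdeg m + bdeg F i k = j then lookup (lookup f k) m else 0)"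
      by (simp add: lookup_sum lookup_fhcomp lookup_restr)
    also have "\<dots> = (if mdeg m + bdeg F i k \<in> ?D then lookup (lookup f k) m else 0)"
      by (rule sum.delta'[OF fin])
    also have "\<dots> = lookup (lookup f k) m"
    proof (cases "lookup (lookup f k) m = 0")
      case False
      then have "m \<in> keys (lookup f k)" "k \<in> keys f" by (auto simp: in_keys_iff)
      then show ?thesis by auto
    qed simp
    finally show "lookup (lookup f k) m = lookup (lookup (\<Sum>j\<in>?D. fhcomp F i j f) k) m" ..
  qed
qed

text \<open>Vector space bases of all graded pieces of \<open>N\<close> generate it, so no
  noetherian argument enters. The cover is far from minimal, but has finitely many basis elements in
  each degree, as the notion of resolution demands. Only the places 0 and 1 of the record
  \<open>y\<close> matter: the given module and its cover.\<close>

lemma graded_cover: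
  fixes G :: "'k::field free_cplx"
  assumes V: "finite V" and fin: "\<And>j. finite {k \<in> basis G i. bdeg G i k = j}"
    and N: "N \<subseteq> fmod V G i" "0 \<in> N" and N_add: "\<And>f g. f \<in> N \<Longrightarrow> g \<in> N \<Longrightarrow> f + g \<in> N"
    and N_mult: "\<And>p f. p \<in> polys V \<Longrightarrow> f \<in> N \<Longrightarrow> vsmult p f \<in> N"
    and N_comp: "\<And>j f. f \<in> N \<Longrightarrow> fhcomp G i j f \<in> N"
  shows "\<exists>y :: 'k free_cplx. basis y 0 = basis G i \<and> bdeg y 0 = bdeg G i \<and>
    (\<forall>j. finite {k \<in> basis y 1. bdeg y 1 k = j}) \<and>
    (\<forall>k\<in>basis y 1. bdiff y 1 k \<in> fpart V y 0 (bdeg y 1 k)) \<and>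
    fdiff y 1 ` fmod V y 1 = N"
proof -
  interpret vs: vector_space "kscale :: 'k \<Rightarrow> _" by (rule vector_space_kscale)
  have "\<exists>b. finite b \<and> b \<subseteq> N \<inter> fpart V G i j \<and> N \<inter> fpart V G i j \<subseteq> vs.span b" for j
  proof -
    have "{k \<in> basis G i. bdeg G i k \<le> j} = (\<Union>e\<in>{..j}. {k \<in> basis G i. bdeg G i k = e})" by auto
    then have "finite {k \<in> basis G i. bdeg G i k \<le> j}" using fin by simp
    then obtain T where T: "finite T" "fpart V G i j \<subseteq> vs.span T" using fpart_finite_span[OF V] by blast
    obtain b where b: "b \<subseteq> N \<inter> fpart V G i j" "vs.independent b" "N \<inter> fpart V G i j \<subseteq> vs.span b"
      by (rule vs.basis_exists) blast
    have "b \<subseteq> vs.span T" using b(1) T(2) by auto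
    then have "finite b" using vs.independent_span_bound[OF T(1) b(2)] by simp
    then show ?thesis using b(1,3) by auto
  qed
  then have "\<forall>j. \<exists>b. finite b \<and> b \<subseteq> N \<inter> fpart V G i j \<and> N \<inter> fpart V G i j \<subseteq> vs.span b" ..
  from choice[OF this] obtain b where b: "\<And>j. finite (b j)" "\<And>j. b j \<subseteq> N \<inter> fpart V G i j"
    "\<And>j. N \<inter> fpart V G i j \<subseteq> vs.span (b j)" by blast
  define e where "e j = (SOME h. bij_betw h {..<card (b j)} (b j))" for j
  have e: "bij_betw (e j) {..<card (b j)} (b j)" for j
    unfolding e_def using ex_bij_betw_nat_finite[OF b(1)[of j]]
    by (intro someI_ex[of "\<lambda>h. bij_betw h {..<card (b j)} (b j)"]) (simp add: lessThan_atLeast0)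
  \<comment> \<open>A natural number codes a degree together with an index into the basis of that
    degree.\<close>
  define B where "B = {n. snd (prod_decode n) < card (b (fst (prod_decode n)))}"
  define D where "D n = fst (prod_decode n)" for n
  define \<delta> where "\<delta> n = e (fst (prod_decode n)) (snd (prod_decode n))" for n
  define y where "y = \<lparr>basis = (\<lambda>l. if l = 0 then basis G i else B), bdeg = (\<lambda>l. if l = 0 then bdeg G i else D),
    bdiff = (\<lambda>_. \<delta>), aug = (\<lambda>_. 1 :: 'k mpoly)\<rparr>"
  have fm0: "fmod V y 0 = fmod V G i" by (simp add: y_def fmod_def)
  have fp0: "fpart V y 0 j = fpart V G i j" for j by (simp add: y_def fmod_def fpart_def)
  have \<delta>: "\<delta> n \<in> b (D n)" if "n \<in> B" for n
    using bij_betwE[OF e[of "D n"]] that by (auto simp: \<delta>_def D_def B_def)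
  have 1: "finite {k \<in> basis y 1. bdeg y 1 k = j}" for j
  proof (rule finite_subset)
    show "{k \<in> basis y 1. bdeg y 1 k = j} \<subseteq> (\<lambda>l. prod_encode (j, l)) ` {..<card (b j)}"
    proof
      fix n assume "n \<in> {k \<in> basis y 1. bdeg y 1 k = j}"
      then have "snd (prod_decode n) < card (b j)" "fst (prod_decode n) = j" by (auto simp: y_def B_def D_def)
      moreover from this have "n = prod_encode (j, snd (prod_decode n))" by (metis prod_decode_inverse prod.collapse)
      ultimately show "n \<in> (\<lambda>l. prod_encode (j, l)) ` {..<card (b j)}" by blast
    qed
  qed simp
  have 2: "bdiff y 1 k \<in> fpart V y 0 (bdeg y 1 k)" if "k \<in> basis y 1" for k
    using that \<delta>[of k] b(2)[of "D k"] unfolding fp0 by (auto simp: y_def)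
  have N_sum: "sum h A \<in> N" if "\<And>x. x \<in> A \<Longrightarrow> h x \<in> N" for h :: "nat \<Rightarrow> _" and A
    using that by (induction A rule: infinite_finite_induct) (auto intro: N N_add)
  have "fdiff y 1 f \<in> N" if f: "f \<in> fmod V y 1" for f
    unfolding fdiff_def
  proof (rule N_sum, rule N_mult)
    fix k assume "k \<in> keys f"
    then have "k \<in> B" using f by (auto simp: y_def fmod_def)
    then show "bdiff y 1 k \<in> N" using \<delta>[of k] b(2)[of "D k"] by (auto simp: y_def)
    show "lookup f k \<in> polys V" using f by (simp add: fmod_def)
  qed
  moreover have "f \<in> fdiff y 1 ` fmod V y 1" if f: "f \<in> N" for f
  proof -
    let ?Im = "fdiff y 1 ` fmod V y 1"
    have im_add: "u + v \<in> ?Im" if "u \<in> ?Im" "v \<in> ?Im" for u v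
      using that by (auto simp: fdiff_add[symmetric] intro!: imageI fmod_add)
    have im_0: "0 \<in> ?Im" by (rule image_eqI[of _ _ 0]) auto
    have im_sum: "sum h A \<in> ?Im" if "\<And>x. x \<in> A \<Longrightarrow> h x \<in> ?Im" for h :: "nat \<Rightarrow> _" and A
      using that
    proof (induction A rule: infinite_finite_induct)
      case (insert x F)
      then show ?case using im_add[of "h x" "sum h F"] by simp
    qed (use im_0 in auto)
    have im_scale: "kscale c u \<in> ?Im" if "u \<in> ?Im" for c u
      using that by (auto simp: kscale_def fdiff_vsmult[symmetric] intro!: imageI fmod_vsmult)
    have im_b: "u \<in> ?Im" if u: "u \<in> b j" for u j
    proof -
      have "u \<in> e j ` {..<card (b j)}" using bij_betw_imp_surj_on[OF e[of j]] u by simp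
      then obtain l where l: "l < card (b j)" "e j l = u" by auto
      define n where "n = prod_encode (j, l)"
      have n: "n \<in> B" "\<delta> n = u" using l by (auto simp: n_def B_def \<delta>_def)
      have "fdiff y 1 (single n 1) = vsmult 1 u" using n by (simp add: fdiff_def y_def)
      also have "\<dots> = u" by (rule poly_mapping_eqI) (simp add: lookup_vsmult)
      finally have "u = fdiff y 1 (single n 1)" by simp
      moreover have "single n 1 \<in> fmod V y 1" using n by (auto simp: fmod_def y_def lookup_single when_def)
      ultimately show ?thesis by blast
    qed
    have sub: "vs.subspace ?Im" unfolding vs.subspace_def using im_0 im_add im_scale by blast
    obtain J where J: "finite J" "f = (\<Sum>j\<in>J. fhcomp G i j f)" using sum_fhcomp by blast
    have "fhcomp G i j f \<in> ?Im" for j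
    proof -
      have "fhcomp G i j f \<in> N \<inter> fpart V G i j" using N_comp[OF f] fpart_fhcomp N(1) f by blast
      then have "fhcomp G i j f \<in> vs.span (b j)" using b(3) by blast
      moreover have "vs.span (b j) \<subseteq> ?Im" by (rule vs.span_minimal[OF _ sub]) (use im_b in blast)
      ultimately show ?thesis by blast
    qed
    then have "(\<Sum>j\<in>J. fhcomp G i j f) \<in> ?Im" by (intro im_sum)
    then show ?thesis using J(2) by simp
  qed
  ultimately have 3: "fdiff y 1 ` fmod V y 1 = N" by blast
  show ?thesis using 1 2 3 by (intro exI[of _ y]) (auto simp: y_def)
qed

text \<open>Each record in the sequence is one link: its module at place 1 covers the kernel left by
  its predecessor and becomes the module at place 0 of its successor. Dependent choice yields the
  sequence, and \<open>F\<close> glues the links.\<close>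

lemma (in kring) graded_free_resolution_exists:
  fixes I :: "'k::field mpoly set"
  assumes I: "hideal V I"
  shows "\<exists>F. graded_free_resolution V I F"
proof -
  define P where "P x \<longleftrightarrow> (\<forall>j. finite {k \<in> basis x 1. bdeg x 1 k = j}) \<and>
    (\<forall>k\<in>basis x 1. bdiff x 1 k \<in> fpart V x 0 (bdeg x 1 k))" for x :: "'k free_cplx"
  define Q where "Q x y \<longleftrightarrow> basis y 0 = basis x 1 \<and> bdeg y 0 = bdeg x 1 \<and>
    fdiff y 1 ` fmod V y 1 = {f \<in> fmod V x 1. fdiff x 1 f = 0}" for x y :: "'k free_cplx"
  \<comment> \<open>S as a free module of rank one, augmented by the identity; the first link covers
    the copy of I inside it.\<close>
  define G where "G = \<lparr>basis = (\<lambda>_. {0}), bdeg = (\<lambda>_ _. 0), bdiff = (\<lambda>_ _. 0), aug = (\<lambda>_. 1 :: 'k mpoly)\<rparr>"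
  have augG: "faug G f = lookup f 0" if "keys f \<subseteq> {0}" for f
    using faug_superset[OF _ that, of G] by (simp add: G_def)
  have G0: "f \<in> fmod V G 0 \<longleftrightarrow> keys f \<subseteq> {0} \<and> (\<forall>k. lookup f k \<in> polys V)" for f :: "'k fvec"
    by (simp add: fmod_def G_def)
  have keys_0: "keys (f :: 'k fvec) \<subseteq> {0}" if "f \<in> fmod V G 0" for f using that G0 by blast
  have "\<exists>y :: 'k free_cplx. basis y 0 = basis G 0 \<and> bdeg y 0 = bdeg G 0 \<and>
    (\<forall>j. finite {k \<in> basis y 1. bdeg y 1 k = j}) \<and>
    (\<forall>k\<in>basis y 1. bdiff y 1 k \<in> fpart V y 0 (bdeg y 1 k)) \<and>
    fdiff y 1 ` fmod V y 1 = {f \<in> fmod V G 0. faug G f \<in> I}"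
  proof (rule graded_cover[OF finite_V])
    show "finite {k \<in> basis G 0. bdeg G 0 k = j}" for j by (simp add: G_def)
    show "0 \<in> {f \<in> fmod V G 0. faug G f \<in> I}" using hideal_0[OF I] by simp
    show "f + g \<in> {f \<in> fmod V G 0. faug G f \<in> I}" if "f \<in> {f \<in> fmod V G 0. faug G f \<in> I}" "g \<in> {f \<in> fmod V G 0. faug G f \<in> I}" for f g
      using that hideal_add[OF I] by (simp add: fmod_add faug_add)
    show "vsmult p f \<in> {f \<in> fmod V G 0. faug G f \<in> I}" if "p \<in> polys V" "f \<in> {f \<in> fmod V G 0. faug G f \<in> I}" for p f
      using that hideal_mult[OF I] by (simp add: fmod_vsmult faug_vsmult)
    show "fhcomp G 0 j f \<in> {f \<in> fmod V G 0. faug G f \<in> I}" if f: "f \<in> {f \<in> fmod V G 0. faug G f \<in> I}" for j f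
    proof -
      have "faug G (fhcomp G 0 j f) = hcomp j (faug G f)"
        using f by (intro faug_fhcomp[of _ _ V]) (auto simp: G_def)
      then show ?thesis using f hideal_hcomp[OF I] fpart_fmod[OF fpart_fhcomp[of f V G 0 j]] by simp
    qed
  qed auto
  then obtain y0 :: "'k free_cplx" where y0: "basis y0 0 = {0}" "bdeg y0 0 = (\<lambda>_. 0)" "P y0"
    "fdiff y0 1 ` fmod V y0 1 = {f \<in> fmod V G 0. faug G f \<in> I}"
    by (auto simp: P_def G_def)
  have "\<exists>y. P y \<and> Q x y" if x: "P x" for x
  proof -
    have gr: "\<And>k. k \<in> basis x (Suc 0) \<Longrightarrow> bdiff x (Suc 0) k \<in> fpart V x 0 (bdeg x (Suc 0) k)"
      using x by (simp add: P_def)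
    have "\<exists>y :: 'k free_cplx. basis y 0 = basis x 1 \<and> bdeg y 0 = bdeg x 1 \<and>
      (\<forall>j. finite {k \<in> basis y 1. bdeg y 1 k = j}) \<and>
      (\<forall>k\<in>basis y 1. bdiff y 1 k \<in> fpart V y 0 (bdeg y 1 k)) \<and>
      fdiff y 1 ` fmod V y 1 = {f \<in> fmod V x 1. fdiff x 1 f = 0}"
    proof (rule graded_cover[OF finite_V])
      show "finite {k \<in> basis x 1. bdeg x 1 k = j}" for j using x by (simp add: P_def)
      show "f + g \<in> {f \<in> fmod V x 1. fdiff x 1 f = 0}" if "f \<in> {f \<in> fmod V x 1. fdiff x 1 f = 0}" "g \<in> {f \<in> fmod V x 1. fdiff x 1 f = 0}" for f g
        using that by (simp add: fmod_add fdiff_add)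
      show "vsmult p f \<in> {f \<in> fmod V x 1. fdiff x 1 f = 0}" if "p \<in> polys V" "f \<in> {f \<in> fmod V x 1. fdiff x 1 f = 0}" for p f
        using that by (simp add: fmod_vsmult fdiff_vsmult)
      show "fhcomp x 1 j f \<in> {f \<in> fmod V x 1. fdiff x 1 f = 0}" if f: "f \<in> {f \<in> fmod V x 1. fdiff x 1 f = 0}" for j f
      proof -
        have "fdiff x 1 (fhcomp x 1 j f) = fhcomp x 0 j (fdiff x 1 f)"
          using fdiff_fhcomp[OF gr, where f = f and j = j] f by simp
        also have "\<dots> = 0" using f by (intro poly_mapping_eqI) (simp add: lookup_fhcomp)
        finally show ?thesis using f fpart_fmod[OF fpart_fhcomp[of f V x 1 j]] by simp
      qed
    qed auto
    then show ?thesis by (auto simp: P_def Q_def)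
  qed
  then have "\<exists>f. \<forall>n. (P (f n) \<and> (n = 0 \<longrightarrow> f n = y0)) \<and> Q (f n) (f (Suc n))"
    using y0(3) by (intro dependent_nat_choice) auto
  then obtain f where f: "\<And>n. P (f n)" "f 0 = y0" "\<And>n. Q (f n) (f (Suc n))" by blast
  define F where "F = \<lparr>basis = (\<lambda>i. case i of 0 \<Rightarrow> {0} | Suc n \<Rightarrow> basis (f n) 1),
    bdeg = (\<lambda>i. case i of 0 \<Rightarrow> (\<lambda>_. 0) | Suc n \<Rightarrow> bdeg (f n) 1),
    bdiff = (\<lambda>i. case i of 0 \<Rightarrow> (\<lambda>_. 0) | Suc n \<Rightarrow> bdiff (f n) 1), aug = (\<lambda>_. 1 :: 'k mpoly)\<rparr>"
  have b0: "basis (f n) 0 = basis F n" "bdeg (f n) 0 = bdeg F n" for n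
    using y0(1,2) f(2) f(3)[of "n - 1"] by (cases n; simp add: F_def Q_def)+
  have b1: "basis F (Suc n) = basis (f n) 1" "bdeg F (Suc n) = bdeg (f n) 1" "bdiff F (Suc n) = bdiff (f n) 1" for n
    by (auto simp: F_def)
  have m1: "fmod V F (Suc n) = fmod V (f n) 1" for n by (simp add: fmod_def b1)
  have p0: "fpart V F n j = fpart V (f n) 0 j" for n j by (simp add: fpart_def fmod_def b0)
  have d1: "fdiff F (Suc n) = fdiff (f n) 1" for n by (simp add: fun_eq_iff fdiff_def b1)
  have m0: "fmod V F 0 = fmod V G 0" by (simp add: fmod_def F_def G_def)
  have aug: "faug F = faug G" by (simp add: fun_eq_iff faug_def F_def G_def)
  have "graded_free_resolution V I F"
    unfolding graded_free_resolution_def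
  proof (intro conjI allI ballI)
    show "finite {k \<in> basis F i. bdeg F i k = j}" for i j
    proof (cases i)
      case 0
      then show ?thesis by (simp add: F_def)
    next
      case (Suc n)
      then show ?thesis using f(1)[of n] by (simp add: b1 P_def)
    qed
    show "bdiff F (Suc i) k \<in> fpart V F i (bdeg F (Suc i) k)" if "k \<in> basis F (Suc i)" for i k
      using f(1)[of i] that by (simp add: b1 p0 P_def)
    show "aug F k \<in> polys V" for k by (simp add: F_def)
    show "mdeg m = bdeg F 0 k" if "m \<in> keys (aug F k)" for k m using that by (simp add: F_def)
    show "\<exists>g\<in>fmod V F 0. p - faug F g \<in> I" if "p \<in> polys V" for p
    proof (rule bexI[of _ "single 0 p"])
      show "single 0 p \<in> fmod V F 0" unfolding m0 G0 using that by (auto simp: lookup_single when_def)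
      show "p - faug F (single 0 p) \<in> I" unfolding aug
        using augG[of "single 0 p"] hideal_0[OF I] by simp
    qed
    show "{g \<in> fmod V F 0. faug F g \<in> I} = fdiff F 1 ` fmod V F 1"
      using y0(4) f(2) d1[of 0] m1[of 0] by (simp add: m0 aug)
    show "{g \<in> fmod V F (Suc i). fdiff F (Suc i) g = 0} = fdiff F (Suc (Suc i)) ` fmod V F (Suc (Suc i))" for i
      using f(3)[of i] by (simp add: m1 d1 Q_def)
  qed
  then show ?thesis by blast
qed

section \<open>Edge ideals of disjoint unions of complete graphs\<close>

definition ugraph :: "nat set \<Rightarrow> (nat \<Rightarrow> nat \<Rightarrow> bool) \<Rightarrow> bool" where
  "ugraph W E \<longleftrightarrow> finite W \<and> (\<forall>u v. E u v \<longrightarrow> E v u \<and> u \<noteq> v \<and> u \<in> W \<and> v \<in> W)"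

lemma ugraph_sym: "ugraph W E \<Longrightarrow> E u v \<Longrightarrow> E v u"
  and ugraph_irrefl: "ugraph W E \<Longrightarrow> \<not> E u u"
  and ugraph_verts: "ugraph W E \<Longrightarrow> E u v \<Longrightarrow> u \<in> W \<and> v \<in> W"
  and ugraph_finite: "ugraph W E \<Longrightarrow> finite W"
  by (auto simp: ugraph_def)

definition cluster :: "(nat \<Rightarrow> nat \<Rightarrow> bool) \<Rightarrow> bool" where
  "cluster E \<longleftrightarrow> (\<forall>u v w. E u v \<longrightarrow> E v w \<longrightarrow> u \<noteq> w \<longrightarrow> E u w)"

definition del :: "(nat \<Rightarrow> nat \<Rightarrow> bool) \<Rightarrow> nat \<Rightarrow> nat \<Rightarrow> nat \<Rightarrow> bool" where
  "del E i a b \<longleftrightarrow> E a b \<and> a \<noteq> i \<and> b \<noteq> i"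

text \<open>The parameter \<open>c\<close> makes it possible to treat the binomial edge ideal (\<open>c = 1\<close>) and its
  initial ideal (\<open>c = 0\<close>) simultaneously.\<close>

definition bgen :: "'k::field \<Rightarrow> nat \<Rightarrow> nat \<Rightarrow> 'k mpoly" where
  "bgen c i j = single (mvar (X i) + mvar (Y j)) 1 - single (mvar (X j) + mvar (Y i)) c"

definition gens :: "'k::field \<Rightarrow> (nat \<Rightarrow> nat \<Rightarrow> bool) \<Rightarrow> pvar set \<Rightarrow> 'k mpoly set" where
  "gens c E D = {bgen c i j | i j. E i j \<and> i < j} \<union> pv ` D"

text \<open>\<open>D\<close> lists the adjoined variables: those of vertices missing from the graph,
  and those divided out in the induction over cliques.\<close>

definition Q :: "nat set \<Rightarrow> 'k::field \<Rightarrow> (nat \<Rightarrow> nat \<Rightarrow> bool) \<Rightarrow> pvar set \<Rightarrow> 'k mpoly set" where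
  "Q V c E D = idl V (gens c E D)"

lemma X_in_pvars [simp]: "X i \<in> pvars V \<longleftrightarrow> i \<in> V" and Y_in_pvars [simp]: "Y i \<in> pvars V \<longleftrightarrow> i \<in> V"
  by (auto simp: pvars_def)

lemma bgen_eq: "bgen c i j = pv (X i) * pv (Y j) - single 0 c * (pv (X j) * pv (Y i))"
  by (simp add: bgen_def pv_def mult_single)

lemma polys_bgen: "i \<in> V \<Longrightarrow> j \<in> V \<Longrightarrow> bgen c i j \<in> polys V"
  unfolding bgen_def by (intro polys_diff polys_single) (auto simp: keys_add_nat)

lemma keys_bgen: "m \<in> keys (bgen c i j) \<Longrightarrow> m = mvar (X i) + mvar (Y j) \<or> m = mvar (X j) + mvar (Y i)"
  by (auto simp: bgen_def in_keys_iff lookup_minus lookup_single when_def split: if_splits)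

lemma gens_polys: "ugraph W E \<Longrightarrow> W \<subseteq> V \<Longrightarrow> D \<subseteq> pvars V \<Longrightarrow> gens c E D \<subseteq> polys V"
  by (auto simp: gens_def intro!: polys_bgen polys_pv dest: ugraph_verts)

lemma hideal_Q:
  assumes "ugraph W E" "W \<subseteq> V" "D \<subseteq> pvars V"
  shows "hideal V (Q V c E D)"
  unfolding Q_def
proof (rule hideal_idl[OF gens_polys[OF assms]])
  fix s assume "s \<in> gens c E D"
  then consider i j where "s = bgen c i j" | v where "s = pv v" by (auto simp: gens_def)
  then show "\<exists>d. \<forall>m\<in>keys s. mdeg m = d"
  proof cases
    case 1
    then show ?thesis using keys_bgen by (intro exI[of _ 2]) (fastforce simp: mdeg_add)
  next
    case 2
    then show ?thesis by (simp add: pv_def)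
  qed
qed

lemma idl_least:
  assumes J: "hideal V J" "S \<subseteq> J" and p: "p \<in> idl V S"
  shows "p \<in> J"
  using p
proof (induction rule: idl.induct)
  case (idl_step m s p c)
  then show ?case
    using J(2) by (intro hideal_add[OF J(1)] hideal_mult[OF J(1)] polys_single) auto
qed (rule hideal_0[OF J(1)])

lemma Q_edge: "E i j \<Longrightarrow> i < j \<Longrightarrow> bgen c i j \<in> Q V c E D"
  unfolding Q_def by (rule idl_gen) (auto simp: gens_def)

lemma Q_var: "d \<in> D \<Longrightarrow> pv d \<in> Q V c E D"
  unfolding Q_def by (rule idl_gen) (auto simp: gens_def)

lemma Q_least:
  assumes "hideal V J" "\<And>i j. E i j \<Longrightarrow> i < j \<Longrightarrow> bgen c i j \<in> J" "\<And>d. d \<in> D \<Longrightarrow> pv d \<in> J"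
  shows "Q V c E D \<subseteq> J"
proof
  fix p assume "p \<in> Q V c E D"
  then show "p \<in> J" unfolding Q_def
    using assms(2,3) by (intro idl_least[OF assms(1), of "gens c E D"]) (auto simp: gens_def)
qed

lemma Q_mono:
  assumes "\<And>i j. E i j \<Longrightarrow> E' i j" "D \<subseteq> D'"
  shows "Q V c E D \<subseteq> Q V c E' D'"
proof
  fix p assume p: "p \<in> Q V c E D"
  have "gens c E D \<subseteq> gens c E' D'" using assms by (auto simp: gens_def)
  then show "p \<in> Q V c E' D'" using p unfolding Q_def by (rule idl_mono)
qed

lemma add_var_Q:
  assumes g: "ugraph W E" "W \<subseteq> V" "D \<subseteq> pvars V" and y: "y \<in> pvars V"
  shows "add_var V (Q V c E D) y = Q V c E (insert y D)"
proof
  have h: "hideal V (Q V c E D)" "hideal V (Q V c E (insert y D))"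
    using g y by (auto intro!: hideal_Q)
  show "add_var V (Q V c E D) y \<subseteq> Q V c E (insert y D)"
  proof
    fix p assume "p \<in> add_var V (Q V c E D) y"
    then obtain a q where p: "p = a + pv y * q" "a \<in> Q V c E D" "q \<in> polys V" by (auto simp: add_var_def)
    have "q * pv y \<in> Q V c E (insert y D)" using p(3) by (intro hideal_mult[OF h(2)] Q_var) auto
    moreover have "a \<in> Q V c E (insert y D)" using p(2) Q_mono[of E E D "insert y D" V c] by auto
    ultimately show "p \<in> Q V c E (insert y D)" using p(1) hideal_add[OF h(2)] by (simp add: mult.commute)
  qed
  show "Q V c E (insert y D) \<subseteq> add_var V (Q V c E D) y"
  proof (rule Q_least[OF hideal_add_var[OF h(1) y]])
    have l: "a \<in> add_var V (Q V c E D) y" if "a \<in> Q V c E D" for a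
      using that by (force simp: add_var_def)
    show "bgen c i j \<in> add_var V (Q V c E D) y" if "E i j" "i < j" for i j using that by (intro l Q_edge)
    have "pv y = 0 + pv y * (1 :: 'a mpoly)" by simp
    then have "pv y \<in> add_var V (Q V c E D) y" using hideal_0[OF h(1)] polys_1 unfolding add_var_def by blast
    then show "pv d \<in> add_var V (Q V c E D) y" if "d \<in> insert y D" for d
      using that by (auto intro: l Q_var)
  qed
qed

lemma divvar_free:
  assumes "\<And>k. k \<in> keys s \<Longrightarrow> y \<notin> keys k"
  shows "divvar y (single m a * s) = (if y \<in> keys m then single (m - mvar y) a * s else 0)"
proof (cases "y \<in> keys m")
  case True
  have "single m a * s = pv y * (single (m - mvar y) a * s)"
    using mvar_add_minus[OF True] by (simp add: pv_def mult.assoc[symmetric] mult_single)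
  then show ?thesis using True by (simp only: divvar_pv_mult if_True)
next
  case False
  have "lookup (divvar y (single m a * s)) k = 0" for k
  proof (rule ccontr)
    assume "lookup (divvar y (single m a * s)) k \<noteq> 0"
    then have "mvar y + k \<in> keys (single m a * s)" by (simp add: lookup_divvar in_keys_iff)
    then obtain k' where k': "mvar y + k = m + k'" "k' \<in> keys s"
      by (auto dest!: subsetD[OF keys_mult] split: if_splits)
    have "y \<in> keys (mvar y + k)" by (simp add: keys_add_nat)
    then show False unfolding k'(1) using False assms[OF k'(2)] by (simp add: keys_add_nat)
  qed
  then show ?thesis using False by (intro poly_mapping_eqI) simp
qed

text \<open>If no generator involves y, division by y acts on the monomial factors alone; this makes
  y a nonzerodivisor modulo the ideal.\<close>

lemma divvar_idl_free:
  assumes S: "\<And>s k. s \<in> S \<Longrightarrow> k \<in> keys s \<Longrightarrow> y \<notin> keys k" and p: "p \<in> idl V S"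
  shows "divvar y p \<in> idl V S"
  using p
proof (induction rule: idl.induct)
  case (idl_step m s p a)
  have dv: "divvar y (single m a * s) = (if y \<in> keys m then single (m - mvar y) a * s else 0)"
    using S[OF idl_step(2)] by (intro divvar_free)
  have "divvar y (single m a * s) \<in> idl V S"
  proof (cases "y \<in> keys m")
    case True
    then have "keys (m - mvar y) \<subseteq> pvars V"
      using idl_step(1) mvar_add_minus[OF True] keys_add_nat[of "mvar y" "m - mvar y"] by auto
    then show ?thesis using True idl_gen_mult[OF _ idl_step(2)] by (simp add: dv)
  qed (simp add: dv idl_zero)
  then show ?case using idl_step by (simp add: divvar_add idl_add)
qed (simp add: idl_zero)

context kring
begin

text \<open>Each new variable is a nonzerodivisor modulo the previous ones and shifts Tor by (1,1),
  starting from S itself.\<close>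

lemma tor_vars:
  assumes "finite D" "D \<subseteq> pvars V"
  shows "(k \<noteq> j \<or> card D < k \<longrightarrow> tor V (Q V c (\<lambda>_ _. False) D) k j 0) \<and>
    (k = card D \<and> j = card D \<longrightarrow> tor V (Q V c (\<lambda>_ _. False) D) k j 1)"
  using assms
proof (induction D arbitrary: k j rule: finite_induct)
  case empty
  have "Q V c (\<lambda>_ _. False) {} = {0}"
  proof -
    have "p = 0" if "p \<in> Q V c (\<lambda>_ _. False) {}" for p
      using that unfolding Q_def by (induction rule: idl.induct) (auto simp: gens_def)
    then show ?thesis using idl_zero by (auto simp: Q_def)
  qed
  then show ?case using tor_zero_ideal[of j k] tor_zero_ideal_00 tor_small[of j k "{0}"] by auto
next
  case (insert y D)
  let ?Q = "Q V c (\<lambda>_ _. False) D"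
  have ug: "ugraph {} (\<lambda>_ _. False)" by (simp add: ugraph_def)
  have y: "y \<in> pvars V" and D: "D \<subseteq> pvars V" using insert by auto
  note h = hideal_Q[OF ug _ D, of c, simplified]
  have add: "Q V c (\<lambda>_ _. False) (insert y D) = add_var V ?Q y"
    by (rule add_var_Q[symmetric, OF ug _ D y]) simp
  have nz: "p \<in> ?Q" if "pv y * p \<in> ?Q" for p
  proof -
    have "divvar y (pv y * p) \<in> ?Q" using that insert.hyps(2) unfolding Q_def
      by (intro divvar_idl_free) (auto simp: gens_def pv_def)
    then show ?thesis by (simp add: divvar_pv_mult)
  qed
  note IH = insert.IH[OF D]
  show ?case
  \<comment> \<open>Places with a zero index are not reached by the shift.\<close>
  proof (cases "k = 0 \<or> j = 0")
    case True
    have "tor V (add_var V ?Q y) k j 0" if kj: "k \<noteq> j"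
    proof (cases "j < k")
      case True
      then show ?thesis using hideal_0[OF hideal_add_var[OF h y]] by (rule tor_small)
    next
      case False
      then have "k = 0" using \<open>k = 0 \<or> j = 0\<close> kj by auto
      then show ?thesis using IH[of 0 j] kj tor_add_var_deg0[OF h] by auto
    qed
    then show ?thesis using True insert.hyps by (auto simp: add)
  next
    case False
    then obtain k' j' where kj: "k = Suc k'" "j = Suc j'" by (metis not0_implies_Suc)
    have c: "card (insert y D) = Suc (card D)" using insert.hyps by simp
    have "tor V ?Q (Suc k') (Suc j') 0 \<Longrightarrow> tor V ?Q k' j' d \<longleftrightarrow> tor V (add_var V ?Q y) k j d" for d
      unfolding kj by (rule tor_nzd_iff[OF h y nz])
    then show ?thesis using IH[of k' j'] IH[of "Suc k'" "Suc j'"] unfolding add c kj by auto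
  qed
qed

end

subsection \<open>Normal forms\<close>

text \<open>These turn out to be the leading monomials of the ideal when \<open>E\<close> is a
  disjoint union of complete graphs.\<close>

definition nonstd :: "(nat \<Rightarrow> nat \<Rightarrow> bool) \<Rightarrow> pvar set \<Rightarrow> mon \<Rightarrow> bool" where
  "nonstd E D m \<longleftrightarrow> keys m \<inter> D \<noteq> {} \<or> (\<exists>i j. E i j \<and> i < j \<and> X i \<in> keys m \<and> Y j \<in> keys m)"

lemma mvar2_add_minus:
  assumes "u \<in> keys m" "v \<in> keys m" "u \<noteq> v"
  obtains n where "m = n + (mvar u + mvar v)"
proof -
  have "v \<in> keys (m - mvar u)" using assms by (auto simp: in_keys_iff lookup_minus lookup_single)
  then have "m = mvar u + (mvar v + (m - mvar u - mvar v))" using mvar_add_minus assms(1) by metis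
  then show thesis using that[of "m - mvar u - mvar v"] by (simp add: ac_simps)
qed

text \<open>With \<open>c = 0\<close> all generators are monomials, so membership is decided term by
  term.\<close>

lemma Q_0_iff:
  assumes "ugraph W E" "W \<subseteq> V" "D \<subseteq> pvars V"
  shows "p \<in> Q V 0 E D \<longleftrightarrow> p \<in> polys V \<and> (\<forall>m\<in>keys p. nonstd E D m)"
proof
  have b0: "bgen 0 i j = single (mvar (X i) + mvar (Y j)) (1::'a)" for i j by (simp add: bgen_def)
  assume p: "p \<in> Q V 0 E D"
  have "\<forall>m\<in>keys p. nonstd E D m"
    using p unfolding Q_def
  proof (induction rule: idl.induct)
    case (idl_step m s p a)
    have "nonstd E D k" if k: "k \<in> keys (single m a * s)" for k
    proof -
      from idl_step(2) consider i j where "s = single (mvar (X i) + mvar (Y j)) 1" "E i j" "i < j"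
        | d where "d \<in> D" "s = single (mvar d) 1"
        by (auto simp: gens_def b0 pv_def)
      then show ?thesis
      proof cases
        case 1
        then have "k = m + (mvar (X i) + mvar (Y j))" using k by (auto simp: mult_single split: if_splits)
        then show ?thesis using 1 by (auto simp: nonstd_def keys_add_nat)
      next
        case 2
        then have "k = m + mvar d" using k by (auto simp: mult_single split: if_splits)
        then show ?thesis using 2 by (auto simp: nonstd_def keys_add_nat)
      qed
    qed
    then show ?case using idl_step Poly_Mapping.keys_add[of "single m a * s" p] by blast
  qed simp
  then show "p \<in> polys V \<and> (\<forall>m\<in>keys p. nonstd E D m)" using hideal_polys[OF hideal_Q[OF assms] p] by simp
next
  note h = hideal_Q[OF assms, of "0 :: 'a"]
  assume p: "p \<in> polys V \<and> (\<forall>m\<in>keys p. nonstd E D m)"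
  show "p \<in> Q V 0 E D"
  proof (rule mpoly_induct_keys[where Q = "\<lambda>m. keys m \<subseteq> pvars V \<and> nonstd E D m" and P = "\<lambda>p. p \<in> Q V 0 E D" and p = p])
    show "keys m \<subseteq> pvars V \<and> nonstd E D m" if "m \<in> keys p" for m using p polysD that by blast
    show "0 \<in> Q V (0 :: 'a) E D" by (rule hideal_0[OF h])
    fix m and a :: 'a and q :: "'a mpoly" assume m: "keys m \<subseteq> pvars V \<and> nonstd E D m" and q: "q \<in> Q V 0 E D"
    have "single m a \<in> Q V 0 E D"
    proof -
      from m consider d where "d \<in> D" "d \<in> keys m" | i j where "E i j" "i < j" "X i \<in> keys m" "Y j \<in> keys m"
        by (auto simp: nonstd_def)
      then show ?thesis
      proof cases
        case 1
        have eq: "m = mvar d + (m - mvar d)" using mvar_add_minus[OF 1(2)] by simp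
        have "keys (m - mvar d) \<subseteq> pvars V" using m keys_add_nat[of "mvar d" "m - mvar d"] eq by auto
        then have "single (m - mvar d) a * pv d \<in> Q V 0 E D" using 1 by (intro hideal_mult[OF h] Q_var polys_single)
        moreover have "single (m - mvar d) a * pv d = single m a"
          using eq by (simp add: pv_def mult_single add.commute)
        ultimately show ?thesis by simp
      next
        case 2
        obtain n where n: "m = n + (mvar (X i) + mvar (Y j))" using mvar2_add_minus[OF 2(3,4)] by blast
        then have "keys n \<subseteq> pvars V" using m by (simp add: keys_add_nat)
        then have "single n a * bgen 0 i j \<in> Q V 0 E D" using 2 by (intro hideal_mult[OF h] Q_edge polys_single)
        moreover have "single n a * bgen 0 i j = single m a" by (simp add: bgen_def mult_single n)
        ultimately show ?thesis by simp
      qed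
    qed
    then show "single m a + q \<in> Q V 0 E D" using q hideal_add[OF h] by blast
  qed
qed

definition cls :: "(nat \<Rightarrow> nat \<Rightarrow> bool) \<Rightarrow> nat \<Rightarrow> nat set" where
  "cls E v = {u. u = v \<or> E u v}"

text \<open>Two monomials have the same signature if they have the same image under
  \<open>x\<^sub>i \<mapsto> s\<^sub>i t\<^sub>C\<close>, \<open>y\<^sub>i \<mapsto> s\<^sub>i u\<^sub>C\<close>, where \<open>C\<close> is the clique of \<open>i\<close>.\<close>

definition same_sig :: "(nat \<Rightarrow> nat \<Rightarrow> bool) \<Rightarrow> mon \<Rightarrow> mon \<Rightarrow> bool" where
  "same_sig E m m' \<longleftrightarrow> (\<forall>i. lookup m (X i) + lookup m (Y i) = lookup m' (X i) + lookup m' (Y i)) \<and>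
     (\<forall>v. (\<Sum>u\<in>cls E v. lookup m (X u)) = (\<Sum>u\<in>cls E v. lookup m' (X u)))"

lemma finite_cls: "ugraph W E \<Longrightarrow> finite (cls E v)"
  by (rule finite_subset[of _ "insert v W"]) (auto simp: cls_def ugraph_def)

lemma mon_eqI:
  assumes "\<And>i. lookup m (X i) = lookup m' (X i)" "\<And>i. lookup m (Y i) = lookup m' (Y i)"
  shows "m = m'"
proof (rule poly_mapping_eqI)
  show "lookup m v = lookup m' v" for v using assms by (cases v) auto
qed

text \<open>The x-degrees over a clique agree, so a surplus at \<open>i\<close> is balanced by a
  deficit at some \<open>j\<close> of the clique; the equal totals at \<open>j\<close> then force
  y_j into \<open>m\<close>. This makes the move from x_i y_j to x_j y_i available.\<close>

lemma same_sig_exchange: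
  assumes g: "ugraph W E" and s: "same_sig E m m'" and i: "lookup m' (X i) < lookup m (X i)"
  obtains j where "E j i" "lookup m (X j) < lookup m' (X j)" "X i \<in> keys m" "Y j \<in> keys m"
proof -
  have "\<exists>j\<in>cls E i. lookup m (X j) < lookup m' (X j)"
  proof (rule ccontr)
    assume "\<not> ?thesis"
    then have "\<forall>j\<in>cls E i. lookup m' (X j) \<le> lookup m (X j)" by (auto simp: not_less)
    moreover have "i \<in> cls E i" by (simp add: cls_def)
    ultimately have "(\<Sum>u\<in>cls E i. lookup m' (X u)) < (\<Sum>u\<in>cls E i. lookup m (X u))"
      using i by (intro sum_strict_mono_ex1 finite_cls[OF g]) auto
    then show False using s by (simp add: same_sig_def)
  qed
  then obtain j where j: "j \<in> cls E i" "lookup m (X j) < lookup m' (X j)" by blast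
  have "j \<noteq> i" using i j by auto
  then have "E j i" using j by (simp add: cls_def)
  moreover have "lookup m (X j) + lookup m (Y j) = lookup m' (X j) + lookup m' (Y j)" using s by (simp add: same_sig_def)
  then have "Y j \<in> keys m" using j(2) by (simp add: in_keys_iff)
  moreover have "X i \<in> keys m" using i by (simp add: in_keys_iff)
  ultimately show thesis using that j(2) by blast
qed

lemma same_sig_swap:
  assumes g: "ugraph W E" and cl: "cluster E" and e: "E i j"
  shows "same_sig E (n + (mvar (X i) + mvar (Y j))) (n + (mvar (X j) + mvar (Y i)))"
  unfolding same_sig_def
proof (intro conjI allI)
  fix v
  have "i \<in> cls E v \<longleftrightarrow> j \<in> cls E v"
    using e cl ugraph_sym[OF g] unfolding cls_def cluster_def by blast
  moreover have "(\<Sum>u\<in>cls E v. lookup (mvar (X k)) (X u)) = (if k \<in> cls E v then 1 else 0)" for k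
    using finite_cls[OF g, of v] by (simp add: lookup_single when_def)
  ultimately show "(\<Sum>u\<in>cls E v. lookup (n + (mvar (X i) + mvar (Y j))) (X u)) =
      (\<Sum>u\<in>cls E v. lookup (n + (mvar (X j) + mvar (Y i))) (X u))"
    by (simp add: lookup_add sum.distrib lookup_single)
qed (simp add: lookup_add lookup_single when_def)

text \<open>The measure is the total surplus of the x-exponents of \<open>m\<close> over those of
  \<open>m'\<close>, by truncated subtraction. An exchange changes the polynomial by a multiple of a
  generator; it lowers the surplus at \<open>i\<close> and creates none at \<open>j\<close>.\<close>

lemma same_sig_cong:
  assumes g: "ugraph W E" "W \<subseteq> V" "D \<subseteq> pvars V" and cl: "cluster E"
  shows "same_sig E m m' \<Longrightarrow> keys m \<subseteq> pvars V \<Longrightarrow> keys m' \<subseteq> pvars V \<Longrightarrow> single m a - single m' a \<in> Q V 1 E D"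
proof (induction "\<Sum>i\<in>W. lookup m (X i) - lookup m' (X i)" arbitrary: m rule: less_induct)
  case less
  note h = hideal_Q[OF g, of "1 :: 'a"]
  have fW: "finite W" using ugraph_finite[OF g(1)] .
  show ?case
  proof (cases "m = m'")
    case True
    then show ?thesis using hideal_0[OF h] by simp
  next
    case False
    have "\<exists>i. lookup m' (X i) < lookup m (X i)"
    proof (rule ccontr)
      assume *: "\<not> ?thesis"
      then have le: "lookup m (X i) \<le> lookup m' (X i)" for i by (auto simp: not_less)
      have "lookup m (X i) = lookup m' (X i)" for i
      proof (rule ccontr)
        assume "lookup m (X i) \<noteq> lookup m' (X i)"
        then have "lookup m (X i) < lookup m' (X i)" using le[of i] by simp
        then have "(\<Sum>u\<in>cls E i. lookup m (X u)) < (\<Sum>u\<in>cls E i. lookup m' (X u))"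
          using le by (intro sum_strict_mono_ex1 finite_cls[OF g(1)]) (auto simp: cls_def)
        then show False using less.prems(1) by (simp add: same_sig_def)
      qed
      moreover from this have "lookup m (Y i) = lookup m' (Y i)" for i
        using less.prems(1) unfolding same_sig_def by (metis add_left_cancel)
      ultimately show False using mon_eqI False by blast
    qed
    then obtain i where i: "lookup m' (X i) < lookup m (X i)" by blast
    obtain j where j: "E j i" "lookup m (X j) < lookup m' (X j)" "X i \<in> keys m" "Y j \<in> keys m"
      by (rule same_sig_exchange[OF g(1) less.prems(1) i])
    obtain n where n: "m = n + (mvar (X i) + mvar (Y j))" using mvar2_add_minus[OF j(3,4)] by blast
    define m2 where "m2 = n + (mvar (X j) + mvar (Y i))"
    have ij: "i \<in> W" "j \<in> W" "i \<noteq> j" "E i j" using j(1) g(1) by (auto simp: ugraph_def)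
    have k2: "keys m2 \<subseteq> pvars V" using less.prems(2) ij g(2) by (auto simp: m2_def n keys_add_nat)
    have s2: "same_sig E m2 m'"
      using same_sig_swap[OF g(1) cl ij(4), of n] less.prems(1) unfolding m2_def n same_sig_def by simp
    have "(\<Sum>l\<in>W. lookup m2 (X l) - lookup m' (X l)) < (\<Sum>l\<in>W. lookup m (X l) - lookup m' (X l))"
    proof (rule sum_strict_mono_ex1[OF fW])
      show "\<forall>l\<in>W. lookup m2 (X l) - lookup m' (X l) \<le> lookup m (X l) - lookup m' (X l)"
        using j(2) by (auto simp: m2_def n lookup_add lookup_single when_def)
      show "\<exists>l\<in>W. lookup m2 (X l) - lookup m' (X l) < lookup m (X l) - lookup m' (X l)"
        using i ij by (intro bexI[of _ i]) (auto simp: m2_def n lookup_add lookup_single when_def)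
    qed
    from less.hyps[OF this s2 k2 less.prems(3)] have 1: "single m2 a - single m' a \<in> Q V 1 E D" .
    have kn: "keys n \<subseteq> pvars V" using less.prems(2) by (simp add: n keys_add_nat)
    have "single m a - single m2 a \<in> Q V 1 E D"
    proof (cases "i < j")
      case True
      have "single n a * bgen 1 i j \<in> Q V 1 E D"
        using ij True kn by (intro hideal_mult[OF h] Q_edge polys_single)
      then show ?thesis by (simp add: bgen_def right_diff_distrib mult_single n m2_def)
    next
      case False
      then have "j < i" using ij by simp
      have "single n (- a) * bgen 1 j i \<in> Q V 1 E D"
        using j(1) \<open>j < i\<close> kn by (intro hideal_mult[OF h] Q_edge polys_single)
      then show ?thesis by (simp add: bgen_def right_diff_distrib mult_single n m2_def single_uminus)
    qed
    then show ?thesis using hideal_add[OF h _ 1] by fastforce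
  qed
qed

definition coeff_sum :: "'k::field mpoly \<Rightarrow> 'k" where
  "coeff_sum p = (\<Sum>m\<in>keys p. lookup p m)"

lemma coeff_sum_superset: "finite M \<Longrightarrow> keys p \<subseteq> M \<Longrightarrow> coeff_sum p = (\<Sum>m\<in>M. lookup p m)"
  unfolding coeff_sum_def by (rule sum.mono_neutral_left) (auto simp: in_keys_iff)

lemma coeff_sum_add: "coeff_sum (p + q) = coeff_sum p + coeff_sum q"
  using Poly_Mapping.keys_add[of p q]
  by (simp add: coeff_sum_superset[of "keys p \<union> keys q"] lookup_add sum.distrib)

lemma coeff_sum_0 [simp]: "coeff_sum 0 = 0"
  by (simp add: coeff_sum_def)

lemma coeff_sum_single [simp]: "coeff_sum (single m a) = a"
  by (cases "a = 0") (simp_all add: coeff_sum_def)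

lemma coeff_sum_diff: "coeff_sum (p - q) = coeff_sum p - coeff_sum q"
  using coeff_sum_add[of "p - q" q] by simp

text \<open>The coefficient that the image monomial of \<open>m0\<close> receives under the
  parametrization, after the variables in \<open>D\<close> are set to zero.\<close>

definition sig_sum :: "(nat \<Rightarrow> nat \<Rightarrow> bool) \<Rightarrow> pvar set \<Rightarrow> mon \<Rightarrow> 'k::field mpoly \<Rightarrow> 'k" where
  "sig_sum E D m0 p = coeff_sum (restr (\<lambda>m. keys m \<inter> D = {} \<and> same_sig E m m0) p)"

lemma sig_sum_add: "sig_sum E D m0 (p + q) = sig_sum E D m0 p + sig_sum E D m0 q"
  and sig_sum_diff: "sig_sum E D m0 (p - q) = sig_sum E D m0 p - sig_sum E D m0 q"
  by (simp_all add: sig_sum_def restr_add restr_diff coeff_sum_add coeff_sum_diff)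

lemma sig_sum_single: "sig_sum E D m0 (single m a) = (if keys m \<inter> D = {} \<and> same_sig E m m0 then a else 0)"
  by (simp add: sig_sum_def restr_single)

lemma sig_sum_Q:
  assumes g: "ugraph W E" and cl: "cluster E" and D: "D \<inter> pvars W = {}" and p: "p \<in> Q V 1 E D"
  shows "sig_sum E D m0 p = 0"
  using p unfolding Q_def
proof (induction rule: idl.induct)
  case (idl_step m s p a)
  from idl_step(2) consider i j where "E i j" "s = bgen 1 i j" | d where "d \<in> D" "s = pv d"
    by (auto simp: gens_def)
  then have "sig_sum E D m0 (single m a * s) = 0"
  proof cases
    case 1
    let ?m1 = "m + (mvar (X i) + mvar (Y j))" and ?m2 = "m + (mvar (X j) + mvar (Y i))"
    have "same_sig E ?m1 m0 \<longleftrightarrow> same_sig E ?m2 m0"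
      using same_sig_swap[OF g cl 1(1), of m] unfolding same_sig_def by simp
    moreover have "i \<in> W" "j \<in> W" using ugraph_verts[OF g 1(1)] by auto
    then have "keys ?m1 \<inter> D = {} \<longleftrightarrow> keys ?m2 \<inter> D = {}" using D by (auto simp: keys_add_nat)
    moreover have "single m a * s = single ?m1 a - single ?m2 a"
      by (simp add: 1 bgen_def right_diff_distrib mult_single)
    ultimately show ?thesis by (simp add: sig_sum_diff sig_sum_single)
  next
    case 2
    then show ?thesis by (simp add: pv_def mult_single sig_sum_single keys_add_nat)
  qed
  then show ?case using idl_step by (simp add: sig_sum_add)
qed (simp add: sig_sum_def)

text \<open>The nonzero coefficient of \<open>m\<close> has to be cancelled within its
  fibre.\<close>

lemma sig_sum_partner:
  assumes s: "sig_sum E D m p = 0" and m: "m \<in> keys p" "keys m \<inter> D = {}"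
  obtains m' where "m' \<in> keys p" "m' \<noteq> m" "keys m' \<inter> D = {}" "same_sig E m' m"
proof -
  let ?r = "restr (\<lambda>k. keys k \<inter> D = {} \<and> same_sig E k m) p"
  have "\<exists>m'\<in>keys ?r. m' \<noteq> m"
  proof (rule ccontr)
    assume "\<not> ?thesis"
    then have "keys ?r = {m}" using m by (auto simp: keys_restr same_sig_def)
    then have "coeff_sum ?r = lookup p m"
      using m by (simp add: coeff_sum_def lookup_restr same_sig_def)
    then show False using s m by (simp add: sig_sum_def in_keys_iff)
  qed
  then show thesis using that by (auto simp: keys_restr)
qed

text \<open>The ideal is the kernel of the parametrization. A kernel element is reduced by one
  monomial at a time: the monomial either contains a variable of \<open>D\<close>, or is pushed onto
  a partner with the same signature.\<close>

lemma Q_1_iff: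
  assumes g: "ugraph W E" "W \<subseteq> V" "D \<subseteq> pvars V" and cl: "cluster E" and D: "D \<inter> pvars W = {}"
  shows "p \<in> Q V 1 E D \<longleftrightarrow> p \<in> polys V \<and> (\<forall>m. sig_sum E D m p = 0)"
proof
  assume "p \<in> Q V 1 E D"
  then show "p \<in> polys V \<and> (\<forall>m. sig_sum E D m p = 0)"
    using hideal_polys[OF hideal_Q[OF g]] sig_sum_Q[OF g(1) cl D] by blast
next
  note h = hideal_Q[OF g, of "1 :: 'a"]
  assume "p \<in> polys V \<and> (\<forall>m. sig_sum E D m p = 0)"
  then show "p \<in> Q V 1 E D"
  proof (induction "card (keys p)" arbitrary: p rule: less_induct)
    case less
    show ?case
    proof (cases "p = 0")
      case True
      then show ?thesis using hideal_0[OF h] by simp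
    next
      case False
      then obtain m where m: "m \<in> keys p" by (metis keys_eq_empty all_not_in_conv)
      have km: "keys m \<subseteq> pvars V" using less.prems m polysD by blast
      have "\<exists>r\<in>Q V 1 E D. keys (p - r) \<subseteq> keys p - {m}"
      proof (cases "keys m \<inter> D = {}")
        case True
        obtain m' where m': "m' \<in> keys p" "m' \<noteq> m" "same_sig E m' m"
          using sig_sum_partner[of E D m p] less.prems m True by metis
        have "single m (lookup p m) - single m' (lookup p m) \<in> Q V 1 E D"
          using m' km polysD[of p V m'] less.prems
          by (intro same_sig_cong[OF g cl]) (auto simp: same_sig_def)
        moreover have "keys (p - (single m (lookup p m) - single m' (lookup p m))) \<subseteq> keys p - {m}"
          using m' m by (auto simp: in_keys_iff lookup_minus lookup_single when_def split: if_splits)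
        ultimately show ?thesis by blast
      next
        case False
        then obtain d where d: "d \<in> keys m" "d \<in> D" by blast
        have eq: "m = mvar d + (m - mvar d)" using mvar_add_minus[OF d(1)] by simp
        have "keys (m - mvar d) \<subseteq> pvars V" using km keys_add_nat[of "mvar d" "m - mvar d"] eq by auto
        then have "single (m - mvar d) (lookup p m) * pv d \<in> Q V 1 E D"
          using d by (intro hideal_mult[OF h] Q_var polys_single)
        moreover have "single (m - mvar d) (lookup p m) * pv d = single m (lookup p m)"
          using eq by (simp add: pv_def mult_single add.commute)
        moreover have "keys (p - single m (lookup p m)) \<subseteq> keys p - {m}"
          by (auto simp: in_keys_iff lookup_minus lookup_single when_def split: if_splits)
        ultimately show ?thesis by auto
      qed
      then obtain r where r: "r \<in> Q V 1 E D" "keys (p - r) \<subseteq> keys p - {m}" by blast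
      have "card (keys (p - r)) < card (keys p)"
        using r(2) m by (intro psubset_card_mono) auto
      moreover have "p - r \<in> polys V \<and> (\<forall>m. sig_sum E D m (p - r) = 0)"
        using less.prems sig_sum_Q[OF g(1) cl D r(1)] hideal_polys[OF h r(1)] by (simp add: polys_diff sig_sum_diff)
      ultimately have "p - r \<in> Q V 1 E D" using less.hyps by blast
      then show ?thesis using hideal_add[OF h _ r(1)] by fastforce
    qed
  qed
qed

lemma coeff_sum_pv_mult: "coeff_sum (pv x * p) = coeff_sum p"
  unfolding coeff_sum_def keys_pv_mult
  by (subst sum.reindex) (auto simp: inj_on_def lookup_pv_mult_add)

lemma restr_pv_mult: "restr P (pv x * p) = pv x * restr (\<lambda>m. P (mvar x + m)) p"
proof (rule poly_mapping_eqI)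
  fix m
  show "lookup (restr P (pv x * p)) m = lookup (pv x * restr (\<lambda>m. P (mvar x + m)) p) m"
    by (cases "x \<in> keys m") (simp_all add: lookup_restr lookup_pv_mult mvar_add_minus)
qed

text \<open>For \<open>c = 0\<close>, x_v divides no generator, as \<open>v\<close> is last in its
  clique. For \<open>c = 1\<close>, multiplication by x_v is injective on signatures and preserves
  the sums over fibres.\<close>

lemma nzd_X:
  assumes c: "c = 0 \<or> c = 1" and g: "ugraph W E" "W \<subseteq> V" "D \<subseteq> pvars V" and cl: "cluster E"
    and D: "D \<inter> pvars W = {}" and v: "v \<in> W" "\<And>u. E u v \<Longrightarrow> u < v"
    and p: "p \<in> polys V" "pv (X v) * p \<in> Q V c E D"
  shows "p \<in> Q V c E D"
proof (cases "c = 0")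
  case True
  have "nonstd E D m" if "m \<in> keys p" for m
  proof -
    have "nonstd E D (mvar (X v) + m)"
      using p(2) that unfolding True Q_0_iff[OF g] by (simp add: keys_pv_mult)
    moreover have "X v \<notin> D" using D v(1) by auto
    moreover have "\<not> (E v j \<and> v < j)" for j using v(2)[of j] ugraph_sym[OF g(1), of v j] by auto
    ultimately show ?thesis by (auto simp: nonstd_def keys_add_nat)
  qed
  then show ?thesis using p(1) unfolding True Q_0_iff[OF g] by simp
next
  case False
  then have c: "c = 1" using c by simp
  have "sig_sum E D m p = 0" for m
  proof -
    have *: "keys (mvar (X v) + k) \<inter> D = {} \<and> same_sig E (mvar (X v) + k) (mvar (X v) + m) \<longleftrightarrow>
      keys k \<inter> D = {} \<and> same_sig E k m" for k
      using D v(1) by (auto simp: same_sig_def keys_add_nat lookup_add sum.distrib)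
    have "sig_sum E D (mvar (X v) + m) (pv (X v) * p) = sig_sum E D m p"
      unfolding sig_sum_def restr_pv_mult coeff_sum_pv_mult * ..
    then show ?thesis using p(2) unfolding c Q_1_iff[OF g cl D] by simp
  qed
  then show ?thesis using p(1) unfolding c Q_1_iff[OF g cl D] by simp
qed

section \<open>Deleting a vertex or a whole clique; the colon ideal by y_v\<close>

lemma ugraph_del: "ugraph W E \<Longrightarrow> ugraph (W - {i}) (del E i)"
  by (auto simp: ugraph_def del_def)

lemma cluster_del: "cluster E \<Longrightarrow> cluster (del E i)"
  unfolding cluster_def del_def by blast

lemma bgen_in:
  assumes J: "hideal V J" and ij: "i \<in> V" "j \<in> V" and x: "pv (X i) \<in> J \<or> pv (Y j) \<in> J" "pv (X j) \<in> J \<or> pv (Y i) \<in> J"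
  shows "bgen c i j \<in> J"
  unfolding bgen_eq
proof (intro hideal_diff[OF J])
  have 1: "pv a * pv b \<in> J" if "pv a \<in> J \<or> pv b \<in> J" "a \<in> pvars V" "b \<in> pvars V" for a b
    using that hideal_mult[OF J, of "pv b" "pv a"] hideal_mult[OF J, of "pv a" "pv b"]
    by (auto simp: polys_pv mult.commute)
  show "pv (X i) * pv (Y j) \<in> J" using x(1) ij by (intro 1) auto
  show "single 0 c * (pv (X j) * pv (Y i)) \<in> J" using x(2) ij by (intro hideal_mult[OF J] 1 polys_const) auto
qed

text \<open>Both terms of a binomial at \<open>i\<close> contain x_i or y_i.\<close>

lemma Q_del:
  assumes g: "ugraph W E" "W \<subseteq> V" "D \<subseteq> pvars V" and i: "X i \<in> D" "Y i \<in> D"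
  shows "Q V c (del E i) D = Q V c E D"
proof
  show "Q V c (del E i) D \<subseteq> Q V c E D" by (rule Q_mono) (auto simp: del_def)
  have h: "hideal V (Q V c (del E i) D)" by (rule hideal_Q[OF ugraph_del[OF g(1)]]) (use g in auto)
  show "Q V c E D \<subseteq> Q V c (del E i) D"
  proof (rule Q_least[OF h])
    fix a b assume ab: "E a b" "a < b"
    have abV: "a \<in> V" "b \<in> V" using ugraph_verts[OF g(1) ab(1)] g(2) by auto
    show "bgen c a b \<in> Q V c (del E i) D"
    proof (cases "a = i \<or> b = i")
      case True
      moreover have "pv (X i) \<in> Q V c (del E i) D" "pv (Y i) \<in> Q V c (del E i) D"
        using i by (auto intro: Q_var)
      ultimately show ?thesis using abV by (intro bgen_in[OF h]) auto
    next
      case False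
      then show ?thesis using ab by (intro Q_edge) (auto simp: del_def)
    qed
  qed (rule Q_var)
qed

definition off :: "(nat \<Rightarrow> nat \<Rightarrow> bool) \<Rightarrow> nat \<Rightarrow> nat \<Rightarrow> nat \<Rightarrow> bool" where
  "off E v a b \<longleftrightarrow> E a b \<and> a \<notin> cls E v \<and> b \<notin> cls E v"

lemma ugraph_off: "ugraph W E \<Longrightarrow> ugraph (W - cls E v) (off E v)"
  by (auto simp: ugraph_def off_def)

lemma cluster_off: "cluster E \<Longrightarrow> cluster (off E v)"
  unfolding cluster_def off_def by blast

lemma divvar_diff: "divvar v (p - q) = divvar v p - divvar v q"
  by (rule poly_mapping_eqI) (simp add: lookup_divvar lookup_minus)

text \<open>Modulo x_v an edge u v gives y_v x_u = 0, so all x_u of the clique enter the colon ideal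
  and make the edges of that clique redundant. Conversely y_v occurs only in the generators x_u y_v
  - c x_v y_u, and dividing their multiples by y_v stays inside the ideal on the right.\<close>

lemma colon_Q:
  assumes g: "ugraph W E" "W \<subseteq> V" "D \<subseteq> pvars V" and cl: "cluster E"
    and D: "D \<inter> pvars W = {}" and v: "v \<in> W" "\<And>u. E u v \<Longrightarrow> u < v"
  shows "colon V (Q V c E (insert (X v) D)) (Y v) = Q V c (off E v) (D \<union> X ` cls E v)"
proof
  let ?I = "Q V c E (insert (X v) D)" and ?T = "Q V c (off E v) (D \<union> X ` cls E v)"
  have CW: "cls E v \<subseteq> W" using g(1) v by (auto simp: cls_def ugraph_def)
  have hI: "hideal V ?I" using g v by (intro hideal_Q) auto
  have hT: "hideal V ?T" using g CW by (intro hideal_Q[OF ugraph_off[OF g(1)]]) auto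
  have vV: "v \<in> V" using v g by auto
  show "?T \<subseteq> colon V ?I (Y v)"
  proof (rule Q_least[OF hideal_colon[OF hI]])
    show "bgen c i j \<in> colon V ?I (Y v)" if "off E v i j" "i < j" for i j
    proof -
      have "bgen c i j \<in> ?I" using that by (intro Q_edge) (auto simp: off_def)
      then show ?thesis using hideal_mult[OF hI _ polys_pv[of "Y v" V]] hideal_polys[OF hI] vV by (simp add: colon_def)
    qed
    fix d assume d: "d \<in> D \<union> X ` cls E v"
    show "pv d \<in> colon V ?I (Y v)"
    proof (cases "d \<in> insert (X v) D")
      case True
      then have "pv d \<in> ?I" by (rule Q_var)
      then show ?thesis using hideal_mult[OF hI _ polys_pv[of "Y v" V]] hideal_polys[OF hI] vV by (simp add: colon_def)
    next
      case False
      then obtain u where u: "d = X u" "E u v" using d by (auto simp: cls_def)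
      have uV: "u \<in> V" using ugraph_verts[OF g(1) u(2)] g(2) by auto
      have "bgen c u v \<in> ?I" using u v by (intro Q_edge) auto
      moreover have "(single 0 c * pv (Y u)) * pv (X v) \<in> ?I"
        using uV by (intro hideal_mult[OF hI] Q_var polys_mult polys_const polys_pv) auto
      ultimately have "bgen c u v + (single 0 c * pv (Y u)) * pv (X v) \<in> ?I" by (rule hideal_add[OF hI])
      moreover have "bgen c u v + (single 0 c * pv (Y u)) * pv (X v) = pv (Y v) * pv d"
        by (simp add: bgen_eq u algebra_simps)
      ultimately show ?thesis using uV u by (simp add: colon_def polys_pv)
    qed
  qed
  \<comment> \<open>If \<open>s\<close> does not involve y_v, the division acts on the monomial
    factor alone.\<close>
  have free: "divvar (Y v) (single m a * s) \<in> ?T"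
    if s: "s \<in> ?T" "\<And>k. k \<in> keys s \<Longrightarrow> Y v \<notin> keys k" and m: "keys m \<subseteq> pvars V" for m a s
  proof -
    have dv: "divvar (Y v) (single m a * s) = (if Y v \<in> keys m then single (m - mvar (Y v)) a * s else 0)"
      using s(2) by (rule divvar_free)
    show ?thesis
    proof (cases "Y v \<in> keys m")
      case True
      have "keys (m - mvar (Y v)) \<subseteq> pvars V"
        using m mvar_add_minus[OF True] keys_add_nat[of "mvar (Y v)" "m - mvar (Y v)"] by auto
      then show ?thesis using True s(1) by (simp add: dv hideal_mult[OF hT] polys_single)
    qed (simp add: dv hideal_0[OF hT])
  qed
  have div_in: "divvar (Y v) q \<in> ?T" if "q \<in> ?I" for q
    using that unfolding Q_def[of V c E]
  proof (induction rule: idl.induct)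
    case (idl_step m s p a)
    have "divvar (Y v) (single m a * s) \<in> ?T"
    proof -
      from idl_step(2) consider d where "s = pv d" "d \<in> insert (X v) D"
        | i j where "s = bgen c i j" "E i j" "i < j"
        by (auto simp: gens_def)
      then show ?thesis
      proof cases
        case 1
        have "pv d \<in> ?T" using 1(2) by (intro Q_var) (auto simp: cls_def)
        moreover have "d \<noteq> Y v" using 1(2) D v(1) by auto
        ultimately show ?thesis using idl_step(1) 1(1) by (intro free) (auto simp: pv_def)
      next
        case 2
        have iV: "i \<in> V" "j \<in> V" using ugraph_verts[OF g(1) 2(2)] g(2) by auto
        have iv: "i \<noteq> v" using v(2)[of j] ugraph_sym[OF g(1) 2(2)] 2(3) by auto
        have cls: "i \<in> cls E v \<longleftrightarrow> j \<in> cls E v"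
          using 2(2) cl ugraph_sym[OF g(1)] unfolding cls_def cluster_def by blast
        show ?thesis
        proof (cases "j = v")
          case False
          have "bgen c i j \<in> ?T"
          proof (cases "i \<in> cls E v")
            case True
            then have "pv (X i) \<in> ?T" "pv (X j) \<in> ?T" using cls by (auto intro!: Q_var)
            then show ?thesis using iV by (intro bgen_in[OF hT]) auto
          next
            case False
            then show ?thesis using 2 cls by (intro Q_edge) (auto simp: off_def)
          qed
          then show ?thesis unfolding 2(1) using idl_step(1) iv False
            by (intro free) (auto dest!: keys_bgen simp: keys_add_nat)
        next
          case True
          \<comment> \<open>Only the first term of this generator contains y_v; dividing it leaves
            x_i, and the second term \<open>t\<close> falls under the case free of y_v.\<close>
          define t where "t = single 0 c * (pv (X v) * pv (Y i))"
          have X: "pv (X i) \<in> ?T" "pv (X v) \<in> ?T" using 2(2) True by (auto intro!: Q_var simp: cls_def)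
          have "t = (single 0 c * pv (Y i)) * pv (X v)" by (simp add: t_def ac_simps)
          then have tT: "t \<in> ?T" using X(2) iV by (auto intro!: hideal_mult[OF hT] polys_mult polys_const polys_pv)
          have kt: "k = mvar (X v) + mvar (Y i)" if "k \<in> keys t" for k
            using that by (auto simp: t_def pv_def mult_single split: if_splits)
          have "Y v \<notin> keys k" if "k \<in> keys t" for k using iv by (simp add: kt[OF that] keys_add_nat)
          then have 1: "divvar (Y v) (single m a * t) \<in> ?T" using tT idl_step(1) by (intro free) auto
          have "single m a * s = pv (Y v) * (single m a * pv (X i)) - single m a * t"
            by (simp add: 2(1) True bgen_eq t_def algebra_simps)
          then have "divvar (Y v) (single m a * s) = single m a * pv (X i) - divvar (Y v) (single m a * t)"
            by (simp only: divvar_diff divvar_pv_mult)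
          then show ?thesis using 1 X(1) idl_step(1)
            by (simp only: hideal_diff[OF hT] hideal_mult[OF hT] polys_single)
        qed
      qed
    qed
    then show ?case using idl_step by (simp add: divvar_add hideal_add[OF hT])
  qed (simp add: hideal_0[OF hT])
  show "colon V ?I (Y v) \<subseteq> ?T"
  proof
    fix p assume "p \<in> colon V ?I (Y v)"
    then show "p \<in> ?T" using div_in[of "pv (Y v) * p"] by (simp add: colon_def divvar_pv_mult)
  qed
qed

section \<open>Projective dimension and top Betti numbers of disjoint unions of complete
  graphs\<close>

context kring
begin

text \<open>The independent set \<open>R\<close> bounds the number of cliques from below, so the
  projective dimension is at most vertices plus adjoined variables minus cliques. That bound rises
  by one when y_v is added (one vertex less, two variables more) and by at most one for the colon
  ideal (a clique is traded for its x-variables, and \<open>R\<close> loses at most one element).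
  Dividing out x_v shifts the index by one and compensates.\<close>

lemma tor_cluster_0:
  fixes c :: "'k::field"
  assumes c: "c = 0 \<or> c = 1"
  shows "ugraph W E \<Longrightarrow> cluster E \<Longrightarrow> W \<subseteq> V \<Longrightarrow> D \<subseteq> pvars V \<Longrightarrow> D \<inter> pvars W = {} \<Longrightarrow>
    R \<subseteq> W \<Longrightarrow> (\<forall>u\<in>R. \<forall>w\<in>R. \<not> E u w) \<Longrightarrow> card W + card D < k + card R \<Longrightarrow> tor V (Q V c E D) k j 0"
proof (induction "card W" arbitrary: W E D R k j rule: less_induct)
  case less
  note g = less.prems(1,3,4) and cl = less.prems(2) and D = less.prems(5) and R = less.prems(6,7)
  have fW: "finite W" by (rule ugraph_finite[OF g(1)])
  have fD: "finite D" by (rule finite_subset[OF g(3) finite_pvars[OF finite_V]])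
  have fR: "finite R" by (rule finite_subset[OF R(1) fW])
  show ?case
  proof (cases "\<exists>u v. E u v")
    case False
    then have "E = (\<lambda>_ _. False)" by auto
    moreover have "card D < k" using less.prems(8) card_mono[OF fW R(1)] by linarith
    ultimately show ?thesis using tor_vars[OF fD g(3), of k j c] by simp
  next
    case True
    \<comment> \<open>The largest vertex with a neighbour is last in its clique, as needed for x_v
      to be a nonzerodivisor and for the colon ideal.\<close>
    define v where "v = Max {v. \<exists>u. E u v}"
    have fin: "finite {v. \<exists>u. E u v}" by (rule finite_subset[OF _ fW]) (auto dest: ugraph_verts[OF g(1)])
    moreover have "{v. \<exists>u. E u v} \<noteq> {}" using True by auto
    ultimately have "v \<in> {v. \<exists>u. E u v}" unfolding v_def by (rule Max_in)
    then obtain w where w: "E w v" by blast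
    have vmax: "u < v" if "E u v" for u
    proof -
      have "u \<in> {v. \<exists>u. E u v}" using ugraph_sym[OF g(1) that] by blast
      then have "u \<le> v" unfolding v_def using fin by simp
      moreover have "u \<noteq> v" using that ugraph_irrefl[OF g(1)] by auto
      ultimately show ?thesis by simp
    qed
    have vW: "v \<in> W" "w \<in> W" and wv: "w \<noteq> v" "E v w" using w g(1) by (auto simp: ugraph_def)
    have vV: "v \<in> V" using vW g(2) by auto
    let ?C = "cls E v"
    have CW: "?C \<subseteq> W" using vW g(1) by (auto simp: cls_def ugraph_def)
    have fC: "finite ?C" by (rule finite_subset[OF CW fW])
    have vD: "X v \<notin> D" "Y v \<notin> D" using D vW by auto
    let ?I = "Q V c E (insert (X v) D)"
    have D1: "insert (X v) D \<subseteq> pvars V" using g(3) vV by simp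
    have hI: "hideal V ?I" by (rule hideal_Q[OF g(1,2) D1])
    have A: "tor V (add_var V ?I (Y v)) (Suc k) (Suc j) 0"
    proof -
      \<comment> \<open>If the deleted vertex represents its clique, its neighbour \<open>w\<close>
        takes over, so \<open>R\<close> keeps its size.\<close>
      let ?D = "insert (Y v) (insert (X v) D)" and ?R = "if v \<in> R then insert w (R - {v}) else R"
      have "add_var V ?I (Y v) = Q V c E ?D" using vV by (intro add_var_Q[OF g(1,2) D1]) simp
      also have "\<dots> = Q V c (del E v) ?D" using D1 vV by (intro Q_del[symmetric, OF g(1,2)]) auto
      finally have eq: "add_var V ?I (Y v) = Q V c (del E v) ?D" .
      have cW: "card (W - {v}) = card W - 1" "0 < card W" using vW fW by (auto simp: card_gt_0_iff)
      have cD: "card ?D = card D + 2" using vD fD by simp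
      have "w \<notin> R" if "v \<in> R" using R(2) that wv by blast
      then have cR: "card ?R = card R" using fR by (auto simp: card_Diff_singleton_if card_insert_if card_gt_0_iff
            simp del: card_0_eq) (metis card_gt_0_iff empty_iff Suc_pred)
      have indep: "\<not> E w r" if "v \<in> R" "r \<in> R - {v}" for r
        using that R(2) cl wv(2) unfolding cluster_def by blast
      then have indep': "\<not> E r w" if "v \<in> R" "r \<in> R - {v}" for r
        using that ugraph_sym[OF g(1)] by blast
      show ?thesis unfolding eq
      proof (rule less.hyps)
        show "card (W - {v}) < card W" using cW by simp
        show "ugraph (W - {v}) (del E v)" by (rule ugraph_del[OF g(1)])
        show "cluster (del E v)" by (rule cluster_del[OF cl])
        show "W - {v} \<subseteq> V" using g(2) by auto
        show "?D \<subseteq> pvars V" using D1 vV by simp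
        show "?D \<inter> pvars (W - {v}) = {}" using D by (auto simp: pvars_def)
        show "?R \<subseteq> W - {v}" using R(1) vW wv by auto
        show "\<forall>u\<in>?R. \<forall>w\<in>?R. \<not> del E v u w"
          using R(2) indep indep' ugraph_irrefl[OF g(1)] by (auto simp: del_def)
        show "card (W - {v}) + card ?D < Suc k + card ?R" using less.prems(8) cW unfolding cD cR by linarith
      qed
    qed
    have B: "tor V (colon V ?I (Y v)) (Suc k) j 0"
    proof -
      have eq: "colon V ?I (Y v) = Q V c (off E v) (D \<union> X ` ?C)"
        by (rule colon_Q[OF g cl D vW(1) vmax])
      have "X ` ?C \<subseteq> pvars W" using CW by auto
      then have "D \<inter> X ` ?C = {}" using D by blast
      then have cD: "card (D \<union> X ` ?C) = card D + card ?C"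
        using fD fC by (simp add: card_Un_disjoint card_image inj_on_def)
      have cW: "card (W - ?C) = card W - card ?C" "card ?C \<le> card W" "0 < card ?C"
        using CW fC fW vW by (auto simp: card_Diff_subset card_mono card_gt_0_iff cls_def)
      have "card (R \<inter> ?C) \<le> 1"
      proof -
        have "a = b" if "a \<in> R \<inter> ?C" "b \<in> R \<inter> ?C" for a b
          using that R(2) cl ugraph_sym[OF g(1)] unfolding cls_def cluster_def by blast
        then show ?thesis by (auto simp: card_le_Suc0_iff_eq fR)
      qed
      moreover have "card R = card (R - ?C) + card (R \<inter> ?C)"
        using card_Diff_subset_Int[of R ?C] fR card_mono[of R "R \<inter> ?C"] by simp
      ultimately have cR: "card R \<le> Suc (card (R - ?C))" by linarith
      show ?thesis unfolding eq
      proof (rule less.hyps)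
        show "card (W - ?C) < card W" using cW by linarith
        show "ugraph (W - ?C) (off E v)" by (rule ugraph_off[OF g(1)])
        show "cluster (off E v)" by (rule cluster_off[OF cl])
        show "W - ?C \<subseteq> V" using g(2) by auto
        show "D \<union> X ` ?C \<subseteq> pvars V" using g(2,3) CW by auto
        show "(D \<union> X ` ?C) \<inter> pvars (W - ?C) = {}" using D by (auto simp: pvars_def)
        show "R - ?C \<subseteq> W - ?C" using R(1) by auto
        show "\<forall>u\<in>R - ?C. \<forall>w\<in>R - ?C. \<not> off E v u w" using R(2) by (auto simp: off_def)
        show "card (W - ?C) + card (D \<union> X ` ?C) < Suc k + card (R - ?C)"
          using less.prems(8) cW cR unfolding cD by linarith
      qed
    qed
    have "tor V ?I (Suc k) (Suc j) 0" by (rule tor_colon_0[OF hI _ B A]) (simp add: vV)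
    moreover have "?I = add_var V (Q V c E D) (X v)" by (rule add_var_Q[symmetric, OF g]) (simp add: vV)
    ultimately show ?thesis
      using nzd_X[OF c g cl D vW(1) vmax] vV by (intro tor_nzd_0[OF hideal_Q[OF g], of "X v"]) auto
  qed
qed

text \<open>This is the last module of the Eagon-Northcott resolution of the 2-minors of a 2 x m
  matrix with m = \<open>card W\<close>: its rank is m - 1 and it lives in a single degree. In the
  recursion the colon ideal, generated by variables, contributes 1 and the clique without
  \<open>v\<close> contributes m - 2; the adjoined variables \<open>D\<close> shift both indices by
  their number.\<close>

lemma tor_clique:
  fixes c :: "'k::field"
  assumes c: "c = 0 \<or> c = 1"
  shows "ugraph W E \<Longrightarrow> (\<And>u w. u \<in> W \<Longrightarrow> w \<in> W \<Longrightarrow> u \<noteq> w \<Longrightarrow> E u w) \<Longrightarrow> W \<noteq> {} \<Longrightarrow> W \<subseteq> V \<Longrightarrow>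
    D \<subseteq> pvars V \<Longrightarrow> D \<inter> pvars W = {} \<Longrightarrow> 0 < l \<Longrightarrow>
    tor V (Q V c E D) (card W - 1 + card D) (card W - 1 + card D + l) (if l = 1 then card W - 1 else 0)"
proof (induction "card W" arbitrary: W E D rule: less_induct)
  case less
  note g = less.prems(1,4,5) and K = less.prems(2) and D = less.prems(6) and l = less.prems(7)
  have fW: "finite W" by (rule ugraph_finite[OF g(1)])
  have fD: "finite D" by (rule finite_subset[OF g(3) finite_pvars[OF finite_V]])
  have cl: "cluster E" unfolding cluster_def using K ugraph_verts[OF g(1)] by blast
  have W0: "0 < card W" using less.prems(3) fW by (simp add: card_gt_0_iff)
  show ?case
  proof (cases "card W = 1")
    case True
    then obtain u where u: "W = {u}" by (auto simp: card_Suc_eq)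
    have "E = (\<lambda>_ _. False)"
    proof (intro ext)
      show "E a b = False" for a b using ugraph_verts[OF g(1), of a b] ugraph_irrefl[OF g(1)] u by auto
    qed
    then show ?thesis using tor_vars[OF fD g(3), of "card D" "card D + l" c] True l
      by (cases "l = 1") simp_all
  next
    case False
    define v where "v = Max W"
    have vW: "v \<in> W" unfolding v_def using fW less.prems(3) by simp
    have vmax: "u < v" if "E u v" for u
    proof -
      have "u \<in> W" "u \<noteq> v" using ugraph_verts[OF g(1) that] ugraph_irrefl[OF g(1)] that by auto
      then show ?thesis unfolding v_def using fW by (simp add: order_less_le)
    qed
    have vV: "v \<in> V" using vW g(2) by auto
    have C: "cls E v = W"
    proof
      show "cls E v \<subseteq> W" using vW g(1) by (auto simp: cls_def ugraph_def)
      show "W \<subseteq> cls E v" using K[OF _ vW] by (auto simp: cls_def)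
    qed
    have vD: "X v \<notin> D" "Y v \<notin> D" using D vW by auto
    let ?I = "Q V c E (insert (X v) D)" and ?D = "insert (Y v) (insert (X v) D)"
    define p where "p = card W - 1 + card D"
    have D1: "insert (X v) D \<subseteq> pvars V" using g(3) vV by simp
    have hI: "hideal V ?I" by (rule hideal_Q[OF g(1,2) D1])
    have cW: "card (W - {v}) = card W - 1" using vW fW by simp
    have W1: "W - {v} \<noteq> {}"
    proof
      assume "W - {v} = {}"
      then have "card (W - {v}) = 0" by (simp only: card.empty)
      then show False using False W0 cW by simp
    qed
    have cD: "card ?D = card D + 2" using vD fD by simp
    have "add_var V ?I (Y v) = Q V c E ?D" using vV by (intro add_var_Q[OF g(1,2) D1]) simp
    also have "\<dots> = Q V c (del E v) ?D" using D1 vV by (intro Q_del[symmetric, OF g(1,2)]) auto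
    finally have eqA: "add_var V ?I (Y v) = Q V c (del E v) ?D" .
    have W2: "2 \<le> card W" using False W0 by linarith
    have A: "tor V (add_var V ?I (Y v)) (Suc p) (Suc (p + l)) (if l = 1 then card W - 2 else 0)"
    proof -
      have "tor V (Q V c (del E v) ?D) (card (W - {v}) - 1 + card ?D) (card (W - {v}) - 1 + card ?D + l)
          (if l = 1 then card (W - {v}) - 1 else 0)"
      proof (rule less.hyps[OF _ ugraph_del[OF g(1)]])
        show "card (W - {v}) < card W" using cW W0 by simp
        show "del E v u w" if "u \<in> W - {v}" "w \<in> W - {v}" "u \<noteq> w" for u w using that K by (auto simp: del_def)
        show "W - {v} \<noteq> {}" by (rule W1)
        show "W - {v} \<subseteq> V" using g(2) by auto
        show "?D \<subseteq> pvars V" using D1 vV by simp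
        show "?D \<inter> pvars (W - {v}) = {}" using D by (auto simp: pvars_def)
      qed (rule l)
      moreover have "card (W - {v}) - 1 + card ?D = Suc p" using W2 unfolding cW cD p_def by linarith
      moreover have "card (W - {v}) - 1 = card W - 2" using cW by simp
      ultimately show ?thesis unfolding eqA by (simp only: add_Suc)
    qed
    have A0: "tor V (add_var V ?I (Y v)) (Suc (Suc p)) (Suc (p + l)) 0"
    proof -
      obtain u where u: "u \<in> W - {v}" using W1 by auto
      show ?thesis unfolding eqA
      proof (rule tor_cluster_0[OF c ugraph_del[OF g(1)] cluster_del[OF cl], where R = "{u}"])
        show "W - {v} \<subseteq> V" using g(2) by auto
        show "?D \<subseteq> pvars V" using D1 vV by simp
        show "?D \<inter> pvars (W - {v}) = {}" using D by (auto simp: pvars_def)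
        show "{u} \<subseteq> W - {v}" using u by simp
        show "\<forall>a\<in>{u}. \<forall>w\<in>{u}. \<not> del E v a w" using ugraph_irrefl[OF g(1)] by (auto simp: del_def)
        show "card (W - {v}) + card ?D < Suc (Suc p) + card {u}" using W2 unfolding cW cD p_def by simp
      qed
    qed
    have "off E v = (\<lambda>_ _. False)" using C ugraph_verts[OF g(1)] by (auto simp: off_def fun_eq_iff)
    then have eqB: "colon V ?I (Y v) = Q V c (\<lambda>_ _. False) (D \<union> X ` W)"
      using colon_Q[OF g cl D vW vmax, of c] C by simp
    have "X ` W \<subseteq> pvars W" by auto
    then have "D \<inter> X ` W = {}" using D by blast
    then have cB: "card (D \<union> X ` W) = Suc p"
      using fD fW W0 by (simp add: card_Un_disjoint card_image inj_on_def p_def)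
    have fB: "finite (D \<union> X ` W)" "D \<union> X ` W \<subseteq> pvars V" using fD fW g by auto
    have B: "tor V (colon V ?I (Y v)) (Suc p) (p + l) (if l = 1 then 1 else 0)"
      using tor_vars[OF fB, of "Suc p" "p + l" c] l unfolding eqB cB by auto
    have B0: "tor V (colon V ?I (Y v)) p (p + l) 0"
      using tor_vars[OF fB, of p "p + l" c] l unfolding eqB by auto
    have "tor V ?I (Suc p) (Suc (p + l)) ((if l = 1 then 1 else 0) + (if l = 1 then card W - 2 else 0))"
      by (rule tor_colon_add[OF hI _ B A B0 A0]) (simp add: vV)
    then have "tor V ?I (Suc p) (Suc (p + l)) (if l = 1 then card W - 1 else 0)"
      using W2 by (cases "l = 1") (simp_all add: numeral_2_eq_2 Suc_diff_Suc)
    moreover have "?I = add_var V (Q V c E D) (X v)" by (rule add_var_Q[symmetric, OF g]) (simp add: vV)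
    moreover have "tor V (Q V c E D) (Suc p) (Suc (p + l)) 0"
    proof (rule tor_cluster_0[OF c g(1) cl g(2,3) D, where R = "{v}"])
      show "{v} \<subseteq> W" using vW by simp
      show "\<forall>a\<in>{v}. \<forall>w\<in>{v}. \<not> E a w" using ugraph_irrefl[OF g(1)] by auto
      show "card W + card D < Suc p + card {v}" using W2 unfolding p_def by simp
    qed
    ultimately show ?thesis
      using tor_nzd_iff[OF hideal_Q[OF g, of c], of "X v" p "p + l"] nzd_X[OF c g cl D vW vmax] vV
      unfolding p_def[symmetric] by auto
  qed
qed

end

section \<open>Edge ideals of general graphs and their initial ideals\<close>

definition cpl :: "(nat \<Rightarrow> nat \<Rightarrow> bool) \<Rightarrow> nat \<Rightarrow> nat \<Rightarrow> nat \<Rightarrow> bool" where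
  "cpl E i a b \<longleftrightarrow> E a b \<or> (E i a \<and> E i b \<and> a \<noteq> b)"

lemma ugraph_cpl: "ugraph W E \<Longrightarrow> ugraph W (cpl E i)"
  by (auto simp: ugraph_def cpl_def)

lemma restr_single_mult:
  assumes "\<And>k. k \<in> keys s \<Longrightarrow> P (m + k) \<longleftrightarrow> P m \<and> P k"
  shows "restr P (single m a * s) = (if P m then single m a * restr P s else (0 :: 'k::field mpoly))"
proof (rule poly_mapping_eqI)
  fix k
  show "lookup (restr P (single m a * s)) k = lookup (if P m then single m a * restr P s else 0) k"
  proof (cases "\<exists>k'. k = m + k'")
    case True
    then obtain k' where k: "k = m + k'" by blast
    show ?thesis
    proof (cases "k' \<in> keys s")
      case True
      then show ?thesis using assms[OF True] by (simp add: lookup_restr k lookup_single_mult)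
    next
      case False
      then show ?thesis by (simp add: lookup_restr k lookup_single_mult in_keys_iff)
    qed
  qed (simp add: lookup_restr lookup_single_mult_0)
qed

abbreviation avoid :: "pvar set \<Rightarrow> 'k::field mpoly \<Rightarrow> 'k mpoly" where
  "avoid D \<equiv> restr (\<lambda>m. keys m \<inter> D = {})"

lemma avoid_single_mult: "avoid D (single m a * s) = (if keys m \<inter> D = {} then single m a * avoid D s else 0)"
  by (rule restr_single_mult) (auto simp: keys_add_nat)

lemma avoid_bgen:
  assumes "X i \<notin> D" "Y i \<notin> D" "X j \<notin> D" "Y j \<notin> D"
  shows "avoid D (bgen c i j) = bgen c i j"
  by (rule restr_id) (use assms in \<open>auto dest!: keys_bgen simp: keys_add_nat\<close>)

lemma avoid_pv: "avoid D (pv v) = (if v \<in> D then 0 else pv v)"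
  by (auto simp: pv_def restr_single)

text \<open>Setting the variables of \<open>D2\<close> to zero either kills or fixes each
  generator.\<close>

lemma avoid_Q:
  assumes g: "ugraph W E" "W \<subseteq> V" "D1 \<subseteq> pvars V" and D: "pvars W \<inter> D2 = {}" and f: "f \<in> Q V c E (D1 \<union> D2)"
  shows "avoid D2 f \<in> Q V c E D1"
proof -
  note h = hideal_Q[OF g, of c]
  show ?thesis using f unfolding Q_def[of V c E "D1 \<union> D2"]
  proof (induction rule: idl.induct)
    case (idl_step m s p a)
    have "avoid D2 s \<in> Q V c E D1"
    proof -
      from idl_step(2) consider i j where "s = bgen c i j" "E i j" "i < j" | d where "s = pv d" "d \<in> D1 \<union> D2"
        by (auto simp: gens_def)
      then show ?thesis
      proof cases
        case 1
        have "i \<in> W" "j \<in> W" using ugraph_verts[OF g(1) 1(2)] by auto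
        then have "X i \<in> pvars W" "Y i \<in> pvars W" "X j \<in> pvars W" "Y j \<in> pvars W" by auto
        then have "avoid D2 s = s" unfolding 1(1) using D by (intro avoid_bgen) blast+
        then show ?thesis using 1 by (simp add: Q_edge)
      next
        case 2
        then show ?thesis by (auto simp: avoid_pv Q_var hideal_0[OF h])
      qed
    qed
    then have "avoid D2 (single m a * s) \<in> Q V c E D1"
      using idl_step(1) by (auto simp: avoid_single_mult hideal_0[OF h] intro: hideal_mult[OF h] polys_single)
    then show ?case using idl_step by (simp add: restr_add hideal_add[OF h])
  qed (simp add: hideal_0[OF h])
qed

lemma bgen_swap: "bgen 1 j i = - bgen (1 :: 'k::field) i j"
  by (simp add: bgen_def)

lemma Q_edge_1:
  assumes g: "ugraph W E" "W \<subseteq> V" "D \<subseteq> pvars V" and e: "E i j"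
  shows "bgen 1 i j \<in> Q V 1 E D"
proof (cases "i < j")
  case False
  then have "j < i" using e ugraph_irrefl[OF g(1)] by (metis linorder_neqE_nat)
  then have "bgen 1 j i \<in> Q V 1 E D" using ugraph_sym[OF g(1) e] by (intro Q_edge)
  then show ?thesis using hideal_uminus[OF hideal_Q[OF g]] by (subst bgen_swap) blast
qed (use e in \<open>rule Q_edge\<close>)

text \<open>For neighbours u, w of \<open>i\<close> with binomial f_uw, the Pluecker-type identity
  x_i f_uw = x_u f_iw - x_w f_iu, and the same with y, put x_i f_uw and y_i f_uw into J_G. Hence
  multiples of new generators by terms involving x_i or y_i lie in J_G already.\<close>

lemma Q_minus_avoid:
  assumes g: "ugraph W E" "W \<subseteq> V" "D \<subseteq> pvars V" and i: "i \<in> W" "X i \<notin> D" "Y i \<notin> D"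
    and f: "f \<in> Q V 1 (cpl E i) D"
  shows "f - avoid {X i, Y i} f \<in> Q V 1 E D"
proof -
  note h = hideal_Q[OF g, of "1 :: 'a"]
  define P where "P = {X i, Y i}"
  show ?thesis using f unfolding P_def[symmetric] Q_def[of V 1 "cpl E i"]
  proof (induction rule: idl.induct)
    case (idl_step m s p a)
    have old: "single m a * s - avoid P (single m a * s) \<in> Q V 1 E D"
      if "s \<in> Q V 1 E D" "avoid P s = s \<or> avoid P s = 0"
    proof -
      have "single m a * s \<in> Q V 1 E D" using that(1) idl_step(1) by (intro hideal_mult[OF h] polys_single)
      then show ?thesis using that(2) by (auto simp: avoid_single_mult hideal_0[OF h])
    qed
    have "single m a * s - avoid P (single m a * s) \<in> Q V 1 E D"
    proof -
      from idl_step(2) consider (new) u w where "s = bgen 1 u w" "E i u" "E i w" "u \<noteq> w"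
        | (edge) u w where "s = bgen 1 u w" "E u w" | (var) d where "s = pv d" "d \<in> D"
        by (auto simp: gens_def cpl_def)
      then show ?thesis
      proof cases
        case var
        then show ?thesis by (intro old) (auto simp: avoid_pv Q_var)
      next
        case edge
        have "avoid P s = s \<or> avoid P s = 0"
        proof (cases "u = i \<or> w = i")
          case True
          then have "avoid P s = 0" unfolding edge(1)
            by (intro restr_eq_0) (auto dest!: keys_bgen simp: keys_add_nat P_def)
          then show ?thesis ..
        next
          case False
          then have "avoid P s = s" unfolding edge(1) by (intro avoid_bgen) (auto simp: P_def)
          then show ?thesis ..
        qed
        then show ?thesis using edge by (intro old) (auto simp: Q_edge_1[OF g])
      next
        case new
        have uw: "u \<noteq> i" "w \<noteq> i" "u \<in> V" "w \<in> V" "i \<in> V" using new(2,3) g(1,2) by (auto simp: ugraph_def)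
        have av: "avoid P s = s" unfolding new(1) using uw by (intro avoid_bgen) (auto simp: P_def)
        have e: "bgen (1 :: 'a) i u \<in> Q V 1 E D" "bgen (1 :: 'a) i w \<in> Q V 1 E D" using new by (auto simp: Q_edge_1[OF g])
        have "pv (X u) * bgen (1 :: 'a) i w - pv (X w) * bgen (1 :: 'a) i u \<in> Q V 1 E D"
          using e uw by (intro hideal_diff[OF h] hideal_mult[OF h] polys_pv) auto
        moreover have "pv (X u) * bgen (1 :: 'a) i w - pv (X w) * bgen (1 :: 'a) i u = pv (X i) * s"
          by (simp add: new(1) bgen_eq algebra_simps)
        ultimately have x: "pv (X i) * s \<in> Q V 1 E D" by simp
        have "pv (Y u) * bgen (1 :: 'a) i w - pv (Y w) * bgen (1 :: 'a) i u \<in> Q V 1 E D"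
          using e uw by (intro hideal_diff[OF h] hideal_mult[OF h] polys_pv) auto
        moreover have "pv (Y u) * bgen (1 :: 'a) i w - pv (Y w) * bgen (1 :: 'a) i u = pv (Y i) * s"
          by (simp add: new(1) bgen_eq algebra_simps)
        ultimately have y: "pv (Y i) * s \<in> Q V 1 E D" by simp
        show ?thesis
        proof (cases "keys m \<inter> P = {}")
          case True
          then show ?thesis by (simp add: avoid_single_mult av hideal_0[OF h])
        next
          case False
          then obtain d where d: "d \<in> keys m" "pv d * s \<in> Q V 1 E D" using x y by (auto simp: P_def)
          have eq: "single m a * s = single (m - mvar d) a * (pv d * s)"
            using mvar_add_minus[OF d(1)] by (simp add: pv_def mult.assoc[symmetric] mult_single add.commute)
          have "keys (m - mvar d) \<subseteq> pvars V"
            using idl_step(1) mvar_add_minus[OF d(1)] keys_add_nat[of "mvar d" "m - mvar d"] by auto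
          then have "single (m - mvar d) a * (pv d * s) \<in> Q V 1 E D"
            by (intro hideal_mult[OF h d(2)] polys_single)
          then have "single m a * s \<in> Q V 1 E D" by (simp only: eq)
          moreover have "avoid P (single m a * s) = 0" using False by (simp only: avoid_single_mult if_False)
          ultimately show ?thesis by simp
        qed
      qed
    qed
    from hideal_add[OF h this idl_step(4)] show ?case by (simp add: restr_add algebra_simps)
  qed (simp add: hideal_0[OF h])
qed

lemma pvars_Diff_insert: "i \<in> V \<Longrightarrow> pvars (V - (W - {i})) = pvars (V - W) \<union> {X i, Y i}"
  by (auto simp: pvars_def)

text \<open>The decomposition is due to Ohtani: modulo \<open>J\<^sub>G\<close>, an element of \<open>J\<^bsub>G\<^sub>i\<^esub>\<close> only depends on its
  part without the variables \<open>x\<^sub>i\<close>, \<open>y\<^sub>i\<close>.\<close>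

lemma Q_Int:
  assumes g: "ugraph W E" "W \<subseteq> V" and i: "i \<in> W"
  shows "Q V 1 E (pvars (V - W)) =
    Q V 1 (cpl E i) (pvars (V - W)) \<inter> Q V 1 (del E i) (pvars (V - (W - {i})))" (is "?G = ?A \<inter> ?B")
proof
  have D: "pvars (V - W) \<subseteq> pvars V" by (auto simp: pvars_def)
  have iV: "i \<in> V" using i g by auto
  note h = hideal_Q[OF g D, of "1 :: 'a"]
  show "?G \<subseteq> ?A \<inter> ?B"
  proof (intro Int_greatest)
    show "?G \<subseteq> ?A" by (rule Q_mono) (auto simp: cpl_def)
    have "?G \<subseteq> Q V 1 E (pvars (V - (W - {i})))" using iV by (intro Q_mono) (auto simp: pvars_def)
    also have "\<dots> = ?B" by (rule Q_del[symmetric, OF g]) (use iV in \<open>auto simp: pvars_def\<close>)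
    finally show "?G \<subseteq> ?B" .
  qed
  show "?A \<inter> ?B \<subseteq> ?G"
  proof
    fix f assume f: "f \<in> ?A \<inter> ?B"
    have 1: "f - avoid {X i, Y i} f \<in> ?G" using f i by (intro Q_minus_avoid[OF g D]) auto
    \<comment> \<open>Setting x_i and y_i to zero carries the second ideal into that of G - i,
      without these two variables.\<close>
    have "avoid {X i, Y i} f \<in> Q V 1 (del E i) (pvars (V - W))"
    proof (rule avoid_Q[OF ugraph_del[OF g(1)]])
      show "f \<in> Q V 1 (del E i) (pvars (V - W) \<union> {X i, Y i})" using f pvars_Diff_insert[OF iV] by simp
      show "pvars (W - {i}) \<inter> {X i, Y i} = {}" by (auto simp: pvars_def)
    qed (use g D in auto)
    moreover have "Q V 1 (del E i) (pvars (V - W)) \<subseteq> ?G" by (rule Q_mono) (auto simp: del_def)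
    ultimately have "avoid {X i, Y i} f \<in> ?G" by blast
    from hideal_add[OF h 1 this] show "f \<in> ?G" by simp
  qed
qed

text \<open>Once x_i and y_i are adjoined, the edges of the completed graph at \<open>i\<close> are
  redundant, and those avoiding \<open>i\<close> all come from the first ideal.\<close>

lemma Q_sum:
  assumes g: "ugraph W E" "W \<subseteq> V" and i: "i \<in> W"
  shows "ideal_sum (Q V 1 (cpl E i) (pvars (V - W))) (Q V 1 (del E i) (pvars (V - (W - {i})))) =
    Q V (1 :: 'k::field) (del (cpl E i) i) (pvars (V - (W - {i})))" (is "ideal_sum ?A ?B = ?H")
proof
  let ?D = "pvars (V - W)" and ?D' = "pvars (V - (W - {i}))"
  have D: "?D \<subseteq> pvars V" "?D' \<subseteq> pvars V" "?D \<subseteq> ?D'" by (auto simp: pvars_def)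
  have iV: "i \<in> V" using i g by auto
  have hA: "hideal V ?A" by (rule hideal_Q[OF ugraph_cpl[OF g(1)] g(2) D(1)])
  have hB: "hideal V ?B" by (rule hideal_Q[OF ugraph_del[OF g(1)] _ D(2)]) (use g in auto)
  have hH: "hideal V ?H" by (rule hideal_Q[OF ugraph_del[OF ugraph_cpl[OF g(1)]] _ D(2)]) (use g in auto)
  have "?A \<subseteq> Q V 1 (cpl E i) ?D'" by (rule Q_mono[OF _ D(3)])
  also have "\<dots> = ?H" by (rule Q_del[symmetric, OF ugraph_cpl[OF g(1)] g(2) D(2)]) (use iV in \<open>auto simp: pvars_def\<close>)
  finally have AH: "?A \<subseteq> ?H" .
  have BH: "?B \<subseteq> ?H" by (rule Q_mono) (auto simp: del_def cpl_def)
  show "ideal_sum ?A ?B \<subseteq> ?H"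
  proof
    fix p assume "p \<in> ideal_sum ?A ?B"
    then obtain a b where "p = a + b" "a \<in> ?A" "b \<in> ?B" by (auto simp: ideal_sum_def)
    then show "p \<in> ?H" using AH BH hideal_add[OF hH] by auto
  qed
  have l: "a \<in> ideal_sum ?A ?B" if "a \<in> ?A" for a using that hideal_0[OF hB] unfolding ideal_sum_def by force
  have r: "b \<in> ideal_sum ?A ?B" if "b \<in> ?B" for b using that hideal_0[OF hA] unfolding ideal_sum_def by force
  show "?H \<subseteq> ideal_sum ?A ?B"
  proof (rule Q_least[OF hideal_ideal_sum[OF hA hB]])
    show "bgen 1 a b \<in> ideal_sum ?A ?B" if "del (cpl E i) i a b" "a < b" for a b
      using that by (intro l Q_edge) (auto simp: del_def)
    show "pv d \<in> ideal_sum ?A ?B" if "d \<in> ?D'" for d using that by (intro r Q_var)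
  qed
qed

subsection \<open>Leading monomials\<close>

lemma var_gt_irrefl: "\<not> var_gt u u"
  by (cases u) auto

lemma var_gt_total: "var_gt u v \<or> u = v \<or> var_gt v u"
  by (cases u; cases v) auto

lemma var_gt_trans: "var_gt u v \<Longrightarrow> var_gt v w \<Longrightarrow> var_gt u w"
  by (cases u; cases v; cases w) auto

lemma lex_less_irrefl: "\<not> lex_less m m"
  by (simp add: lex_less_def)

lemma lex_less_trans:
  assumes "lex_less a b" "lex_less b c"
  shows "lex_less a c"
proof -
  obtain v where v: "lookup a v < lookup b v" "\<And>u. var_gt u v \<Longrightarrow> lookup a u = lookup b u"
    using assms(1) by (auto simp: lex_less_def)
  obtain w where w: "lookup b w < lookup c w" "\<And>u. var_gt u w \<Longrightarrow> lookup b u = lookup c u"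
    using assms(2) by (auto simp: lex_less_def)
  consider "var_gt v w" | "v = w" | "var_gt w v" using var_gt_total by blast
  then show ?thesis
  proof cases
    case 1
    show ?thesis unfolding lex_less_def
    proof (intro exI[of _ v] conjI allI impI)
      show "lookup a v < lookup c v" using v(1) w(2)[OF 1] by simp
      show "lookup a u = lookup c u" if "var_gt u v" for u
        using v(2)[OF that] w(2)[OF var_gt_trans[OF that 1]] by simp
    qed
  next
    case 2
    then show ?thesis unfolding lex_less_def using v w by (intro exI[of _ v]) auto
  next
    case 3
    show ?thesis unfolding lex_less_def
    proof (intro exI[of _ w] conjI allI impI)
      show "lookup a w < lookup c w" using w(1) v(2)[OF 3] by simp
      show "lookup a u = lookup c u" if "var_gt u w" for u
        using w(2)[OF that] v(2)[OF var_gt_trans[OF that 3]] by simp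
    qed
  qed
qed

lemma ex_var_gt_max:
  assumes "finite S" "S \<noteq> {}"
  shows "\<exists>v\<in>S. \<forall>u. var_gt u v \<longrightarrow> u \<notin> S"
  using assms
proof (induction S rule: finite_ne_induct)
  case (singleton x)
  then show ?case using var_gt_irrefl by auto
next
  case (insert x S)
  then obtain v where v: "v \<in> S" "\<And>u. var_gt u v \<Longrightarrow> u \<notin> S" by blast
  show ?case
  proof (cases "var_gt x v")
    case True
    then show ?thesis using v var_gt_irrefl var_gt_trans by (intro bexI[of _ x]) auto
  next
    case False
    then show ?thesis using v by (intro bexI[of _ v]) auto
  qed
qed

lemma lex_less_total:
  assumes "m \<noteq> m'"
  shows "lex_less m m' \<or> lex_less m' m"
proof -
  let ?S = "{v \<in> keys m \<union> keys m'. lookup m v \<noteq> lookup m' v}"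
  have S: "v \<in> ?S \<longleftrightarrow> lookup m v \<noteq> lookup m' v" for v by (auto simp: in_keys_iff)
  have "?S \<noteq> {}" using assms S poly_mapping_eqI[of m m'] by blast
  then obtain v where "v \<in> ?S" and mx: "\<And>u. var_gt u v \<Longrightarrow> u \<notin> ?S" using ex_var_gt_max[of ?S] by auto
  then have v: "lookup m v \<noteq> lookup m' v" using S by blast
  have eq: "lookup m u = lookup m' u" if "var_gt u v" for u using mx[OF that] S[of u] by blast
  show ?thesis
  proof (cases "lookup m v < lookup m' v")
    case True
    then show ?thesis using eq unfolding lex_less_def by blast
  next
    case False
    then have "lookup m' v < lookup m v" using v by simp
    then show ?thesis using eq unfolding lex_less_def by force
  qed
qed

lemma lex_less_add: "lex_less m m' \<Longrightarrow> lex_less (n + m) (n + m')"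
  by (auto simp: lex_less_def lookup_add)

lemma leading_mon_exists:
  assumes "p \<noteq> 0"
  shows "\<exists>m. leading_mon p m"
proof -
  have "\<exists>m\<in>M. \<forall>m'\<in>M. m' \<noteq> m \<longrightarrow> lex_less m' m" if "finite M" "M \<noteq> {}" for M :: "mon set"
    using that
  proof (induction M rule: finite_ne_induct)
    case (insert x M)
    then obtain m where m: "m \<in> M" "\<And>m'. m' \<in> M \<Longrightarrow> m' \<noteq> m \<Longrightarrow> lex_less m' m" by blast
    show ?case
    proof (cases "lex_less x m")
      case True
      then show ?thesis using m by (intro bexI[of _ m]) auto
    next
      case False
      moreover have "x \<noteq> m" using insert.hyps m(1) by auto
      ultimately have mx: "lex_less m x" using lex_less_total[of x m] by blast
      have "lex_less m' x" if "m' \<in> M" for m'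
        using m(2)[OF that] lex_less_trans[OF _ mx, of m'] mx by (cases "m' = m") auto
      then show ?thesis by (intro bexI[of _ x]) auto
    qed
  qed simp
  from this[of "keys p"] show ?thesis using assms unfolding leading_mon_def by auto
qed

definition LM :: "'k::field mpoly set \<Rightarrow> mon set" where
  "LM I = {m. \<exists>f\<in>I. leading_mon f m}"

definition inI :: "nat set \<Rightarrow> 'k::field mpoly set \<Rightarrow> 'k mpoly set" where
  "inI V I = {p \<in> polys V. keys p \<subseteq> LM I}"

lemma LM_hom:
  assumes I: "hideal V I" and m: "m \<in> LM I"
  obtains f where "f \<in> I" "leading_mon f m" "lookup f m = 1" "\<And>k. k \<in> keys f \<Longrightarrow> mdeg k = mdeg m"
proof -
  obtain f where f: "f \<in> I" "leading_mon f m" using m by (auto simp: LM_def)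
  let ?g = "single 0 (inverse (lookup f m)) * hcomp (mdeg m) f"
  have nz: "lookup f m \<noteq> 0" using f(2) by (auto simp: leading_mon_def in_keys_iff)
  have lk: "lookup ?g k = (if mdeg k = mdeg m then inverse (lookup f m) * lookup f k else 0)" for k
    by (simp add: lookup_const_mult lookup_restr)
  have ks: "k \<in> keys ?g \<longleftrightarrow> k \<in> keys f \<and> mdeg k = mdeg m" for k
    using nz by (simp add: in_keys_iff lk)
  show thesis
  proof (rule that[of ?g])
    show "?g \<in> I" by (intro hideal_mult[OF I] hideal_hcomp[OF I] f polys_const)
    show "leading_mon ?g m" using f(2) by (auto simp: leading_mon_def ks)
    show "lookup ?g m = 1" using nz by (simp add: lk)
    show "mdeg k = mdeg m" if "k \<in> keys ?g" for k using that ks by blast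
  qed
qed

lemma LM_keys: "hideal V I \<Longrightarrow> m \<in> LM I \<Longrightarrow> keys m \<subseteq> pvars V"
  by (auto simp: LM_def leading_mon_def dest: hideal_polys polysD)

lemma LM_mult:
  assumes I: "hideal V I" and m: "m \<in> LM I" and n: "keys n \<subseteq> pvars V"
  shows "n + m \<in> LM I"
proof -
  obtain f where f: "f \<in> I" "leading_mon f m" using m by (auto simp: LM_def)
  have "leading_mon (single n 1 * f) (n + m)"
    unfolding leading_mon_def
  proof (intro conjI ballI impI)
    show "n + m \<in> keys (single n 1 * f)"
      using f(2) by (simp add: in_keys_iff lookup_single_mult leading_mon_def)
    fix k assume k: "k \<in> keys (single n 1 * f)" "k \<noteq> n + m"
    then obtain k' where k': "k = n + k'" using lookup_single_mult_0[of k n 1 f] by (auto simp: in_keys_iff)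
    then have "k' \<in> keys f" "k' \<noteq> m" using k by (auto simp: in_keys_iff lookup_single_mult)
    then show "lex_less k (n + m)" using f(2) k' by (auto simp: leading_mon_def lex_less_add)
  qed
  moreover have "single n 1 * f \<in> I" using f(1) n by (intro hideal_mult[OF I] polys_single)
  ultimately show ?thesis by (auto simp: LM_def)
qed

lemma hideal_inI:
  assumes I: "hideal V I"
  shows "hideal V (inI V I)"
proof (rule hidealI)
  show "p + q \<in> inI V I" if "p \<in> inI V I" "q \<in> inI V I" for p q
    using that Poly_Mapping.keys_add[of p q] by (auto simp: inI_def polys_add)
  show "q * p \<in> inI V I" if p: "p \<in> inI V I" and q: "q \<in> polys V" for p q
  proof -
    have "k \<in> LM I" if "k \<in> keys (q * p)" for k
    proof -
      from subsetD[OF keys_mult that] obtain a b where "k = a + b" "a \<in> keys q" "b \<in> keys p" by blast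
      then show ?thesis using p LM_mult[OF I, of b a] polysD[OF q] by (auto simp: inI_def)
    qed
    then show ?thesis using p q by (auto simp: inI_def polys_mult)
  qed
qed (auto simp: inI_def polys_restr keys_restr)

lemma initial_ideal_eq:
  assumes I: "hideal V I"
  shows "initial_ideal V I = inI V I"
proof -
  let ?S = "{single m 1 | m. \<exists>f\<in>I. leading_mon f m} :: 'a mpoly set"
  have S: "?S = (\<lambda>m. single m 1) ` LM I" by (auto simp: LM_def)
  have SP: "?S \<subseteq> polys V" unfolding S using LM_keys[OF I] by (auto intro: polys_single)
  have "idl V ?S \<subseteq> inI V I"
  proof
    fix p assume "p \<in> idl V ?S"
    then show "p \<in> inI V I"
      by (rule idl_least[OF hideal_inI[OF I], rotated]) (use SP in \<open>auto simp: inI_def S\<close>)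
  qed
  moreover have "p \<in> idl V ?S" if p: "p \<in> inI V I" for p
  proof (rule mpoly_induct_keys[where Q = "\<lambda>m. m \<in> LM I" and P = "\<lambda>p. p \<in> idl V ?S"])
    show "m \<in> LM I" if "m \<in> keys p" for m using p that by (auto simp: inI_def)
    show "single m c + q \<in> idl V ?S" if "m \<in> LM I" "q \<in> idl V ?S" for m c and q :: "'a mpoly"
    proof -
      have "single 0 c * single m 1 + q \<in> idl V ?S" using that by (intro idl_step) (auto simp: S)
      then show ?thesis by (simp add: mult_single)
    qed
  qed (rule idl_zero)
  ultimately show ?thesis unfolding initial_ideal_def genideal_idl[OF SP] by blast
qed

lemma LM_mono: "A \<subseteq> B \<Longrightarrow> LM A \<subseteq> LM B"
  by (auto simp: LM_def)

text \<open>Division by both ideals: the covering of leading monomials lets each leading term of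
  \<open>r\<close> be removed by an element of A or of B, with all terms staying below
  \<open>m\<close>. The descent ends because only finitely many monomials have degree at most
  \<open>e\<close>.\<close>

lemma LM_sum_split:
  assumes V: "finite V" and A: "hideal V A" and B: "hideal V B" and sub: "LM (ideal_sum A B) \<subseteq> LM A \<union> LM B"
  shows "r \<in> ideal_sum A B \<Longrightarrow> (\<And>k. k \<in> keys r \<Longrightarrow> mdeg k = e \<and> lex_less k m) \<Longrightarrow>
    \<exists>a\<in>A. \<exists>b\<in>B. r = a + b \<and> (\<forall>k\<in>keys a \<union> keys b. lex_less k m)"
proof (induction "card {n. keys n \<subseteq> pvars V \<and> mdeg n \<le> e \<and> lex_less n m}" arbitrary: r m rule: less_induct)
  case less
  note AB = hideal_ideal_sum[OF A B]
  show ?case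
  proof (cases "r = 0")
    case True
    then show ?thesis using hideal_0[OF A] hideal_0[OF B] by (intro bexI[of _ 0]) auto
  next
    case False
    then obtain m1 where m1: "leading_mon r m1" using leading_mon_exists by blast
    then have m1k: "m1 \<in> keys r" by (simp add: leading_mon_def)
    have m1m: "mdeg m1 = e" "lex_less m1 m" using less.prems(2)[OF m1k] by auto
    have m1V: "keys m1 \<subseteq> pvars V" using polysD[OF hideal_polys[OF AB less.prems(1)] m1k] .
    have "m1 \<in> LM A \<union> LM B" using sub less.prems(1) m1 by (auto simp: LM_def)
    then obtain f where f: "f \<in> A \<or> f \<in> B" "leading_mon f m1" "lookup f m1 = 1" "\<And>k. k \<in> keys f \<Longrightarrow> mdeg k = mdeg m1"
      using LM_hom[OF A, of m1] LM_hom[OF B, of m1] by (metis UnE)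
    define g where "g = single 0 (lookup r m1) * f"
    have g: "g \<in> A \<or> g \<in> B" unfolding g_def using f(1) hideal_mult[OF A] hideal_mult[OF B] polys_const by blast
    have gAB: "g \<in> ideal_sum A B"
      using g hideal_0[OF A] hideal_0[OF B] unfolding ideal_sum_def by force
    have kg: "k \<in> keys f" if "k \<in> keys g" for k using that by (auto simp: g_def in_keys_iff lookup_const_mult)
    have lt: "mdeg k = e \<and> lex_less k m1" if k: "k \<in> keys (r - g)" for k
    proof -
      have "lookup (r - g) m1 = 0" by (simp add: g_def lookup_minus lookup_const_mult f(3))
      then have "k \<noteq> m1" using k by (auto simp: in_keys_iff)
      moreover have "k \<in> keys r \<or> k \<in> keys f" using k kg keys_diff[of r g] by blast
      ultimately show ?thesis using m1 f(2,4) m1m less.prems(2)[of k] by (auto simp: leading_mon_def)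
    qed
    have "{n. keys n \<subseteq> pvars V \<and> mdeg n \<le> e \<and> lex_less n m1} \<subset> {n. keys n \<subseteq> pvars V \<and> mdeg n \<le> e \<and> lex_less n m}"
    proof
      show "{n. keys n \<subseteq> pvars V \<and> mdeg n \<le> e \<and> lex_less n m1} \<subseteq> {n. keys n \<subseteq> pvars V \<and> mdeg n \<le> e \<and> lex_less n m}"
        using lex_less_trans m1m by blast
      show "{n. keys n \<subseteq> pvars V \<and> mdeg n \<le> e \<and> lex_less n m1} \<noteq> {n. keys n \<subseteq> pvars V \<and> mdeg n \<le> e \<and> lex_less n m}"
        using m1m m1V lex_less_irrefl by blast
    qed
    moreover have "finite {n. keys n \<subseteq> pvars V \<and> mdeg n \<le> e \<and> lex_less n m}"
      by (rule finite_subset[OF _ finite_monomials[OF finite_pvars[OF V], of e]]) auto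
    ultimately have "card {n. keys n \<subseteq> pvars V \<and> mdeg n \<le> e \<and> lex_less n m1} < card {n. keys n \<subseteq> pvars V \<and> mdeg n \<le> e \<and> lex_less n m}"
      by (rule psubset_card_mono[rotated])
    from less.hyps[OF this hideal_diff[OF AB less.prems(1) gAB] lt]
    obtain a b where ab: "a \<in> A" "b \<in> B" "r - g = a + b" "\<And>k. k \<in> keys a \<union> keys b \<Longrightarrow> lex_less k m1" by blast
    have gm: "lex_less k m" if "k \<in> keys g" for k
      using kg[OF that] f(2) m1m lex_less_trans unfolding leading_mon_def by metis
    have abm: "lex_less k m" if "k \<in> keys a \<union> keys b" for k using ab(4)[OF that] m1m lex_less_trans by blast
    show ?thesis
    proof (cases "g \<in> A")
      case True
      have "r = (g + a) + b" using ab(3) by (simp add: algebra_simps)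
      moreover have "lex_less k m" if "k \<in> keys (g + a) \<union> keys b" for k
        using that Poly_Mapping.keys_add[of g a] gm abm by blast
      ultimately show ?thesis using hideal_add[OF A True ab(1)] ab(2) by blast
    next
      case False
      then have gB: "g \<in> B" using g by simp
      have "r = a + (g + b)" using ab(3) by (simp add: algebra_simps)
      moreover have "lex_less k m" if "k \<in> keys a \<union> keys (g + b)" for k
        using that Poly_Mapping.keys_add[of g b] gm abm by blast
      ultimately show ?thesis using hideal_add[OF B gB ab(2)] ab(1) by blast
    qed
  qed
qed

text \<open>Monic \<open>f\<close> in A and \<open>g\<close> in B with the same leading monomial
  \<open>m\<close> differ by an element of A + B with smaller terms. If it splits as a + b with
  smaller terms, then f - a = g + b lies in both ideals and still has leading monomial
  \<open>m\<close>.\<close>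

lemma inI_Int:
  assumes V: "finite V" and A: "hideal V A" and B: "hideal V B" and sub: "LM (ideal_sum A B) \<subseteq> LM A \<union> LM B"
  shows "inI V (A \<inter> B) = inI V A \<inter> inI V B"
proof -
  have "m \<in> LM (A \<inter> B)" if m: "m \<in> LM A" "m \<in> LM B" for m
  proof -
    obtain f where f: "f \<in> A" "leading_mon f m" "lookup f m = 1" "\<And>k. k \<in> keys f \<Longrightarrow> mdeg k = mdeg m"
      using LM_hom[OF A m(1)] by blast
    obtain g where g: "g \<in> B" "leading_mon g m" "lookup g m = 1" "\<And>k. k \<in> keys g \<Longrightarrow> mdeg k = mdeg m"
      using LM_hom[OF B m(2)] by blast
    have "f - g = f + - g" by simp
    then have "f - g \<in> ideal_sum A B" using f(1) hideal_uminus[OF B g(1)] unfolding ideal_sum_def by blast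
    moreover have "mdeg k = mdeg m \<and> lex_less k m" if k: "k \<in> keys (f - g)" for k
    proof -
      have "lookup (f - g) m = 0" by (simp add: lookup_minus f(3) g(3))
      then have "k \<noteq> m" using k by (auto simp: in_keys_iff)
      moreover have "k \<in> keys f \<or> k \<in> keys g" using k keys_diff[of f g] by blast
      ultimately show ?thesis using f(2) g(2) f(4)[of k] g(4)[of k] unfolding leading_mon_def by blast
    qed
    ultimately obtain a b where ab: "a \<in> A" "b \<in> B" "f - g = a + b" "\<And>k. k \<in> keys a \<union> keys b \<Longrightarrow> lex_less k m"
      using LM_sum_split[OF V A B sub, of "f - g" "mdeg m" m] by blast
    have "f - a = g + b" using ab(3) by (simp add: algebra_simps)
    then have "f - a \<in> A \<inter> B" using hideal_diff[OF A f(1) ab(1)] hideal_add[OF B g(1) ab(2)] by simp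
    moreover have "leading_mon (f - a) m"
      unfolding leading_mon_def
    proof (intro conjI ballI impI)
      have "lookup a m = 0" using ab(4)[of m] lex_less_irrefl by (auto simp: in_keys_iff)
      then show "m \<in> keys (f - a)" by (simp add: in_keys_iff lookup_minus f(3))
      show "lex_less k m" if "k \<in> keys (f - a)" "k \<noteq> m" for k
        using that keys_diff[of f a] ab(4)[of k] f(2) unfolding leading_mon_def by blast
    qed
    ultimately show ?thesis by (auto simp: LM_def)
  qed
  moreover have "LM (A \<inter> B) \<subseteq> LM A \<inter> LM B" by (auto simp: LM_def)
  ultimately have "LM (A \<inter> B) = LM A \<inter> LM B" by blast
  then show ?thesis by (auto simp: inI_def)
qed

lemma inI_sum:
  assumes A: "hideal V A" and B: "hideal V B" and sub: "LM (ideal_sum A B) \<subseteq> LM A \<union> LM B"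
  shows "ideal_sum (inI V A) (inI V B) = inI V (ideal_sum A B)"
proof
  have "A \<subseteq> ideal_sum A B" "B \<subseteq> ideal_sum A B"
    using hideal_0[OF A] hideal_0[OF B] by (force simp: ideal_sum_def)+
  then have L: "LM A \<subseteq> LM (ideal_sum A B)" "LM B \<subseteq> LM (ideal_sum A B)" by (simp_all add: LM_mono)
  show "ideal_sum (inI V A) (inI V B) \<subseteq> inI V (ideal_sum A B)"
  proof
    fix p assume "p \<in> ideal_sum (inI V A) (inI V B)"
    then obtain a b where p: "p = a + b" "a \<in> inI V A" "b \<in> inI V B" unfolding ideal_sum_def by blast
    have "keys (a + b) \<subseteq> LM (ideal_sum A B)"
      using p(2,3) L Poly_Mapping.keys_add[of a b] unfolding inI_def by blast
    then show "p \<in> inI V (ideal_sum A B)" using p by (simp add: inI_def polys_add)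
  qed
  show "inI V (ideal_sum A B) \<subseteq> ideal_sum (inI V A) (inI V B)"
  proof
    fix p assume p: "p \<in> inI V (ideal_sum A B)"
    let ?a = "restr (\<lambda>m. m \<in> LM A) p" and ?b = "restr (\<lambda>m. m \<notin> LM A) p"
    have "p = ?a + ?b" by (rule poly_mapping_eqI) (simp add: lookup_add lookup_restr)
    moreover have "?a \<in> inI V A" using p by (auto simp: inI_def polys_restr keys_restr)
    moreover have "?b \<in> inI V B" using p sub by (auto simp: inI_def polys_restr keys_restr)
    ultimately show "p \<in> ideal_sum (inI V A) (inI V B)" unfolding ideal_sum_def by blast
  qed
qed

text \<open>A leading monomial with a variable of an absent vertex belongs to the second ideal.
  Otherwise these variables can be set to zero in the polynomial without losing the leading term,
  and the result needs only edges of the completed graph that avoid \<open>i\<close>.\<close>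

lemma LM_Q_sub:
  assumes g: "ugraph W E" "W \<subseteq> V" and i: "i \<in> W"
  shows "LM (Q V (1 :: 'k::field) (del (cpl E i) i) (pvars (V - (W - {i})))) \<subseteq>
    LM (Q V (1 :: 'k) (cpl E i) (pvars (V - W))) \<union> LM (Q V (1 :: 'k) (del E i) (pvars (V - (W - {i}))))"
    (is "LM ?H \<subseteq> LM ?A \<union> LM ?B")
proof
  let ?D' = "pvars (V - (W - {i}))"
  have D: "?D' \<subseteq> pvars V" by (auto simp: pvars_def)
  have hB: "hideal V ?B" by (rule hideal_Q[OF ugraph_del[OF g(1)] _ D]) (use g in auto)
  note ugH = ugraph_del[OF ugraph_cpl[OF g(1), of i], of i]
  have hH: "hideal V ?H" by (rule hideal_Q[OF ugH _ D]) (use g in auto)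
  fix m assume m: "m \<in> LM ?H"
  show "m \<in> LM ?A \<union> LM ?B"
  proof (cases "keys m \<inter> ?D' = {}")
    case False
    then obtain d where d: "d \<in> keys m" "d \<in> ?D'" by blast
    have "single (m - mvar d) 1 * pv d \<in> ?B"
      using LM_keys[OF hH m] mvar_add_minus[OF d(1)] keys_add_nat[of "mvar d" "m - mvar d"] d(2)
      by (intro hideal_mult[OF hB] Q_var polys_single) auto
    moreover have "single (m - mvar d) 1 * pv d = (single m 1 :: 'k mpoly)"
      using mvar_add_minus[OF d(1)] by (simp add: pv_def mult_single add.commute)
    ultimately have "single m 1 \<in> ?B" by simp
    moreover have "leading_mon (single m (1 :: 'k)) m" by (simp add: leading_mon_def)
    ultimately show ?thesis by (auto simp: LM_def)
  next
    case True
    obtain f where f: "f \<in> ?H" "leading_mon f m" using m by (auto simp: LM_def)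
    have "avoid ?D' f \<in> Q V 1 (del (cpl E i) i) {}"
      by (rule avoid_Q[OF ugH]) (use f g in \<open>auto simp: pvars_def\<close>)
    moreover have "Q V 1 (del (cpl E i) i) {} \<subseteq> ?A" by (rule Q_mono) (auto simp: del_def)
    ultimately have "avoid ?D' f \<in> ?A" by blast
    moreover have "leading_mon (avoid ?D' f) m"
      using f(2) True by (auto simp: leading_mon_def keys_restr)
    ultimately show ?thesis by (auto simp: LM_def)
  qed
qed

text \<open>The binomials form a Groebner basis: a standard leading monomial \<open>m\<close> would
  have a smaller \<open>m'\<close> in its fibre. At the first x_i where they differ \<open>m\<close>
  has a surplus, the exchange partner \<open>j\<close> must come after \<open>i\<close>, and so x_i
  y_j divides \<open>m\<close>, a contradiction.\<close>

lemma inI_cluster: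
  assumes g: "ugraph W E" "W \<subseteq> V" "D \<subseteq> pvars V" and cl: "cluster E" and D: "D \<inter> pvars W = {}"
  shows "inI V (Q V (1 :: 'k::field) E D) = Q V (0 :: 'k) E D"
proof -
  let ?Q = "Q V (1 :: 'k) E D"
  note h = hideal_Q[OF g, of "1 :: 'k"]
  have "m \<in> LM ?Q \<longleftrightarrow> nonstd E D m" if mV: "keys m \<subseteq> pvars V" for m
  proof
    assume "nonstd E D m"
    then consider d where "d \<in> D" "d \<in> keys m" | i j where "E i j" "i < j" "X i \<in> keys m" "Y j \<in> keys m"
      by (auto simp: nonstd_def)
    then show "m \<in> LM ?Q"
    proof cases
      case 1
      have "leading_mon (pv d :: 'k mpoly) (mvar d)" by (simp add: leading_mon_def pv_def)
      then have "mvar d \<in> LM ?Q" using Q_var[OF 1(1)] by (auto simp: LM_def)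
      moreover have "keys (m - mvar d) \<subseteq> pvars V"
        using mV mvar_add_minus[OF 1(2)] keys_add_nat[of "mvar d" "m - mvar d"] by auto
      ultimately have "(m - mvar d) + mvar d \<in> LM ?Q" by (intro LM_mult[OF h])
      then show ?thesis using mvar_add_minus[OF 1(2)] by (simp add: add.commute)
    next
      case 2
      obtain n where n: "m = n + (mvar (X i) + mvar (Y j))" using mvar2_add_minus[OF 2(3,4)] by blast
      have lt: "lex_less (mvar (X j) + mvar (Y i)) (mvar (X i) + mvar (Y j))"
        unfolding lex_less_def
      proof (intro exI[of _ "X i"] conjI allI impI)
        show "lookup (mvar (X j) + mvar (Y i)) (X i) < lookup (mvar (X i) + mvar (Y j)) (X i)"
          using 2(2) by (simp add: lookup_add lookup_single when_def)
        show "lookup (mvar (X j) + mvar (Y i)) u = lookup (mvar (X i) + mvar (Y j)) u" if "var_gt u (X i)" for u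
          using that 2(2) by (cases u) (auto simp: lookup_add lookup_single when_def)
      qed
      then have ne: "mvar (X j) + mvar (Y i) \<noteq> mvar (X i) + mvar (Y j)" using lex_less_irrefl by metis
      have "leading_mon (bgen (1 :: 'k) i j) (mvar (X i) + mvar (Y j))"
        unfolding leading_mon_def
      proof (intro conjI ballI impI)
        show "mvar (X i) + mvar (Y j) \<in> keys (bgen (1 :: 'k) i j)"
          using ne by (auto simp: bgen_def in_keys_iff lookup_minus lookup_single when_def)
        show "lex_less k (mvar (X i) + mvar (Y j))" if "k \<in> keys (bgen (1 :: 'k) i j)" "k \<noteq> mvar (X i) + mvar (Y j)" for k
          using keys_bgen[OF that(1)] that(2) lt by blast
      qed
      then have "mvar (X i) + mvar (Y j) \<in> LM ?Q" 
        using Q_edge[of E i j "1 :: 'k" V D, OF 2(1,2)] by (auto simp: LM_def)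
      then show ?thesis unfolding n using mV by (intro LM_mult[OF h, of "mvar (X i) + mvar (Y j)"]) (simp_all add: n keys_add_nat)
    qed
  next
    assume "m \<in> LM ?Q"
    then obtain f where f: "f \<in> ?Q" "leading_mon f m" by (auto simp: LM_def)
    show "nonstd E D m"
    proof (rule ccontr)
      assume std: "\<not> nonstd E D m"
      have "sig_sum E D m f = 0" using f(1) unfolding Q_1_iff[OF g cl D] by blast
      moreover have "m \<in> keys f" using f(2) by (simp add: leading_mon_def)
      moreover have "keys m \<inter> D = {}" using std by (auto simp: nonstd_def)
      ultimately obtain m' where m': "m' \<in> keys f" "m' \<noteq> m" "same_sig E m' m" by (rule sig_sum_partner)
      then have sm: "same_sig E m m'" by (simp add: same_sig_def)
      have "lex_less m' m" using f(2) m' by (simp add: leading_mon_def)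
      then obtain v where v: "lookup m' v < lookup m v" "\<And>u. var_gt u v \<Longrightarrow> lookup m' u = lookup m u"
        by (auto simp: lex_less_def)
      show False
      proof (cases v)
        case (X i)
        then have "lookup m' (X i) < lookup m (X i)" using v(1) by simp
        then obtain j where j: "E j i" "lookup m (X j) < lookup m' (X j)" "X i \<in> keys m" "Y j \<in> keys m"
          by (rule same_sig_exchange[OF g(1) sm])
        have "\<not> j < i" using v(2)[of "X j"] X j(2) by auto
        moreover have "j \<noteq> i" using j(1) ugraph_irrefl[OF g(1)] by auto
        ultimately have "i < j" by simp
        then show False using std j ugraph_sym[OF g(1) j(1)] by (auto simp: nonstd_def)
      next
        case (Y i)
        \<comment> \<open>A first difference at y_i is impossible: x_i precedes y_i, and the totals
          at \<open>i\<close> agree.\<close>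
        then have "lookup m' (X i) = lookup m (X i)" using v(2)[of "X i"] by simp
        moreover have "lookup m (X i) + lookup m (Y i) = lookup m' (X i) + lookup m' (Y i)"
          using sm by (simp add: same_sig_def)
        ultimately show False using v(1) Y by simp
      qed
    qed
  qed
  then have "p \<in> inI V ?Q \<longleftrightarrow> p \<in> Q V 0 E D" for p
    unfolding Q_0_iff[OF g] inI_def using polysD by blast
  then show ?thesis by blast
qed

section \<open>Block graphs\<close>

text \<open>Blocks being cliques, phrased with paths: neighbours of \<open>v\<close> that lie in one
  component of G - v are adjacent. In this form the property can be followed through
  \<open>del\<close> and \<open>cpl\<close> without mention of blocks.\<close>

definition bgraph :: "(nat \<Rightarrow> nat \<Rightarrow> bool) \<Rightarrow> bool" where
  "bgraph E \<longleftrightarrow> (\<forall>v u w. E v u \<longrightarrow> E v w \<longrightarrow> u \<noteq> w \<longrightarrow> (del E v)\<^sup>*\<^sup>* u w \<longrightarrow> E u w)"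

definition simplicial :: "(nat \<Rightarrow> nat \<Rightarrow> bool) \<Rightarrow> nat \<Rightarrow> bool" where
  "simplicial E v \<longleftrightarrow> (\<forall>a b. E v a \<longrightarrow> E v b \<longrightarrow> a \<noteq> b \<longrightarrow> E a b)"

text \<open>For block graphs this means that no vertex has clique degree \<open>2\<close>, that is, indecomposability.\<close>

definition branching :: "(nat \<Rightarrow> nat \<Rightarrow> bool) \<Rightarrow> bool" where
  "branching E \<longleftrightarrow> (\<forall>v. \<not> simplicial E v \<longrightarrow> (\<exists>a b c. E v a \<and> E v b \<and> E v c \<and>
     a \<noteq> b \<and> a \<noteq> c \<and> b \<noteq> c \<and> \<not> E a b \<and> \<not> E a c \<and> \<not> E b c))"

definition inner :: "nat set \<Rightarrow> (nat \<Rightarrow> nat \<Rightarrow> bool) \<Rightarrow> nat set" where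
  "inner W E = {v \<in> W. \<not> simplicial E v}"

lemma bgraphD: "bgraph E \<Longrightarrow> E v u \<Longrightarrow> E v w \<Longrightarrow> u \<noteq> w \<Longrightarrow> (del E v)\<^sup>*\<^sup>* u w \<Longrightarrow> E u w"
  unfolding bgraph_def by blast

lemma bgraph_del:
  assumes "bgraph E"
  shows "bgraph (del E i)"
  unfolding bgraph_def
proof (intro allI impI)
  fix v u w assume *: "del E i v u" "del E i v w" "u \<noteq> w" "(del (del E i) v)\<^sup>*\<^sup>* u w"
  have "del (del E i) v \<le> del E v" by (auto simp: del_def)
  then have "(del E v)\<^sup>*\<^sup>* u w" using *(4) by (blast dest: rtranclp_mono)
  then show "del E i u w" using bgraphD[OF assms, of v u w] * by (auto simp: del_def)
qed

text \<open>A new edge from \<open>a\<close> to \<open>b\<close> is replaced by the detour through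
  \<open>i\<close>, which avoids \<open>v\<close>.\<close>

lemma rtranclp_cpl:
  assumes g: "ugraph W E" and v: "v \<noteq> i" and r: "(del (cpl E i) v)\<^sup>*\<^sup>* u w"
  shows "(del E v)\<^sup>*\<^sup>* u w"
  using r
proof (induction rule: rtranclp_induct)
  case (step a b)
  have "(del E v)\<^sup>*\<^sup>* a b"
  proof (cases "E a b")
    case True
    then show ?thesis using step(2) by (auto simp: del_def)
  next
    case False
    then have "del E v a i" "del E v i b" using step(2) v ugraph_sym[OF g] by (auto simp: del_def cpl_def)
    then show ?thesis by (meson rtranclp.rtrancl_into_rtrancl rtranclp.rtrancl_refl)
  qed
  then show ?case using step(3) by (rule rtranclp_trans[rotated])
qed simp

lemma rtranclp_cpl_all:
  assumes g: "ugraph W E" and r: "(cpl E i)\<^sup>*\<^sup>* u w"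
  shows "E\<^sup>*\<^sup>* u w"
  using r
proof (induction rule: rtranclp_induct)
  case (step a b)
  have "E\<^sup>*\<^sup>* a b"
  proof (cases "E a b")
    case False
    then have "E a i" "E i b" using step(2) ugraph_sym[OF g] by (auto simp: cpl_def)
    then show ?thesis by (meson rtranclp.rtrancl_into_rtrancl rtranclp.rtrancl_refl)
  qed auto
  then show ?case using step(3) by (rule rtranclp_trans[rotated])
qed simp

text \<open>A new edge would mean a detour through \<open>i\<close> joining \<open>a\<close> and
  \<open>b\<close> outside \<open>v\<close>, so that they were adjacent before.\<close>

lemma cpl_nbr_iff:
  assumes g: "ugraph W E" "bgraph E" and v: "v \<noteq> i" "E v a" "E v b"
  shows "cpl E i a b \<longleftrightarrow> E a b"
proof
  assume c: "cpl E i a b"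
  show "E a b"
  proof (rule ccontr)
    assume n: "\<not> E a b"
    then have e: "E i a" "E i b" "a \<noteq> b" using c by (auto simp: cpl_def)
    have av: "a \<noteq> v" "b \<noteq> v" using v ugraph_irrefl[OF g(1)] by auto
    have "del E v a i" "del E v i b" using e av v ugraph_sym[OF g(1)] by (auto simp: del_def)
    then have "(del E v)\<^sup>*\<^sup>* a b" by (meson rtranclp.rtrancl_into_rtrancl rtranclp.rtrancl_refl)
    then show False using bgraphD[OF g(2) v(2,3) e(3)] n by blast
  qed
qed (simp add: cpl_def)

text \<open>Paths avoiding \<open>v\<close> in the completed graph yield such paths in the old one.
  Edges at \<open>v\<close> are old or lie in the new clique of \<open>i\<close>; when both kinds
  meet, the old neighbour reaches \<open>i\<close> outside \<open>v\<close>, hence equals or is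
  adjacent to \<open>i\<close> and belongs to the new clique.\<close>

lemma bgraph_cpl:
  assumes g: "ugraph W E" "bgraph E"
  shows "bgraph (cpl E i)"
  unfolding bgraph_def
proof (intro allI impI)
  fix v u w assume *: "cpl E i v u" "cpl E i v w" "u \<noteq> w" "(del (cpl E i) v)\<^sup>*\<^sup>* u w"
  show "cpl E i u w"
  proof (cases "v = i")
    case True
    then show ?thesis using * ugraph_irrefl[OF g(1)] by (auto simp: cpl_def)
  next
    case v: False
    have r: "(del E v)\<^sup>*\<^sup>* u w" by (rule rtranclp_cpl[OF g(1) v *(4)])
    have mixed: "cpl E i a b" if ab: "E v a" "E i v" "E i b" "a \<noteq> b" "(del E v)\<^sup>*\<^sup>* a b" "b \<noteq> v" for a b
    proof (cases "a = i")
      case True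
      then show ?thesis using ab by (simp add: cpl_def)
    next
      case False
      have "del E v b i" using ab v ugraph_sym[OF g(1)] by (auto simp: del_def)
      then have "(del E v)\<^sup>*\<^sup>* a i" using ab(5) by (meson rtranclp.rtrancl_into_rtrancl)
      then have "E a i" using bgraphD[OF g(2) ab(1) _ False] ugraph_sym[OF g(1) ab(2)] by blast
      then show ?thesis using ab ugraph_sym[OF g(1)] by (auto simp: cpl_def)
    qed
    have sym: "(del E v)\<^sup>*\<^sup>* w u"
    proof -
      have "symp (del E v)" using ugraph_sym[OF g(1)] by (auto simp: symp_def del_def)
      then show ?thesis using sympD[OF symp_rtranclp r] by blast
    qed
    have nv: "u \<noteq> v" "w \<noteq> v" using *(1,2) ugraph_irrefl[OF g(1)] by (auto simp: cpl_def)
    consider "E v u" "E v w" | "E v u" "E i v" "E i w" | "E v w" "E i v" "E i u" | "E i u" "E i w"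
      using *(1,2) by (auto simp: cpl_def)
    then show ?thesis
    proof cases
      case 1
      then show ?thesis using bgraphD[OF g(2) _ _ *(3) r] by (simp add: cpl_def)
    next
      case 2
      then show ?thesis using mixed[OF _ _ _ *(3) r] nv by blast
    next
      case 3
      then have "cpl E i w u" using mixed[OF _ _ _ _ sym] nv *(3) by blast
      then show ?thesis using ugraph_sym[OF g(1)] by (auto simp: cpl_def)
    next
      case 4
      then show ?thesis using *(3) by (simp add: cpl_def)
    qed
  qed
qed

lemma simplicial_cpl_self: "ugraph W E \<Longrightarrow> simplicial (cpl E i) i"
proof -
  assume g: "ugraph W E"
  have "E i a" if "cpl E i i a" for a using that ugraph_irrefl[OF g] by (auto simp: cpl_def)
  then show ?thesis by (auto simp: simplicial_def cpl_def)
qed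

lemma simplicial_cpl:
  assumes g: "ugraph W E" "bgraph E" and v: "v \<noteq> i"
  shows "simplicial (cpl E i) v \<longleftrightarrow> simplicial E v"
proof
  assume s: "simplicial (cpl E i) v"
  show "simplicial E v" unfolding simplicial_def
  proof (intro allI impI)
    fix a b assume ab: "E v a" "E v b" "a \<noteq> b"
    then have "cpl E i v a" "cpl E i v b" by (auto simp: cpl_def)
    then have "cpl E i a b" using s ab(3) unfolding simplicial_def by blast
    then show "E a b" using cpl_nbr_iff[OF g v ab(1,2)] by simp
  qed
next
  assume s: "simplicial E v"
  have mixed: "cpl E i a b" if ab: "E v a" "E i v" "E i b" "a \<noteq> b" for a b
  proof (cases "a = i")
    case False
    then have "E a i" using s ab(1) ugraph_sym[OF g(1) ab(2)] unfolding simplicial_def by blast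
    then show ?thesis using ab ugraph_sym[OF g(1)] by (auto simp: cpl_def)
  qed (use ab in \<open>simp add: cpl_def\<close>)
  show "simplicial (cpl E i) v" unfolding simplicial_def
  proof (intro allI impI)
    fix a b assume ab: "cpl E i v a" "cpl E i v b" "a \<noteq> b"
    consider "E v a" "E v b" | "E v a" "E i v" "E i b" | "E v b" "E i v" "E i a" | "E i a" "E i b"
      using ab(1,2) by (auto simp: cpl_def)
    then show "cpl E i a b"
    proof cases
      case 1
      then have "E a b" using s ab(3) unfolding simplicial_def by blast
      then show ?thesis by (simp add: cpl_def)
    next
      case 2
      then show ?thesis using mixed ab(3) by blast
    next
      case 3
      then have "cpl E i b a" using mixed ab(3) by blast
      then show ?thesis using ugraph_sym[OF g(1)] by (auto simp: cpl_def)
    next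
      case 4
      then show ?thesis using ab(3) by (simp add: cpl_def)
    qed
  qed
qed

lemma simplicial_del: "simplicial E v \<Longrightarrow> simplicial (del E i) v"
  by (auto simp: simplicial_def del_def)

lemma nonsimplicial_nbrs:
  assumes "\<not> simplicial E i"
  obtains a b where "E i a" "E i b" "a \<noteq> b" "\<not> E a b"
  using assms unfolding simplicial_def by blast

text \<open>An edge from \<open>w\<close> to \<open>b\<close> would give the path i, w, b outside
  \<open>v\<close> and force \<open>i\<close> and \<open>b\<close> to be adjacent.\<close>

lemma replace_nbr:
  assumes g: "ugraph W E" "bgraph E" and e: "E v i" "E i w" "w \<noteq> v" "E v b" "b \<noteq> i" "\<not> E i b"
  shows "\<not> cpl E i w b" "w \<noteq> b"
proof -
  have ne: "i \<noteq> v" "b \<noteq> v" using e ugraph_irrefl[OF g(1)] by auto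
  show "\<not> cpl E i w b"
  proof
    assume "cpl E i w b"
    then have "E w b" using e by (auto simp: cpl_def)
    then have "del E v i w" "del E v w b" using e ne by (auto simp: del_def)
    then have "(del E v)\<^sup>*\<^sup>* i b" by (meson rtranclp.rtrancl_into_rtrancl rtranclp.rtrancl_refl)
    then show False using bgraphD[OF g(2) e(1,4)] e by blast
  qed
  show "w \<noteq> b" using e by auto
qed

text \<open>A vertex \<open>i\<close> among independent neighbours of \<open>v\<close> can be replaced by another neighbour \<open>w\<close> of \<open>i\<close>
  when \<open>i\<close> is removed from the completed graph.\<close>

lemma replace_nbr_pair:
  assumes g: "ugraph W E" "bgraph E" and v: "v \<noteq> i" and w: "E i w" "w \<noteq> v"
    and xy: "E v x" "E v y" "x \<noteq> y" "\<not> E x y"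
  defines "r \<equiv> \<lambda>x. if x = i then w else x"
  shows "del (cpl E i) i v (r x)" "r x \<noteq> r y" "\<not> del (cpl E i) i (r x) (r y)"
proof -
  have wi: "w \<noteq> i" using w ugraph_irrefl[OF g(1)] by auto
  show "del (cpl E i) i v (r x)"
    using v w wi xy ugraph_sym[OF g(1)] by (auto simp: r_def del_def cpl_def)
  consider "x \<noteq> i" "y \<noteq> i" | "x = i" "y \<noteq> i" | "x \<noteq> i" "y = i" using xy by blast
  then have "r x \<noteq> r y \<and> \<not> cpl E i (r x) (r y)"
  proof cases
    case 1
    then show ?thesis using xy cpl_nbr_iff[OF g v xy(1,2)] by (simp add: r_def)
  next
    case 2
    then show ?thesis using replace_nbr[OF g _ w, of y] xy by (simp add: r_def)
  next
    case 3
    have "\<not> cpl E i w x \<and> w \<noteq> x"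
      using replace_nbr[OF g _ w, of x] xy 3 ugraph_sym[OF g(1), of i x] by auto
    moreover have "cpl E i x w \<Longrightarrow> cpl E i w x" using ugraph_sym[OF g(1)] by (auto simp: cpl_def)
    ultimately show ?thesis using 3 by (auto simp: r_def)
  qed
  then show "r x \<noteq> r y" "\<not> del (cpl E i) i (r x) (r y)" by (auto simp: del_def)
qed

lemma second_nbr:
  assumes "E i a" "E i b" "a \<noteq> b"
  obtains w where "E i w" "w \<noteq> v"
  using assms by metis

text \<open>A nonsimplicial \<open>i\<close> has a neighbour besides \<open>v\<close> that stands in
  for it among nonadjacent neighbours of \<open>v\<close>, so deleting \<open>i\<close> after
  completion frees no vertex. This is why the number of free vertices is preserved.\<close>

lemma simplicial_cpl_del:
  assumes g: "ugraph W E" "bgraph E" and i: "\<not> simplicial E i" and v: "v \<noteq> i"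
  shows "simplicial (del (cpl E i) i) v \<longleftrightarrow> simplicial E v"
proof
  assume "simplicial E v"
  then show "simplicial (del (cpl E i) i) v" using simplicial_cpl[OF g v] simplicial_del by blast
next
  assume s: "simplicial (del (cpl E i) i) v"
  show "simplicial E v"
  proof (rule ccontr)
    assume "\<not> simplicial E v"
    then obtain x y where xy: "E v x" "E v y" "x \<noteq> y" "\<not> E x y" by (rule nonsimplicial_nbrs)
    obtain a b where "E i a" "E i b" "a \<noteq> b" using i by (rule nonsimplicial_nbrs)
    then obtain w where w: "E i w" "w \<noteq> v" by (rule second_nbr)
    have "\<not> E y x" using xy ugraph_sym[OF g(1)] by blast
    then show False
      using replace_nbr_pair[OF g v w xy] replace_nbr_pair(1)[OF g v w xy(2,1) xy(3)[symmetric]] s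
      unfolding simplicial_def by blast
  qed
qed

lemma branching_cpl:
  assumes g: "ugraph W E" "bgraph E" "branching E"
  shows "branching (cpl E i)"
  unfolding branching_def
proof (intro allI impI)
  fix v assume n: "\<not> simplicial (cpl E i) v"
  then have v: "v \<noteq> i" using simplicial_cpl_self[OF g(1)] by auto
  then have "\<not> simplicial E v" using n simplicial_cpl[OF g(1,2)] by blast
  then obtain a b c where abc: "E v a" "E v b" "E v c" "a \<noteq> b" "a \<noteq> c" "b \<noteq> c" "\<not> E a b" "\<not> E a c" "\<not> E b c"
    using g(3) unfolding branching_def by blast
  then show "\<exists>a b c. cpl E i v a \<and> cpl E i v b \<and> cpl E i v c \<and> a \<noteq> b \<and> a \<noteq> c \<and> b \<noteq> c \<and>
      \<not> cpl E i a b \<and> \<not> cpl E i a c \<and> \<not> cpl E i b c"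
    using cpl_nbr_iff[OF g(1,2) v] by (intro exI[of _ a] exI[of _ b] exI[of _ c]) (simp add: cpl_def[of _ _ v])
qed

lemma branching_cpl_del:
  assumes g: "ugraph W E" "bgraph E" "branching E" and i: "\<not> simplicial E i"
  shows "branching (del (cpl E i) i)"
  unfolding branching_def
proof (intro allI impI)
  fix v assume n: "\<not> simplicial (del (cpl E i) i) v"
  then have v: "v \<noteq> i" by (auto simp: simplicial_def del_def)
  then have "\<not> simplicial E v" using n simplicial_cpl_del[OF g(1,2) i] by blast
  then obtain a b c where abc: "E v a" "E v b" "E v c" "a \<noteq> b" "a \<noteq> c" "b \<noteq> c" "\<not> E a b" "\<not> E a c" "\<not> E b c"
    using g(3) unfolding branching_def by blast
  obtain a' b' where "E i a'" "E i b'" "a' \<noteq> b'" using i by (rule nonsimplicial_nbrs)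
  then obtain w where w: "E i w" "w \<noteq> v" by (rule second_nbr)
  define r where "r = (\<lambda>x. if x = i then w else x)"
  have pr: "del (cpl E i) i v (r x) \<and> r x \<noteq> r y \<and> \<not> del (cpl E i) i (r x) (r y)"
    if "E v x" "E v y" "x \<noteq> y" "\<not> E x y" for x y
    using replace_nbr_pair[OF g(1,2) v w that] by (simp add: r_def)
  have "\<not> E c a" using abc ugraph_sym[OF g(1)] by blast
  then have "del (cpl E i) i v (r c)" using pr[of c a] abc by blast
  then show "\<exists>a b c. del (cpl E i) i v a \<and> del (cpl E i) i v b \<and> del (cpl E i) i v c \<and> a \<noteq> b \<and> a \<noteq> c \<and> b \<noteq> c \<and>
      \<not> del (cpl E i) i a b \<and> \<not> del (cpl E i) i a c \<and> \<not> del (cpl E i) i b c"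
    using pr[OF abc(1,2,4,7)] pr[OF abc(1,3,5,8)] pr[OF abc(2,3,6,9)] by blast
qed

lemma rtranclp_cpl_del:
  assumes g: "ugraph W E" and u: "u \<noteq> i" and r: "E\<^sup>*\<^sup>* u z" and z: "z \<noteq> i"
  shows "(del (cpl E i) i)\<^sup>*\<^sup>* u z"
proof -
  let ?H = "del (cpl E i) i"
  \<comment> \<open>While the walk sits at \<open>i\<close>, the invariant keeps all neighbours of
    \<open>i\<close> reachable, so it may leave in any direction.\<close>
  have "(z \<noteq> i \<longrightarrow> ?H\<^sup>*\<^sup>* u z) \<and> (z = i \<longrightarrow> (\<forall>y. E i y \<longrightarrow> ?H\<^sup>*\<^sup>* u y))"
    using r
  proof (induction rule: rtranclp_induct)
    case base
    then show ?case using u by simp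
  next
    case (step z z')
    show ?case
    proof (cases "z' = i")
      case False
      show ?thesis
      proof (cases "z = i")
        case True
        then show ?thesis using step False by simp
      next
        case nz: False
        have "?H z z'" using step(2) False nz by (simp add: del_def cpl_def)
        then show ?thesis using step(3) nz False by (auto intro: rtranclp.rtrancl_into_rtrancl)
      qed
    next
      case True
      have nz: "z \<noteq> i" using step(2) True ugraph_irrefl[OF g] by auto
      have "?H\<^sup>*\<^sup>* u y" if y: "E i y" for y
      proof (cases "y = z")
        case True
        then show ?thesis using step(3) nz by simp
      next
        case False
        have "y \<noteq> i" using y ugraph_irrefl[OF g] by auto
        then have "?H z y" using step(2) True y nz False ugraph_sym[OF g] by (auto simp: del_def cpl_def)
        then show ?thesis using step(3) nz by (auto intro: rtranclp.rtrancl_into_rtrancl)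
      qed
      then show ?thesis using True by simp
    qed
  qed
  then show ?thesis using z by simp
qed

lemma inner_cpl:
  assumes g: "ugraph W E" "bgraph E"
  shows "inner W (cpl E i) = inner W E - {i}"
proof -
  have "v \<in> inner W (cpl E i) \<longleftrightarrow> v \<in> inner W E - {i}" for v
    using simplicial_cpl[OF g, of v i] simplicial_cpl_self[OF g(1), of i] by (cases "v = i") (auto simp: inner_def)
  then show ?thesis by blast
qed

lemma inner_del: "inner (W - {i}) (del E i) \<subseteq> inner W E - {i}"
  using simplicial_del by (auto simp: inner_def)

lemma inner_cpl_del:
  assumes g: "ugraph W E" "bgraph E" and i: "\<not> simplicial E i"
  shows "inner (W - {i}) (del (cpl E i) i) = inner W E - {i}"
  using simplicial_cpl_del[OF g i] by (auto simp: inner_def)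

lemma cluster_iff_inner: "ugraph W E \<Longrightarrow> inner W E = {} \<Longrightarrow> cluster E"
  unfolding cluster_def inner_def simplicial_def using ugraph_sym ugraph_verts by blast

subsection \<open>From graphs to adjacency relations\<close>

abbreviation adj :: "nat graph \<Rightarrow> nat \<Rightarrow> nat \<Rightarrow> bool" where
  "adj G u v \<equiv> {u, v} \<in> edges G"

lemma ugraph_adj:
  assumes "simple_graph G"
  shows "ugraph (verts G) (adj G)"
  unfolding ugraph_def
proof (intro conjI allI impI)
  show "finite (verts G)" using assms by (simp add: simple_graph_def)
  fix u v assume uv: "adj G u v"
  then have "{u, v} \<subseteq> verts G" "card {u, v} = 2" using assms by (auto simp: simple_graph_def)
  then show "u \<in> verts G" "v \<in> verts G" "u \<noteq> v" by auto
  show "adj G v u" using uv by (simp add: insert_commute)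
qed

lemma maximal_clique_exists:
  assumes G: "simple_graph G" and C: "clique G C"
  shows "\<exists>D. maximal_clique G D \<and> C \<subseteq> D"
proof -
  have fin: "finite (verts G)" using G by (simp add: simple_graph_def)
  let ?P = "\<lambda>D. clique G D \<and> C \<subseteq> D"
  have "\<forall>D. ?P D \<longrightarrow> card D < Suc (card (verts G))"
    using fin by (auto simp: clique_def card_mono less_Suc_eq_le)
  then obtain D where D: "?P D" "\<And>D'. ?P D' \<Longrightarrow> card D' \<le> card D"
    using ex_has_greatest_nat[of ?P C card "Suc (card (verts G))"] C by blast
  have "D' = D" if "clique G D'" "D \<subseteq> D'" for D'
  proof -
    have "finite D'" using that fin finite_subset by (auto simp: clique_def)
    moreover have "card D' \<le> card D" using D that by blast
    ultimately show ?thesis using that(2) card_seteq[of D' D] by blast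
  qed
  then show ?thesis using D by (auto simp: maximal_clique_def)
qed

text \<open>The closed neighbourhood of a simplicial vertex is its only maximal clique; two
  nonadjacent neighbours lie in different maximal cliques.\<close>

lemma cdeg_simplicial:
  assumes G: "simple_graph G" and v: "v \<in> verts G"
  shows "simplicial (adj G) v \<Longrightarrow> cdeg G v = 1" "\<not> simplicial (adj G) v \<Longrightarrow> cdeg G v > 1"
proof -
  note ug = ugraph_adj[OF G]
  assume s: "simplicial (adj G) v"
  let ?N = "insert v {u. adj G v u}"
  have sub: "C \<subseteq> ?N" if "clique G C" "v \<in> C" for C using that by (auto simp: clique_def)
  have N: "clique G ?N"
    unfolding clique_def
  proof (intro conjI ballI impI)
    show "?N \<subseteq> verts G" using v ugraph_verts[OF ug] by blast
    show "adj G a b" if "a \<in> ?N" "b \<in> ?N" "a \<noteq> b" for a b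
      using that s ugraph_sym[OF ug] unfolding simplicial_def by blast
  qed
  have "{C. maximal_clique G C \<and> v \<in> C} = {?N}"
  proof (intro Set.set_eqI iffI)
    fix C assume "C \<in> {C. maximal_clique G C \<and> v \<in> C}"
    then have "C \<subseteq> ?N" "\<And>D. clique G D \<Longrightarrow> C \<subseteq> D \<Longrightarrow> D = C" using sub by (auto simp: maximal_clique_def)
    then show "C \<in> {?N}" using N by blast
  next
    fix C assume "C \<in> {?N}"
    then have C: "C = ?N" by simp
    have "D = C" if "clique G D" "C \<subseteq> D" for D using sub[OF that(1)] that(2) C by blast
    then have "maximal_clique G C" using N C unfolding maximal_clique_def by blast
    then show "C \<in> {C. maximal_clique G C \<and> v \<in> C}" using C by simp
  qed
  then show "cdeg G v = 1" by (simp add: cdeg_def)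
next
  note ug = ugraph_adj[OF G]
  assume "\<not> simplicial (adj G) v"
  then obtain a b where ab: "adj G v a" "adj G v b" "a \<noteq> b" "\<not> adj G a b" by (rule nonsimplicial_nbrs)
  have cl: "clique G {v, u}" if "adj G v u" for u
    using that ugraph_verts[OF ug that] by (auto simp: clique_def insert_commute)
  obtain A where A: "maximal_clique G A" "{v, a} \<subseteq> A" using maximal_clique_exists[OF G cl[OF ab(1)]] by blast
  obtain B where B: "maximal_clique G B" "{v, b} \<subseteq> B" using maximal_clique_exists[OF G cl[OF ab(2)]] by blast
  have "A \<noteq> B" using A B ab by (auto simp: maximal_clique_def clique_def)
  moreover have "finite {C. maximal_clique G C \<and> v \<in> C}"
  proof (rule finite_subset[of _ "Pow (verts G)"])
    show "finite (Pow (verts G))" using G by (simp add: simple_graph_def)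
  qed (auto simp: maximal_clique_def clique_def)
  moreover have "{A, B} \<subseteq> {C. maximal_clique G C \<and> v \<in> C}" using A B by auto
  ultimately have "card {A, B} \<le> cdeg G v" unfolding cdeg_def by (intro card_mono)
  then show "cdeg G v > 1" using \<open>A \<noteq> B\<close> by simp
qed

lemma free_vertex_iff: "simple_graph G \<Longrightarrow> free_vertex G v \<longleftrightarrow> v \<in> verts G \<and> simplicial (adj G) v"
  using cdeg_simplicial[of G v]
  by (cases "v \<in> verts G"; cases "simplicial (adj G) v") (auto simp: free_vertex_def)

lemma inner_vertex_iff: "simple_graph G \<Longrightarrow> inner_vertex G v \<longleftrightarrow> v \<in> inner (verts G) (adj G)"
  using cdeg_simplicial[of G v]
  by (cases "v \<in> verts G"; cases "simplicial (adj G) v") (auto simp: inner_vertex_def inner_def)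

lemma rtranclp_adj: "(adj G)\<^sup>*\<^sup>* u v \<longleftrightarrow> (u, v) \<in> {(u, v). {u, v} \<in> edges G}\<^sup>*"
  by (simp add: rtrancl_def)

lemma connected_graph_iff:
  "connected_graph G \<longleftrightarrow> verts G \<noteq> {} \<and> (\<forall>u\<in>verts G. \<forall>v\<in>verts G. (adj G)\<^sup>*\<^sup>* u v)"
  unfolding connected_graph_def reachable_def rtranclp_adj by blast

section \<open>Paths, cycles and blocks\<close>

lemma rtranclp_distinct_path:
  assumes "r\<^sup>*\<^sup>* u w"
  shows "\<exists>xs. xs \<noteq> [] \<and> hd xs = u \<and> last xs = w \<and> distinct xs \<and> successively r xs"
  using assms
proof (induction rule: converse_rtranclp_induct)
  case base
  then show ?case by (intro exI[of _ "[w]"]) simp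
next
  case (step u v)
  then obtain xs where xs: "xs \<noteq> []" "hd xs = v" "last xs = w" "distinct xs" "successively r xs" by blast
  show ?case
  proof (cases "u \<in> set xs")
    case True
    then obtain ys zs where "xs = ys @ u # zs" by (meson split_list)
    then show ?thesis using xs by (intro exI[of _ "u # zs"]) (auto simp: successively_append_iff)
  next
    case False
    then show ?thesis using xs step(1) by (intro exI[of _ "u # xs"]) (auto simp: successively_Cons)
  qed
qed

lemma successively_rtranclp:
  assumes "successively r xs" "xs \<noteq> []"
  shows "r\<^sup>*\<^sup>* (hd xs) (last xs)"
  using assms
proof (induction xs rule: induct_list012)
  case (3 x y zs)
  then show ?case by (auto intro: converse_rtranclp_into_rtranclp)
qed auto

definition induced :: "'a graph \<Rightarrow> 'a set \<Rightarrow> 'a graph" where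
  "induced G P = (P, {e \<in> edges G. e \<subseteq> P})"

lemma subgraph_induced: "simple_graph G \<Longrightarrow> P \<subseteq> verts G \<Longrightarrow> subgraph (induced G P) G"
  by (auto simp: subgraph_def simple_graph_def induced_def intro: finite_subset)

lemma not_cutpoint:
  assumes H: "connected_graph H"
    and conn: "\<And>u w. u \<in> verts H - {x} \<Longrightarrow> w \<in> verts H - {x} \<Longrightarrow> (adj (delete_vertex H x))\<^sup>*\<^sup>* u w"
  shows "\<not> cutpoint H x"
proof
  assume c: "cutpoint H x"
  have R: "reachable (delete_vertex H x) = (verts H - {x}) \<times> (verts H - {x})"
    using conn unfolding reachable_def rtranclp_adj by (auto simp: delete_vertex_def)
  have "components (delete_vertex H x) \<subseteq> {verts H - {x}}"
    unfolding components_def R by (auto simp: quotient_def delete_vertex_def)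
  then have "card (components (delete_vertex H x)) \<le> 1"
    using card_mono[of "{verts H - {x}}"] by simp
  moreover have "reachable H = verts H \<times> verts H" using H by (auto simp: connected_graph_def reachable_def)
  then have "components H = {verts H}" using H by (auto simp: components_def quotient_def connected_graph_def)
  ultimately show False using c by (simp add: cutpoint_def)
qed

text \<open>Vertices and edges are counted together because subgraphs need not be induced.\<close>

lemma block_exists:
  assumes G: "simple_graph G" and H: "nonseparable_subgraph H G"
  shows "\<exists>B. block B G \<and> subgraph H B"
proof -
  have fin: "finite (verts G)" using G by (simp add: simple_graph_def)
  have finE: "finite (edges G)"
    by (rule finite_subset[of _ "Pow (verts G)"]) (use G fin in \<open>auto simp: simple_graph_def\<close>)
  let ?P = "\<lambda>B. nonseparable_subgraph B G \<and> subgraph H B" and ?f = "\<lambda>B. card (verts B) + card (edges B)"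
  have sub: "verts B \<subseteq> verts G" "edges B \<subseteq> edges G" "simple_graph B" if "nonseparable_subgraph B G" for B
    using that by (auto simp: nonseparable_subgraph_def subgraph_def)
  have "?f B < Suc (card (verts G) + card (edges G))" if "?P B" for B
    using sub[of B] that card_mono[OF fin, of "verts B"] card_mono[OF finE, of "edges B"] by linarith
  moreover have "?P H" using H sub[OF H] by (auto simp: subgraph_def)
  ultimately obtain B where B: "?P B" "\<And>B'. ?P B' \<Longrightarrow> ?f B' \<le> ?f B"
    using ex_has_greatest_nat[of ?P H ?f "Suc (card (verts G) + card (edges G))"] by blast
  have "B' = B" if B': "nonseparable_subgraph B' G" "subgraph B B'" for B'
  proof -
    have le: "verts B \<subseteq> verts B'" "edges B \<subseteq> edges B'" using B'(2) by (auto simp: subgraph_def)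
    have "subgraph H B'" using B(1) le by (auto simp: subgraph_def)
    then have "?f B' \<le> ?f B" using B(2) B'(1) by blast
    moreover have fv: "finite (verts B')" by (rule finite_subset[OF sub(1)[OF B'(1)] fin])
    moreover have fe: "finite (edges B')" by (rule finite_subset[OF sub(2)[OF B'(1)] finE])
    moreover have "card (verts B) \<le> card (verts B')" "card (edges B) \<le> card (edges B')"
      using le fv fe by (auto intro: card_mono)
    ultimately have "card (verts B') \<le> card (verts B)" "card (edges B') \<le> card (edges B)" by linarith+
    then have "verts B = verts B'" "edges B = edges B'" using le fv fe card_seteq by metis+
    then show ?thesis by (simp add: prod_eq_iff)
  qed
  then show ?thesis using B(1) unfolding block_def by blast
qed

lemma adj_induced: "adj (induced G P) a b \<longleftrightarrow> adj G a b \<and> a \<in> P \<and> b \<in> P"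
  by (auto simp: induced_def)

lemma adj_delete_vertex: "adj (delete_vertex H x) a b \<longleftrightarrow> adj H a b \<and> a \<noteq> x \<and> b \<noteq> x"
  by (auto simp: delete_vertex_def)

lemma rtranclp_sym: "ugraph W E \<Longrightarrow> E\<^sup>*\<^sup>* a b \<Longrightarrow> E\<^sup>*\<^sup>* b a"
proof -
  assume g: "ugraph W E" and r: "E\<^sup>*\<^sup>* a b"
  have "symp E" using ugraph_sym[OF g] by (auto simp: symp_def)
  then show ?thesis using sympD[OF symp_rtranclp r] by blast
qed

text \<open>A cycle is nonseparable: deleting a vertex leaves every other vertex connected to \<open>v\<close> along one
  of the two arcs.\<close>

lemma cycle_nonseparable:
  assumes G: "simple_graph G" and v: "adj G v u" "adj G v w" and xs: "xs \<noteq> []" "hd xs = u" "last xs = w"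
    "distinct xs" "successively (del (adj G) v) xs" "v \<notin> set xs"
  shows "nonseparable_subgraph (induced G (insert v (set xs))) G"
proof -
  note ug = ugraph_adj[OF G]
  let ?P = "insert v (set xs)"
  let ?H = "induced G ?P"
  have uw: "u \<in> set xs" "w \<in> set xs" using xs(1-3) by auto
  have "y \<in> verts G" if "y \<in> set xs" for y
  proof -
    from that obtain ys zs where yz: "xs = ys @ y # zs" by (meson split_list)
    show ?thesis
    proof (cases ys rule: rev_cases)
      case Nil
      then have "y = u" using yz xs(2) by simp
      then show ?thesis using ugraph_verts[OF ug v(1)] by simp
    next
      case (snoc ys' y')
      then have "del (adj G) v y' y" using xs(5) yz by (simp add: successively_append_iff)
      then show ?thesis using ugraph_verts[OF ug, of y' y] by (simp add: del_def)
    qed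
  qed
  then have sub: "subgraph ?H G" using G ugraph_verts[OF ug v(1)] by (intro subgraph_induced) auto
  then have sH: "simple_graph ?H" by (simp add: subgraph_def)
  note ugH = ugraph_adj[OF sH]
  have conn: "(adj (delete_vertex ?H x))\<^sup>*\<^sup>* a b" if ab: "a \<in> ?P - {x}" "b \<in> ?P - {x}" for a b x
  proof -
    let ?E = "adj (delete_vertex ?H x)"
    have ugE: "ugraph (verts ?H - {x}) ?E"
      using ugraph_del[OF ugH, of x] unfolding adj_delete_vertex del_def .
    have path: "?E\<^sup>*\<^sup>* (hd ys) (last ys)" if ys: "successively (del (adj G) v) ys" "ys \<noteq> []" "set ys \<subseteq> set xs - {x}" for ys
    proof (rule successively_rtranclp[OF _ ys(2)])
      have EE: "?E a b" if "a \<in> set ys" "b \<in> set ys" "del (adj G) v a b" for a b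
        using that ys(3) unfolding adj_delete_vertex adj_induced by (auto simp: del_def)
      show "successively ?E ys" by (rule successively_mono[OF ys(1)]) (rule EE)
    qed
    \<comment> \<open>Everything that remains is connected to one hub: \<open>v\<close>, or the end
      \<open>u\<close> of the path when \<open>v\<close> itself is deleted.\<close>
    define c where "c = (if x = v then u else v)"
    have "?E\<^sup>*\<^sup>* y c" if y: "y \<in> ?P - {x}" for y
    proof (cases "y = v")
      case True
      then show ?thesis using y by (simp add: c_def)
    next
      case False
      then have "y \<in> set xs" "y \<noteq> x" using y by auto
      then obtain ys zs where yz: "xs = ys @ y # zs" by (meson split_list)
      have s1: "successively (del (adj G) v) (ys @ [y])" "successively (del (adj G) v) (y # zs)"
        using xs(5) unfolding yz by (auto simp: successively_append_iff)
      have h: "hd (ys @ [y]) = u" "last (y # zs) = w" using xs(2,3) unfolding yz by (cases ys; simp)+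
      have disj: "set ys \<inter> set zs = {}" "y \<notin> set zs" "y \<notin> set ys" using xs(4) unfolding yz by auto
      show ?thesis
      proof (cases "x \<in> set ys")
        case True
        then have "x \<noteq> v" using xs(6) yz by auto
        have "set (y # zs) \<subseteq> set xs - {x}" using True disj \<open>y \<noteq> x\<close> yz by auto
        then have "?E\<^sup>*\<^sup>* y w" using path[OF s1(2)] h(2) by simp
        moreover have "w \<noteq> x"
          using \<open>set (y # zs) \<subseteq> set xs - {x}\<close> last_in_set[of "y # zs"] h(2) by auto
        then have "?E w v" using v(2) ugraph_sym[OF ug v(2)] uw \<open>x \<noteq> v\<close>
          unfolding adj_delete_vertex adj_induced by auto
        ultimately show ?thesis using \<open>x \<noteq> v\<close> by (simp add: c_def rtranclp.rtrancl_into_rtrancl)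
      next
        case False
        then have s: "set (ys @ [y]) \<subseteq> set xs - {x}" using \<open>y \<noteq> x\<close> yz by auto
        then have "?E\<^sup>*\<^sup>* u y" using path[OF s1(1)] h(1) by simp
        then have yu: "?E\<^sup>*\<^sup>* y u" by (rule rtranclp_sym[OF ugE])
        show ?thesis
        proof (cases "x = v")
          case False
          have "u \<noteq> x" using s hd_in_set[of "ys @ [y]"] h(1) by auto
          then have "?E u v" using ugraph_sym[OF ug v(1)] uw False
            unfolding adj_delete_vertex adj_induced by auto
          then show ?thesis using yu False by (simp add: c_def rtranclp.rtrancl_into_rtrancl)
        qed (use yu in \<open>simp add: c_def\<close>)
      qed
    qed
    from this[OF ab(1)] rtranclp_sym[OF ugE this[OF ab(2)]] show ?thesis by (rule rtranclp_trans)
  qed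
  have cH: "connected_graph ?H"
    unfolding connected_graph_iff
  proof (intro conjI ballI)
    show "verts ?H \<noteq> {}" by (simp add: induced_def)
    fix a b assume "a \<in> verts ?H" "b \<in> verts ?H"
    then have ab: "a \<in> ?P" "b \<in> ?P" by (auto simp: induced_def)
    \<comment> \<open>Deleting a point outside the cycle changes nothing, so connectedness of the
      cycle is a special case.\<close>
    obtain x where x: "x \<notin> ?P" using ex_new_if_finite[of ?P] by auto
    have "(adj (delete_vertex ?H x))\<^sup>*\<^sup>* a b" using conn[of a x b] ab x by auto
    moreover have "adj (delete_vertex ?H x) \<le> adj ?H" by (auto simp: adj_delete_vertex)
    ultimately show "(adj ?H)\<^sup>*\<^sup>* a b" by (blast dest: rtranclp_mono)
  qed
  have "\<not> cutpoint ?H x" for x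
    by (rule not_cutpoint[OF cH]) (use conn in \<open>auto simp: induced_def\<close>)
  then show ?thesis using sub cH by (auto simp: nonseparable_subgraph_def)
qed

text \<open>A simple path from \<open>u\<close> to \<open>w\<close> off \<open>v\<close> closes up
  through \<open>v\<close> to a cycle; the block containing it is complete, which makes
  \<open>u\<close> and \<open>w\<close> adjacent.\<close>

lemma bgraph_adj:
  assumes G: "simple_graph G" and b: "block_graph G"
  shows "bgraph (adj G)"
  unfolding bgraph_def
proof (intro allI impI)
  fix v u w assume *: "adj G v u" "adj G v w" "u \<noteq> w" "(del (adj G) v)\<^sup>*\<^sup>* u w"
  note ug = ugraph_adj[OF G]
  obtain xs where xs: "xs \<noteq> []" "hd xs = u" "last xs = w" "distinct xs" "successively (del (adj G) v) xs"
    using rtranclp_distinct_path[OF *(4)] by blast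
  have uv: "u \<noteq> v" using *(1) ugraph_irrefl[OF ug] by auto
  have "v \<notin> set xs"
  proof
    assume "v \<in> set xs"
    then obtain ys zs where yz: "xs = ys @ v # zs" by (meson split_list)
    show False
    proof (cases ys rule: rev_cases)
      case Nil
      then show False using yz xs(2) uv by simp
    next
      case (snoc ys' y')
      then have "del (adj G) v y' v" using xs(5) yz by (simp add: successively_append_iff)
      then show False by (simp add: del_def)
    qed
  qed
  from cycle_nonseparable[OF G *(1,2) xs this] block_exists[OF G] obtain B
    where B: "block B G" "subgraph (induced G (insert v (set xs))) B" by blast
  have "u \<in> verts B" "w \<in> verts B" using B(2) xs(1-3) by (auto simp: subgraph_def induced_def)
  then have "adj B u w" using b B(1) *(3) unfolding block_graph_def clique_def by blast
  then show "adj G u w" using B(1) by (auto simp: block_def nonseparable_subgraph_def subgraph_def)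
qed

text \<open>Let C be the component of G - v containing a neighbour \<open>a\<close>. The graph
  splits at \<open>v\<close> into the part on C with \<open>v\<close> and the rest. In the first
  part \<open>v\<close> is free, as its neighbours in C are adjacent; indecomposability then denies
  freeness in the rest, giving two nonadjacent neighbours outside C, and \<open>a\<close> completes
  the triple.\<close>

lemma branching_adj:
  assumes G: "simple_graph G" and b: "bgraph (adj G)" and d: "\<not> decomposable G"
  shows "branching (adj G)"
  unfolding branching_def
proof (intro allI impI)
  note ug = ugraph_adj[OF G]
  fix v assume "\<not> simplicial (adj G) v"
  then obtain a c where ac: "adj G v a" "adj G v c" "a \<noteq> c" "\<not> adj G a c" by (rule nonsimplicial_nbrs)
  define C where "C = {u \<in> verts G. (del (adj G) v)\<^sup>*\<^sup>* a u}"
  let ?G1 = "induced G (insert v C)" and ?G2 = "induced G (verts G - C)"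
  have vV: "v \<in> verts G" "a \<in> verts G" "c \<in> verts G" using ugraph_verts[OF ug] ac by auto
  have av: "a \<noteq> v" "c \<noteq> v" using ac ugraph_irrefl[OF ug] by auto
  have CV: "C \<subseteq> verts G" by (auto simp: C_def)
  have aC: "a \<in> C" using vV by (simp add: C_def)
  have step: "y \<in> C" if "x \<in> C" "adj G x y" "x \<noteq> v" "y \<noteq> v" for x y
    using that ugraph_verts[OF ug that(2)] by (auto simp: C_def del_def intro: rtranclp.rtrancl_into_rtrancl)
  have nv: "u \<noteq> v" if "(del (adj G) v)\<^sup>*\<^sup>* a u" for u
    using that by (cases rule: rtranclp.cases) (auto simp: del_def av)
  then have vC: "v \<notin> C" by (auto simp: C_def)
  have nbrC: "adj G a u" if "u \<in> C" "adj G v u" "u \<noteq> a" for u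
    using bgraphD[OF b ac(1) that(2)] that by (auto simp: C_def)
  have cC: "c \<notin> C" using nbrC[of c] ac by auto
  have sub: "subgraph ?G1 G" "subgraph ?G2 G" using CV vV by (auto intro!: subgraph_induced[OF G])
  then have sg: "simple_graph ?G1" "simple_graph ?G2" by (auto simp: subgraph_def)
  have un: "G = graph_union ?G1 ?G2"
  proof (rule prod_eqI)
    show "verts G = verts (graph_union ?G1 ?G2)" using CV vV by (auto simp: graph_union_def induced_def)
    show "edges G = edges (graph_union ?G1 ?G2)"
    proof
      show "edges G \<subseteq> edges (graph_union ?G1 ?G2)"
      proof
        fix e assume e: "e \<in> edges G"
        then have "card e = 2" "e \<subseteq> verts G" using G by (auto simp: simple_graph_def)
        then obtain x y where xy: "e = {x, y}" by (auto simp: card_2_iff)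
        have "e \<subseteq> insert v C \<or> e \<subseteq> verts G - C"
        proof (cases "x \<in> C \<or> y \<in> C")
          case True
          then have "x \<in> insert v C \<and> y \<in> insert v C"
            using step[of x y] step[of y x] e xy vC by (auto simp: insert_commute)
          then show ?thesis using xy by auto
        next
          case False
          then show ?thesis using xy \<open>e \<subseteq> verts G\<close> by auto
        qed
        then show "e \<in> edges (graph_union ?G1 ?G2)" using e by (auto simp: graph_union_def induced_def)
      qed
    qed (auto simp: graph_union_def induced_def)
  qed
  have card1: "card S \<noteq> 1" if "x \<in> S" "y \<in> S" "x \<noteq> y" for S and x y :: nat
    using that by (auto simp: card_Suc_eq)
  have cd: "card (verts ?G1) \<noteq> 1" "card (verts ?G2) \<noteq> 1"
    using card1[of v "insert v C" a] card1[of v "verts G - C" c] aC cC vV vC av by (auto simp: induced_def)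
  have int: "verts ?G1 \<inter> verts ?G2 = {v}" using vV vC by (auto simp: induced_def)
  have "simplicial (adj ?G1) v"
    unfolding simplicial_def adj_induced
  proof (intro allI impI)
    fix x y assume xy: "adj G v x \<and> v \<in> insert v C \<and> x \<in> insert v C" "adj G v y \<and> v \<in> insert v C \<and> y \<in> insert v C" "x \<noteq> y"
    then have xC: "x \<in> C" "y \<in> C" using ugraph_irrefl[OF ug] by auto
    have "symp (del (adj G) v)" using ugraph_sym[OF ug] by (auto simp: symp_def del_def)
    then have "(del (adj G) v)\<^sup>*\<^sup>* x a" using xC(1) sympD[OF symp_rtranclp] by (auto simp: C_def)
    then have "(del (adj G) v)\<^sup>*\<^sup>* x y" using xC(2) by (auto simp: C_def)
    then have "adj G x y" using bgraphD[OF b] xy by blast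
    then show "adj G x y \<and> x \<in> insert v C \<and> y \<in> insert v C" using xC by simp
  qed
  then have f1: "free_vertex ?G1 v" unfolding free_vertex_iff[OF sg(1)] by (simp add: induced_def)
  have "\<not> free_vertex ?G2 v"
    using d sub un cd int f1 unfolding decomposable_def by blast
  then have "\<not> simplicial (adj ?G2) v" using vV vC unfolding free_vertex_iff[OF sg(2)] by (simp add: induced_def)
  then obtain x y where xy: "adj ?G2 v x" "adj ?G2 v y" "x \<noteq> y" "\<not> adj ?G2 x y" by (rule nonsimplicial_nbrs)
  then have xy': "adj G v x" "adj G v y" "x \<notin> C" "y \<notin> C" "\<not> adj G x y" unfolding adj_induced by auto
  have xv: "x \<noteq> v" "y \<noteq> v" using xy' ugraph_irrefl[OF ug] by auto
  have "\<not> adj G a x" "\<not> adj G a y" using step[OF aC] av xv xy' by auto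
  moreover have "a \<noteq> x" "a \<noteq> y" using aC xy' by auto
  ultimately show "\<exists>a b c. adj G v a \<and> adj G v b \<and> adj G v c \<and> a \<noteq> b \<and> a \<noteq> c \<and> b \<noteq> c \<and>
      \<not> adj G a b \<and> \<not> adj G a c \<and> \<not> adj G b c"
    using ac(1) xy' xy(3) by blast
qed

section \<open>Extremal Betti numbers\<close>

text \<open>\<open>T W E\<close> stands for the ideal of the graph on \<open>W\<close> with the
  variables of all vertices outside \<open>W\<close> adjoined. These axioms are all that the
  induction uses, so it is done once for J_G and its initial ideal; \<open>c\<close> tells which
  ideal occurs for clusters.\<close>

locale edge_ideal_family = kring +
  fixes T :: "nat set \<Rightarrow> (nat \<Rightarrow> nat \<Rightarrow> bool) \<Rightarrow> 'k::field mpoly set" and c :: 'k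
  assumes c01: "c = 0 \<or> c = 1"
    and hideal_T: "ugraph W E \<Longrightarrow> W \<subseteq> V \<Longrightarrow> hideal V (T W E)"
    and T_Int: "ugraph W E \<Longrightarrow> W \<subseteq> V \<Longrightarrow> i \<in> W \<Longrightarrow> T W E = T W (cpl E i) \<inter> T (W - {i}) (del E i)"
    and T_sum: "ugraph W E \<Longrightarrow> W \<subseteq> V \<Longrightarrow> i \<in> W \<Longrightarrow>
      ideal_sum (T W (cpl E i)) (T (W - {i}) (del E i)) = T (W - {i}) (del (cpl E i) i)"
    and T_cluster: "ugraph W E \<Longrightarrow> W \<subseteq> V \<Longrightarrow> cluster E \<Longrightarrow> T W E = Q V c E (pvars (V - W))"
begin

lemma card_pvars_Diff: "card (pvars (V - W)) = 2 * card (V - W)"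
proof -
  have "card (X ` (V - W) \<union> Y ` (V - W)) = card (X ` (V - W)) + card (Y ` (V - W))"
    using finite_V by (intro card_Un_disjoint) auto
  then show ?thesis by (simp add: pvars_def card_image inj_on_def)
qed

lemma card_Diff_Diff: "W \<subseteq> V \<Longrightarrow> i \<in> W \<Longrightarrow> card (V - (W - {i})) = Suc (card (V - W))"
proof -
  assume "W \<subseteq> V" "i \<in> W"
  then have "V - (W - {i}) = insert i (V - W)" by auto
  then show ?thesis using finite_V \<open>i \<in> W\<close> by simp
qed

lemma hideals:
  assumes "ugraph W E" "W \<subseteq> V"
  shows "hideal V (T W (cpl E i))" "hideal V (T (W - {i}) (del E i))"
  using assms by (auto intro!: hideal_T ugraph_cpl ugraph_del)

text \<open>\<open>R\<close> picks vertices in different components. Completing at \<open>i\<close>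
  leaves the bound unchanged; deleting \<open>i\<close> raises it by one, which at least one
  additional component makes up for; in the sum of the two ideals the rise by one is absorbed by
  \<open>Suc k\<close>.\<close>

lemma tor_projdim:
  "ugraph W E \<Longrightarrow> bgraph E \<Longrightarrow> W \<subseteq> V \<Longrightarrow> R \<subseteq> W \<Longrightarrow> (\<forall>u\<in>R. \<forall>w\<in>R. u \<noteq> w \<longrightarrow> \<not> E\<^sup>*\<^sup>* u w) \<Longrightarrow>
    card W + 2 * card (V - W) < k + card R \<Longrightarrow> tor V (T W E) k j 0"
proof (induction "card (inner W E)" arbitrary: W E R k j rule: less_induct)
  case less
  note g = less.prems(1,2) and WV = less.prems(3) and R = less.prems(4,5)
  have fW: "finite W" by (rule ugraph_finite[OF g(1)])
  have fR: "finite R" by (rule finite_subset[OF R(1) fW])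
  have fI: "finite (inner W E)" using fW by (simp add: inner_def)
  show ?case
  proof (cases "inner W E = {}")
    case True
    then have cl: "cluster E" by (rule cluster_iff_inner[OF g(1)])
    have "tor V (Q V c E (pvars (V - W))) k j 0"
    proof (rule tor_cluster_0[OF c01 g(1) cl WV _ _ R(1)])
      show "\<forall>u\<in>R. \<forall>w\<in>R. \<not> E u w"
      proof (intro ballI notI)
        fix u w assume uw: "u \<in> R" "w \<in> R" "E u w"
        then have "u \<noteq> w" "E\<^sup>*\<^sup>* u w" using ugraph_irrefl[OF g(1)] by auto
        then show False using R(2) uw by blast
      qed
      show "card W + card (pvars (V - W)) < k + card R" using less.prems(6) card_pvars_Diff by simp
    qed (auto simp: pvars_def)
    then show ?thesis using T_cluster[OF g(1) WV cl] by simp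
  next
    case False
    then obtain i where i: "i \<in> W" "\<not> simplicial E i" "i \<in> inner W E" by (auto simp: inner_def)
    obtain a b where ab: "E i a" "E i b" "a \<noteq> b" "\<not> E a b" using i(2) by (rule nonsimplicial_nbrs)
    have abW: "a \<in> W" "b \<in> W" "a \<noteq> i" "b \<noteq> i" using ab g(1) by (auto simp: ugraph_def)
    have lt: "card (inner W E - {i}) < card (inner W E)" by (rule card_Diff1_less[OF fI i(3)])
    have cW: "card (W - {i}) = card W - 1" "0 < card W" using i fW by (auto simp: card_gt_0_iff)
    note cV = card_Diff_Diff[OF WV i(1)]
    have A: "tor V (T W (cpl E i)) k j 0"
    proof (rule less.hyps[OF _ ugraph_cpl[OF g(1)] bgraph_cpl[OF g] WV R(1) _ less.prems(6)])
      show "card (inner W (cpl E i)) < card (inner W E)" using lt inner_cpl[OF g] by simp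
      show "\<forall>u\<in>R. \<forall>w\<in>R. u \<noteq> w \<longrightarrow> \<not> (cpl E i)\<^sup>*\<^sup>* u w" using R(2) rtranclp_cpl_all[OF g(1)] by blast
    qed
    have mono: "E\<^sup>*\<^sup>* u w" if "(del E i)\<^sup>*\<^sup>* u w" for u w
    proof -
      have "del E i \<le> E" by (auto simp: del_def)
      then show ?thesis using that by (blast dest: rtranclp_mono)
    qed
    have monoH: "E\<^sup>*\<^sup>* u w" if "(del (cpl E i) i)\<^sup>*\<^sup>* u w" for u w
    proof -
      have "del (cpl E i) i \<le> cpl E i" by (auto simp: del_def)
      then have "(cpl E i)\<^sup>*\<^sup>* u w" using that by (blast dest: rtranclp_mono)
      then show ?thesis by (rule rtranclp_cpl_all[OF g(1)])
    qed
    have ai: "E\<^sup>*\<^sup>* a i" "E\<^sup>*\<^sup>* b i" using ab ugraph_sym[OF g(1)] by auto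
    have B: "tor V (T (W - {i}) (del E i)) k j 0"
    proof -
      \<comment> \<open>At most one representative lies in the component of \<open>i\<close>; it is
        exchanged for \<open>a\<close> and \<open>b\<close>, which the deletion of \<open>i\<close>
        separates.\<close>
      define R0 where "R0 = {r \<in> R. E\<^sup>*\<^sup>* r i}"
      have R0: "card R0 \<le> 1"
      proof -
        have "r = r'" if "r \<in> R0" "r' \<in> R0" for r r'
        proof (rule ccontr)
          assume "r \<noteq> r'"
          have "E\<^sup>*\<^sup>* r r'" using that rtranclp_sym[OF g(1), of r' i] by (auto simp: R0_def)
          then show False using R(2) that \<open>r \<noteq> r'\<close> by (auto simp: R0_def)
        qed
        then show ?thesis using fR by (auto simp: card_le_Suc0_iff_eq R0_def)
      qed
      let ?R = "insert a (insert b (R - R0))"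
      have nin: "a \<notin> R - R0" "b \<notin> R - R0" using ai by (auto simp: R0_def)
      have "card (R - R0) = card R - card R0" "card R0 \<le> card R"
        using fR by (auto simp: card_Diff_subset R0_def card_mono)
      then have cR: "Suc (card R) \<le> card ?R" using nin ab(3) fR R0 by simp
      have far: "\<not> E\<^sup>*\<^sup>* r x" "\<not> E\<^sup>*\<^sup>* x r" if "r \<in> R - R0" "E\<^sup>*\<^sup>* x i" for r x
        using that rtranclp_trans[of E r x i] rtranclp_sym[OF g(1), of x r] by (auto simp: R0_def)
      have nab: "\<not> (del E i)\<^sup>*\<^sup>* a b" using bgraphD[OF g(2) ab(1-3)] ab(4) by blast
      then have nba: "\<not> (del E i)\<^sup>*\<^sup>* b a" using rtranclp_sym[OF ugraph_del[OF g(1)]] by blast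
      have "\<not> (del E i)\<^sup>*\<^sup>* u w" if "u \<in> ?R" "w \<in> ?R" "u \<noteq> w" for u w
      proof -
        from that consider "u \<in> R - R0" "w \<in> R - R0" | "u \<in> {a, b}" "w \<in> R - R0" | "u \<in> R - R0" "w \<in> {a, b}" | "u \<in> {a, b}" "w \<in> {a, b}"
          by blast
        then show ?thesis
        proof cases
          case 1
          then show ?thesis using R(2) that(3) mono by blast
        next
          case 2
          then show ?thesis using far(2)[of w u] ai mono by blast
        next
          case 3
          then show ?thesis using far(1)[of u w] ai mono by blast
        next
          case 4
          then show ?thesis using nab nba that(3) by blast
        qed
      qed
      moreover have "card (inner (W - {i}) (del E i)) < card (inner W E)"
        using card_mono[OF _ inner_del[of W i E]] fI lt by fastforce
      moreover have "w' + 2 * Suc x < k + r'" if "w + 2 * x < k + r" "w' = w - 1" "0 < w" "Suc r \<le> r'" for w w' x r r' :: nat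
        using that by arith
      from this[OF less.prems(6) cW cR]
      have "card (W - {i}) + 2 * card (V - (W - {i})) < k + card ?R" unfolding cV .
      moreover have "?R \<subseteq> W - {i}" using R(1) abW by (auto simp: R0_def)
      ultimately show ?thesis
        using WV by (intro less.hyps[OF _ ugraph_del[OF g(1)] bgraph_del[OF g(2)], of i ?R]) blast+
    qed
    have C: "tor V (T (W - {i}) (del (cpl E i) i)) (Suc k) j 0"
    proof -
      let ?R = "if i \<in> R then insert a (R - {i}) else R"
      have aR: "a \<notin> R" if "i \<in> R" using R(2) that ai(1) abW by blast
      have cR: "card ?R = card R" using aR fR card_Suc_Diff1[OF fR, of i] by (cases "i \<in> R") simp_all
      have "\<not> E\<^sup>*\<^sup>* u w" if "u \<in> ?R" "w \<in> ?R" "u \<noteq> w" for u w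
      proof (cases "i \<in> R")
        case True
        have ia: "E\<^sup>*\<^sup>* i a" using ab(1) by auto
        have "\<not> E\<^sup>*\<^sup>* a r \<and> \<not> E\<^sup>*\<^sup>* r a" if r: "r \<in> R - {i}" for r
        proof (intro conjI notI)
          have no: "\<not> E\<^sup>*\<^sup>* i r" "\<not> E\<^sup>*\<^sup>* r i" using R(2) True r by auto
          show False if "E\<^sup>*\<^sup>* a r" using rtranclp_trans[OF ia that] no by simp
          show False if "E\<^sup>*\<^sup>* r a" using rtranclp_trans[OF that ai(1)] no by simp
        qed
        moreover have "u \<in> insert a (R - {i})" "w \<in> insert a (R - {i})" using that True by simp_all
        ultimately show ?thesis using that(3) R(2) by blast
      qed (use that R(2) in auto)
      then have "\<forall>u\<in>?R. \<forall>w\<in>?R. u \<noteq> w \<longrightarrow> \<not> (del (cpl E i) i)\<^sup>*\<^sup>* u w" using monoH by blast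
      moreover have "card (inner (W - {i}) (del (cpl E i) i)) < card (inner W E)"
        using lt inner_cpl_del[OF g i(2)] by simp
      moreover have "w' + 2 * Suc x < Suc k + r" if "w + 2 * x < k + r" "w' = w - 1" "0 < w" for w w' x r :: nat
        using that by arith
      from this[OF less.prems(6) cW]
      have "card (W - {i}) + 2 * card (V - (W - {i})) < Suc k + card ?R" unfolding cV cR .
      moreover have "?R \<subseteq> W - {i}" using R(1) abW by auto
      ultimately show ?thesis
        using WV by (intro less.hyps[OF _ ugraph_del[OF ugraph_cpl[OF g(1)]] bgraph_del[OF bgraph_cpl[OF g]], of i i ?R]) blast+
    qed
    show ?thesis
      unfolding T_Int[OF g(1) WV i(1)]
      by (rule tor_Int_0[OF hideals[OF g(1) WV] A B]) (simp add: T_sum[OF g(1) WV i(1)] C)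
  qed
qed

text \<open>\<open>p\<close> is the largest index that \<open>tor_projdim\<close> leaves open for a
  connected graph. The difference \<open>card W - card (inner W E)\<close> is the number of free
  vertices, constant while inner vertices are removed until a clique is left.\<close>

lemma tor_top:
  "ugraph W E \<Longrightarrow> bgraph E \<Longrightarrow> branching E \<Longrightarrow> W \<subseteq> V \<Longrightarrow> W \<noteq> {} \<Longrightarrow>
    (\<And>u w. u \<in> W \<Longrightarrow> w \<in> W \<Longrightarrow> E\<^sup>*\<^sup>* u w) \<Longrightarrow> card (inner W E) < l \<Longrightarrow> p = card W - 1 + 2 * card (V - W) \<Longrightarrow>
    tor V (T W E) p (p + l) (if l = Suc (card (inner W E)) then card W - card (inner W E) - 1 else 0)"
proof (induction "card (inner W E)" arbitrary: W E l p rule: less_induct)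
  case less
  note g = less.prems(1,2) and br = less.prems(3) and WV = less.prems(4) and conn = less.prems(6) and l = less.prems(7) and p = less.prems(8)
  have fW: "finite W" by (rule ugraph_finite[OF g(1)])
  have fI: "finite (inner W E)" using fW by (simp add: inner_def)
  have W0: "0 < card W" using less.prems(5) fW by (simp add: card_gt_0_iff)
  show ?case
  proof (cases "inner W E = {}")
    case True
    then have cl: "cluster E" by (rule cluster_iff_inner[OF g(1)])
    have clique: "E u w" if "u \<in> W" "w \<in> W" "u \<noteq> w" for u w
    proof -
      have "u = w \<or> E u w" using conn[OF that(1,2)]
      proof (induction rule: rtranclp_induct)
        case (step y z)
        then show ?case using cl unfolding cluster_def by blast
      qed simp
      then show ?thesis using that by simp
    qed
    have "tor V (Q V c E (pvars (V - W))) (card W - 1 + card (pvars (V - W))) (card W - 1 + card (pvars (V - W)) + l)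
        (if l = 1 then card W - 1 else 0)"
      using l by (intro tor_clique[OF c01 g(1) clique less.prems(5) WV]) (auto simp: pvars_def)
    then show ?thesis using T_cluster[OF g(1) WV cl] True
      by (cases "l = 1") (simp_all add: card_pvars_Diff p)
  next
    case False
    then obtain i where i: "i \<in> W" "\<not> simplicial E i" "i \<in> inner W E" by (auto simp: inner_def)
    obtain x y z where xyz: "E i x" "E i y" "E i z" "x \<noteq> y" "x \<noteq> z" "y \<noteq> z" "\<not> E x y" "\<not> E x z" "\<not> E y z"
      using br i(2) unfolding branching_def by blast
    have W3: "x \<in> W - {i}" "y \<in> W - {i}" "z \<in> W - {i}" using xyz(1-3) g(1) by (auto simp: ugraph_def)
    define n where "n = card (inner W E)"
    have n0: "0 < n" using i(3) fI by (auto simp: n_def card_gt_0_iff)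
    have nI: "card (inner W E - {i}) = n - 1" using i(3) fI by (simp add: n_def)
    have cW: "card (W - {i}) = card W - 1" using i fW by simp
    have W1: "1 < card W"
    proof -
      have "0 < card (W - {i})" using W3 fW by (auto simp: card_gt_0_iff)
      then show ?thesis using cW by linarith
    qed
    note cV = card_Diff_Diff[OF WV i(1)]
    \<comment> \<open>Completion loses an inner vertex, so \<open>l\<close> lies strictly beyond the
      degree of the top class.\<close>
    have A0: "tor V (T W (cpl E i)) p (p + l) 0"
    proof -
      have "tor V (T W (cpl E i)) p (p + l) (if l = Suc (card (inner W (cpl E i))) then card W - card (inner W (cpl E i)) - 1 else 0)"
      proof (rule less.hyps[OF _ ugraph_cpl[OF g(1)] bgraph_cpl[OF g] branching_cpl[OF g br] WV less.prems(5) _ _ p])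
        show "card (inner W (cpl E i)) < card (inner W E)" using n0 nI inner_cpl[OF g] by (simp add: n_def)
        show "card (inner W (cpl E i)) < l" using l nI inner_cpl[OF g] by (simp add: n_def)
        have "E \<le> cpl E i" by (auto simp: cpl_def)
        then show "(cpl E i)\<^sup>*\<^sup>* u w" if "u \<in> W" "w \<in> W" for u w using conn[OF that] by (blast dest: rtranclp_mono)
      qed
      moreover have "l \<noteq> Suc (card (inner W (cpl E i)))" using l nI inner_cpl[OF g] n0 by (simp add: n_def)
      ultimately show ?thesis by simp
    qed
    have A1: "tor V (T W (cpl E i)) (Suc p) (p + l) 0"
      by (rule tor_projdim[OF ugraph_cpl[OF g(1)] bgraph_cpl[OF g] WV, of "{i}"]) (use i W0 p in auto)
    \<comment> \<open>Deletion leaves three neighbours of \<open>i\<close> in different components.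
      With w = \<open>card W\<close> and d = \<open>card (V - W)\<close> the bound is (w - 1) + 2 (d
      + 1) - 3 = p - 1, so everything from \<open>p\<close> on vanishes.\<close>
    have B: "tor V (T (W - {i}) (del E i)) k j 0" if "p \<le> k" for k j
    proof (rule tor_projdim[OF ugraph_del[OF g(1)] bgraph_del[OF g(2)], of _ "{x, y, z}"])
      have "\<not> (del E i)\<^sup>*\<^sup>* u w" if "E i u" "E i w" "u \<noteq> w" "\<not> E u w" for u w
        using bgraphD[OF g(2) that(1-3)] that(4) by blast
      then show "\<forall>u\<in>{x, y, z}. \<forall>w\<in>{x, y, z}. u \<noteq> w \<longrightarrow> \<not> (del E i)\<^sup>*\<^sup>* u w"
        using xyz ugraph_sym[OF g(1)] by (metis insertE singletonD)
      have c3: "card {x, y, z} = 3" using xyz by simp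
      show "card (W - {i}) + 2 * card (V - (W - {i})) < k + card {x, y, z}"
        unfolding c3 cV cW using that p by simp
    qed (use W3 WV in auto)
    have C: "tor V (T (W - {i}) (del (cpl E i) i)) (Suc p) (p + l) (if l = Suc n then card W - n - 1 else 0)"
    proof -
      let ?H = "del (cpl E i) i"
      \<comment> \<open>The internal degree p + l is read at the top index p + 1 of the smaller
        graph, with l - 1 in place of l.\<close>
      have "tor V (T (W - {i}) ?H) (Suc p) (Suc p + (l - 1))
          (if l - 1 = Suc (card (inner (W - {i}) ?H)) then card (W - {i}) - card (inner (W - {i}) ?H) - 1 else 0)"
      proof (rule less.hyps[OF _ ugraph_del[OF ugraph_cpl[OF g(1)]] bgraph_del[OF bgraph_cpl[OF g]] branching_cpl_del[OF g br i(2)]])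
        show "card (inner (W - {i}) ?H) < card (inner W E)" using inner_cpl_del[OF g i(2)] nI n0 by (simp add: n_def)
        show "card (inner (W - {i}) ?H) < l - 1" using inner_cpl_del[OF g i(2)] nI n0 l by (simp add: n_def)
        show "W - {i} \<subseteq> V" using WV by auto
        show "W - {i} \<noteq> {}" using W3 by auto
        show "?H\<^sup>*\<^sup>* u w" if "u \<in> W - {i}" "w \<in> W - {i}" for u w
          using that conn by (intro rtranclp_cpl_del[OF g(1)]) auto
        show "Suc p = card (W - {i}) - 1 + 2 * card (V - (W - {i}))" using W1 unfolding cV cW p by arith
      qed
      moreover have "Suc p + (l - 1) = p + l" using l by simp
      moreover have "card (inner (W - {i}) ?H) = n - 1" using inner_cpl_del[OF g i(2)] nI by simp
      moreover have "l - 1 = Suc (n - 1) \<longleftrightarrow> l = Suc n" using n0 l by auto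
      moreover have "card (W - {i}) - (n - 1) - 1 = card W - n - 1" using cW n0 by simp
      ultimately show ?thesis by (simp only:)
    qed
    have "tor V (T W (cpl E i) \<inter> T (W - {i}) (del E i)) p (p + l) (if l = Suc n then card W - n - 1 else 0)"
      by (rule tor_Int_Suc[OF hideals[OF g(1) WV] A0 B A1 B]) (simp_all add: T_sum[OF g(1) WV i(1)] C)
    then show ?thesis unfolding T_Int[OF g(1) WV i(1), symmetric] n_def .
  qed
qed

end

text \<open>This makes f(G) - 1 nonzero. Passing to G_i - i removes one inner vertex, and the
  neighbours of \<open>i\<close> keep the size at least 2 until no inner vertex is left.\<close>

lemma num_simplicial_ge_2:
  "ugraph W E \<Longrightarrow> bgraph E \<Longrightarrow> branching E \<Longrightarrow> 2 \<le> card W \<Longrightarrow> card (inner W E) + 2 \<le> card W"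
proof (induction "card (inner W E)" arbitrary: W E rule: less_induct)
  case less
  note g = less.prems(1,2) and br = less.prems(3)
  have fW: "finite W" by (rule ugraph_finite[OF g(1)])
  have fI: "finite (inner W E)" using fW by (simp add: inner_def)
  show ?case
  proof (cases "inner W E = {}")
    case True
    then show ?thesis using less.prems(4) by simp
  next
    case False
    then obtain i where i: "i \<in> W" "\<not> simplicial E i" "i \<in> inner W E" by (auto simp: inner_def)
    obtain x y where xy: "E i x" "E i y" "x \<noteq> y" using i(2) by (rule nonsimplicial_nbrs)
    then have "{x, y} \<subseteq> W - {i}" using g(1) by (auto simp: ugraph_def)
    then have "card {x, y} \<le> card (W - {i})" using fW by (intro card_mono) auto
    then have W2: "2 \<le> card (W - {i})" using xy by simp
    have cI: "card (inner W E - {i}) < card (inner W E)" "card (inner W E) = Suc (card (inner W E - {i}))"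
      using i(3) fI card_Suc_Diff1[OF fI i(3)] by auto
    have "card (inner (W - {i}) (del (cpl E i) i)) + 2 \<le> card (W - {i})"
      using cI inner_cpl_del[OF g i(2)] W2
      by (intro less.hyps ugraph_del ugraph_cpl g bgraph_del bgraph_cpl[OF g] branching_cpl_del[OF g br i(2)]) auto
    then show ?thesis using inner_cpl_del[OF g i(2)] cI i(1) fW by simp
  qed
qed

lemma edge_ideal_family_Q:
  assumes V: "finite V"
  shows "edge_ideal_family V (\<lambda>W E. Q V 1 E (pvars (V - W))) (1 :: 'k::field)"
proof (unfold_locales)
  show "finite V" by fact
  fix W E assume g: "ugraph W E" "W \<subseteq> V"
  show "hideal V (Q V (1 :: 'k) E (pvars (V - W)))" by (rule hideal_Q[OF g]) (auto simp: pvars_def)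
  fix i assume i: "i \<in> W"
  show "Q V (1 :: 'k) E (pvars (V - W)) = Q V 1 (cpl E i) (pvars (V - W)) \<inter> Q V 1 (del E i) (pvars (V - (W - {i})))"
    by (rule Q_Int[OF g i])
  show "ideal_sum (Q V 1 (cpl E i) (pvars (V - W))) (Q V 1 (del E i) (pvars (V - (W - {i})))) =
      Q V (1 :: 'k) (del (cpl E i) i) (pvars (V - (W - {i})))"
    by (rule Q_sum[OF g i])
qed auto

lemma edge_ideal_family_inI:
  assumes V: "finite V"
  shows "edge_ideal_family V (\<lambda>W E. inI V (Q V 1 E (pvars (V - W)))) (0 :: 'k::field)"
proof (unfold_locales)
  show "finite V" by fact
  interpret F: edge_ideal_family V "\<lambda>W E. Q V 1 E (pvars (V - W))" "1 :: 'k" by (rule edge_ideal_family_Q[OF V])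
  fix W E assume g: "ugraph W E" "W \<subseteq> V"
  show "hideal V (inI V (Q V (1 :: 'k) E (pvars (V - W))))" by (rule hideal_inI[OF F.hideal_T[OF g]])
  show "inI V (Q V (1 :: 'k) E (pvars (V - W))) = Q V 0 E (pvars (V - W))" if "cluster E"
    by (rule inI_cluster[OF g _ that]) (auto simp: pvars_def)
  fix i assume i: "i \<in> W"
  let ?A = "Q V (1 :: 'k) (cpl E i) (pvars (V - W))" and ?B = "Q V (1 :: 'k) (del E i) (pvars (V - (W - {i})))"
  have h: "hideal V ?A" "hideal V ?B" by (rule F.hideals[OF g])+
  have sub: "LM (ideal_sum ?A ?B) \<subseteq> LM ?A \<union> LM ?B"
    unfolding Q_sum[OF g i] by (rule LM_Q_sub[OF g i])
  show "inI V (Q V (1 :: 'k) E (pvars (V - W))) = inI V ?A \<inter> inI V ?B"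
    unfolding Q_Int[OF g i] by (rule inI_Int[OF V h sub])
  show "ideal_sum (inI V ?A) (inI V ?B) = inI V (Q V (1 :: 'k) (del (cpl E i) i) (pvars (V - (W - {i}))))"
    unfolding inI_sum[OF h sub] Q_sum[OF g i] ..
qed auto

text \<open>Beyond homological degree n - 1 the bound on the projective dimension suffices, with a
  single vertex as representative; at n - 1 itself \<open>tor_top\<close> excludes larger
  \<open>l\<close>.\<close>

lemma (in edge_ideal_family) extremal_betti_T:
  assumes g: "ugraph V E" "bgraph E" "branching E" and conn: "\<And>u w. u \<in> V \<Longrightarrow> w \<in> V \<Longrightarrow> E\<^sup>*\<^sup>* u w"
    and V2: "2 \<le> card V"
  shows "betti V (T V E) (card V - 1) (card V - 1 + Suc (card (inner V E))) = card V - card (inner V E) - 1"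
    "extremal_betti V (T V E) (card V - 1) (Suc (card (inner V E)))"
proof -
  note h = hideal_T[OF g(1) subset_refl]
  note b = betti_eqI[OF h graded_free_resolution_exists[OF h]]
  have ne: "V \<noteq> {}" using V2 by auto
  have top: "tor V (T V E) (card V - 1) (card V - 1 + l)
      (if l = Suc (card (inner V E)) then card V - card (inner V E) - 1 else 0)" if "card (inner V E) < l" for l
    by (rule tor_top[OF g subset_refl ne conn that]) simp_all
  show 1: "betti V (T V E) (card V - 1) (card V - 1 + Suc (card (inner V E))) = card V - card (inner V E) - 1"
    using top[of "Suc (card (inner V E))"] by (intro b) simp
  have "betti V (T V E) k (k + l) = 0" if kl: "(k, l) \<noteq> (card V - 1, Suc (card (inner V E)))" "card V - 1 \<le> k" "Suc (card (inner V E)) \<le> l" for k l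
  proof (cases "k = card V - 1")
    case True
    then show ?thesis using kl top[of l] by (intro b) auto
  next
    case False
    obtain v where v: "v \<in> V" using ne by blast
    have "tor V (T V E) k (k + l) 0"
      by (rule tor_projdim[OF g(1,2) subset_refl, of "{v}"]) (use v False kl(2) in auto)
    then show ?thesis by (rule b)
  qed
  then show "extremal_betti V (T V E) (card V - 1) (Suc (card (inner V E)))"
    using 1 num_simplicial_ge_2[OF g V2] by (auto simp: extremal_betti_def)
qed

text \<open>A single vertex is excluded: there J = 0 and f = 1, so the Betti number f - 1 is zero
  and cannot be extremal.\<close>

theorem theorem2p2:
  fixes G :: "nat graph" and n :: nat and J :: "'k::field mpoly set"
  assumes "simple_graph G" and "verts G = {1..n}" and "n \<ge> 2"
    and "connected_graph G" and "block_graph G" and "\<not> decomposable G"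
    and "J = binomial_edge_ideal G"
  shows "extremal_betti {1..n} J (n - 1) (num_inner G + 1)
       \<and> extremal_betti {1..n} (initial_ideal {1..n} J) (n - 1) (num_inner G + 1)
       \<and> betti {1..n} (initial_ideal {1..n} J) (n - 1) (n - 1 + num_inner G + 1)
           = betti {1..n} J (n - 1) (n - 1 + num_inner G + 1)
       \<and> betti {1..n} J (n - 1) (n - 1 + num_inner G + 1) = num_free G - 1"
proof -
  define V where "V = {1..n}"
  have V: "finite V" "card V = n" "verts G = V" using assms(2) by (auto simp: V_def)
  have ug: "ugraph V (adj G)" using ugraph_adj[OF assms(1)] V(3) by simp
  note bg = bgraph_adj[OF assms(1,5)]
  note br = branching_adj[OF assms(1) bg assms(6)]
  have conn: "(adj G)\<^sup>*\<^sup>* u w" if "u \<in> V" "w \<in> V" for u w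
    using assms(4) that V(3) unfolding connected_graph_iff by blast
  have V2: "2 \<le> card V" using assms(3) V by simp
  have inner: "num_inner G = card (inner V (adj G))"
    unfolding num_inner_def inner_vertex_iff[OF assms(1)] V(3) by simp
  have "{v. free_vertex G v} = V - inner V (adj G)"
    unfolding free_vertex_iff[OF assms(1)] V(3) by (auto simp: inner_def)
  moreover have "inner V (adj G) \<subseteq> V" by (auto simp: inner_def)
  ultimately have free: "num_free G = card V - card (inner V (adj G))"
    unfolding num_free_def using V(1) by (simp add: card_Diff_subset finite_subset)
  have gens: "{pv (X i) * pv (Y j) - pv (X j) * pv (Y i) | i j. {i, j} \<in> edges G \<and> i < j} = gens (1 :: 'k) (adj G) {}"
    by (auto simp: gens_def bgen_eq)
  \<comment> \<open>All vertices are present, so no variables are adjoined: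
    \<open>pvars (V - V)\<close> is empty.\<close>
  have J: "J = Q V 1 (adj G) (pvars (V - V))"
    unfolding assms(7) binomial_edge_ideal_def gens V(3) Q_def
    by (simp add: genideal_idl[OF gens_polys[OF ug subset_refl]] pvars_def)
  interpret A: edge_ideal_family V "\<lambda>W E. Q V 1 E (pvars (V - W))" "1 :: 'k" by (rule edge_ideal_family_Q[OF V(1)])
  interpret B: edge_ideal_family V "\<lambda>W E. inI V (Q V 1 E (pvars (V - W)))" "0 :: 'k" by (rule edge_ideal_family_inI[OF V(1)])
  have inJ: "initial_ideal V J = inI V (Q V 1 (adj G) (pvars (V - V)))"
    unfolding J by (rule initial_ideal_eq[OF A.hideal_T[OF ug subset_refl]])
  note a = A.extremal_betti_T[OF ug bg br conn V2, folded J inner free]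
    and b = B.extremal_betti_T[OF ug bg br conn V2, folded inJ inner free]
  show ?thesis using a b unfolding V(2) V_def[symmetric] by simp
qed

end
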